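(* Let $M$ be a compact connected $C^\infty$ Riemannian manifold of dimension $n\ge 3$, let $X$ be a $C^1$ vector field on $M$ with flow $X_t$, and let $\Gamma\subset M$ be a compact $X_t$-invariant set. Let $T_\Gamma M=E\oplus F$ be a $DX_t$-invariant splitting over $\Gamma$ with $\dim F=k\ge2$. Let $\widetilde F=\wedge^kF$ be the $\wedge^kDX_t$-invariant subbundle of $\wedge^kT_\Gamma M$ generated by the vectors of $F$, and let $\widetilde E$ be the $\wedge^kDX_t$-invariant subbundle such that $\widetilde E\oplus\widetilde F$ is a splitting of the $k$-th exterior power $\wedge^kT_\Gamma M$. Then $\widetilde E\oplus\widetilde F$ is a dominated splitting for $\wedge^kDX_t$ if and only if there exists $\eta<0$ such that $$\liminf_{t\to+\infty}\frac1t\log\|DX_t|_{E_x}\|-\limsup_{t\to+\infty}\frac1t\log m(DX_t|_{F_x})<\eta$$ for all $x$ in a total probability subset of $\Gamma$.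
   Context: $M$ may have boundary, in which case $X$ is assumed inwardly transverse to $\partial M$. A set $\Gamma$ is invariant if $X_t(\Gamma)=\Gamma$ for all $t\in\mathbb{R}$. With $\{e_1,\dots,e_\ell\}$ a family of bases of $E$ and $\{f_1,\dots,f_k\}$ a family of bases of $F$ ($k=\dim F$), $\widetilde F$ is generated by $f_1\wedge\dots\wedge f_k$, and $\widetilde E$ is generated by all $e_{i_1}\wedge\dots\wedge e_{i_k}$ with $1\le i_1<\dots<i_k\le\ell$, together with all exterior products of $i$ basis elements of $E$ with $j$ basis elements of $F$, where $i+j=k$ and $i,j\ge1$. Both are $\wedge^kDX_t$-invariant and $\wedge^kT_\Gamma M=\widetilde E\oplus\widetilde F$. A continuous $\wedge^kDX_t$-invariant splitting $\widetilde E\oplus\widetilde F$ with both subbundles nonzero at every point is dominated for $\wedge^kDX_t$ if there are $K,\lambda>0$ with $\|\wedge^kDX_t|_{\widetilde E_x}\|\cdot\|\wedge^kDX_{-t}|_{\widetilde F_{X_t(x)}}\|<Ke^{-\lambda t}$ for all $x\in\Gamma$ and all $t>0$, where $\wedge^kT_\Gamma M$ carries the norm induced by the Riemannian metric. For a linear isomorphism $A$, $\|A\|$ is the operator norm and $m(A)=\inf_{\|v\|=1}\|Av\|=\|A^{-1}\|^{-1}$ is the minimum norm (co-norm). A subset $Y\subset\Gamma$ is a total probability subset of $\Gamma$ if $\mu(Y)=1$ for every probability measure $\mu$ on $\Gamma$ that is invariant under $X_t$ for all $t\in\mathbb{R}$. *)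

theory Defs
  imports "HOL-Analysis.Analysis" "HOL-Combinatorics.Permutations"
begin

section \<open>Maps of class \<open>C\<^sup>m\<close> on subsets of Euclidean space\<close>

primrec C_open :: "nat \<Rightarrow> ('a::euclidean_space \<Rightarrow> 'b::real_normed_vector) \<Rightarrow> 'a set \<Rightarrow> bool" where
  "C_open 0 f W \<longleftrightarrow> continuous_on W f"
| "C_open (Suc m) f W \<longleftrightarrow>
     (\<exists>f'. (\<forall>x\<in>W. (f has_derivative f' x) (at x)) \<and> (\<forall>v. C_open m (\<lambda>x. f' x v) W))"

text \<open>On a set that need not be open (a relatively open part of a half-space), class
  \<open>C\<^sup>m\<close> means: near every point, the map is the restriction of a \<open>C\<^sup>m\<close> map on an open set.\<close>

definition C_on :: "enat \<Rightarrow> ('a::euclidean_space \<Rightarrow> 'b::real_normed_vector) \<Rightarrow> 'a set \<Rightarrow> bool" where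
  "C_on m f S \<longleftrightarrow> (\<forall>x\<in>S. \<exists>W h. open W \<and> x \<in> W \<and>
     (\<forall>j. enat j \<le> m \<longrightarrow> C_open j h W) \<and> (\<forall>y\<in>S \<inter> W. h y = f y))"


section \<open>Manifolds with boundary\<close>

text \<open>The manifold is the universe of the type \<open>'m\<close>; its dimension is \<open>CARD('n)\<close>. A chart is a
  coordinate domain together with a coordinate map (only relevant on that domain).\<close>

type_synonym 'n coords = "real ^ 'n"

type_synonym ('m, 'n) chart = "'m set \<times> ('m \<Rightarrow> 'n coords)"

definition half_space :: "'n::{finite,linorder} coords set" where
  "half_space = {v. 0 \<le> v $ Max UNIV}"

definition chart_inv :: "('m, 'n) chart \<Rightarrow> 'n coords \<Rightarrow> 'm" where
  "chart_inv c = inv_into (fst c) (snd c)"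

definition is_chart :: "('m::topological_space, 'n::{finite,linorder}) chart \<Rightarrow> bool" where
  "is_chart c \<longleftrightarrow> open (fst c) \<and> openin (top_of_set half_space) (snd c ` fst c) \<and>
     homeomorphism (fst c) (snd c ` fst c) (snd c) (chart_inv c)"

definition smooth_atlas :: "('m::topological_space, 'n::{finite,linorder}) chart set \<Rightarrow> bool" where
  "smooth_atlas \<A> \<longleftrightarrow> (\<forall>c\<in>\<A>. is_chart c) \<and> (\<Union>c\<in>\<A>. fst c) = UNIV \<and>
     (\<forall>c\<in>\<A>. \<forall>c'\<in>\<A>. C_on \<infinity> (snd c' \<circ> chart_inv c) (snd c ` (fst c \<inter> fst c')))"

text \<open>The tangent space at \<open>p\<close> is \<open>real ^ 'n\<close>, tangent vectors being identified with their
  coordinates in one fixed chart \<open>chart_at \<A> p\<close> around \<open>p\<close>. Passing to the coordinates in another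
  chart is done by the derivative of the transition map.\<close>

definition chart_at :: "('m, 'n) chart set \<Rightarrow> 'm \<Rightarrow> ('m, 'n) chart" where
  "chart_at \<A> p = (SOME c. c \<in> \<A> \<and> p \<in> fst c)"

text \<open>Derivatives are taken within relatively open subsets of the half-space, where they are
  unique, also at boundary points.\<close>

definition coord_change ::
    "('m, 'n::finite) chart \<Rightarrow> ('m, 'n) chart \<Rightarrow> 'm \<Rightarrow> 'n coords \<Rightarrow> 'n coords" where
  "coord_change c c' p =
     frechet_derivative (snd c' \<circ> chart_inv c) (at (snd c p) within snd c ` (fst c \<inter> fst c'))"

definition riemannian_metric ::
    "('m::topological_space, 'n::{finite,linorder}) chart set \<Rightarrow>
     ('m \<Rightarrow> 'n coords \<Rightarrow> 'n coords \<Rightarrow> real) \<Rightarrow> bool" where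
  "riemannian_metric \<A> g \<longleftrightarrow>
     (\<forall>p. bilinear (g p) \<and> (\<forall>u v. g p u v = g p v u) \<and> (\<forall>v. v \<noteq> 0 \<longrightarrow> 0 < g p v v)) \<and>
     (\<forall>c\<in>\<A>. \<forall>u v. C_on \<infinity>
        (\<lambda>y. let p = chart_inv c y; T = coord_change c (chart_at \<A> p) p in g p (T u) (T v))
        (snd c ` fst c))"

definition C1_vector_field ::
    "('m::topological_space, 'n::{finite,linorder}) chart set \<Rightarrow> ('m \<Rightarrow> 'n coords) \<Rightarrow> bool" where
  "C1_vector_field \<A> X \<longleftrightarrow> (\<forall>c\<in>\<A>. C_on 1
     (\<lambda>y. let p = chart_inv c y in coord_change (chart_at \<A> p) c p (X p)) (snd c ` fst c))"

definition inwardly_transverse ::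
    "('m::topological_space, 'n::{finite,linorder}) chart set \<Rightarrow> ('m \<Rightarrow> 'n coords) \<Rightarrow> bool" where
  "inwardly_transverse \<A> X \<longleftrightarrow> (\<forall>c\<in>\<A>. \<forall>p\<in>fst c. snd c p $ Max UNIV = 0 \<longrightarrow>
     0 < coord_change (chart_at \<A> p) c p (X p) $ Max UNIV)"


section \<open>The flow and its derivative\<close>

definition integral_curve ::
    "('m::topological_space, 'n::{finite,linorder}) chart set \<Rightarrow> ('m \<Rightarrow> 'n coords) \<Rightarrow>
     (real \<Rightarrow> 'm) \<Rightarrow> real set \<Rightarrow> bool" where
  "integral_curve \<A> X \<gamma> I \<longleftrightarrow> continuous_on I \<gamma> \<and>
     (\<forall>t\<in>I. (snd (chart_at \<A> (\<gamma> t)) \<circ> \<gamma> has_vector_derivative X (\<gamma> t)) (at t within I))"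

text \<open>Since the field points inwards along the boundary, the flow is defined on the whole manifold
  for nonnegative times only. For \<open>t < 0\<close> the map \<open>\<phi> t\<close> is the inverse of \<open>\<phi> (- t)\<close>, defined on the
  image of the latter; its values elsewhere are irrelevant.\<close>

definition is_flow ::
    "('m::topological_space, 'n::{finite,linorder}) chart set \<Rightarrow> ('m \<Rightarrow> 'n coords) \<Rightarrow>
     (real \<Rightarrow> 'm \<Rightarrow> 'm) \<Rightarrow> bool" where
  "is_flow \<A> X \<phi> \<longleftrightarrow>
     (\<forall>x. \<phi> 0 x = x \<and> integral_curve \<A> X (\<lambda>t. \<phi> t x) {0..}) \<and>
     (\<forall>t\<ge>0. \<forall>x. \<phi> (- t) (\<phi> t x) = x)"

definition flow_deriv ::
    "('m, 'n::finite) chart set \<Rightarrow> (real \<Rightarrow> 'm \<Rightarrow> 'm) \<Rightarrow> real \<Rightarrow> 'm \<Rightarrow> 'n coords \<Rightarrow> 'n coords" where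
  "flow_deriv \<A> \<phi> t x = (let c = chart_at \<A> x; c' = chart_at \<A> (\<phi> t x) in
     frechet_derivative (snd c' \<circ> \<phi> t \<circ> chart_inv c) (at (snd c x) within snd c ` fst c))"

definition invariant_set :: "(real \<Rightarrow> 'm \<Rightarrow> 'm) \<Rightarrow> 'm set \<Rightarrow> bool" where
  "invariant_set \<phi> \<Gamma> \<longleftrightarrow> (\<forall>t. \<phi> t ` \<Gamma> = \<Gamma>)"

definition total_probability ::
    "(real \<Rightarrow> 'm::topological_space \<Rightarrow> 'm) \<Rightarrow> 'm set \<Rightarrow> 'm set \<Rightarrow> bool" where
  "total_probability \<phi> \<Gamma> Y \<longleftrightarrow> Y \<subseteq> \<Gamma> \<and>
     (\<forall>\<mu>. sets \<mu> = sets (restrict_space borel \<Gamma>) \<and> emeasure \<mu> \<Gamma> = 1 \<and>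
          (\<forall>t. \<forall>B\<in>sets \<mu>. emeasure \<mu> (\<phi> t -` B \<inter> \<Gamma>) = emeasure \<mu> B)
        \<longrightarrow> emeasure \<mu> Y = 1)"


section \<open>Exterior powers\<close>

text \<open>The exterior algebra of \<open>real ^ 'n\<close> is modelled by \<open>real ^ ('n set)\<close>: the unit vector with
  index \<open>{s\<^sub>1 < \<dots> < s\<^sub>k}\<close> is the product of the standard basis vectors with indices
  \<open>s\<^sub>1, \<dots>, s\<^sub>k\<close>, and the coordinates of a decomposable \<open>k\<close>-vector are its \<open>k \<times> k\<close> minors.\<close>

type_synonym 'n kvector = "real ^ ('n set)"

definition leibniz_det :: "nat \<Rightarrow> (nat \<Rightarrow> nat \<Rightarrow> real) \<Rightarrow> real" where
  "leibniz_det k a = (\<Sum>p | p permutes {..<k}. of_int (sign p) * (\<Prod>i<k. a i (p i)))"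

definition elem :: "'n::linorder set \<Rightarrow> nat \<Rightarrow> 'n" where
  "elem S j = sorted_list_of_set S ! j"

definition wedge :: "nat \<Rightarrow> (nat \<Rightarrow> 'n coords) \<Rightarrow> 'n::{finite,linorder} kvector" where
  "wedge k u = (\<chi> S. if card S = k then leibniz_det k (\<lambda>i j. u i $ elem S j) else 0)"

definition ext_power :: "nat \<Rightarrow> 'n::{finite,linorder} kvector set" where
  "ext_power k = span (range (wedge k))"

text \<open>The linear map with \<open>u\<^sub>1 \<and> \<dots> \<and> u\<^sub>k \<mapsto> T u\<^sub>1 \<and> \<dots> \<and> T u\<^sub>k\<close>, and the bilinear form with
  \<open>(u\<^sub>1 \<and> \<dots> \<and> u\<^sub>k, v\<^sub>1 \<and> \<dots> \<and> v\<^sub>k) \<mapsto> det (G u\<^sub>i v\<^sub>j)\<close>, both expanded in the standard basis.\<close>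

definition ext_map ::
    "nat \<Rightarrow> ('n coords \<Rightarrow> 'n coords) \<Rightarrow>
     'n::{finite,linorder} kvector \<Rightarrow> 'n kvector" where
  "ext_map k T \<omega> = (\<Sum>S | card S = k. \<omega> $ S *\<^sub>R wedge k (\<lambda>i. T (axis (elem S i) 1)))"

definition ext_inner ::
    "nat \<Rightarrow> ('n coords \<Rightarrow> 'n coords \<Rightarrow> real) \<Rightarrow>
     'n::{finite,linorder} kvector \<Rightarrow> 'n kvector \<Rightarrow> real" where
  "ext_inner k G \<omega> \<eta> = (\<Sum>S | card S = k. \<Sum>S' | card S' = k.
     \<omega> $ S * \<eta> $ S' * leibniz_det k (\<lambda>i j. G (axis (elem S i) 1) (axis (elem S' j) 1)))"


section \<open>Norms of restricted linear maps\<close>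

definition form_norm :: "('v \<Rightarrow> 'v \<Rightarrow> real) \<Rightarrow> 'v \<Rightarrow> real" where
  "form_norm G v = sqrt (G v v)"

definition op_norm :: "('v \<Rightarrow> real) \<Rightarrow> ('w \<Rightarrow> real) \<Rightarrow> 'v set \<Rightarrow> ('v \<Rightarrow> 'w) \<Rightarrow> real" where
  "op_norm N N' V T = (SUP v\<in>{v\<in>V. N v = 1}. N' (T v))"

definition min_norm :: "('v \<Rightarrow> real) \<Rightarrow> ('w \<Rightarrow> real) \<Rightarrow> 'v set \<Rightarrow> ('v \<Rightarrow> 'w) \<Rightarrow> real" where
  "min_norm N N' V T = (INF v\<in>{v\<in>V. N v = 1}. N' (T v))"


section \<open>Invariant splittings\<close>

text \<open>Both the tangent bundle and its exterior powers are treated at once: \<open>L T\<close> is the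
  map induced by \<open>T\<close> on the fibres, so \<open>L = id\<close> for the tangent bundle and \<open>L = ext_map k\<close> for its
  \<open>k\<close>-th exterior power. The parameter \<open>W\<close> is the fibre.\<close>

definition continuous_section ::
    "('m::topological_space, 'n::finite) chart set \<Rightarrow>
     (('n coords \<Rightarrow> 'n coords) \<Rightarrow> 'w::euclidean_space \<Rightarrow> 'w) \<Rightarrow>
     'm set \<Rightarrow> ('m \<Rightarrow> 'w) \<Rightarrow> bool" where
  "continuous_section \<A> L S \<sigma> \<longleftrightarrow> (\<forall>c\<in>\<A>.
     continuous_on (S \<inter> fst c) (\<lambda>y. L (coord_change (chart_at \<A> y) c y) (\<sigma> y)))"

definition is_basis :: "'w::real_vector set \<Rightarrow> nat \<Rightarrow> (nat \<Rightarrow> 'w) \<Rightarrow> bool" where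
  "is_basis V d b \<longleftrightarrow> inj_on b {..<d} \<and> independent (b ` {..<d}) \<and> span (b ` {..<d}) = V"

definition continuous_subbundle ::
    "('m::topological_space, 'n::finite) chart set \<Rightarrow>
     (('n coords \<Rightarrow> 'n coords) \<Rightarrow> 'w::euclidean_space \<Rightarrow> 'w) \<Rightarrow>
     'm set \<Rightarrow> ('m \<Rightarrow> 'w set) \<Rightarrow> bool" where
  "continuous_subbundle \<A> L \<Gamma> V \<longleftrightarrow> (\<forall>x\<in>\<Gamma>. \<exists>U d s. open U \<and> x \<in> U \<and>
     (\<forall>y\<in>U \<inter> \<Gamma>. is_basis (V y) d (\<lambda>i. s i y)) \<and>
     (\<forall>i<d. continuous_section \<A> L (U \<inter> \<Gamma>) (s i)))"

definition invariant_splitting ::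
    "('m::topological_space, 'n::finite) chart set \<Rightarrow> (real \<Rightarrow> 'm \<Rightarrow> 'm) \<Rightarrow>
     (('n coords \<Rightarrow> 'n coords) \<Rightarrow> 'w::euclidean_space \<Rightarrow> 'w) \<Rightarrow> 'w set \<Rightarrow>
     'm set \<Rightarrow> ('m \<Rightarrow> 'w set) \<Rightarrow> ('m \<Rightarrow> 'w set) \<Rightarrow> bool" where
  "invariant_splitting \<A> \<phi> L W \<Gamma> E F \<longleftrightarrow>
     continuous_subbundle \<A> L \<Gamma> E \<and> continuous_subbundle \<A> L \<Gamma> F \<and>
     (\<forall>x\<in>\<Gamma>. subspace (E x) \<and> subspace (F x) \<and> E x \<noteq> {0} \<and> F x \<noteq> {0} \<and>
        {u + v | u v. u \<in> E x \<and> v \<in> F x} = W \<and> E x \<inter> F x = {0}) \<and>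
     (\<forall>t. \<forall>x\<in>\<Gamma>. L (flow_deriv \<A> \<phi> t x) ` E x = E (\<phi> t x) \<and>
        L (flow_deriv \<A> \<phi> t x) ` F x = F (\<phi> t x))"

definition F_tilde ::
    "nat \<Rightarrow> (nat \<Rightarrow> 'm \<Rightarrow> 'n::{finite,linorder} coords) \<Rightarrow> 'm \<Rightarrow> 'n kvector set" where
  "F_tilde k f x = span {wedge k (\<lambda>r. f r x)}"

definition E_tilde ::
    "nat \<Rightarrow> nat \<Rightarrow> (nat \<Rightarrow> 'm \<Rightarrow> 'n::{finite,linorder} coords) \<Rightarrow> (nat \<Rightarrow> 'm \<Rightarrow> 'n coords) \<Rightarrow>
     'm \<Rightarrow> 'n kvector set" where
  "E_tilde l k e f x = span (
     {wedge k (\<lambda>r. e (a r) x) | a. strict_mono_on {..<k} a \<and> a ` {..<k} \<subseteq> {..<l}} \<union>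
     {wedge k (\<lambda>r. if r < i then e (a r) x else f (b (r - i)) x) | i j a b.
        i + j = k \<and> 1 \<le> i \<and> 1 \<le> j \<and> a ` {..<i} \<subseteq> {..<l} \<and> b ` {..<j} \<subseteq> {..<k}})"

definition dominated_ext_splitting ::
    "('m::topological_space, 'n::{finite,linorder}) chart set \<Rightarrow>
     ('m \<Rightarrow> 'n coords \<Rightarrow> 'n coords \<Rightarrow> real) \<Rightarrow> (real \<Rightarrow> 'm \<Rightarrow> 'm) \<Rightarrow> nat \<Rightarrow> 'm set \<Rightarrow>
     ('m \<Rightarrow> 'n kvector set) \<Rightarrow> ('m \<Rightarrow> 'n kvector set) \<Rightarrow> bool" where
  "dominated_ext_splitting \<A> g \<phi> k \<Gamma> E F \<longleftrightarrow>
     invariant_splitting \<A> \<phi> (ext_map k) (ext_power k) \<Gamma> E F \<and>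
     (\<exists>K \<kappa>. 0 < K \<and> 0 < \<kappa> \<and> (\<forall>x\<in>\<Gamma>. \<forall>t>0.
        (let N = (\<lambda>p. form_norm (ext_inner k (g p))); y = \<phi> t x in
           op_norm (N x) (N y) (E x) (ext_map k (flow_deriv \<A> \<phi> t x)) *
           op_norm (N y) (N x) (F y) (ext_map k (flow_deriv \<A> \<phi> (- t) y))
         < K * exp (- \<kappa> * t))))"

end

theory Submission
  imports Defs "HOL-Analysis.Analysis"
begin

text \<open>Both sides are equivalent to the uniform exponential decay of
  \<open>\<parallel>DX\<^sub>t|E\<^sub>x\<parallel> \<cdot> \<parallel>DX\<^sub>-\<^sub>t|F\<^sub>y\<parallel>\<close>, where \<open>y = X\<^sub>t(x)\<close>.

  For domination this is linear algebra. In frames adapted to the splitting, with constants that are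
  uniform over \<open>\<Gamma>\<close> by compactness, let \<open>q\<close> be the product above and \<open>Q\<close> its analogue for the
  induced splitting of the exterior power. Replacing one vector of \<open>f\<^sub>1 \<and> \<dots> \<and> f\<^sub>k\<close> by a vector of
  \<open>E\<close> gives \<open>q \<le> K Q\<close>; replacing \<open>i \<ge> 1\<close> of them multiplies the norm by about \<open>q\<^sup>i\<close>, which
  gives \<open>Q \<le> K (q + q\<^sup>k)\<close>.

  For the growth rates, \<open>a\<^sub>t = log \<parallel>DX\<^sub>t|E\<parallel>\<close> and \<open>b\<^sub>t = - log m(DX\<^sub>t|F)\<close> are continuous subadditive
  cocycles. If no \<open>a\<^sub>n + b\<^sub>n\<close> were negative on all of \<open>\<Gamma>\<close>, then averaging along orbit segments on
  which it is nonnegative would give an invariant probability measure \<open>\<mu>\<close> with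
  \<open>\<integral> (a\<^sub>n + b\<^sub>n) d\<mu> \<ge> 0\<close> for all \<open>n\<close>. By the Katznelson--Weiss proof of the subadditive ergodic
  theorem, \<open>1/n \<integral> a\<^sub>n d\<mu>\<close> and \<open>1/n \<integral> b\<^sub>n d\<mu>\<close> are eventually below the integrals of the lower growth
  rates plus \<open>\<epsilon>\<close>, and these sum to at most \<open>\<eta> < 0\<close>. So \<open>a\<^sub>n + b\<^sub>n < 0\<close> for some \<open>n\<close>, and
  subadditivity turns this into linear decay.

  The derivative of the flow exists only because orbits of \<open>\<Gamma>\<close> avoid the boundary; its existence
  and continuity come from Gronwall estimates in charts.\<close>

section \<open>Determinants and exterior powers\<close>

text \<open>The hypothesis adds two separate lower limits, and their sum can lie strictly below the
  lower limit of \<open>a\<^sub>t + b\<^sub>t\<close>. So it says nothing direct about a + b: the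
  measure is extracted from orbits on which a + b is nonnegative, but the lower growth rates are
  integrated for a and for b one at a time. Taking these rates along integers keeps them measurable;
  rounding times costs a bounded amount. Tangent vectors at p are coordinates in a chart chosen by
  \<open>SOME\<close>, which may jump with p. Raw coordinates at nearby points are therefore not
  comparable. Comparisons are made in one fixed chart, or between the norms of vectors with equal
  coordinates in two frames; closeness is measured by factors exp \<epsilon>, which become additive
  errors in logarithms. Norms on exterior powers are handled as Euclidean volumes: every fibre
  metric is the pullback of the Euclidean product by a linear map, and appending a vector to a wedge
  multiplies its norm by the distance of that vector to the span of the earlier ones.\<close>

lemma elem_bij_betw:
  fixes S :: "'n::{finite,linorder} set"
  shows "card S = k \<Longrightarrow> bij_betw (elem S) {..<k} S"
  unfolding elem_def
  by (rule bij_betw_nth) (auto simp: sorted_list_of_set.length_sorted_key_list_of_set)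

lemma elem_strict_mono:
  fixes S :: "'n::{finite,linorder} set"
  assumes "card S = k" "i < j" "j < k"
  shows "elem S i < elem S j"
  unfolding elem_def
  using assms strict_sorted_list_of_set[of S]
  by (auto simp: sorted_wrt_iff_nth_less)

section \<open>Signed permutation sums and their row operations\<close>

lemma leibniz_det_cong:
  assumes "\<And>i j. i < k \<Longrightarrow> j < k \<Longrightarrow> a i j = b i j"
  shows "leibniz_det k a = leibniz_det k b"
  unfolding leibniz_det_def
  by (intro sum.cong refl arg_cong2[where f="(*)"] prod.cong)
     (auto simp: assms permutes_in_image[where S="{..<k}", simplified])

text \<open>Summing over inverse permutations leaves the sign unchanged, and reindexing each product
  by p exchanges the roles of rows and columns.\<close>

lemma leibniz_det_transpose: "leibniz_det k (\<lambda>i j. a j i) = leibniz_det k a"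
proof -
  let ?P = "{p. p permutes {..<k}}"
  have "leibniz_det k (\<lambda>i j. a j i) = (\<Sum>p\<in>?P. of_int (sign (inv p)) * (\<Prod>i<k. a (inv p i) i))"
    unfolding leibniz_det_def by (rule sum_permutations_inverse)
  also have "\<dots> = (\<Sum>p\<in>?P. of_int (sign p) * (\<Prod>i<k. a i (p i)))"
  proof (rule sum.cong[OF refl])
    fix p assume "p \<in> ?P"
    then have p: "p permutes {..<k}" by simp
    have "(\<Prod>i<k. a (inv p i) i) = prod ((\<lambda>i. a (inv p i) i) \<circ> p) {..<k}"
      by (rule prod.permute[OF p])
    also have "\<dots> = (\<Prod>i<k. a i (p i))"
      using p by (simp add: permutes_inverses o_def)
    moreover have "sign (inv p) = sign p"
      using p by (simp add: sign_inverse permutation_permutes exI[of _ "{..<k}"])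
    ultimately show "of_int (sign (inv p)) * (\<Prod>i<k. a (inv p i) i)
        = (of_int (sign p) * (\<Prod>i<k. a i (p i)) :: real)"
      by simp
  qed
  finally show ?thesis by (simp add: leibniz_det_def)
qed

lemma leibniz_det_permute_rows:
  assumes q: "q permutes {..<k}"
  shows "leibniz_det k (\<lambda>i. a (q i)) = of_int (sign q) * leibniz_det k a"
proof -
  let ?P = "{p. p permutes {..<k}}"
  have pq: "permutation q" using q by (auto simp: permutation_permutes)
  have "leibniz_det k (\<lambda>i. a (q i)) = (\<Sum>p\<in>?P. of_int (sign (p \<circ> q)) * (\<Prod>i<k. a (q i) ((p \<circ> q) i)))"
    unfolding leibniz_det_def by (rule sum_permutations_compose_right[OF q])
  also have "\<dots> = (\<Sum>p\<in>?P. of_int (sign q) * (of_int (sign p) * (\<Prod>i<k. a i (p i))))"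
  proof (rule sum.cong[OF refl])
    fix p assume "p \<in> ?P"
    then have p: "p permutes {..<k}" by simp
    then have pp: "permutation p" by (auto simp: permutation_permutes)
    have "(\<Prod>i<k. a i (p i)) = prod ((\<lambda>i. a i (p i)) \<circ> q) {..<k}"
      by (rule prod.permute[OF q])
    then show "of_int (sign (p \<circ> q)) * (\<Prod>i<k. a (q i) ((p \<circ> q) i))
      = (of_int (sign q) * (of_int (sign p) * (\<Prod>i<k. a i (p i))) :: real)"
      using sign_compose[OF pp pq] by (simp add: o_def mult_ac)
  qed
  finally show ?thesis by (simp add: leibniz_det_def sum_distrib_left)
qed

text \<open>Swapping the two equal rows changes nothing and also reverses the sign.\<close>

lemma leibniz_det_equal_rows:
  assumes "i < k" "j < k" "i \<noteq> j" "\<And>m. m < k \<Longrightarrow> a i m = a j m"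
  shows "leibniz_det k a = 0"
proof -
  let ?q = "Transposition.transpose i j"
  have q: "?q permutes {..<k}" using assms by (intro permutes_swap_id) auto
  have "leibniz_det k a = leibniz_det k (\<lambda>r. a (?q r))"
    by (rule leibniz_det_cong) (auto simp: Transposition.transpose_def assms)
  also have "\<dots> = - leibniz_det k a"
    using leibniz_det_permute_rows[OF q] assms(3) by (simp add: sign_swap_id)
  finally show ?thesis by simp
qed

lemma leibniz_det_zero_row:
  assumes "i < k" "\<And>m. m < k \<Longrightarrow> a i m = 0"
  shows "leibniz_det k a = 0"
  unfolding leibniz_det_def
proof (rule sum.neutral, safe)
  fix p assume "p permutes {..<k}"
  then have "p i < k" using assms(1) permutes_in_image[of p "{..<k}" i] by auto
  then have "\<exists>i\<in>{..<k}. a i (p i) = 0" using assms by auto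
  then have "(\<Prod>i<k. a i (p i)) = 0" by simp
  then show "of_int (sign p) * (\<Prod>i<k. a i (p i)) = 0" by simp
qed

lemma leibniz_det_diagonal:
  assumes "\<And>i j. i < k \<Longrightarrow> j < k \<Longrightarrow> i \<noteq> j \<Longrightarrow> a i j = 0"
  shows "leibniz_det k a = (\<Prod>i<k. a i i)"
proof -
  have "leibniz_det k a = (\<Sum>p\<in>{id}. of_int (sign p) * (\<Prod>i<k. a i (p i)))"
    unfolding leibniz_det_def
  proof (rule sum.mono_neutral_right)
    show "finite {p. p permutes {..<k}}" by (simp add: finite_permutations)
    show "{id} \<subseteq> {p. p permutes {..<k}}" by (simp add: permutes_id)
    show "\<forall>p\<in>{p. p permutes {..<k}} - {id}. of_int (sign p) * (\<Prod>i<k. a i (p i)) = 0"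
    proof (rule ballI)
      fix p assume "p \<in> {p. p permutes {..<k}} - {id}"
      then have p: "p permutes {..<k}" "p \<noteq> id" by auto
      then obtain i where "p i \<noteq> i" by (auto simp: fun_eq_iff)
      then have "i < k" using p permutes_not_in[of p "{..<k}" i] by auto
      then have "p i < k" using permutes_in_image[of p "{..<k}" i] p by auto
      then have "\<exists>i\<in>{..<k}. a i (p i) = 0" using assms[of i "p i"] \<open>p i \<noteq> i\<close> \<open>i < k\<close>
        by (auto intro!: bexI[of _ i])
      then have "(\<Prod>i<k. a i (p i)) = 0" by simp
      then show "of_int (sign p) * (\<Prod>i<k. a i (p i)) = 0" by simp
    qed
  qed
  then show ?thesis by (simp add: sign_id)
qed

lemma leibniz_det_linear_row:
  assumes "r < k"
  shows "leibniz_det k (a(r := (\<lambda>j. c * x j + d * y j)))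
    = c * leibniz_det k (a(r := x)) + d * leibniz_det k (a(r := y))"
proof -
  have *: "(\<Prod>i<k. (a(r := z)) i (p i)) = z (p r) * (\<Prod>i\<in>{..<k} - {r}. a i (p i))" for z p
    using assms by (subst prod.remove[of _ r]) (auto intro!: arg_cong2[where f="(*)"] prod.cong)
  show ?thesis
    unfolding leibniz_det_def *
    by (simp add: sum_distrib_left sum.distrib[symmetric] algebra_simps)
qed

text \<open>Cauchy--Binet.\<close>

lemma leibniz_det_mult:
  fixes U :: "nat \<Rightarrow> 'n::{finite,linorder} \<Rightarrow> real"
  shows "leibniz_det k (\<lambda>i j. \<Sum>a\<in>UNIV. U i a * L a j)
    = (\<Sum>S | card S = k. leibniz_det k (\<lambda>i j. U i (elem S j)) * leibniz_det k (\<lambda>i j. L (elem S i) j))"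
proof -
  let ?P = "{p. p permutes {..<k}}"
  let ?F = "PiE {..<k} (\<lambda>_. UNIV :: 'n set)"
  let ?I = "{s \<in> ?F. inj_on s {..<k}}"
  let ?d = "\<lambda>s. leibniz_det k (\<lambda>i j. L (s i) j)"
  have finF: "finite ?F" by (intro finite_PiE) auto
  have "leibniz_det k (\<lambda>i j. \<Sum>a\<in>UNIV. U i a * L a j)
      = (\<Sum>p\<in>?P. of_int (sign p) * (\<Sum>s\<in>?F. \<Prod>i<k. U i (s i) * L (s i) (p i)))"
    unfolding leibniz_det_def by (subst prod_sum_PiE) auto
  also have "\<dots> = (\<Sum>s\<in>?F. (\<Prod>i<k. U i (s i)) * ?d s)"
    unfolding leibniz_det_def sum_distrib_left
    by (subst sum.swap) (simp add: prod.distrib mult_ac)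
  \<comment> \<open>A choice of inner indices that is not injective repeats a row of L, so its
    determinant vanishes. The injective choices are then grouped by their image S.\<close>
  also have "\<dots> = (\<Sum>s\<in>?I. (\<Prod>i<k. U i (s i)) * ?d s)"
  proof (rule sum.mono_neutral_right[OF finF])
    show "\<forall>s\<in>?F - ?I. (\<Prod>i<k. U i (s i)) * ?d s = 0"
    proof
      fix s assume "s \<in> ?F - ?I"
      then obtain i j where "i < k" "j < k" "i \<noteq> j" "s i = s j" by (auto simp: inj_on_def)
      then have "?d s = 0"
        by (intro leibniz_det_equal_rows[of i k j]) auto
      then show "(\<Prod>i<k. U i (s i)) * ?d s = 0" by simp
    qed
  qed auto
  also have "\<dots> = (\<Sum>S | card S = k. \<Sum>s\<in>{s\<in>?I. s ` {..<k} = S}. (\<Prod>i<k. U i (s i)) * ?d s)"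
  proof (rule sum.group[symmetric])
    show "finite ?I" using finF by (rule rev_finite_subset) blast
    show "(\<lambda>s. s ` {..<k}) ` ?I \<subseteq> {S. card S = k}"
      by (rule image_subsetI) (simp add: card_image)
  qed simp
  also have "\<dots> = (\<Sum>S | card S = k. leibniz_det k (\<lambda>i j. U i (elem S j)) * ?d (elem S))"
  proof (rule sum.cong[OF refl])
    fix S :: "'n set" assume "S \<in> {S. card S = k}"
    then have S: "card S = k" by simp
    note bij = elem_bij_betw[OF S]
    define ix where "ix = inv_into {..<k} (elem S)"
    have ix: "ix x < k" "elem S (ix x) = x" if "x \<in> S" for x
      using that bij inv_into_into[of x "elem S" "{..<k}"] f_inv_into_f[of x "elem S" "{..<k}"]
      unfolding ix_def bij_betw_def by auto
    have ix2: "ix (elem S i) = i" if "i < k" for i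
      using that bij inv_into_f_f unfolding ix_def bij_betw_def by force
    \<comment> \<open>An injection with image S is \<open>elem S\<close> after a unique permutation
      of the positions. Functions in \<open>PiE\<close> are undefined from k on while permutations
      are the identity there, hence the \<open>restrict\<close> in one direction and the case
      distinction in the other.\<close>
    have "(\<Sum>s\<in>{s\<in>?I. s ` {..<k} = S}. (\<Prod>i<k. U i (s i)) * ?d s)
      = (\<Sum>p\<in>?P. (\<Prod>i<k. U i (elem S (p i))) * ?d (elem S \<circ> p))"
    proof (rule sum.reindex_bij_witness[where
          i = "\<lambda>p. restrict (elem S \<circ> p) {..<k}" and
          j = "\<lambda>s i. if i < k then ix (s i) else i"])
      fix s assume s: "s \<in> {s\<in>?I. s ` {..<k} = S}"
      then have sS: "\<And>i. i < k \<Longrightarrow> s i \<in> S" by auto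
      show "restrict (elem S \<circ> (\<lambda>i. if i < k then ix (s i) else i)) {..<k} = s"
        using s sS ix by (auto simp: fun_eq_iff PiE_def extensional_def)
      have "inj_on (\<lambda>i. ix (s i)) {..<k}"
      proof (rule inj_onI)
        fix i j assume ij: "i \<in> {..<k}" "j \<in> {..<k}" "ix (s i) = ix (s j)"
        have "s i = elem S (ix (s i))" using ij(1) by (intro ix(2)[OF sS, symmetric]) simp
        also have "\<dots> = elem S (ix (s j))" by (simp only: ij(3))
        also have "\<dots> = s j" using ij(2) by (intro ix(2)[OF sS]) simp
        finally have "s i = s j" .
        moreover have "inj_on s {..<k}" using s by simp
        ultimately show "i = j" using ij by (simp add: inj_on_eq_iff)
      qed
      then have "inj_on (\<lambda>i. if i < k then ix (s i) else i) {..<k}"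
        by (simp add: inj_on_def)
      then have "bij_betw (\<lambda>i. if i < k then ix (s i) else i) {..<k} {..<k}"
        using sS ix(1) unfolding bij_betw_def by (intro conjI endo_inj_surj) auto
      then show "(\<lambda>i. if i < k then ix (s i) else i) \<in> ?P"
        unfolding mem_Collect_eq by (rule bij_imp_permutes) simp
      show "(\<Prod>i<k. U i (elem S (if i < k then ix (s i) else i))) *
          ?d (elem S \<circ> (\<lambda>i. if i < k then ix (s i) else i)) = (\<Prod>i<k. U i (s i)) * ?d s"
        using sS ix by (auto intro!: arg_cong2[where f="(*)"] prod.cong leibniz_det_cong)
    next
      fix p assume "p \<in> ?P"
      then have p: "p permutes {..<k}" by simp
      have pk: "p i < k" if "i < k" for i using that permutes_in_image[OF p, of i] by auto
      show "(\<lambda>i. if i < k then ix (restrict (elem S \<circ> p) {..<k} i) else i) = p"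
        using pk ix2 permutes_not_in[OF p] by (auto simp: fun_eq_iff)
      have "bij_betw (elem S \<circ> p) {..<k} S"
        using bij_betw_trans[OF permutes_imp_bij[OF p] bij] .
      then have "bij_betw (restrict (elem S \<circ> p) {..<k}) {..<k} S"
        by (subst bij_betw_cong[where g="elem S \<circ> p"]) auto
      then have "inj_on (restrict (elem S \<circ> p) {..<k}) {..<k}"
        "restrict (elem S \<circ> p) {..<k} ` {..<k} = S" by (simp_all only: bij_betw_def)
      moreover have "restrict (elem S \<circ> p) {..<k} \<in> ?F" by auto
      ultimately show "restrict (elem S \<circ> p) {..<k} \<in> {s\<in>?I. s ` {..<k} = S}"
        by (simp only: mem_Collect_eq)
    qed
    also have "\<dots> = (\<Sum>p\<in>?P. of_int (sign p) * (\<Prod>i<k. U i (elem S (p i)))) * ?d (elem S)"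
      using leibniz_det_permute_rows[of _ k "\<lambda>i j. L (elem S i) j"]
      by (simp add: sum_distrib_left o_def mult_ac)
    finally show "(\<Sum>s\<in>{s\<in>?I. s ` {..<k} = S}. (\<Prod>i<k. U i (s i)) * ?d s)
      = leibniz_det k (\<lambda>i j. U i (elem S j)) * ?d (elem S)"
      by (simp add: leibniz_det_def)
  qed
  finally show ?thesis .
qed

text \<open>A permutation that moves k picks up a vanishing entry of the last row; the others are
  exactly the permutations of the first k positions. Applied to Gram matrices whose last vector is
  orthogonal to all others.\<close>

lemma leibniz_det_Suc_last_row:
  assumes "\<And>j. j < k \<Longrightarrow> a k j = 0"
  shows "leibniz_det (Suc k) a = leibniz_det k a * a k k"
proof -
  have eq: "{p. p permutes {..<k}} \<subseteq> {p. p permutes {..<Suc k}}"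
    by (auto intro: permutes_subset)
  have "leibniz_det (Suc k) a = (\<Sum>p | p permutes {..<k}. of_int (sign p) * (\<Prod>i<Suc k. a i (p i)))"
    unfolding leibniz_det_def
  proof (rule sum.mono_neutral_right[OF _ eq])
    show "finite {p. p permutes {..<Suc k}}" by (simp add: finite_permutations)
    show "\<forall>p\<in>{p. p permutes {..<Suc k}} - {p. p permutes {..<k}}.
        of_int (sign p) * (\<Prod>i<Suc k. a i (p i)) = 0"
    proof (rule ballI)
      fix p assume "p \<in> {p. p permutes {..<Suc k}} - {p. p permutes {..<k}}"
      then have p: "p permutes {..<Suc k}" "\<not> p permutes {..<k}" by auto
      have "p k \<noteq> k"
      proof
        assume "p k = k"
        then have "p permutes {..<k}"
          by (intro permutes_superset[OF p(1)]) (auto simp: less_Suc_eq)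
        then show False using p by simp
      qed
      moreover have "p k < Suc k" using permutes_in_image[OF p(1), of k] by simp
      ultimately have "a k (p k) = 0" by (intro assms) simp
      then show "of_int (sign p) * (\<Prod>i<Suc k. a i (p i)) = 0" by simp
    qed
  qed
  also have "\<dots> = (\<Sum>p | p permutes {..<k}. of_int (sign p) * (\<Prod>i<k. a i (p i)) * a k k)"
  proof (rule sum.cong[OF refl])
    fix p assume "p \<in> {p. p permutes {..<k}}"
    then have "p k = k" using permutes_not_in[of p "{..<k}" k] by simp
    then show "of_int (sign p) * (\<Prod>i<Suc k. a i (p i)) = of_int (sign p) * (\<Prod>i<k. a i (p i)) * a k k"
      by simp
  qed
  finally show ?thesis by (simp add: leibniz_det_def sum_distrib_right)
qed

section \<open>Products of vectors and the maps they induce\<close>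

lemma wedge_nth:
  "wedge k u $ S = (if card S = k then leibniz_det k (\<lambda>i j. u i $ elem S j) else 0)"
  by (simp add: wedge_def)

lemma wedge_cong: "(\<And>i. i < k \<Longrightarrow> u i = v i) \<Longrightarrow> wedge k u = wedge k v"
  by (auto simp: vec_eq_iff wedge_nth intro!: leibniz_det_cong)

lemma wedge_permute:
  "p permutes {..<k} \<Longrightarrow> wedge k (\<lambda>i. u (p i)) = of_int (sign p) *\<^sub>R wedge k u"
  using leibniz_det_permute_rows[of p k] by (auto simp: vec_eq_iff wedge_nth)

lemma norm_wedge_permute:
  "p permutes {..<k} \<Longrightarrow> norm (wedge k (\<lambda>i. u (p i))) = norm (wedge k u)"
  using wedge_permute[of p k u] by (simp add: sign_def)

lemma wedge_equal:
  "i < k \<Longrightarrow> j < k \<Longrightarrow> i \<noteq> j \<Longrightarrow> u i = u j \<Longrightarrow> wedge k u = 0"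
  using leibniz_det_equal_rows[of i k j "\<lambda>i j. u i $ elem _ j"]
  by (simp add: vec_eq_iff wedge_nth)

lemma wedge_linear_row:
  assumes "r < k"
  shows "wedge k (u(r := c *\<^sub>R x + d *\<^sub>R y)) = c *\<^sub>R wedge k (u(r := x)) + d *\<^sub>R wedge k (u(r := y))"
proof -
  have *: "(\<lambda>i j. (u(r := z)) i $ elem S j) = (\<lambda>i j. u i $ elem S j)(r := (\<lambda>j. z $ elem S j))"
    for z S by (auto simp: fun_eq_iff)
  show ?thesis
    unfolding vec_eq_iff wedge_nth vector_add_component vector_scaleR_component *
    using leibniz_det_linear_row[OF assms] by simp
qed

lemma linear_wedge_row: "r < k \<Longrightarrow> linear (\<lambda>x. wedge k (u(r := x)))"
  using wedge_linear_row[of r k u 1 _ 1] wedge_linear_row[of r k u _ _ 0 0]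
  by (intro linearI) auto

text \<open>If S' differs from S but has the same size, some index of S is missing from S', and the
  corresponding row of the minor is zero.\<close>

lemma wedge_axis:
  assumes "card S = k"
  shows "wedge k (\<lambda>i. axis (elem S i) 1) = axis S (1::real)"
proof (rule vec_eq_iff[THEN iffD2], rule allI)
  fix S' :: "'a set"
  consider "card S' \<noteq> k" | "S' = S" | "card S' = k" "S' \<noteq> S" by auto
  then show "wedge k (\<lambda>i. axis (elem S i) 1) $ S' = axis S (1::real) $ S'"
  proof cases
    case 1
    then show ?thesis using assms by (auto simp: wedge_nth axis_def)
  next
    case 2
    have "inj_on (elem S) {..<k}" using elem_bij_betw[OF assms] by (simp add: bij_betw_def)
    then show ?thesis using 2 assms
      by (auto simp: wedge_nth axis_def inj_on_eq_iff leibniz_det_diagonal)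
  next
    case 3
    then have "\<not> S \<subseteq> S'" using card_subset_eq[of S' S] assms by auto
    then obtain i where i: "i < k" "elem S i \<notin> S'"
      using elem_bij_betw[OF assms] unfolding bij_betw_def by force
    have "leibniz_det k (\<lambda>i j. axis (elem S i) 1 $ elem S' j) = (0::real)"
    proof (rule leibniz_det_zero_row[OF i(1)])
      fix m assume "m < k"
      then have "elem S' m \<in> S'" using elem_bij_betw[OF 3(1)] by (auto simp: bij_betw_def)
      then show "axis (elem S i) 1 $ elem S' m = (0::real)" using i by (auto simp: axis_def)
    qed
    then show ?thesis using 3 by (simp add: wedge_nth axis_def)
  qed
qed

lemma linear_ext_map: "linear (ext_map k T)"
  unfolding ext_map_def
  by (intro linearI) (simp_all add: sum.distrib scaleR_left_distrib scaleR_sum_right)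

lemma ext_map_axis:
  assumes "card S = k"
  shows "ext_map k T (axis S 1) = wedge k (\<lambda>i. T (axis (elem S i) 1))"
proof -
  have "ext_map k T (axis S 1) = (\<Sum>S'\<in>{S}. axis S 1 $ S' *\<^sub>R wedge k (\<lambda>i. T (axis (elem S' i) 1)))"
    unfolding ext_map_def using assms by (intro sum.mono_neutral_right) (auto simp: axis_def)
  then show ?thesis by simp
qed

lemma linear_axis_expansion:
  fixes H :: "real ^ 'n \<Rightarrow> 'w::real_vector"
  assumes "linear H" shows "H \<xi> = (\<Sum>i\<in>UNIV. \<xi> $ i *\<^sub>R H (axis i 1))"
proof -
  have "H \<xi> = H (\<Sum>i\<in>UNIV. \<xi> $ i *\<^sub>R axis i 1)"
    using basis_expansion[of \<xi>] by (simp add: scalar_mult_eq_scaleR)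
  then show ?thesis by (simp add: linear_sum[OF assms] linear_scale[OF assms])
qed

text \<open>Each coordinate is an instance of Cauchy-Binet, for the matrix of the vectors
  \<open>u i\<close> times the matrix of T.\<close>

lemma ext_map_wedge:
  assumes "linear T"
  shows "ext_map k T (wedge k u) = wedge k (\<lambda>i. T (u i))"
proof (rule vec_eq_iff[THEN iffD2], rule allI)
  fix S' :: "'a set"
  show "ext_map k T (wedge k u) $ S' = wedge k (\<lambda>i. T (u i)) $ S'"
    using leibniz_det_mult[of k "\<lambda>i a. u i $ a" "\<lambda>a j. T (axis a 1) $ elem S' j"]
    by (simp add: ext_map_def wedge_nth linear_axis_expansion[OF assms, of "u _"])
qed

lemma axis_expansion: "\<xi> = (\<Sum>i\<in>UNIV. \<xi> $ i *\<^sub>R axis i (1::real))"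
  using basis_expansion[of \<xi>] by (simp add: scalar_mult_eq_scaleR)

text \<open>Used for two index types: indices of \<open>real ^ 'n\<close>, and index sets for the
  exterior algebra. An adapted frame carries such subspaces of the first kind to E and F, and its
  exterior power carries those of the second kind to the induced splitting.\<close>

definition coord_space :: "'n::finite set \<Rightarrow> (real ^ 'n) set" where
  "coord_space I = {\<xi>. \<forall>i. i \<notin> I \<longrightarrow> \<xi> $ i = 0}"

lemma subspace_coord_space: "subspace (coord_space I)"
  by (auto simp: coord_space_def subspace_def)

lemma axis_in_coord_space: "axis i c \<in> coord_space I \<longleftrightarrow> i \<in> I \<or> c = 0"
  by (auto simp: coord_space_def axis_def)

lemma coord_space_eq_span: "coord_space I = span ((\<lambda>i. axis i 1) ` I)"
proof
  show "coord_space I \<subseteq> span ((\<lambda>i. axis i 1) ` I)"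
  proof
    fix \<xi> assume "\<xi> \<in> coord_space I"
    then have "\<xi> $ i *\<^sub>R axis i (1::real) \<in> span ((\<lambda>i. axis i 1) ` I)" for i
      by (cases "i \<in> I") (auto simp: coord_space_def span_zero intro: span_scale span_base)
    then have "(\<Sum>i\<in>UNIV. \<xi> $ i *\<^sub>R axis i (1::real)) \<in> span ((\<lambda>i. axis i 1) ` I)" by (intro span_sum)
    then show "\<xi> \<in> span ((\<lambda>i. axis i 1) ` I)" by (simp only: axis_expansion[symmetric])
  qed
  show "span ((\<lambda>i. axis i 1) ` I) \<subseteq> coord_space I"
    by (intro span_minimal subspace_coord_space) (auto simp: axis_in_coord_space)
qed

lemma ext_power_eq: "ext_power k = coord_space {S. card S = k}"
proof
  show "ext_power k \<subseteq> coord_space {S. card S = k}"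
    unfolding ext_power_def by (intro span_minimal subspace_coord_space) (auto simp: coord_space_def wedge_nth)
  have "axis S (1::real) \<in> range (wedge k)" if "card S = k" for S using wedge_axis[OF that] by (metis rangeI)
  then show "coord_space {S. card S = k} \<subseteq> ext_power k"
    unfolding coord_space_eq_span ext_power_def by (intro span_mono) auto
qed

lemma wedge_in_ext_power: "wedge k u \<in> ext_power k"
  unfolding ext_power_def by (rule span_base) simp

lemma subspace_ext_power: "subspace (ext_power k)"
  unfolding ext_power_def by (rule subspace_span)

lemma ext_map_in_ext_power: "ext_map k T \<omega> \<in> ext_power k"
  unfolding ext_map_def
  by (intro subspace_sum subspace_scale subspace_ext_power wedge_in_ext_power)

lemma ext_map_compose:
  assumes "linear T"
  shows "ext_map k T (ext_map k T' \<omega>) = ext_map k (\<lambda>v. T (T' v)) \<omega>"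
proof -
  have "ext_map k T (ext_map k T' \<omega>) = (\<Sum>S | card S = k. \<omega> $ S *\<^sub>R ext_map k T (wedge k (\<lambda>i. T' (axis (elem S i) 1))))"
    unfolding ext_map_def[of k T' \<omega>]
    by (simp add: linear_sum[OF linear_ext_map] linear_scale[OF linear_ext_map])
  then show ?thesis by (simp add: ext_map_wedge[OF assms] ext_map_def[of k _ \<omega>])
qed

lemma ext_map_cong: "(\<And>v. T v = T' v) \<Longrightarrow> ext_map k T \<omega> = ext_map k T' \<omega>"
  by (simp add: ext_map_def)

text \<open>\<open>ext_map k\<close> discards the coordinates of all other degrees, so it acts as
  the identity on degree k only.\<close>

lemma ext_map_ident:
  assumes "\<omega> \<in> ext_power k"
  shows "ext_map k (\<lambda>v. v) \<omega> = \<omega>"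
proof -
  have "\<omega> = (\<Sum>S\<in>UNIV. \<omega> $ S *\<^sub>R axis S (1::real))" by (rule axis_expansion)
  also have "\<dots> = (\<Sum>S | card S = k. \<omega> $ S *\<^sub>R axis S (1::real))"
    using assms by (intro sum.mono_neutral_right) (auto simp: ext_power_eq coord_space_def)
  finally show ?thesis by (simp add: ext_map_def wedge_axis)
qed

text \<open>The Gram determinant, by Cauchy-Binet for a matrix and the transpose of another
  one.\<close>

lemma inner_wedge: "wedge k u \<bullet> wedge k v = leibniz_det k (\<lambda>i j. u i \<bullet> v j)"
proof -
  have "wedge k u \<bullet> wedge k v = (\<Sum>S | card S = k. wedge k u $ S * wedge k v $ S)"
    unfolding inner_vec_def inner_real_def by (rule sum.mono_neutral_right) (auto simp: wedge_nth)
  also have "\<dots> = leibniz_det k (\<lambda>i j. \<Sum>a\<in>UNIV. u i $ a * v j $ a)"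
    unfolding leibniz_det_mult
    using leibniz_det_transpose[of k "\<lambda>i j. v i $ elem _ j"] by (simp add: wedge_nth)
  finally show ?thesis by (simp add: inner_vec_def)
qed

text \<open>If a form is the Euclidean product pulled back by P, then the form it induces on
  k-vectors is the Euclidean product pulled back by \<open>ext_map k P\<close>. In this way all
  fibre norms become Euclidean norms.\<close>

lemma ext_inner_inner:
  "ext_inner k (\<lambda>u v. P u \<bullet> P v) \<omega> \<eta> = ext_map k P \<omega> \<bullet> ext_map k P \<eta>"
proof -
  have "ext_map k P \<omega> \<bullet> ext_map k P \<eta> = (\<Sum>S' | card S' = k. \<Sum>S | card S = k. \<omega> $ S * \<eta> $ S' *
     (wedge k (\<lambda>i. P (axis (elem S i) 1)) \<bullet> wedge k (\<lambda>j. P (axis (elem S' j) 1))))"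
    unfolding ext_map_def by (simp add: inner_sum_left inner_sum_right mult_ac sum_distrib_left)
  then show ?thesis unfolding ext_inner_def inner_wedge[symmetric] by (subst sum.swap) simp
qed

subsection \<open>Norms of decomposable vectors\<close>

text \<open>The wedge is linear in its last entry and vanishes when that entry repeats an earlier
  one.\<close>

lemma wedge_Suc_add_span:
  assumes "y \<in> span (u ` {..<k})"
  shows "wedge (Suc k) (u(k := y + z)) = wedge (Suc k) (u(k := z))"
proof -
  interpret linear "\<lambda>x. wedge (Suc k) (u(k := x))" by (rule linear_wedge_row) simp
  have "wedge (Suc k) (u(k := y)) = 0"
    using assms
  proof (induction rule: span_induct)
    case (step x)
    then obtain i where "i < k" "x = u i" by auto
    then show ?case by (intro wedge_equal[of i _ k]) auto
  next
    show "subspace {x. wedge (Suc k) (u(k := x)) = 0}"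
      unfolding subspace_def using zero add scale by auto
  qed
  then show ?thesis using add[of y z] by simp
qed

text \<open>Volume is base times height: once the last vector is replaced by its component z
  orthogonal to the others, the last row of the Gram matrix is zero off the diagonal.\<close>

lemma norm_wedge_Suc:
  assumes "u k = y + z" "y \<in> span (u ` {..<k})" "\<And>i. i < k \<Longrightarrow> z \<bullet> u i = 0"
  shows "norm (wedge (Suc k) u) = norm (wedge k u) * norm z"
proof -
  let ?v = "u(k := z)"
  have "wedge (Suc k) u = wedge (Suc k) ?v"
    using wedge_Suc_add_span[OF assms(2), of z] assms(1) by (metis fun_upd_triv)
  moreover have "(norm (wedge (Suc k) ?v))\<^sup>2 = (norm (wedge k u) * norm z)\<^sup>2"
  proof -
    have "(norm (wedge (Suc k) ?v))\<^sup>2 = leibniz_det (Suc k) (\<lambda>i j. ?v i \<bullet> ?v j)"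
      by (simp add: power2_norm_eq_inner inner_wedge)
    also have "\<dots> = leibniz_det k (\<lambda>i j. ?v i \<bullet> ?v j) * (z \<bullet> z)"
      using assms(3) by (subst leibniz_det_Suc_last_row) auto
    also have "leibniz_det k (\<lambda>i j. ?v i \<bullet> ?v j) = leibniz_det k (\<lambda>i j. u i \<bullet> u j)"
      by (rule leibniz_det_cong) auto
    finally show ?thesis by (simp add: power_mult_distrib power2_norm_eq_inner inner_wedge)
  qed
  ultimately show ?thesis by (simp add: power2_eq_iff_nonneg)
qed

lemma norm_wedge_Suc_obtain:
  obtains y z where "u k = y + z" "y \<in> span (u ` {..<k})" "z \<bullet> y = 0"
    "norm (wedge (Suc k) u) = norm (wedge k u) * norm z"
proof -
  obtain y z where yz: "y \<in> span (u ` {..<k})" "\<And>w. w \<in> span (u ` {..<k}) \<Longrightarrow> orthogonal z w" "u k = y + z"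
    using orthogonal_subspace_decomp_exists[of "u ` {..<k}" "u k"] by metis
  then have "norm (wedge (Suc k) u) = norm (wedge k u) * norm z"
    by (intro norm_wedge_Suc[of u k y z]) (auto simp: orthogonal_def span_base)
  with yz that show ?thesis by (auto simp: orthogonal_def)
qed

lemma norm_wedge_Suc_le: "norm (wedge (Suc k) u) \<le> norm (wedge k u) * norm (u k)"
proof -
  obtain y z where yz: "u k = y + z" "z \<bullet> y = 0" "norm (wedge (Suc k) u) = norm (wedge k u) * norm z"
    using norm_wedge_Suc_obtain[of u k] by metis
  have "(norm z)\<^sup>2 \<le> (norm (u k))\<^sup>2"
    using yz by (simp add: power2_norm_eq_inner algebra_simps inner_commute[of y z])
  then have "norm z \<le> norm (u k)" by (simp add: power2_le_iff_abs_le)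
  then show ?thesis using yz by (simp add: mult_left_mono)
qed

text \<open>The height is attained as the distance to one particular y in the span, so any lower
  bound for the distance to the span bounds it.\<close>

lemma norm_wedge_Suc_ge:
  assumes "\<And>y. y \<in> span (u ` {..<k}) \<Longrightarrow> d \<le> norm (u k - y)"
  shows "norm (wedge k u) * d \<le> norm (wedge (Suc k) u)"
proof -
  obtain y z where yz: "u k = y + z" "y \<in> span (u ` {..<k})"
    "norm (wedge (Suc k) u) = norm (wedge k u) * norm z"
    using norm_wedge_Suc_obtain[of u k] by metis
  then have "d \<le> norm z" using assms[of y] by simp
  then show ?thesis using yz by (simp add: mult_left_mono)
qed

lemma norm_wedge_add_le:
  assumes "\<And>r. m \<le> r \<Longrightarrow> r < m + i \<Longrightarrow> norm (u r) \<le> M" "0 \<le> M"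
  shows "norm (wedge (m + i) u) \<le> norm (wedge m u) * M ^ i"
  using assms
proof (induction i)
  case (Suc i)
  have "norm (wedge (m + Suc i) u) \<le> norm (wedge (m + i) u) * norm (u (m + i))"
    using norm_wedge_Suc_le[of "m + i" u] by simp
  also have "\<dots> \<le> (norm (wedge m u) * M ^ i) * M"
    using Suc by (intro mult_mono) auto
  finally show ?case by (simp add: mult_ac)
qed simp

text \<open>The first m vectors stay behind as a factor. Two wedges that share these vectors can
  then be compared by cancelling it.\<close>

lemma norm_wedge_add_ge:
  assumes "\<And>r y. m \<le> r \<Longrightarrow> r < m + i \<Longrightarrow> y \<in> span (u ` {..<r}) \<Longrightarrow> d \<le> norm (u r - y)" "0 \<le> d"
  shows "norm (wedge m u) * d ^ i \<le> norm (wedge (m + i) u)"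
  using assms
proof (induction i)
  case (Suc i)
  have "(norm (wedge m u) * d ^ i) * d \<le> norm (wedge (m + i) u) * d"
    using Suc by (intro mult_right_mono) auto
  also have "\<dots> \<le> norm (wedge (m + Suc i) u)"
    using norm_wedge_Suc_ge[of u "m + i" d] Suc.prems by simp
  finally show ?case by (simp add: mult_ac)
qed simp

lemma norm_wedge_0: "norm (wedge 0 u) = 1"
proof -
  have "wedge 0 u \<bullet> wedge 0 u = 1" by (simp add: inner_wedge leibniz_det_diagonal)
  then show ?thesis by (simp add: norm_eq_sqrt_inner)
qed

lemma norm_wedge_le:
  assumes "\<And>r. r < k \<Longrightarrow> norm (u r) \<le> M" "0 \<le> M"
  shows "norm (wedge k u) \<le> M ^ k"
  using norm_wedge_add_le[of 0 k u M] assms by (simp add: norm_wedge_0)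

text \<open>A crude bound by the triangle inequality over the basis. Only its dependence on M
  matters; the number of index sets goes into a uniform constant.\<close>

lemma norm_ext_map_le:
  fixes T :: "'n::{finite,linorder} coords \<Rightarrow> 'n coords"
  assumes "\<And>v. norm (T v) \<le> M * norm v" "0 \<le> M"
  shows "norm (ext_map k T \<omega>) \<le> real (card (UNIV :: 'n set set)) * M ^ k * norm \<omega>"
proof -
  have "norm (ext_map k T \<omega>) \<le> (\<Sum>S\<in>{S. card S = k}. norm (\<omega> $ S *\<^sub>R wedge k (\<lambda>i. T (axis (elem S i) 1))))"
    unfolding ext_map_def by (rule norm_sum)
  also have "\<dots> \<le> (\<Sum>S\<in>{S :: 'n set. card S = k}. norm \<omega> * M ^ k)"
  proof (rule sum_mono)
    fix S :: "'n set" assume "S \<in> {S. card S = k}"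
    have "norm (wedge k (\<lambda>i. T (axis (elem S i) 1))) \<le> M ^ k"
      using assms(1)[of "axis _ 1"] assms(2) by (intro norm_wedge_le) auto
    then show "norm (\<omega> $ S *\<^sub>R wedge k (\<lambda>i. T (axis (elem S i) 1))) \<le> norm \<omega> * M ^ k"
      using component_le_norm_cart[of \<omega> S] by (auto intro!: mult_mono)
  qed
  also have "\<dots> \<le> (\<Sum>S\<in>(UNIV :: 'n set set). norm \<omega> * M ^ k)"
    using assms(2) by (intro sum_mono2) auto
  finally show ?thesis by (simp add: mult_ac)
qed

subsection \<open>Inner products as pulled back Euclidean products\<close>

text \<open>Gram-Schmidt by induction on the index set. Carrying the span along as well ensures that
  the next basis vector is independent of the vectors built so far.\<close>

lemma orthonormal_basis_of_form:
  fixes G :: "real ^ 'n \<Rightarrow> real ^ 'n \<Rightarrow> real"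
  assumes G: "bilinear G" "\<And>u v. G u v = G v u" "\<And>v. v \<noteq> 0 \<Longrightarrow> 0 < G v v"
  shows "\<exists>q. (\<forall>i\<in>B. \<forall>j\<in>B. G (q i) (q j) = (if i = j then 1 else 0)) \<and>
     span (q ` B) = span ((\<lambda>i. axis i 1) ` B)"
proof -
  have "finite B" by simp
  then show ?thesis
proof (induction B rule: finite_induct)
  case (insert b B)
  note lr = linear_sum[OF G(1)[unfolded bilinear_def, THEN conjunct1, rule_format]]
    linear_sum[OF G(1)[unfolded bilinear_def, THEN conjunct2, rule_format]] bilinear_ladd[OF G(1)] bilinear_radd[OF G(1)]
    bilinear_lmul[OF G(1)] bilinear_rmul[OF G(1)] bilinear_lsub[OF G(1)] bilinear_rsub[OF G(1)]
  obtain q where q: "\<And>i j. i \<in> B \<Longrightarrow> j \<in> B \<Longrightarrow> G (q i) (q j) = (if i = j then 1 else 0)"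
    "span (q ` B) = span ((\<lambda>i. axis i 1) ` B)" using insert by blast
  define a :: "real ^ 'n" where "a = axis b 1"
  \<comment> \<open>\<open>w\<close> is the G-orthogonal projection of the new vector onto the span
    reached so far.\<close>
  define w where "w = (\<Sum>i\<in>B. G a (q i) *\<^sub>R q i)"
  have w: "w \<in> span (q ` B)" unfolding w_def by (intro span_sum span_scale span_base) auto
  have orth: "G (a - w) (q j) = 0" if "j \<in> B" for j
  proof -
    have "(\<Sum>i\<in>B. G a (q i) * G (q i) (q j)) = (\<Sum>i\<in>B. if i = j then G a (q j) else 0)"
      using that q(1) by (intro sum.cong) auto
    then show ?thesis using that insert(1) by (simp add: w_def lr)
  qed
  have "a \<notin> span ((\<lambda>i. axis i 1) ` B)"
  proof
    assume "a \<in> span ((\<lambda>i. axis i 1) ` B)"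
    then have "a $ b = 0"
    proof (induction rule: span_induct)
      case (step x) then show ?case using \<open>b \<notin> B\<close> by (auto simp: axis_def)
    qed (auto simp: subspace_def)
    then show False by (simp add: a_def)
  qed
  then have "a - w \<noteq> 0" using w q(2) by auto
  then have pos: "G (a - w) (a - w) > 0" by (rule G(3))
  define c where "c = 1 / sqrt (G (a - w) (a - w))"
  have c: "c * (c * G (a - w) (a - w)) = 1" "c \<noteq> 0"
    using pos by (auto simp: c_def real_sqrt_mult_self field_simps)
  define q' where "q' = q(b := c *\<^sub>R (a - w))"
  have q'B: "q' ` B = q ` B" using insert(2) by (auto simp: q'_def)
  have "G (q' i) (q' j) = (if i = j then 1 else 0)" if "i \<in> insert b B" "j \<in> insert b B" for i j
  proof -
    have "G (c *\<^sub>R (a - w)) (c *\<^sub>R (a - w)) = 1"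
      using c by (simp only: bilinear_lmul[OF G(1)] bilinear_rmul[OF G(1)] real_scaleR_def)
    moreover have "G (c *\<^sub>R (a - w)) (q r) = 0" if "r \<in> B" for r
      using orth[OF that] by (simp only: bilinear_lmul[OF G(1)]) simp
    moreover have "G (q r) (c *\<^sub>R (a - w)) = 0" if "r \<in> B" for r
      using calculation(2)[OF that] G(2) by simp
    ultimately show ?thesis using that q(1) insert(2) by (auto simp: q'_def)
  qed
  moreover have "span (q' ` insert b B) = span ((\<lambda>i. axis i 1) ` insert b B)"
  proof -
    have "span (insert (c *\<^sub>R (a - w)) (q ` B)) = span (insert a (q ` B))"
    proof (rule span_eq[THEN iffD2], safe)
      show "c *\<^sub>R (a - w) \<in> span (insert a (q ` B))"
      proof (intro span_scale span_diff)
        show "w \<in> span (insert a (q ` B))" using w by (rule span_mono[THEN subsetD, rotated]) auto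
      qed (simp add: span_base)
      have "w \<in> span (insert (c *\<^sub>R (a - w)) (q ` B))"
        using w by (rule span_mono[THEN subsetD, rotated]) auto
      moreover have "(1/c) *\<^sub>R (c *\<^sub>R (a - w)) \<in> span (insert (c *\<^sub>R (a - w)) (q ` B))"
        by (intro span_scale span_base) simp
      ultimately have "(1/c) *\<^sub>R (c *\<^sub>R (a - w)) + w \<in> span (insert (c *\<^sub>R (a - w)) (q ` B))"
        by (intro span_add)
      then show "a \<in> span (insert (c *\<^sub>R (a - w)) (q ` B))" using c by simp
    qed (auto intro: span_base)
    also have "span (insert a (q ` B)) = span (insert a ((\<lambda>i. axis i 1) ` B))"
      using q(2) by (auto simp: span_insert)
    finally have "span (insert (c *\<^sub>R (a - w)) (q ` B)) = span ((\<lambda>i. axis i 1) ` insert b B)"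
      by (simp add: a_def)
    moreover have "q' ` insert b B = insert (c *\<^sub>R (a - w)) (q ` B)"
      unfolding image_insert q'B by (simp add: q'_def)
    ultimately show ?thesis by simp
  qed
  ultimately show ?case by blast
qed simp
qed

text \<open>\<open>P u\<close> lists the coefficients of u in a G-orthonormal basis.\<close>

lemma form_eq_pullback_inner:
  fixes G :: "real ^ 'n \<Rightarrow> real ^ 'n \<Rightarrow> real"
  assumes G: "bilinear G" "\<And>u v. G u v = G v u" "\<And>v. v \<noteq> 0 \<Longrightarrow> 0 < G v v"
  obtains P :: "real ^ 'n \<Rightarrow> real ^ 'n" where "linear P" "\<And>u v. G u v = P u \<bullet> P v"
proof -
  note lr = linear_sum[OF G(1)[unfolded bilinear_def, THEN conjunct1, rule_format]]
    linear_sum[OF G(1)[unfolded bilinear_def, THEN conjunct2, rule_format]] bilinear_ladd[OF G(1)] bilinear_radd[OF G(1)]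
    bilinear_lmul[OF G(1)] bilinear_rmul[OF G(1)]
  obtain q :: "'n \<Rightarrow> real ^ 'n" where q: "\<And>i j. G (q i) (q j) = (if i = j then 1 else 0)"
    and sp: "span (range q) = span ((\<lambda>i. axis i 1) ` (UNIV :: 'n set))"
  proof -
    have "\<exists>q :: 'n \<Rightarrow> real ^ 'n. (\<forall>i\<in>UNIV. \<forall>j\<in>UNIV. G (q i) (q j) = (if i = j then 1 else 0)) \<and>
       span (q ` UNIV) = span ((\<lambda>i. axis i 1) ` UNIV)"
      by (rule orthonormal_basis_of_form[OF G(1)]) (use G in auto)
    then show ?thesis using that by blast
  qed
  have "span ((\<lambda>i. axis i (1::real)) ` (UNIV :: 'n set)) = UNIV"
  proof -
    have "(\<lambda>i. axis i (1::real)) ` (UNIV :: 'n set) = Basis" by (auto simp: Basis_vec_def)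
    then show ?thesis by simp
  qed
  then have spq: "span (range q) = UNIV" using sp by simp
  have expand: "u = (\<Sum>i\<in>UNIV. G u (q i) *\<^sub>R q i)" for u
  proof -
    have "u \<in> span (range q)" using spq by simp
    then show ?thesis
    proof (induction rule: span_induct)
      case (step x)
      then obtain j where "x = q j" by auto
      then show ?case by (simp add: q if_distrib[of "\<lambda>x. x *\<^sub>R _"] cong: if_cong)
    next
      show "subspace {u. u = (\<Sum>i\<in>UNIV. G u (q i) *\<^sub>R q i)}"
        unfolding subspace_def
        by (auto simp: bilinear_lzero[OF G(1)] lr scaleR_left_distrib sum.distrib
            scaleR_sum_right[symmetric] simp flip: scaleR_scaleR)
    qed
  qed
  define P where "P u = (\<chi> i. G u (q i))" for u
  have "linear P" unfolding P_def by (intro linearI) (auto simp: vec_eq_iff lr)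
  moreover have "G u v = P u \<bullet> P v" for u v
  proof -
    have "G u v = G u (\<Sum>i\<in>UNIV. G v (q i) *\<^sub>R q i)" using expand[of v] by simp
    also have "\<dots> = P u \<bullet> P v" by (simp add: lr P_def inner_vec_def mult_ac)
    finally show ?thesis .
  qed
  ultimately show ?thesis by (rule that)
qed

section \<open>Domination of a splitting and of its exterior power\<close>

text \<open>Two enumerations of the same set differ by a permutation, which affects only the sign of
  the wedge.\<close>

lemma norm_wedge_reindex:
  assumes b: "bij_betw b {..<k} S" and b': "bij_betw b' {..<k} S"
  shows "norm (wedge k (\<lambda>i. v (b i))) = norm (wedge k (\<lambda>i. v (b' i)))"
proof -
  define ix where "ix = inv_into {..<k} b'"
  define p where "p i = (if i < k then ix (b i) else i)" for i
  have ix: "bij_betw ix S {..<k}" unfolding ix_def by (rule bij_betw_inv_into[OF b'])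
  have "bij_betw (ix \<circ> b) {..<k} {..<k}" by (rule bij_betw_trans[OF b ix])
  then have "bij_betw p {..<k} {..<k}"
    by (subst bij_betw_cong[of _ _ "ix \<circ> b"]) (auto simp: p_def)
  then have p: "p permutes {..<k}" by (rule bij_imp_permutes) (simp add: p_def)
  have "b' (p i) = b i" if "i < k" for i
  proof -
    have "b i \<in> b' ` {..<k}" using b b' that by (auto simp: bij_betw_def)
    then show ?thesis using that by (simp add: p_def ix_def f_inv_into_f)
  qed
  then have "wedge k (\<lambda>i. v (b i)) = wedge k (\<lambda>i. v (b' (p i)))"
    by (intro wedge_cong) simp
  then show ?thesis using norm_wedge_permute[OF p, of "\<lambda>i. v (b' i)"] by simp
qed

section \<open>Injectivity of induced maps and the two summands of an exterior power\<close>

lemma ext_map_eq_0_imp: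
  assumes "linear T" "inj T" "\<omega> \<in> ext_power k" "ext_map k T \<omega> = 0"
  shows "\<omega> = 0"
proof -
  obtain S where S: "linear S" "S \<circ> T = id" using linear_injective_left_inverse[OF assms(1,2)] by auto
  have "\<omega> = ext_map k (\<lambda>v. v) \<omega>" by (rule ext_map_ident[OF assms(3), symmetric])
  also have "\<dots> = ext_map k S (ext_map k T \<omega>)"
    unfolding ext_map_compose[OF S(1)] using S(2) by (intro ext_map_cong) (auto simp: fun_eq_iff)
  finally show ?thesis using assms(4) linear_0[OF linear_ext_map] by metis
qed

lemma inj_on_ext_map:
  fixes T :: "'n::{finite,linorder} coords \<Rightarrow> 'n coords"
  shows "linear T \<Longrightarrow> inj T \<Longrightarrow> inj_on (ext_map k T) (ext_power k)"
  using ext_map_eq_0_imp linear_inj_on_iff_eq_0[OF linear_ext_map subspace_ext_power] by blast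

lemma wedge_frame_nonzero:
  fixes T :: "'n::{finite,linorder} coords \<Rightarrow> 'n coords"
  assumes "linear T" "inj T" "card S = k" shows "wedge k (\<lambda>i. T (axis (elem S i) 1)) \<noteq> 0"
proof
  assume "wedge k (\<lambda>i. T (axis (elem S i) 1)) = 0"
  then have "ext_map k T (axis S 1) = 0" by (simp add: ext_map_axis[OF assms(3)])
  moreover have "axis S 1 \<in> ext_power k" using wedge_in_ext_power[of k] wedge_axis[OF assms(3)] by metis
  ultimately have "axis S (1::real) = 0" using ext_map_eq_0_imp[OF assms(1,2)] by blast
  then show False by simp
qed

text \<open>An intrinsic version of the first summand: arbitrary vectors of E and F in any order, at
  least one from E. Without reference to bases, its behaviour under linear maps is immediate;
  agreement with the generators built from ordered bases is shown in
  \<open>E_tilde_eq\<close>.\<close>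

definition mixed_power :: "nat \<Rightarrow> 'n::{finite,linorder} coords set \<Rightarrow> 'n coords set \<Rightarrow> 'n kvector set" where
  "mixed_power k E F = span {wedge k w | w. (\<forall>r<k. w r \<in> E \<union> F) \<and> (\<exists>r<k. w r \<in> E)}"

definition pure_power :: "nat \<Rightarrow> 'n::{finite,linorder} coords set \<Rightarrow> 'n kvector set" where
  "pure_power k F = span {wedge k w | w. \<forall>r<k. w r \<in> F}"

lemma wedge_in_mixed_power: "(\<And>s. s < k \<Longrightarrow> w s \<in> E \<union> F) \<Longrightarrow> r < k \<Longrightarrow> w r \<in> E \<Longrightarrow> wedge k w \<in> mixed_power k E F"
  unfolding mixed_power_def by (rule span_base) blast

lemma wedge_in_pure_power: "(\<And>r. r < k \<Longrightarrow> w r \<in> F) \<Longrightarrow> wedge k w \<in> pure_power k F"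
  unfolding pure_power_def by (rule span_base) blast

lemma ext_map_image_wedges:
  assumes "linear T"
  shows "ext_map k T ` {wedge k w | w. \<forall>r<k. w r \<in> V r} = {wedge k w | w. \<forall>r<k. w r \<in> T ` V r}" (is "_ ` ?A = ?B")
proof
  show "ext_map k T ` ?A \<subseteq> ?B" using ext_map_wedge[OF assms] by fastforce
  show "?B \<subseteq> ext_map k T ` ?A"
  proof
    fix \<omega> assume "\<omega> \<in> ?B"
    then obtain w where w: "\<omega> = wedge k w" "\<And>r. r < k \<Longrightarrow> \<exists>u. w r = T u \<and> u \<in> V r" by blast
    then obtain u where "\<And>r. r < k \<Longrightarrow> w r = T (u r) \<and> u r \<in> V r" by metis
    with w(1) show "\<omega> \<in> ext_map k T ` ?A"
      by (intro image_eqI[of _ _ "wedge k u"]) (auto simp: ext_map_wedge[OF assms] intro!: wedge_cong)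
  qed
qed

text \<open>Fixing the position r that must hold a vector of E splits the generators into families
  in which every position has its own subspace, the form handled by
  \<open>ext_map_image_wedges\<close>.\<close>

lemma mixed_power_span: "mixed_power k E F = span (\<Union>r<k. {wedge k w | w. \<forall>s<k. w s \<in> (if s = r then E else E \<union> F)})"
proof -
  have *: "(\<forall>r<k. w r \<in> E \<union> F) \<and> (\<exists>r<k. w r \<in> E) \<longleftrightarrow> (\<exists>r<k. \<forall>s<k. w s \<in> (if s = r then E else E \<union> F))" for w
    by (auto split: if_splits)
  have "{wedge k w | w. \<exists>r<k. B r w} = (\<Union>r<k. {wedge k w | w. B r w})" for B by blast
  then show ?thesis unfolding mixed_power_def * by (rule arg_cong)
qed

lemma ext_map_image_mixed_power:
  assumes "linear T"
  shows "ext_map k T ` mixed_power k E F = mixed_power k (T ` E) (T ` F)"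
  unfolding mixed_power_span linear_span_image[OF linear_ext_map, symmetric] image_UN ext_map_image_wedges[OF assms]
  by (simp add: image_Un if_distrib[of "(`) T"])

lemma ext_map_image_pure_power:
  assumes "linear T"
  shows "ext_map k T ` pure_power k F = pure_power k (T ` F)"
  unfolding pure_power_def linear_span_image[OF linear_ext_map, symmetric] ext_map_image_wedges[OF assms] ..

lemma subspace_mixed_power: "subspace (mixed_power k E F)"
  unfolding mixed_power_def by (rule subspace_span)

lemma subspace_pure_power: "subspace (pure_power k F)"
  unfolding pure_power_def by (rule subspace_span)

text \<open>A factor supported off J gives a zero row in the minor indexed by J. Conversely an index
  set of size k other than J has an element outside J, so its unit vector is a generator.\<close>

lemma mixed_power_coord_space:
  fixes J :: "'n::{finite,linorder} set"
  assumes J: "card J = k"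
  shows "mixed_power k (coord_space (- J)) (coord_space J) = coord_space {S. card S = k \<and> S \<noteq> J}"
proof
  show "mixed_power k (coord_space (- J)) (coord_space J) \<subseteq> coord_space {S. card S = k \<and> S \<noteq> J}"
    unfolding mixed_power_def
  proof (rule span_minimal[OF _ subspace_coord_space], safe)
    fix w :: "nat \<Rightarrow> 'n coords" and r assume w: "r < k" "w r \<in> coord_space (- J)"
    have "leibniz_det k (\<lambda>i j. w i $ elem J j) = 0"
      by (rule leibniz_det_zero_row[OF w(1)])
        (use w elem_bij_betw[OF J] in \<open>auto simp: coord_space_def bij_betw_def\<close>)
    then show "wedge k w \<in> coord_space {S. card S = k \<and> S \<noteq> J}" by (auto simp: coord_space_def wedge_nth)
  qed
  have "axis S 1 \<in> mixed_power k (coord_space (- J)) (coord_space J)" if S: "card S = k" "S \<noteq> J" for S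
  proof -
    have "\<not> S \<subseteq> J" using card_subset_eq[of J S] S J by auto
    then obtain r where "r < k" "elem S r \<notin> J" using elem_bij_betw[OF S(1)] unfolding bij_betw_def by force
    then have "wedge k (\<lambda>i. axis (elem S i) 1) \<in> mixed_power k (coord_space (- J)) (coord_space J)"
      by (intro wedge_in_mixed_power[of k _ _ _ r]) (auto simp: axis_in_coord_space)
    then show ?thesis by (simp add: wedge_axis[OF S(1)])
  qed
  then show "coord_space {S. card S = k \<and> S \<noteq> J} \<subseteq> mixed_power k (coord_space (- J)) (coord_space J)"
    unfolding coord_space_eq_span[of "{S. card S = k \<and> S \<noteq> J}"] by (intro span_minimal subspace_mixed_power) auto
qed

text \<open>If all factors are supported in J, an index outside J gives a zero column, that is, a
  zero row of the transpose.\<close>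

lemma pure_power_coord_space:
  fixes J :: "'n::{finite,linorder} set"
  assumes J: "card J = k"
  shows "pure_power k (coord_space J) = coord_space {J}"
proof
  show "pure_power k (coord_space J) \<subseteq> coord_space {J}"
    unfolding pure_power_def
  proof (rule span_minimal[OF _ subspace_coord_space], safe)
    fix w :: "nat \<Rightarrow> 'n coords" assume w: "\<forall>r<k. w r \<in> coord_space J"
    have "leibniz_det k (\<lambda>i j. w i $ elem S j) = 0" if S: "card S = k" "S \<noteq> J" for S
    proof -
      have "\<not> S \<subseteq> J" using card_subset_eq[of J S] S J by auto
      then obtain r where r: "r < k" "elem S r \<notin> J" using elem_bij_betw[OF S(1)] unfolding bij_betw_def by force
      have "leibniz_det k (\<lambda>i j. w j $ elem S i) = 0"
        by (rule leibniz_det_zero_row[OF r(1)]) (use w r in \<open>auto simp: coord_space_def\<close>)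
      then show ?thesis using leibniz_det_transpose[of k "\<lambda>i j. w i $ elem S j"] by simp
    qed
    then show "wedge k w \<in> coord_space {J}" by (auto simp: coord_space_def wedge_nth)
  qed
  show "coord_space {J} \<subseteq> pure_power k (coord_space J)"
    using wedge_in_pure_power[of k "\<lambda>i. axis (elem J i) 1" "coord_space J"] elem_bij_betw[OF J]
    unfolding coord_space_eq_span[of "{J}"]
    by (intro span_minimal subspace_pure_power) (auto simp: wedge_axis[OF J] bij_betw_def axis_in_coord_space)
qed

text \<open>The frame is encoded as the linear map \<open>H\<close> that takes the standard basis to it.\<close>

locale adapted_frame =
  fixes I J :: "'n::{finite,linorder} set" and H :: "'n coords \<Rightarrow> 'n coords"
    and E F :: "'n coords set" and k :: nat
  assumes J_eq: "J = - I" and card_J: "card J = k"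
    and lin: "linear H" and inj: "inj H"
    and E_eq: "E = H ` coord_space I" and F_eq: "F = H ` coord_space J"
begin

lemma frame_in: "i \<in> I \<Longrightarrow> H (axis i c) \<in> E" "j \<in> J \<Longrightarrow> H (axis j c) \<in> F"
  by (auto simp: E_eq F_eq axis_in_coord_space)

lemma mixed_power_eq: "mixed_power k E F = ext_map k H ` coord_space {S. card S = k \<and> S \<noteq> J}"
  using ext_map_image_mixed_power[OF lin, of k "coord_space I" "coord_space J"] mixed_power_coord_space[OF card_J]
  by (simp add: E_eq F_eq J_eq)

lemma pure_power_eq: "pure_power k F = ext_map k H ` coord_space {J}"
  using ext_map_image_pure_power[OF lin, of k "coord_space J"] pure_power_coord_space[OF card_J] by (simp add: F_eq)

lemma ext_map_coord_space:
  assumes "\<S> \<subseteq> {S. card S = k}"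
  shows "ext_map k H ` coord_space \<S> = span ((\<lambda>S. wedge k (\<lambda>i. H (axis (elem S i) 1))) ` \<S>)"
proof -
  have "(\<lambda>S. ext_map k H (axis S 1)) ` \<S> = (\<lambda>S. wedge k (\<lambda>i. H (axis (elem S i) 1))) ` \<S>"
    using assms by (intro image_cong ext_map_axis) auto
  then show ?thesis
    by (simp add: coord_space_eq_span linear_span_image[OF linear_ext_map, symmetric] image_image)
qed

lemma mixed_power_eq_span:
  "mixed_power k E F = span ((\<lambda>S. wedge k (\<lambda>i. H (axis (elem S i) 1))) ` {S. card S = k \<and> S \<noteq> J})"
  unfolding mixed_power_eq by (rule ext_map_coord_space) auto

lemma pure_power_eq_span: "pure_power k F = span {wedge k (\<lambda>i. H (axis (elem J i) 1))}"
  using ext_map_coord_space[of "{J}"] card_J by (simp add: pure_power_eq)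

text \<open>Turns a vector in the span of some mapped frame vectors into coordinates. Distances to
  such spans can then be estimated from below through a single coordinate on which the span
  vanishes.\<close>

lemma span_frame:
  assumes "\<And>r. r < m \<Longrightarrow> b r \<in> A" "y \<in> span ((\<lambda>r. L (H (axis (b r) 1))) ` {..<m})" "linear L"
  obtains \<eta> where "\<eta> \<in> coord_space A" "y = L (H \<eta>)"
proof -
  have LH: "linear (\<lambda>\<xi>. L (H \<xi>))" using linear_compose[OF lin assms(3)] by (simp add: o_def)
  have "span ((\<lambda>r. L (H (axis (b r) 1))) ` {..<m}) \<subseteq> (\<lambda>\<xi>. L (H \<xi>)) ` coord_space A"
    using assms(1) by (intro span_minimal linear_subspace_image[OF LH] subspace_coord_space)
      (auto simp: axis_in_coord_space)
  with assms(2) that show ?thesis by auto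
qed

end

section \<open>Volume estimates in an adapted frame\<close>

lemma norm_axis_diff_ge:
  fixes \<xi> :: "real ^ 'n"
  assumes "\<eta> \<in> coord_space A" "j \<notin> A"
  shows "\<bar>\<xi> $ j\<bar> \<le> norm (\<xi> - \<eta>)"
  using component_le_norm_cart[of "\<xi> - \<eta>" j] assms by (simp add: coord_space_def)

context adapted_frame
begin

text \<open>Enumerate S and J so that their m common indices come first; the volumes of the common
  part then cancel. Each remaining vector of S lies in E and contributes a factor at most
  \<open>\<alpha> * C\<close> to the Q-volume, while each remaining vector of J has Q-distance at
  least \<open>1 / (\<beta> * C)\<close> from the span of its predecessors.\<close>

lemma mixed_wedge_bound:
  fixes P Q :: "'n coords \<Rightarrow> 'n coords"
  assumes P: "linear P" and Q: "linear Q"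
    and C: "1 \<le> C" "\<And>\<xi>. norm \<xi> \<le> C * norm (P (H \<xi>))" "\<And>\<xi>. norm (P (H \<xi>)) \<le> C * norm \<xi>"
    and \<alpha>: "0 \<le> \<alpha>" "\<And>v. v \<in> E \<Longrightarrow> norm (Q v) \<le> \<alpha> * norm (P v)"
    and \<beta>: "0 < \<beta>" "\<And>v. v \<in> F \<Longrightarrow> norm (P v) \<le> \<beta> * norm (Q v)"
    and S: "card S = k" "S \<noteq> J"
  shows "norm (wedge k (\<lambda>i. Q (H (axis (elem S i) 1)))) * norm (wedge k (\<lambda>i. P (H (axis (elem J i) 1))))
    \<le> C ^ (3 * k) * (\<alpha> * \<beta> + (\<alpha> * \<beta>) ^ k) * norm (wedge k (\<lambda>i. Q (H (axis (elem J i) 1))))"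
proof -
  define m where "m = card (S \<inter> J)"
  define i where "i = k - m"
  have "m \<le> k" using S unfolding m_def by (metis card_mono finite inf_le1)
  moreover have "m \<noteq> k"
  proof
    assume "m = k"
    then have "S \<inter> J = S" "S \<inter> J = J"
      using card_subset_eq[of S "S \<inter> J"] card_subset_eq[of J "S \<inter> J"] S card_J by (auto simp: m_def)
    then show False using S by auto
  qed
  ultimately have i: "k = m + i" "1 \<le> i" "i \<le> k" by (auto simp: i_def)
  obtain b0 where b0: "bij_betw b0 {..<m} (S \<inter> J)"
    using ex_bij_betw_nat_finite[of "S \<inter> J"] by (auto simp: m_def atLeast0LessThan)
  have extend: "\<exists>b. bij_betw b {..<k} A \<and> (\<forall>r<m. b r = b0 r)" if "card A = k" "S \<inter> J \<subseteq> A" for A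
  proof -
    have "card (A - S \<inter> J) = card {m..<k}" using that by (simp add: card_Diff_subset m_def)
    then obtain b1 where b1: "bij_betw b1 {m..<k} (A - S \<inter> J)"
      using finite_same_card_bij[of "{m..<k}" "A - S \<inter> J"] by auto
    define b where "b r = (if r < m then b0 r else b1 r)" for r
    have "bij_betw b ({..<m} \<union> {m..<k}) ((S \<inter> J) \<union> (A - S \<inter> J))"
    proof (rule bij_betw_combine)
      show "bij_betw b {..<m} (S \<inter> J)"
        using b0 by (subst bij_betw_cong[of _ _ b0]) (auto simp: b_def)
      show "bij_betw b {m..<k} (A - S \<inter> J)"
        using b1 by (subst bij_betw_cong[of _ _ b1]) (auto simp: b_def)
    qed auto
    moreover have "{..<m} \<union> {m..<k} = {..<k}" "(S \<inter> J) \<union> (A - S \<inter> J) = A"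
      using that \<open>m \<le> k\<close> by auto
    ultimately show ?thesis by (auto simp: b_def)
  qed
  obtain b where b: "bij_betw b {..<k} S" "\<And>r. r < m \<Longrightarrow> b r = b0 r"
    using extend[of S] S by auto
  obtain b' where b': "bij_betw b' {..<k} J" "\<And>r. r < m \<Longrightarrow> b' r = b0 r"
    using extend[of J] card_J by auto
  let ?Q = "\<lambda>b r. Q (H (axis (b r) 1))"
  have QS: "norm (wedge k (?Q (elem S))) = norm (wedge k (?Q b))"
    using norm_wedge_reindex[OF elem_bij_betw[OF S(1)] b(1), of "\<lambda>a. Q (H (axis a 1))"] by simp
  have QJ: "norm (wedge k (?Q (elem J))) = norm (wedge k (?Q b'))"
    using norm_wedge_reindex[OF elem_bij_betw[OF card_J] b'(1), of "\<lambda>a. Q (H (axis a 1))"] by simp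
  have eq: "wedge m (?Q b) = wedge m (?Q b')" by (rule wedge_cong) (simp add: b b')
  have "norm (wedge (m + i) (?Q b)) \<le> norm (wedge m (?Q b)) * (\<alpha> * C) ^ i"
  proof (rule norm_wedge_add_le)
    fix r assume r: "m \<le> r" "r < m + i"
    have "b r \<in> S" using b(1) r i by (auto simp: bij_betw_def)
    moreover have "b r \<notin> S \<inter> J"
    proof
      assume "b r \<in> S \<inter> J"
      then obtain r' where "r' < m" "b r = b0 r'" using b0 by (auto simp: bij_betw_def)
      then have "b r = b r'" using b by simp
      then have "r = r'"
        using inj_onD[OF bij_betw_imp_inj_on[OF b(1)], of r r'] r i \<open>r' < m\<close> by simp
      then show False using r \<open>r' < m\<close> by simp
    qed
    ultimately have "b r \<in> I" using J_eq by auto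
    then have "norm (?Q b r) \<le> \<alpha> * norm (P (H (axis (b r) 1)))" by (intro \<alpha> frame_in)
    also have "\<dots> \<le> \<alpha> * (C * 1)"
      using C(3)[of "axis (b r) 1"] by (intro mult_left_mono \<alpha>) auto
    finally show "norm (?Q b r) \<le> \<alpha> * C" by simp
  qed (use \<alpha> C in auto)
  moreover have "norm (wedge m (?Q b')) * (1 / (\<beta> * C)) ^ i \<le> norm (wedge (m + i) (?Q b'))"
  proof (rule norm_wedge_add_ge)
    fix r y assume r: "m \<le> r" "r < m + i" and y: "y \<in> span (?Q b' ` {..<r})"
    have bJ: "b' s \<in> J" if "s < k" for s using b'(1) that by (auto simp: bij_betw_def)
    have inj': "b' s \<noteq> b' r" if "s < r" for s
      using b'(1) that r i by (auto simp: bij_betw_def inj_on_def)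
    obtain \<eta> where \<eta>: "\<eta> \<in> coord_space (J - {b' r})" "y = Q (H \<eta>)"
      using span_frame[of r b' "J - {b' r}" y Q] bJ inj' r i y Q by auto
    define \<zeta> where "\<zeta> = axis (b' r) 1 - \<eta>"
    have "\<eta> \<in> coord_space J" using \<eta> by (auto simp: coord_space_def)
    then have "\<zeta> \<in> coord_space J" unfolding \<zeta>_def using bJ[of r] r i
      by (intro subspace_diff[OF subspace_coord_space]) (auto simp: axis_in_coord_space)
    then have "H \<zeta> \<in> F" by (simp add: F_eq)
    have "1 \<le> norm \<zeta>" unfolding \<zeta>_def
      using norm_axis_diff_ge[OF \<eta>(1), of "b' r" "axis (b' r) 1"] by (simp add: axis_def)
    also have "\<dots> \<le> C * norm (P (H \<zeta>))" by (rule C)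
    also have "\<dots> \<le> C * (\<beta> * norm (Q (H \<zeta>)))" using C(1) \<beta>(2)[OF \<open>H \<zeta> \<in> F\<close>] by simp
    also have "Q (H \<zeta>) = ?Q b' r - y"
      by (simp add: \<zeta>_def \<eta> linear_diff[OF lin] linear_diff[OF Q])
    finally show "1 / (\<beta> * C) \<le> norm (?Q b' r - y)"
      using \<beta>(1) C(1) by (simp add: field_simps)
  qed (use \<beta> C in auto)
  ultimately have 1: "norm (wedge k (?Q (elem S))) \<le> norm (wedge m (?Q b')) * (\<alpha> * C) ^ i"
    and 2: "norm (wedge m (?Q b')) \<le> norm (wedge k (?Q (elem J))) * (\<beta> * C) ^ i"
    using i QS QJ eq \<beta>(1) C(1) by (simp_all add: field_simps power_mult_distrib)
  have 3: "norm (wedge k (\<lambda>i. P (H (axis (elem J i) 1)))) \<le> C ^ k"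
    using C(1) C(3)[of "axis _ 1"] by (intro norm_wedge_le) auto
  \<comment> \<open>Since 1 \<le> i \<le> k, the power i is dominated by the first power if the
    product is at most 1 and by the k-th power otherwise. This is where the two-term bound comes
    from.\<close>
  have q: "(\<alpha> * \<beta>) ^ i \<le> \<alpha> * \<beta> + (\<alpha> * \<beta>) ^ k"
  proof (cases "\<alpha> * \<beta> \<le> 1")
    case True
    then have "(\<alpha> * \<beta>) ^ i \<le> (\<alpha> * \<beta>) ^ 1" using \<alpha> \<beta> i by (intro power_decreasing) auto
    moreover have "0 \<le> (\<alpha> * \<beta>) ^ k" using \<alpha> \<beta> by simp
    ultimately show ?thesis by simp
  next
    case False
    then have "(\<alpha> * \<beta>) ^ i \<le> (\<alpha> * \<beta>) ^ k" using i by (intro power_increasing) auto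
    moreover have "0 \<le> \<alpha> * \<beta>" using \<alpha> \<beta> by simp
    ultimately show ?thesis by linarith
  qed
  let ?W = "norm (wedge k (?Q (elem J)))"
  have "norm (wedge k (?Q (elem S))) * norm (wedge k (\<lambda>i. P (H (axis (elem J i) 1))))
    \<le> ((?W * (\<beta> * C) ^ i) * (\<alpha> * C) ^ i) * C ^ k"
    using \<alpha> \<beta> C(1) by (intro mult_mono order_trans[OF 1] mult_right_mono 2 3) auto
  \<comment> \<open>The exponent collects k factors from the P-volume of the frame of F and i
    factors from each of the two comparisons.\<close>
  also have "\<dots> = C ^ (k + 2 * i) * (\<alpha> * \<beta>) ^ i * ?W"
    by (simp add: power_mult_distrib power_add power_mult power2_eq_square mult_ac)
  also have "\<dots> \<le> C ^ (3 * k) * (\<alpha> * \<beta> + (\<alpha> * \<beta>) ^ k) * ?W"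
    using C(1) i q \<alpha> \<beta> by (intro mult_mono mult_right_mono power_increasing) auto
  finally show ?thesis .
qed

text \<open>Test the bounds A and B on two k-vectors that share k - 1 frame vectors of F and end in
  e and in f respectively. The first is mixed, the second pure. Each norm is the volume of the
  common part times a height, and the common volumes \<open>w0\<close> and \<open>w1\<close> cancel
  when the two inequalities are multiplied.\<close>

lemma wedge_exchange_bound:
  fixes P Q :: "'n coords \<Rightarrow> 'n coords"
  assumes P: "linear P" and Q: "linear Q"
    and C: "1 \<le> C" "\<And>\<xi>. norm \<xi> \<le> C * norm (P (H \<xi>))" "\<And>\<xi>. norm (P (H \<xi>)) \<le> C * norm \<xi>"
    and angle: "\<And>u v. u \<in> E \<Longrightarrow> v \<in> F \<Longrightarrow> norm (Q u) \<le> C * norm (Q (u + v))"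
    and A: "0 \<le> A" "\<And>\<omega>. \<omega> \<in> mixed_power k E F \<Longrightarrow> norm (ext_map k Q \<omega>) \<le> A * norm (ext_map k P \<omega>)"
    and B: "0 \<le> B" "\<And>\<omega>. \<omega> \<in> pure_power k F \<Longrightarrow> norm (ext_map k P \<omega>) \<le> B * norm (ext_map k Q \<omega>)"
    and k: "1 \<le> k" and e: "e \<in> E" and f: "f \<in> F"
  shows "norm (Q e) * norm (P f) \<le> real CARD('n) * C ^ 3 * (A * B) * (norm (P e) * norm (Q f))"
proof (cases "f = 0")
  case True
  then show ?thesis using A B C by (simp add: linear_0[OF P])
next
  case False
  obtain \<xi> where \<xi>: "\<xi> \<in> coord_space J" "f = H \<xi>" using f F_eq by auto
  then have "\<xi> \<noteq> 0" using False linear_0[OF lin] by auto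
  define n where "n = real CARD('n)"
  have n: "n > 0" by (simp add: n_def)
  \<comment> \<open>The frame vector with index j is the one left out of the common part. Choosing a
    coordinate of comparable size to \<open>\<xi>\<close> keeps f at a definite distance from the
    span of the remaining vectors.\<close>
  obtain j where j: "norm \<xi> \<le> n * \<bar>\<xi> $ j\<bar>"
  proof -
    have "\<exists>j. norm \<xi> \<le> n * \<bar>\<xi> $ j\<bar>"
    proof (rule ccontr)
      assume "\<nexists>j. norm \<xi> \<le> n * \<bar>\<xi> $ j\<bar>"
      then have "\<bar>\<xi> $ j\<bar> < norm \<xi> / n" for j using n by (simp add: not_le field_simps)
      then have "(\<Sum>j\<in>UNIV. \<bar>\<xi> $ j\<bar>) < (\<Sum>j\<in>(UNIV :: 'n set). norm \<xi> / n)"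
        by (intro sum_strict_mono) auto
      also have "\<dots> = norm \<xi>" using n by (simp add: n_def)
      finally show False using norm_le_l1_cart[of \<xi>] by simp
    qed
    then show ?thesis using that by blast
  qed
  then have "\<xi> $ j \<noteq> 0" using \<open>\<xi> \<noteq> 0\<close> by auto
  then have jJ: "j \<in> J" using \<xi> by (auto simp: coord_space_def)
  obtain k' where k': "k = Suc k'" using k by (cases k) auto
  define b where "b = elem (J - {j})"
  have card: "card (J - {j}) = k'" using jJ card_J k' by simp
  then have b: "bij_betw b {..<k'} (J - {j})" unfolding b_def by (rule elem_bij_betw)
  have bJ: "b r \<in> J - {j}" if "r < k'" for r using b that by (auto simp: bij_betw_def)
  define u where "u v r = (if r < k' then H (axis (b r) 1) else v)" for v :: "'n coords" and r
  let ?h = "\<lambda>r. H (axis (b r) 1)"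
  define w0 where "w0 = norm (wedge k' (\<lambda>r. P (?h r)))"
  define w1 where "w1 = norm (wedge k' (\<lambda>r. Q (?h r)))"
  have ueq: "wedge k' (\<lambda>r. L (u v r)) = wedge k' (\<lambda>r. L (?h r))" for L :: "'n coords \<Rightarrow> 'n coords" and v
    by (rule wedge_cong) (simp add: u_def)
  have uim: "(\<lambda>r. L (u v r)) ` {..<k'} = (\<lambda>r. L (?h r)) ` {..<k'}" for L :: "'n coords \<Rightarrow> 'n coords" and v
    by (auto simp: u_def)
  have uk: "u v k' = v" for v by (simp add: u_def)
  have map_u: "ext_map k L (wedge k (u v)) = wedge (Suc k') (\<lambda>r. L (u v r))" if "linear L" for L v
    using ext_map_wedge[OF that] k' by simp
  have le_P: "norm (ext_map k P (wedge k (u v))) \<le> w0 * norm (P v)" for v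
    using norm_wedge_Suc_le[of k' "\<lambda>r. P (u v r)"] by (simp add: map_u[OF P] ueq w0_def uk)
  have le_Q: "norm (ext_map k Q (wedge k (u v))) \<le> w1 * norm (Q v)" for v
    using norm_wedge_Suc_le[of k' "\<lambda>r. Q (u v r)"] by (simp add: map_u[OF Q] ueq w1_def uk)
  have mem_e: "wedge k (u e) \<in> mixed_power k E F"
    using bJ frame_in(2) e k' by (intro wedge_in_mixed_power[of k _ _ _ k']) (auto simp: u_def)
  have mem_f: "wedge k (u f) \<in> pure_power k F"
    using bJ frame_in(2) f by (intro wedge_in_pure_power) (auto simp: u_def)
  \<comment> \<open>The common vectors span a part of F, so the angle condition bounds the height of
    \<open>Q e\<close> from below.\<close>
  have "w1 * (norm (Q e) / C) \<le> norm (ext_map k Q (wedge k (u e)))"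
  proof -
    have "norm (Q e) / C \<le> norm (Q (u e k') - y)" if y: "y \<in> span ((\<lambda>r. Q (u e r)) ` {..<k'})" for y
    proof -
      obtain \<eta> where \<eta>: "\<eta> \<in> coord_space J" "y = Q (H \<eta>)"
        using span_frame[of k' b J y Q] bJ y Q by (auto simp: uim)
      have "- H \<eta> \<in> F" using \<eta> F_eq linear_subspace_image[OF lin subspace_coord_space] subspace_neg by blast
      then have "norm (Q e) \<le> C * norm (Q (e + - H \<eta>))" by (intro angle e)
      then show ?thesis using C(1) \<eta> by (simp add: uk linear_diff[OF Q] field_simps)
    qed
    then show ?thesis
      using norm_wedge_Suc_ge[of "\<lambda>r. Q (u e r)" k' "norm (Q e) / C"] by (simp add: map_u[OF Q] ueq w1_def)
  qed
  also have "\<dots> \<le> A * norm (ext_map k P (wedge k (u e)))" by (rule A(2)[OF mem_e])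
  also have "\<dots> \<le> A * (w0 * norm (P e))" by (intro mult_left_mono le_P A)
  finally have 1: "w1 * norm (Q e) \<le> C * A * w0 * norm (P e)"
    using C(1) by (simp add: field_simps)
  \<comment> \<open>The span of the common vectors has vanishing j-th coordinate, so subtracting
    from f an element of it leaves that coordinate intact. The factor n comes from the choice of j,
    and the two factors C from converting norms to coordinates and back.\<close>
  have "w0 * (norm (P f) / (n * C\<^sup>2)) \<le> norm (ext_map k P (wedge k (u f)))"
  proof -
    have "norm (P f) / (n * C\<^sup>2) \<le> norm (P (u f k') - y)" if y: "y \<in> span ((\<lambda>r. P (u f r)) ` {..<k'})" for y
    proof -
      obtain \<eta> where \<eta>: "\<eta> \<in> coord_space (J - {j})" "y = P (H \<eta>)"
        using span_frame[of k' b "J - {j}" y P] bJ y P by (auto simp: uim)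
      have "norm (P f) \<le> C * norm \<xi>" using C(3) \<xi> by simp
      also have "\<dots> \<le> C * (n * \<bar>\<xi> $ j\<bar>)" using C(1) j by simp
      also have "\<dots> \<le> C * (n * norm (\<xi> - \<eta>))"
        using C(1) n norm_axis_diff_ge[OF \<eta>(1)] by simp
      also have "\<dots> \<le> C * (n * (C * norm (P (H (\<xi> - \<eta>)))))"
        using C n by simp
      also have "P (H (\<xi> - \<eta>)) = P (u f k') - y"
        by (simp add: linear_diff[OF lin] linear_diff[OF P] \<eta> \<xi> uk)
      finally show ?thesis using C(1) n by (simp add: field_simps power2_eq_square)
    qed
    then show ?thesis
      using norm_wedge_Suc_ge[of "\<lambda>r. P (u f r)" k' "norm (P f) / (n * C\<^sup>2)"] by (simp add: map_u[OF P] ueq w0_def)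
  qed
  also have "\<dots> \<le> B * norm (ext_map k Q (wedge k (u f)))" by (rule B(2)[OF mem_f])
  also have "\<dots> \<le> B * (w1 * norm (Q f))" by (intro mult_left_mono le_Q B)
  finally have 2: "w0 * norm (P f) \<le> n * C\<^sup>2 * B * w1 * norm (Q f)"
    using C(1) n by (simp add: field_simps)
  have "linear (\<lambda>\<xi>. P (H \<xi>))" using linear_compose[OF lin P] by (simp add: o_def)
  moreover have "\<zeta> = 0" if "P (H \<zeta>) = 0" for \<zeta> using C(2)[of \<zeta>] that by simp
  ultimately have "linear (\<lambda>\<xi>. P (H \<xi>))" "inj (\<lambda>\<xi>. P (H \<xi>))" using linear_injective_0 by blast+
  from wedge_frame_nonzero[OF this card] have "w0 > 0" by (simp add: w0_def b_def)
  have Pf: "norm (P f) > 0" using C(2)[of \<xi>] \<open>\<xi> \<noteq> 0\<close> \<xi> C(1) by (auto simp: zero_less_mult_iff)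
  \<comment> \<open>Q is only assumed linear, so positivity of \<open>w1\<close> is read off from
    inequality 2, whose left side is positive.\<close>
  have "w1 \<noteq> 0" using 2 mult_pos_pos[OF \<open>w0 > 0\<close> Pf] by auto
  then have "w1 > 0" by (simp add: w1_def)
  have "(w1 * norm (Q e)) * (w0 * norm (P f)) \<le> (C * A * w0 * norm (P e)) * (n * C\<^sup>2 * B * w1 * norm (Q f))"
    using \<open>w0 > 0\<close> \<open>w1 > 0\<close> A(1) C(1) by (intro mult_mono[OF 1 2]) auto
  then have "(w0 * w1) * (norm (Q e) * norm (P f)) \<le> (w0 * w1) * (n * C ^ 3 * (A * B) * (norm (P e) * norm (Q f)))"
    by (simp add: power2_eq_square power3_eq_cube mult_ac)
  then show ?thesis using \<open>w0 > 0\<close> \<open>w1 > 0\<close> by (simp add: n_def)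
qed

end

section \<open>Operator norms and co-norms of restricted linear maps\<close>

definition pos_def_form :: "('v::real_vector \<Rightarrow> 'v \<Rightarrow> real) \<Rightarrow> bool" where
  "pos_def_form G \<longleftrightarrow> bilinear G \<and> (\<forall>u v. G u v = G v u) \<and> (\<forall>v. v \<noteq> 0 \<longrightarrow> 0 < G v v)"

lemma norm_le_on_subspace:
  fixes P :: "'v::euclidean_space \<Rightarrow> 'p::euclidean_space"
  assumes "linear P" "subspace V" "\<And>v. v \<in> V \<Longrightarrow> P v = 0 \<Longrightarrow> v = 0"
  obtains c where "c > 0" "\<And>v. v \<in> V \<Longrightarrow> norm v \<le> c * norm (P v)"
proof -
  obtain e where e: "e > 0" "\<forall>x\<in>V. e * norm x \<le> norm (P x)"
    using injective_imp_isometric[OF closed_subspace[OF assms(2)] assms(2) linear_conv_bounded_linear[THEN iffD1, OF assms(1)]]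
      assms(3) by auto
  show ?thesis
  proof (rule that[of "1 / e"])
    show "norm v \<le> 1 / e * norm (P v)" if "v \<in> V" for v
      using e that by (simp add: field_simps)
  qed (use e in simp)
qed

text \<open>Norms are given as Euclidean norms after linear maps P and Q, which covers tangent
  spaces and exterior powers alike. P has to be injective only on V, because
  \<open>ext_map k P\<close> kills every degree except k.\<close>

locale normed_restriction =
  fixes N :: "'v::euclidean_space \<Rightarrow> real" and N' :: "'w::euclidean_space \<Rightarrow> real"
    and P :: "'v \<Rightarrow> 'p::euclidean_space" and Q :: "'w \<Rightarrow> 'q::euclidean_space"
    and V :: "'v set" and T :: "'v \<Rightarrow> 'w"
  assumes N: "\<And>v. N v = norm (P v)" and N': "\<And>w. N' w = norm (Q w)"
    and P: "linear P" and Q: "linear Q" and T: "linear T"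
    and V: "subspace V" "V \<noteq> {0}" and inj: "\<And>v. v \<in> V \<Longrightarrow> P v = 0 \<Longrightarrow> v = 0"
begin

lemma bounded_on: "\<exists>c. \<forall>v\<in>V. N' (T v) \<le> c * N v"
proof -
  obtain c where c: "c > 0" "\<And>v. v \<in> V \<Longrightarrow> norm v \<le> c * norm (P v)"
    using norm_le_on_subspace[OF P V(1) inj] by metis
  have "linear (\<lambda>v. Q (T v))" using linear_compose[OF T Q] by (simp add: o_def)
  then obtain b where b: "b > 0" "\<And>v. norm (Q (T v)) \<le> b * norm v"
    using linear_bounded_pos by blast
  show ?thesis
  proof (intro exI ballI)
    fix v assume "v \<in> V"
    then have "b * norm v \<le> b * (c * norm (P v))" using b(1) c(2) by simp
    then show "N' (T v) \<le> b * c * N v" using b(2)[of v] unfolding N N' by (simp add: mult_ac)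
  qed
qed

lemma unit_exists:
  assumes "v \<in> V" "v \<noteq> 0"
  shows "N v > 0" "(1 / N v) *\<^sub>R v \<in> {v \<in> V. N v = 1}" "N' (T ((1 / N v) *\<^sub>R v)) = N' (T v) / N v"
proof -
  show *: "N v > 0" using inj assms by (auto simp: N)
  show "(1 / N v) *\<^sub>R v \<in> {v \<in> V. N v = 1}"
    using * assms subspace_scale[OF V(1)] by (simp add: N linear_scale[OF P])
  show "N' (T ((1 / N v) *\<^sub>R v)) = N' (T v) / N v"
    using * by (simp add: N' linear_scale[OF T] linear_scale[OF Q])
qed

lemma units_nonempty: "{v \<in> V. N v = 1} \<noteq> {}"
proof -
  obtain v where "v \<in> V" "v \<noteq> 0" using V subspace_0[OF V(1)] by auto
  then show ?thesis using unit_exists(2) by blast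
qed

text \<open>Over the reals a supremum or infimum carries information only for a nonempty bounded
  set. Nonemptiness rests on \<open>V \<noteq> {0}\<close>, boundedness on finite dimension.\<close>

lemma bdd: "bdd_above ((\<lambda>v. N' (T v)) ` {v \<in> V. N v = 1})" "bdd_below ((\<lambda>v. N' (T v)) ` {v \<in> V. N v = 1})"
proof -
  obtain c where c: "\<And>v. v \<in> V \<Longrightarrow> N' (T v) \<le> c * N v" using bounded_on by blast
  then show "bdd_above ((\<lambda>v. N' (T v)) ` {v \<in> V. N v = 1})" by (intro bdd_aboveI2[of _ _ c]) force
  show "bdd_below ((\<lambda>v. N' (T v)) ` {v \<in> V. N v = 1})" by (intro bdd_belowI2[of _ 0]) (auto simp: N')
qed

lemma op_norm_ge:
  assumes "v \<in> V" shows "N' (T v) \<le> op_norm N N' V T * N v"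
proof (cases "v = 0")
  case True
  then show ?thesis by (simp add: N N' linear_0[OF P] linear_0[OF T] linear_0[OF Q])
next
  case False
  note u = unit_exists[OF assms False]
  have "N' (T ((1 / N v) *\<^sub>R v)) \<le> op_norm N N' V T"
    unfolding op_norm_def by (rule cSUP_upper[OF u(2) bdd(1)])
  then show ?thesis using u by (simp add: field_simps)
qed

lemma op_norm_le:
  assumes "\<And>v. v \<in> V \<Longrightarrow> N' (T v) \<le> c * N v" shows "op_norm N N' V T \<le> c"
  unfolding op_norm_def by (rule cSUP_least[OF units_nonempty]) (use assms in force)

lemma op_norm_nonneg: "0 \<le> op_norm N N' V T"
proof -
  obtain v where v: "v \<in> V" "N v = 1" using units_nonempty by auto
  have "0 \<le> N' (T v)" by (simp add: N')
  then show ?thesis using op_norm_ge[OF v(1)] v by simp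
qed

lemma min_norm_le:
  assumes "v \<in> V" shows "min_norm N N' V T * N v \<le> N' (T v)"
proof (cases "v = 0")
  case True
  then show ?thesis by (simp add: N N' linear_0[OF P] linear_0[OF T] linear_0[OF Q])
next
  case False
  note u = unit_exists[OF assms False]
  have "min_norm N N' V T \<le> N' (T ((1 / N v) *\<^sub>R v))"
    unfolding min_norm_def by (rule cINF_lower[OF bdd(2) u(2)])
  then show ?thesis using u by (simp add: field_simps)
qed

lemma min_norm_ge:
  assumes "\<And>v. v \<in> V \<Longrightarrow> c * N v \<le> N' (T v)" shows "c \<le> min_norm N N' V T"
  unfolding min_norm_def by (rule cINF_greatest[OF units_nonempty]) (use assms in force)

lemma op_norm_pos:
  assumes "\<And>v. v \<in> V \<Longrightarrow> Q (T v) = 0 \<Longrightarrow> v = 0"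
  shows "0 < op_norm N N' V T"
proof -
  obtain v where v: "v \<in> V" "v \<noteq> 0" using V subspace_0[OF V(1)] by auto
  then have "0 < N' (T v)" using assms by (auto simp: N')
  also have "\<dots> \<le> op_norm N N' V T * N v" by (rule op_norm_ge[OF v(1)])
  finally show ?thesis using unit_exists(1)[OF v] by (simp add: zero_less_mult_iff)
qed

text \<open>A left inverse S of T is the inverse of the restriction of T to V once it is restricted
  to the image of V; the co-norm is the reciprocal of its norm.\<close>

lemma min_norm_eq:
  assumes S: "linear S" "\<And>v. S (T v) = v" and Q_inj: "\<And>w. w \<in> T ` V \<Longrightarrow> Q w = 0 \<Longrightarrow> w = 0"
  shows "0 < min_norm N N' V T" "min_norm N N' V T = 1 / op_norm N' N (T ` V) S"
proof -
  have "T ` V \<noteq> {0}"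
  proof
    assume *: "T ` V = {0}"
    have "S 0 = 0" by (rule linear_0[OF S(1)])
    then have "V \<subseteq> {0}" using * S(2) by (metis image_subset_iff order_refl singleton_iff subsetI)
    then show False using V subspace_0[OF V(1)] by auto
  qed
  then interpret inv: normed_restriction N' N Q P "T ` V" S
    by - (rule normed_restriction.intro,
      ((rule N N' P Q S(1) linear_subspace_image[OF T V(1)] Q_inj; assumption?) | assumption)+)
  let ?\<beta> = "op_norm N' N (T ` V) S"
  have pos: "0 < ?\<beta>"
  proof (rule inv.op_norm_pos)
    fix w assume "w \<in> T ` V" "P (S w) = 0"
    then obtain v where v: "v \<in> V" "w = T v" by auto
    then have "v = 0" using inj[of v] S(2)[of v] \<open>P (S w) = 0\<close> by simp
    then show "w = 0" using v linear_0[OF T] by simp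
  qed
  have "1 / ?\<beta> \<le> min_norm N N' V T"
  proof (rule min_norm_ge)
    fix v assume "v \<in> V"
    then have "N (S (T v)) \<le> ?\<beta> * N' (T v)" by (intro inv.op_norm_ge) auto
    then show "1 / ?\<beta> * N v \<le> N' (T v)" using pos S by (simp add: field_simps)
  qed
  moreover then show mpos: "0 < min_norm N N' V T" using pos by (smt (verit) divide_pos_pos)
  moreover have "?\<beta> \<le> 1 / min_norm N N' V T"
  proof (rule inv.op_norm_le)
    fix w assume "w \<in> T ` V"
    then obtain v where "v \<in> V" "w = T v" by auto
    then show "N (S w) \<le> 1 / min_norm N N' V T * N' w"
      using min_norm_le[of v] mpos S by (simp add: field_simps)
  qed
  ultimately show "min_norm N N' V T = 1 / ?\<beta>" using pos mpos by (simp add: field_simps)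
qed

end

text \<open>One and the same P serves the form and the forms it induces in all degrees k.\<close>

lemma pos_def_form_factor:
  fixes G :: "'n::{finite,linorder} coords \<Rightarrow> 'n coords \<Rightarrow> real"
  assumes "pos_def_form G"
  shows "\<exists>P :: 'n coords \<Rightarrow> 'n coords. linear P \<and> inj P \<and> (\<forall>v. form_norm G v = norm (P v)) \<and>
    (\<forall>k \<omega>. form_norm (ext_inner k G) \<omega> = norm (ext_map k P \<omega>))"
proof -
  obtain P :: "'n coords \<Rightarrow> 'n coords" where P: "linear P" "\<And>u v. G u v = P u \<bullet> P v"
    using form_eq_pullback_inner[of G] assms unfolding pos_def_form_def by metis
  have "v = 0" if "P v = 0" for v
    using that assms P(2)[of v v] by (auto simp: pos_def_form_def)
  then have "inj P" using linear_injective_0[OF P(1)] by blast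
  moreover have "G = (\<lambda>u v. P u \<bullet> P v)" using P by (simp add: fun_eq_iff)
  ultimately show ?thesis
    using P by (intro exI[of _ P]) (auto simp: form_norm_def norm_eq_sqrt_inner ext_inner_inner)
qed

lemma mixed_power_subset: "mixed_power k E F \<subseteq> ext_power k"
  unfolding mixed_power_def by (intro span_minimal subspace_ext_power) (auto intro: wedge_in_ext_power)

lemma pure_power_subset: "pure_power k F \<subseteq> ext_power k"
  unfolding pure_power_def by (intro span_minimal subspace_ext_power) (auto intro: wedge_in_ext_power)

context adapted_frame
begin

lemma mixed_power_nontrivial:
  assumes "I \<noteq> {}" "1 \<le> k" shows "mixed_power k E F \<noteq> {0}"
proof -
  obtain i where i: "i \<in> I" using assms by auto
  obtain j where j: "j \<in> J" using assms card_J by fastforce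
  \<comment> \<open>Exchanging a single index of J for one of I is the smallest change that leaves
    the pure power.\<close>
  define S where "S = insert i (J - {j})"
  have S: "card S = k" "S \<noteq> J" using i j J_eq card_J assms by (auto simp: S_def)
  then have "ext_map k H (axis S 1) \<in> mixed_power k E F"
    unfolding mixed_power_eq by (intro imageI) (simp add: axis_in_coord_space)
  then show ?thesis using wedge_frame_nonzero[OF lin inj S(1)] by (auto simp: ext_map_axis[OF S(1)])
qed

lemma pure_power_nontrivial: "pure_power k F \<noteq> {0}"
proof -
  have "wedge k (\<lambda>i. H (axis (elem J i) 1)) \<in> pure_power k F"
    unfolding pure_power_eq_span by (rule span_base) simp
  then show ?thesis using wedge_frame_nonzero[OF lin inj card_J] by auto
qed

lemma subspace_E: "subspace E" and subspace_F: "subspace F"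
  unfolding E_eq F_eq by (rule linear_subspace_image[OF lin subspace_coord_space])+

lemma frame_image_nontrivial: "A \<noteq> {} \<Longrightarrow> H ` coord_space A \<noteq> {0}"
proof -
  assume "A \<noteq> {}"
  then obtain i where "i \<in> A" by auto
  then have "axis i 1 \<in> coord_space A" by (auto simp: coord_space_def axis_def)
  moreover have "H (axis i 1) \<noteq> 0" using linear_injective_0[OF lin] inj by (auto simp: axis_eq_0_iff)
  ultimately show ?thesis by blast
qed

lemma E_nontrivial: "I \<noteq> {} \<Longrightarrow> E \<noteq> {0}" and F_nontrivial: "1 \<le> k \<Longrightarrow> F \<noteq> {0}"
  using frame_image_nontrivial[of I] frame_image_nontrivial[of J] card_J by (fastforce simp: E_eq F_eq)+

text \<open>The map \<open>Q \<circ> T\<close> plays the part of Q in the two volume estimates. The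
  first inequality follows from the exchange bound by taking suprema, the second from the volume
  bound by expanding mixed k-vectors in the frame.\<close>

lemma ext_op_norm_comparison:
  fixes G G' :: "'n coords \<Rightarrow> 'n coords \<Rightarrow> real"
  assumes G: "pos_def_form G" "pos_def_form G'"
    and T: "linear T" "inj T" and S: "linear S" "\<And>v. S (T v) = v" and ne: "I \<noteq> {}" "1 \<le> k"
    and C: "1 \<le> C" "\<And>\<xi>. norm \<xi> \<le> C * form_norm G (H \<xi>)" "\<And>\<xi>. form_norm G (H \<xi>) \<le> C * norm \<xi>"
    and angle: "\<And>u v. u \<in> E \<Longrightarrow> v \<in> F \<Longrightarrow> form_norm G' (T u) \<le> C * form_norm G' (T u + T v)"
  defines "\<alpha> \<equiv> op_norm (form_norm G) (form_norm G') E T"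
    and "\<beta> \<equiv> op_norm (form_norm G') (form_norm G) (T ` F) S"
    and "A \<equiv> op_norm (form_norm (ext_inner k G)) (form_norm (ext_inner k G')) (mixed_power k E F) (ext_map k T)"
    and "B \<equiv> op_norm (form_norm (ext_inner k G')) (form_norm (ext_inner k G)) (pure_power k (T ` F)) (ext_map k S)"
  shows "\<alpha> * \<beta> \<le> real CARD('n) * C ^ 3 * (A * B)"
    and "A * B \<le> (real CARD('n set))\<^sup>2 * C ^ (4 * k) * (\<alpha> * \<beta> + (\<alpha> * \<beta>) ^ k)"
proof -
  obtain P where P: "linear P" "inj P" "\<And>v. form_norm G v = norm (P v)"
    "\<And>k \<omega>. form_norm (ext_inner k G) \<omega> = norm (ext_map k P \<omega>)" using pos_def_form_factor[OF G(1)] by auto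
  obtain Q where Q: "linear Q" "inj Q" "\<And>v. form_norm G' v = norm (Q v)"
    "\<And>k \<omega>. form_norm (ext_inner k G') \<omega> = norm (ext_map k Q \<omega>)" using pos_def_form_factor[OF G(2)] by auto
  have P0: "P v = 0 \<Longrightarrow> v = 0" and Q0: "Q v = 0 \<Longrightarrow> v = 0" and T0: "T v = 0 \<Longrightarrow> v = 0" for v
    using P(2) Q(2) T(2) linear_injective_0[OF P(1)] linear_injective_0[OF Q(1)] linear_injective_0[OF T(1)] by blast+
  have TH: "linear (\<lambda>\<xi>. T (H \<xi>))" "inj (\<lambda>\<xi>. T (H \<xi>))"
    using linear_compose[OF lin T(1)] inj_compose[OF T(2) inj] by (simp_all add: o_def)
  interpret TH: adapted_frame I J "\<lambda>\<xi>. T (H \<xi>)" "T ` E" "T ` F" k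
    using TH J_eq card_J by (intro adapted_frame.intro) (auto simp: E_eq F_eq)
  interpret a: normed_restriction "form_norm G" "form_norm G'" P Q E T
    by (rule normed_restriction.intro) (rule P Q T P0 subspace_E E_nontrivial[OF ne(1)]; assumption?)+
  interpret b: normed_restriction "form_norm G'" "form_norm G" Q P "T ` F" S
    by (rule normed_restriction.intro)
      (rule P Q S(1) Q0 TH.subspace_F TH.F_nontrivial[OF ne(2)]; assumption?)+
  have A_inj: "\<omega> = 0" if "\<omega> \<in> mixed_power k E F" "ext_map k P \<omega> = 0" for \<omega>
    using that mixed_power_subset[of k E F] ext_map_eq_0_imp[OF P(1,2)] by blast
  have B_inj: "\<omega> = 0" if "\<omega> \<in> pure_power k (T ` F)" "ext_map k Q \<omega> = 0" for \<omega>
    using that pure_power_subset[of k "T ` F"] ext_map_eq_0_imp[OF Q(1,2)] by blast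
  interpret A: normed_restriction "form_norm (ext_inner k G)" "form_norm (ext_inner k G')"
      "ext_map k P" "ext_map k Q" "mixed_power k E F" "ext_map k T"
    by (rule normed_restriction.intro)
      (rule P Q linear_ext_map mixed_power_nontrivial[OF ne] A_inj subspace_mixed_power; assumption?)+
  have pT: "ext_map k T ` pure_power k F = pure_power k (T ` F)" by (rule ext_map_image_pure_power[OF T(1)])
  have Sinv: "ext_map k S (ext_map k T \<omega>) = \<omega>" if "\<omega> \<in> ext_power k" for \<omega>
    using ext_map_ident[OF that] by (simp add: ext_map_compose[OF S(1)] S(2))
  interpret B: normed_restriction "form_norm (ext_inner k G')" "form_norm (ext_inner k G)"
      "ext_map k Q" "ext_map k P" "pure_power k (T ` F)" "ext_map k S"
    by (rule normed_restriction.intro)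
      (rule P Q linear_ext_map B_inj subspace_pure_power TH.pure_power_nontrivial; assumption?)+
  have QT: "linear (\<lambda>v. Q (T v))" using linear_compose[OF T(1) Q(1)] by (simp add: o_def)
  have extQT: "ext_map k (\<lambda>v. Q (T v)) \<omega> = ext_map k Q (ext_map k T \<omega>)" for \<omega>
    by (simp add: ext_map_compose[OF Q(1)])
  have a: "norm (Q (T v)) \<le> \<alpha> * norm (P v)" if "v \<in> E" for v
    using a.op_norm_ge[OF that] by (simp add: P Q \<alpha>_def)
  have b: "norm (P v) \<le> \<beta> * norm (Q (T v))" if "v \<in> F" for v
    using b.op_norm_ge[of "T v"] that by (simp add: P Q S \<beta>_def)
  have \<alpha>0: "0 \<le> \<alpha>" using a.op_norm_nonneg by (simp add: \<alpha>_def)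
  have \<beta>0: "0 < \<beta>" unfolding \<beta>_def by (rule b.op_norm_pos) (use S(2) in \<open>auto dest!: P0 simp: linear_0[OF T(1)]\<close>)
  have A0: "0 \<le> A" using A.op_norm_nonneg by (simp add: A_def)
  have B0: "0 \<le> B" using B.op_norm_nonneg by (simp add: B_def)
  have Abd: "norm (ext_map k (\<lambda>v. Q (T v)) \<omega>) \<le> A * norm (ext_map k P \<omega>)" if "\<omega> \<in> mixed_power k E F" for \<omega>
    using A.op_norm_ge[OF that] by (simp add: P Q A_def extQT)
  have Bbd: "norm (ext_map k P \<omega>) \<le> B * norm (ext_map k (\<lambda>v. Q (T v)) \<omega>)" if "\<omega> \<in> pure_power k F" for \<omega>
  proof -
    have "ext_map k T \<omega> \<in> pure_power k (T ` F)" using that pT by auto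
    from B.op_norm_ge[OF this] show ?thesis
      using Sinv[of \<omega>] that pure_power_subset[of k F] by (auto simp: P Q B_def extQT)
  qed
  note C' = C[unfolded P]
  have angle': "norm (Q (T u)) \<le> C * norm (Q (T (u + v)))" if "u \<in> E" "v \<in> F" for u v
    using angle[OF that] by (simp add: Q linear_add[OF T(1)])
  show "\<alpha> * \<beta> \<le> real CARD('n) * C ^ 3 * (A * B)"
  proof -
    let ?K = "real CARD('n) * C ^ 3 * (A * B)"
    have ex: "norm (Q (T e)) * norm (P f) \<le> ?K * (norm (P e) * norm (Q (T f)))" if "e \<in> E" "f \<in> F" for e f
      using wedge_exchange_bound[OF P(1) QT C' angle' A0 Abd B0 Bbd ne(2) that] by simp
    \<comment> \<open>With e fixed, the supremum over F is taken first; the supremum over E follows.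
      The case \<open>Q (T e) = 0\<close> is separated because the first supremum divides by that
      norm.\<close>
    have "\<beta> * norm (Q (T e)) \<le> ?K * norm (P e)" if e: "e \<in> E" for e
    proof (cases "Q (T e) = 0")
      case True
      then show ?thesis using A0 B0 C(1) by simp
    next
      case False
      have "\<beta> \<le> ?K * norm (P e) / norm (Q (T e))"
        unfolding \<beta>_def
      proof (rule b.op_norm_le)
        fix w assume "w \<in> T ` F"
        then show "form_norm G (S w) \<le> ?K * norm (P e) / norm (Q (T e)) * form_norm G' w"
          using ex[OF e] False by (auto simp: P Q S field_simps)
      qed
      then show ?thesis using False by (simp add: field_simps)
    qed
    then have "\<alpha> \<le> ?K / \<beta>"
      unfolding \<alpha>_def using \<beta>0 by (intro a.op_norm_le) (auto simp: P Q field_simps)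
    then show ?thesis using \<beta>0 by (simp add: field_simps)
  qed
  show "A * B \<le> (real CARD('n set))\<^sup>2 * C ^ (4 * k) * (\<alpha> * \<beta> + (\<alpha> * \<beta>) ^ k)"
  proof -
    define n where "n = real CARD('n set)"
    have n: "n > 0" by (simp add: n_def)
    define q where "q = \<alpha> * \<beta> + (\<alpha> * \<beta>) ^ k"
    have q0: "0 \<le> q" using \<alpha>0 \<beta>0 by (simp add: q_def)
    let ?wQ = "\<lambda>S. norm (wedge k (\<lambda>i. Q (T (H (axis (elem S i) 1)))))"
    let ?wP = "norm (wedge k (\<lambda>i. P (H (axis (elem J i) 1))))"
    let ?h = "\<lambda>S. wedge k (\<lambda>i. H (axis (elem S i) 1))"
    have PH: "linear (\<lambda>\<xi>. P (H \<xi>))" using linear_compose[OF lin P(1)] by (simp add: o_def)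
    have PH_inj: "inj (\<lambda>\<xi>. P (H \<xi>))" using inj_compose[OF P(2) inj] by (simp add: o_def)
    \<comment> \<open>\<open>M\<close> recovers frame coordinates from their P-images. Its norm is
      at most C by the lower bound on the frame, so \<open>ext_map k M\<close> controls the
      coordinates of a k-vector.\<close>
    obtain M where M: "linear M" "M \<circ> (\<lambda>\<xi>. P (H \<xi>)) = id"
      using linear_injective_left_inverse[OF PH PH_inj] by blast
    then have M': "(\<lambda>\<xi>. P (H \<xi>)) \<circ> M = id" using linear_inverse_left[OF PH M(1)] by blast
    have Mb: "norm (M v) \<le> C * norm v" for v
      using C'(2)[of "M v"] fun_cong[OF M', of v] by simp
    have wJ: "?wQ J > 0" and wP: "?wP > 0"
      using wedge_frame_nonzero[OF linear_compose[OF TH(1) Q(1)] inj_compose[OF Q(2) TH(2)] card_J]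
        wedge_frame_nonzero[OF PH PH_inj card_J] by simp_all
    have Sb: "?wQ S * ?wP \<le> C ^ (3 * k) * q * ?wQ J" if "card S = k" "S \<noteq> J" for S
      using mixed_wedge_bound[OF P(1) QT C' \<alpha>0 a \<beta>0 b that] by (simp add: q_def)
    \<comment> \<open>The pure power is a line, so the norm of the inverse on it is bounded by the
      ratio of two volumes.\<close>
    have B_le: "B \<le> ?wP / ?wQ J"
      unfolding B_def
    proof (rule B.op_norm_le)
      fix \<omega> assume "\<omega> \<in> pure_power k (T ` F)"
      then obtain \<omega>' where \<omega>': "\<omega>' \<in> pure_power k F" "\<omega> = ext_map k T \<omega>'" using pT by auto
      then obtain c where c: "\<omega>' = c *\<^sub>R ?h J" unfolding pure_power_eq_span span_singleton by auto
      have "ext_map k S \<omega> = \<omega>'" using Sinv \<omega>' pure_power_subset by auto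
      moreover have "norm (ext_map k P \<omega>') = \<bar>c\<bar> * ?wP"
        by (simp add: c linear_scale[OF linear_ext_map] ext_map_wedge[OF P(1)])
      moreover have "norm (ext_map k Q \<omega>) = \<bar>c\<bar> * ?wQ J"
        by (simp add: c \<omega>' extQT[symmetric] linear_scale[OF linear_ext_map] ext_map_wedge[OF QT])
      ultimately show "form_norm (ext_inner k G) (ext_map k S \<omega>) \<le> ?wP / ?wQ J * form_norm (ext_inner k G') \<omega>"
        using wJ by (simp add: P Q)
    qed
    \<comment> \<open>One factor n counts the summands of the expansion, the other comes with
      \<open>C ^ k\<close> from the bound on the coordinates, and \<open>C ^ (3 * k)\<close> comes
      from the volume estimate for each S other than J.\<close>
    have A_le: "A \<le> n\<^sup>2 * C ^ (4 * k) * q * ?wQ J / ?wP"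
      unfolding A_def
    proof (rule A.op_norm_le)
      fix \<omega> assume "\<omega> \<in> mixed_power k E F"
      then obtain \<theta> where \<theta>: "\<theta> \<in> ext_power k" "\<theta> $ J = 0" "\<omega> = ext_map k H \<theta>"
        unfolding mixed_power_eq by (auto simp: ext_power_eq coord_space_def)
      have "\<theta> = ext_map k M (ext_map k P \<omega>)"
      proof -
        have "ext_map k M (ext_map k P \<omega>) = ext_map k (\<lambda>v. M (P (H v))) \<theta>"
          by (simp add: \<theta> ext_map_compose[OF M(1)] ext_map_compose[OF P(1)])
        also have "\<dots> = ext_map k (\<lambda>v. v) \<theta>"
          using M(2) by (intro ext_map_cong) (auto simp: fun_eq_iff)
        finally show ?thesis using ext_map_ident[OF \<theta>(1)] by simp
      qed
      then have \<theta>n: "norm \<theta> \<le> n * C ^ k * norm (ext_map k P \<omega>)"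
        using norm_ext_map_le[OF Mb, of k "ext_map k P \<omega>"] C(1) by (simp add: n_def)
      have "ext_map k Q (ext_map k T \<omega>) = ext_map k (\<lambda>v. Q (T (H v))) \<theta>"
        by (simp add: \<theta> extQT[symmetric] ext_map_compose[OF QT])
      also have "norm \<dots> \<le> (\<Sum>S\<in>{S :: 'n set. card S = k}. norm (\<theta> $ S *\<^sub>R wedge k (\<lambda>i. Q (T (H (axis (elem S i) 1))))))"
        unfolding ext_map_def by (rule norm_sum)
      also have "\<dots> \<le> (\<Sum>S\<in>{S :: 'n set. card S = k}. norm \<theta> * (C ^ (3 * k) * q * ?wQ J / ?wP))"
      proof (rule sum_mono)
        fix S :: "'n set" assume "S \<in> {S. card S = k}"
        then have S: "card S = k" by simp
        have nn: "0 \<le> C ^ (3 * k) * q * ?wQ J / ?wP" using C(1) q0 by simp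
        show "norm (\<theta> $ S *\<^sub>R wedge k (\<lambda>i. Q (T (H (axis (elem S i) 1))))) \<le> norm \<theta> * (C ^ (3 * k) * q * ?wQ J / ?wP)"
        proof (cases "S = J")
          case True
          then show ?thesis using mult_nonneg_nonneg[OF norm_ge_zero[of \<theta>] nn]
            by (simp only: \<theta>(2) scaleR_zero_left norm_zero)
        next
          case False
          then have "?wQ S \<le> C ^ (3 * k) * q * ?wQ J / ?wP" using Sb[OF S False] wP by (simp add: field_simps)
          then show ?thesis using component_le_norm_cart[of \<theta> S] by (simp only: norm_scaleR) (intro mult_mono, auto)
        qed
      qed
      also have "\<dots> \<le> (\<Sum>S\<in>(UNIV :: 'n set set). norm \<theta> * (C ^ (3 * k) * q * ?wQ J / ?wP))"
        using C(1) q0 by (intro sum_mono2) auto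
      also have "\<dots> = n * norm \<theta> * (C ^ (3 * k) * q * ?wQ J / ?wP)" by (simp add: n_def)
      also have "\<dots> \<le> n * (n * C ^ k * norm (ext_map k P \<omega>)) * (C ^ (3 * k) * q * ?wQ J / ?wP)"
        using \<theta>n C(1) q0 n by (intro mult_right_mono mult_left_mono) auto
      also have "\<dots> = n\<^sup>2 * (C ^ k * C ^ (3 * k)) * q * ?wQ J / ?wP * norm (ext_map k P \<omega>)"
        by (simp add: power2_eq_square mult_ac)
      also have "C ^ k * C ^ (3 * k) = C ^ (4 * k)" by (simp add: power_add[symmetric])
      finally show "form_norm (ext_inner k G') (ext_map k T \<omega>)
          \<le> n\<^sup>2 * C ^ (4 * k) * q * ?wQ J / ?wP * form_norm (ext_inner k G) \<omega>"
        by (simp add: P Q)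
    qed
    have "A * B \<le> (n\<^sup>2 * C ^ (4 * k) * q * ?wQ J / ?wP) * (?wP / ?wQ J)"
      using A_le B_le A0 B0 order_trans[OF A0 A_le] by (intro mult_mono) auto
    also have "\<dots> = n\<^sup>2 * C ^ (4 * k) * q" using wJ wP by simp
    finally show ?thesis by (simp add: n_def q_def)
  qed
qed

end

section \<open>Measures from positive functionals\<close>

text \<open>Normality is that of the compact Hausdorff space \<Gamma>, so the function is continuous
  and bounded on \<Gamma> and may do anything outside.\<close>

lemma compact_Urysohn:
  fixes \<Gamma> :: "'m::t2_space set"
  assumes "compact \<Gamma>" "compact K" "K \<subseteq> \<Gamma>" "K \<subseteq> U" "open U"
  shows "\<exists>u :: 'm \<Rightarrow> real. continuous_on \<Gamma> u \<and> (\<forall>x\<in>\<Gamma>. 0 \<le> u x \<and> u x \<le> 1) \<and>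
     (\<forall>x\<in>K. u x = 1) \<and> (\<forall>x\<in>\<Gamma> - U. u x = 0)"
proof -
  let ?X = "top_of_set \<Gamma>"
  have "compact_space ?X" using assms by (simp add: compact_space_subtopology)
  moreover have "Hausdorff_space ?X"
  proof (rule Hausdorff_space_subtopology)
    show "Hausdorff_space (euclidean :: 'm topology)"
      unfolding Hausdorff_space_def disjnt_def using hausdorff by fastforce
  qed
  ultimately have "normal_space ?X" by (simp add: compact_Hausdorff_or_regular_imp_normal_space)
  moreover have "closedin ?X (\<Gamma> - U)"
    using assms by (auto simp: closedin_closed intro!: exI[of _ "- U"])
  moreover have "closedin ?X K"
    using assms compact_imp_closed[OF assms(2)] by (auto simp: closedin_closed intro!: exI[of _ K])
  moreover have "disjnt (\<Gamma> - U) K" using assms by (auto simp: disjnt_def)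
  ultimately obtain u where u: "continuous_map ?X (top_of_set {0..1::real}) u"
     "u ` (\<Gamma> - U) \<subseteq> {0}" "u ` K \<subseteq> {1}"
    using Urysohn_lemma[of ?X "\<Gamma> - U" K 0 1] by auto
  have "continuous_on \<Gamma> u" using u(1) by (simp add: continuous_map_in_subtopology)
  moreover have "\<forall>x\<in>\<Gamma>. 0 \<le> u x \<and> u x \<le> 1"
    using u(1) by (auto simp: continuous_map_in_subtopology image_subset_iff Pi_iff)
  ultimately show ?thesis using u(2,3) by (intro exI[of _ u]) auto
qed

lemma compact_bounded_fun:
  assumes "compact \<Gamma>" "continuous_on \<Gamma> (h :: 'm::topological_space \<Rightarrow> real)"
  shows "\<exists>B>0. \<forall>x\<in>\<Gamma>. \<bar>h x\<bar> \<le> B"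
  using bounded_pos[of "h ` \<Gamma>"] compact_imp_bounded[OF compact_continuous_image[OF assms(2,1)]] by auto

lemma measurable_continuous_restrict:
  assumes "continuous_on \<Gamma> T" "T ` \<Gamma> \<subseteq> \<Gamma>"
  shows "T \<in> measurable (restrict_space borel \<Gamma>) (restrict_space borel \<Gamma>)"
  using borel_measurable_continuous_on_restrict[OF assms(1)] assms(2)
  by (intro measurable_restrict_space2) (auto simp: space_restrict_space)

text \<open>The hypotheses of Riesz representation on \<Gamma>. Arguments are functions on the whole
  type, but monotonicity makes L depend only on the values on \<Gamma> of functions that are
  continuous there.\<close>

locale positive_functional =
  fixes \<Gamma> :: "'m::t2_space set" and L :: "('m \<Rightarrow> real) \<Rightarrow> real"
  assumes compact: "compact \<Gamma>"
    and L_add: "\<And>h k. continuous_on \<Gamma> h \<Longrightarrow> continuous_on \<Gamma> k \<Longrightarrow> L (\<lambda>x. h x + k x) = L h + L k"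
    and L_scale: "\<And>h c. continuous_on \<Gamma> h \<Longrightarrow> L (\<lambda>x. c * h x) = c * L h"
    and L_mono: "\<And>h k. continuous_on \<Gamma> h \<Longrightarrow> continuous_on \<Gamma> k \<Longrightarrow> (\<And>x. x \<in> \<Gamma> \<Longrightarrow> h x \<le> k x) \<Longrightarrow> L h \<le> L k"
    and L_one: "L (\<lambda>_. 1) = 1"
begin

lemma L_const: "L (\<lambda>_. c) = c"
  using L_scale[of "\<lambda>_. 1" c] L_one by simp

lemma L_sum: "(\<And>i. i \<in> A \<Longrightarrow> continuous_on \<Gamma> (h i)) \<Longrightarrow> L (\<lambda>x. \<Sum>i\<in>A. h i x) = (\<Sum>i\<in>A. L (h i))"
proof (induction A rule: infinite_finite_induct)
  case (insert i A)
  then show ?case using L_add[of "h i" "\<lambda>x. \<Sum>i\<in>A. h i x"] by (simp add: continuous_on_sum)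
qed (simp_all add: L_const)

section \<open>The content of an open set\<close>

definition below :: "'m set \<Rightarrow> ('m \<Rightarrow> real) set" where
  "below U = {h. continuous_on \<Gamma> h \<and> (\<forall>x\<in>\<Gamma>. 0 \<le> h x \<and> h x \<le> indicator U x)}"

text \<open>The mass that a representing measure has to give to the part of U inside \<Gamma>.
  Competitors vanish off U but need not have compact support in U; the proofs below make up for this
  by cutting off at a small height.\<close>

definition weight :: "'m set \<Rightarrow> real" where
  "weight U = (SUP h\<in>below U. L h)"

lemma below_iff: "h \<in> below U \<longleftrightarrow> continuous_on \<Gamma> h \<and>
    (\<forall>x\<in>\<Gamma>. 0 \<le> h x \<and> h x \<le> 1 \<and> (x \<notin> U \<longrightarrow> h x = 0))"
  unfolding below_def by (force simp: indicator_def)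

lemma below_cont: "h \<in> below U \<Longrightarrow> continuous_on \<Gamma> h"
  by (simp add: below_def)

lemma below_le_1: "h \<in> below U \<Longrightarrow> L h \<le> 1"
proof -
  assume h: "h \<in> below U"
  have "L h \<le> L (\<lambda>_. 1)"
  proof (rule L_mono)
    fix x assume "x \<in> \<Gamma>"
    then have "h x \<le> indicator U x" using h by (simp add: below_def)
    also have "\<dots> \<le> 1" by (simp add: indicator_def)
    finally show "h x \<le> 1" .
  qed (use h in \<open>auto simp: below_def\<close>)
  then show ?thesis by (simp add: L_one)
qed

lemma zero_below: "(\<lambda>_. 0) \<in> below U"
  by (simp add: below_def)

lemma below_bdd: "bdd_above (L ` below U)"
  using below_le_1 by (intro bdd_aboveI2[of _ _ 1]) auto

lemma weight_ge: "h \<in> below U \<Longrightarrow> L h \<le> weight U"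
  unfolding weight_def by (rule cSUP_upper[OF _ below_bdd])

lemma weight_le: "(\<And>h. h \<in> below U \<Longrightarrow> L h \<le> c) \<Longrightarrow> weight U \<le> c"
  unfolding weight_def using zero_below by (intro cSUP_least) auto

lemma weight_nonneg: "0 \<le> weight U"
  using weight_ge[OF zero_below] L_const[of 0] by simp

lemma weight_approx:
  assumes "0 < e" shows "\<exists>h\<in>below U. weight U - e < L h"
proof (rule ccontr)
  assume "\<not> ?thesis"
  then have "weight U \<le> weight U - e" by (intro weight_le) (auto simp: not_less)
  then show False using assms by simp
qed

lemma weight_mono: "U \<inter> \<Gamma> \<subseteq> V \<Longrightarrow> weight U \<le> weight V"
proof (rule weight_le)
  fix h assume "U \<inter> \<Gamma> \<subseteq> V" "h \<in> below U"
  then have "h \<in> below V" unfolding below_iff by blast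
  then show "L h \<le> weight V" by (rule weight_ge)
qed

lemma weight_full: "\<Gamma> \<subseteq> U \<Longrightarrow> weight U = 1"
proof (rule antisym)
  assume "\<Gamma> \<subseteq> U"
  then have "(\<lambda>_. 1) \<in> below U" by (auto simp: below_def)
  then show "1 \<le> weight U" using weight_ge L_one by metis
qed (intro weight_le below_le_1)

lemma weight_empty: "weight {} = 0"
proof (rule antisym[OF weight_le weight_nonneg])
  fix h assume "h \<in> below {}"
  then have "L h \<le> L (\<lambda>_. 0)" by (intro L_mono) (auto simp: below_def)
  then show "L h \<le> 0" by (simp add: L_const)
qed

lemma superlevel_compact:
  assumes "continuous_on \<Gamma> h" shows "compact {x \<in> \<Gamma>. (e :: real) \<le> h x}"
proof -
  have "closedin (top_of_set \<Gamma>) (\<Gamma> \<inter> h -` {e..})"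
    using assms by (intro continuous_closedin_preimage) auto
  moreover have "\<Gamma> \<inter> h -` {e..} = {x \<in> \<Gamma>. e \<le> h x}" by auto
  ultimately show ?thesis using closedin_compact[OF compact] by auto
qed

text \<open>The set outside V where h is at least e is compact and lies in U, so a Urysohn function
  u equal to 1 on it splits h. The part \<open>h * u\<close> is below U, and the rest, lowered by e
  and cut at 0, is below V.\<close>

lemma weight_Un:
  assumes "open U" "open V"
  shows "weight (U \<union> V) \<le> weight U + weight V"
proof (rule weight_le)
  fix h assume h: "h \<in> below (U \<union> V)"
  then have hc: "continuous_on \<Gamma> h" by (rule below_cont)
  show "L h \<le> weight U + weight V"
  proof (rule field_le_epsilon)
    fix e :: real assume e: "0 < e"
    define K where "K = {x \<in> \<Gamma>. e \<le> h x} - V"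
    have "compact K" unfolding K_def using superlevel_compact[OF hc] assms(2) by (rule compact_diff)
    moreover have KU: "K \<subseteq> U"
    proof
      fix x assume x: "x \<in> K"
      then have "x \<notin> U \<union> V \<longrightarrow> h x = 0" using h by (auto simp: K_def below_iff)
      then show "x \<in> U" using x e by (auto simp: K_def)
    qed
    moreover have "K \<subseteq> \<Gamma>" by (auto simp: K_def)
    ultimately obtain u where u: "continuous_on \<Gamma> u" "\<And>x. x \<in> \<Gamma> \<Longrightarrow> 0 \<le> u x \<and> u x \<le> (1::real)"
       "\<And>x. x \<in> K \<Longrightarrow> u x = 1" "\<And>x. x \<in> \<Gamma> - U \<Longrightarrow> u x = 0"
      using compact_Urysohn[OF compact, of K U] assms(1) by blast
    have hb: "0 \<le> h x" "h x \<le> 1" if "x \<in> \<Gamma>" for x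
      using h that by (auto simp: below_iff)
    let ?a = "\<lambda>x. h x * u x" and ?b = "\<lambda>x. max 0 (h x * (1 - u x) - e)"
    have a: "?a \<in> below U"
      unfolding below_def using hc u hb
      by (auto intro!: continuous_intros simp: indicator_def mult_le_one)
    have b: "?b \<in> below V"
      unfolding below_def mem_Collect_eq
    proof safe
      show "continuous_on \<Gamma> ?b" by (intro continuous_intros hc u)
      fix x assume x: "x \<in> \<Gamma>"
      show "?b x \<le> indicator V x"
      proof (cases "x \<in> V")
        case True
        have "h x * (1 - u x) \<le> 1" using hb[OF x] u(2)[OF x] by (intro mult_le_one) auto
        then show ?thesis using True e by simp
      next
        case False
        have "h x * (1 - u x) \<le> e"
        proof (cases "e \<le> h x")
          case True
          then have "x \<in> K" using x False by (simp add: K_def)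
          then show ?thesis using u(3) e by simp
        next
          case False
          have "h x * (1 - u x) \<le> h x * 1" using hb[OF x] u(2)[OF x] by (intro mult_left_mono) auto
          then show ?thesis using False by simp
        qed
        then show ?thesis using False by simp
      qed
    qed simp
    have "L h \<le> L (\<lambda>x. (?a x + ?b x) + e)"
      using below_cont[OF a] below_cont[OF b]
      by (intro L_mono hc) (auto intro!: continuous_intros simp: algebra_simps)
    also have "\<dots> = L (\<lambda>x. ?a x + ?b x) + L (\<lambda>_. e)"
      using below_cont[OF a] below_cont[OF b] by (intro L_add) (auto intro: continuous_on_add)
    also have "\<dots> = L ?a + L ?b + e"
      using L_add[OF below_cont[OF a] below_cont[OF b]] by (simp add: L_const)
    also have "\<dots> \<le> weight U + weight V + e" using weight_ge[OF a] weight_ge[OF b] by simp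
    finally show "L h \<le> weight U + weight V + e" .
  qed
qed

lemma weight_UN_finite:
  fixes U :: "nat \<Rightarrow> 'm set"
  assumes "\<And>i. open (U i)"
  shows "weight (\<Union>i<n. U i) \<le> (\<Sum>i<n. weight (U i))"
proof (induction n)
  case (Suc n)
  have "weight (\<Union>i<Suc n. U i) = weight ((\<Union>i<n. U i) \<union> U n)"
    by (simp add: lessThan_Suc Un_commute)
  also have "\<dots> \<le> weight (\<Union>i<n. U i) + weight (U n)"
    using assms by (intro weight_Un) auto
  finally show ?case using Suc by simp
qed (simp add: weight_empty)

text \<open>The set where h is at least e is compact, so finitely many of the open sets cover it;
  lowering h by e puts it below their union.\<close>

lemma weight_UN:
  fixes U :: "nat \<Rightarrow> 'm set"
  assumes "\<And>i. open (U i)" "h \<in> below (\<Union>i. U i)" "0 < e"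
  shows "\<exists>n. L h \<le> (\<Sum>i<n. weight (U i)) + e"
proof -
  let ?K = "{x \<in> \<Gamma>. e \<le> h x}"
  have hc: "continuous_on \<Gamma> h" by (rule below_cont[OF assms(2)])
  have sub: "?K \<subseteq> (\<Union>i. U i)"
  proof
    fix x assume x: "x \<in> ?K"
    then have "x \<notin> (\<Union>i. U i) \<longrightarrow> h x = 0" using assms by (auto simp: below_iff)
    then show "x \<in> (\<Union>i. U i)" using x assms(3) by auto
  qed
  obtain C where C: "finite C" "?K \<subseteq> (\<Union>i\<in>C. U i)"
    using compactE_image[OF superlevel_compact[OF hc, of e], of UNIV U] assms(1) sub by auto
  obtain n where n: "C \<subseteq> {..<n}" using C(1) finite_nat_iff_bounded by blast
  let ?b = "\<lambda>x. max 0 (h x - e)"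
  have b: "?b \<in> below (\<Union>i<n. U i)"
    unfolding below_def mem_Collect_eq
  proof safe
    show "continuous_on \<Gamma> ?b" by (intro continuous_intros hc)
    fix x assume x: "x \<in> \<Gamma>"
    have "h x \<le> 1" using assms(2) x by (simp add: below_iff)
    then show "?b x \<le> indicator (\<Union>i<n. U i) x"
      using C n x assms(3) by (cases "e \<le> h x") (auto simp: indicator_def)
  qed simp
  have "L h \<le> L (\<lambda>x. ?b x + e)" using below_cont[OF b]
    by (intro L_mono hc) (auto intro!: continuous_intros)
  also have "\<dots> = L ?b + L (\<lambda>_. e)" by (rule L_add[OF below_cont[OF b]]) auto
  also have "\<dots> \<le> (\<Sum>i<n. weight (U i)) + e"
    using weight_ge[OF b] weight_UN_finite[where U = U and n = n, OF assms(1)] by (simp add: L_const)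
  finally show ?thesis by blast
qed

section \<open>Caratheodory extension of the content\<close>

definition outer :: "'m set \<Rightarrow> ennreal" where
  "outer A = (INF U\<in>{U. open U \<and> A \<subseteq> U}. ennreal (weight U))"

lemma outer_le: "open U \<Longrightarrow> A \<subseteq> U \<Longrightarrow> outer A \<le> ennreal (weight U)"
  unfolding outer_def by (rule INF_lower) simp

lemma outer_ge: "(\<And>U. open U \<Longrightarrow> A \<subseteq> U \<Longrightarrow> c \<le> ennreal (weight U)) \<Longrightarrow> c \<le> outer A"
  unfolding outer_def by (rule INF_greatest) simp

lemma outer_open: "open U \<Longrightarrow> outer (\<Gamma> \<inter> U) = ennreal (weight U)"
proof (rule antisym)
  assume U: "open U"
  show "outer (\<Gamma> \<inter> U) \<le> ennreal (weight U)" using U by (intro outer_le) auto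
  show "ennreal (weight U) \<le> outer (\<Gamma> \<inter> U)"
    using weight_mono weight_nonneg by (intro outer_ge ennreal_leI weight_mono) auto
qed

lemma outer_mono: "A \<subseteq> B \<Longrightarrow> outer A \<le> outer B"
  by (intro outer_ge outer_le) auto

lemma outer_top: "outer \<Gamma> = 1"
  using outer_open[of UNIV] weight_full[of UNIV] by simp

lemma outer_empty: "outer {} = 0"
  using outer_le[of "{}" "{}"] by (simp add: weight_empty)

lemma outer_UN: "outer (\<Union>i::nat. A i) \<le> (\<Sum>i. outer (A i))"
proof (rule ennreal_le_epsilon)
  fix e :: real assume e: "0 < e" and fin: "(\<Sum>i. outer (A i)) < top"
  have "\<exists>U. open U \<and> A n \<subseteq> U \<and> ennreal (weight U) \<le> outer (A n) + e * (1/2) ^ Suc n" for n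
  proof -
    have "outer (A n) < outer (A n) + e * (1/2) ^ Suc n"
      using fin e by (auto simp add: less_top dest!: ennreal_suminf_lessD)
    then show ?thesis unfolding outer_def INF_less_iff by (auto intro: less_imp_le)
  qed
  then obtain U where U: "\<And>n. open (U n)" "\<And>n. A n \<subseteq> U n"
    "\<And>n. ennreal (weight (U n)) \<le> outer (A n) + e * (1/2) ^ Suc n" by metis
  have "outer (\<Union>i. A i) \<le> ennreal (weight (\<Union>i. U i))"
    using U by (intro outer_le) blast+
  also have "\<dots> \<le> (\<Sum>i. ennreal (weight (U i)))"
  proof (rule ennreal_le_epsilon)
    fix d :: real assume d: "0 < d"
    obtain h where h: "h \<in> below (\<Union>i. U i)" "weight (\<Union>i. U i) - d / 2 < L h"
      using weight_approx[of "d/2"] d by auto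
    obtain n where "L h \<le> (\<Sum>i<n. weight (U i)) + d / 2"
      using weight_UN[OF U(1) h(1), of "d/2"] d by auto
    then have "weight (\<Union>i. U i) \<le> (\<Sum>i<n. weight (U i)) + d" using h by linarith
    then have "ennreal (weight (\<Union>i. U i)) \<le> ennreal (\<Sum>i<n. weight (U i)) + ennreal d"
      using d weight_nonneg by (subst ennreal_plus[symmetric]) (auto intro!: ennreal_leI sum_nonneg)
    also have "\<dots> = (\<Sum>i<n. ennreal (weight (U i))) + ennreal d"
      using weight_nonneg by (simp add: sum_ennreal)
    also have "\<dots> \<le> (\<Sum>i. ennreal (weight (U i))) + ennreal d"
      by (intro add_right_mono sum_le_suminf) auto
    finally show "ennreal (weight (\<Union>i. U i)) \<le> (\<Sum>i. ennreal (weight (U i))) + ennreal d" .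
  qed
  also have "\<dots> \<le> (\<Sum>n. outer (A n) + e * (1/2) ^ Suc n)"
    by (intro suminf_le allI U) auto
  also have "\<dots> = (\<Sum>n. outer (A n)) + (\<Sum>n. ennreal e * ennreal ((1/2) ^ Suc n))"
    using e by (subst suminf_add[symmetric])
      (auto simp del: ennreal_suminf_cmult simp add: ennreal_mult[symmetric])
  also have "\<dots> = (\<Sum>n. outer (A n)) + e"
    unfolding ennreal_suminf_cmult
    by (subst suminf_ennreal_eq[OF zero_le_power power_half_series]) auto
  finally show "outer (\<Union>i. A i) \<le> (\<Sum>i. outer (A i)) + e" .
qed

lemma outer_measure_space_outer: "outer_measure_space (Pow \<Gamma>) outer"
  unfolding outer_measure_space_def positive_def increasing_def countably_subadditive_def
  using outer_empty outer_mono outer_UN by blast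

lemma outer_Un: "outer (A \<union> B) \<le> outer A + outer B"
proof -
  define D where "D i = (if i = 0 then A else if i = 1 then B else {})" for i :: nat
  have "A \<union> B = (\<Union>i. D i)"
  proof
    show "A \<union> B \<subseteq> (\<Union>i. D i)" using UN_upper[of 0 UNIV D] UN_upper[of 1 UNIV D] by (auto simp: D_def)
  qed (auto simp: D_def split: if_splits)
  then have "outer (A \<union> B) \<le> (\<Sum>i. outer (D i))" using outer_UN by simp
  also have "\<dots> = (\<Sum>i\<in>{0, 1}. outer (D i))"
    by (intro suminf_finite) (auto simp: outer_empty D_def)
  also have "\<dots> = outer A + outer B" by (simp add: D_def)
  finally show ?thesis .
qed

text \<open>For V open around A choose h nearly optimal below \<open>V \<inter> U\<close>. The set
  where h is less than d is a neighbourhood of the part of V outside U; choose k nearly optimal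
  below its intersection with V. There h is small, so h + k is at most 1 + d and, after scaling,
  competes for V.\<close>

lemma open_in_lambda:
  assumes U: "open U" shows "\<Gamma> \<inter> U \<in> lambda_system \<Gamma> (Pow \<Gamma>) outer"
proof -
  interpret Pow: sigma_algebra \<Gamma> "Pow \<Gamma>" by (rule sigma_algebra_Pow)
  have "outer (A \<inter> (\<Gamma> \<inter> U)) + outer (A - \<Gamma> \<inter> U) \<le> outer A" if A: "A \<subseteq> \<Gamma>" for A
  proof (rule outer_ge)
    fix V assume V: "open V" "A \<subseteq> V"
    have *: "weight (V \<inter> U) + enn2real (outer (V \<inter> \<Gamma> - U)) \<le> weight V"
    proof (rule field_le_epsilon)
      fix e :: real assume "0 < e"
      \<comment> \<open>Three losses of size d occur: from the choice of h, from the choice of k,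
        and from the scaling by 1 + d.\<close>
      define d where "d = min 1 (e / 3)"
      have d: "0 < d" "3 * d \<le> e" "d \<le> 1" using \<open>0 < e\<close> by (auto simp: d_def)
      obtain h where h: "h \<in> below (V \<inter> U)" "weight (V \<inter> U) - d < L h"
        using weight_approx[OF d(1)] by auto
      have hc: "continuous_on \<Gamma> h" by (rule below_cont[OF h(1)])
      obtain W' where W': "open W'" "W' \<inter> \<Gamma> = h -` {..<d} \<inter> \<Gamma>"
        using hc[unfolded continuous_on_open_invariant] open_lessThan by blast
      let ?W = "V \<inter> W'"
      have h0: "h x = 0" if "x \<in> \<Gamma>" "x \<notin> V \<inter> U" for x
        using h(1) that unfolding below_iff by blast
      have "V \<inter> \<Gamma> - U \<subseteq> ?W" using W' h0 d by auto
      then have "outer (V \<inter> \<Gamma> - U) \<le> ennreal (weight ?W)"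
        using V W' by (intro outer_le) auto
      then have o: "enn2real (outer (V \<inter> \<Gamma> - U)) \<le> weight ?W"
        using enn2real_mono[of "outer (V \<inter> \<Gamma> - U)" "ennreal (weight ?W)"] weight_nonneg by simp
      obtain k where k: "k \<in> below ?W" "weight ?W - d < L k"
        using weight_approx[OF d(1)] by auto
      let ?s = "\<lambda>x. (1 / (1 + d)) * (h x + k x)"
      have "?s \<in> below V"
        unfolding below_def mem_Collect_eq
      proof safe
        show "continuous_on \<Gamma> ?s" by (intro continuous_intros hc below_cont[OF k(1)])
        fix x assume x: "x \<in> \<Gamma>"
        have b: "0 \<le> h x" "h x \<le> 1" "0 \<le> k x" "k x \<le> 1" "x \<notin> V \<inter> U \<Longrightarrow> h x = 0" "x \<notin> ?W \<Longrightarrow> k x = 0"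
          using h(1) k(1) x unfolding below_iff by blast+
        show "0 \<le> ?s x" using b d by simp
        have "h x + k x \<le> (1 + d) * indicator V x"
        proof (cases "x \<in> ?W")
          case True
          then have "h x < d" using W' x by auto
          then show ?thesis using b True d by (simp add: indicator_def)
        next
          case False
          then show ?thesis using b d by (cases "x \<in> V") (auto simp: indicator_def)
        qed
        then show "?s x \<le> indicator V x" using d by (simp add: field_simps)
      qed
      then have "(1 + d) * L ?s \<le> (1 + d) * weight V" using d weight_ge by (intro mult_left_mono) auto
      moreover have "L ?s = (1 / (1 + d)) * (L h + L k)"
        unfolding L_scale[OF continuous_on_add[OF hc below_cont[OF k(1)]]]
        by (simp only: L_add[OF hc below_cont[OF k(1)]])
      moreover have "(1 + d) * ((1 / (1 + d)) * (L h + L k)) = L h + L k" using d by simp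
      ultimately have "L h + L k \<le> (1 + d) * weight V" by (simp only:)
      also have "\<dots> \<le> weight V + d"
      proof -
        have "weight V \<le> 1" by (intro weight_le below_le_1)
        then have "d * weight V \<le> d * 1" using d by (intro mult_left_mono) auto
        then show ?thesis by (simp add: algebra_simps)
      qed
      finally show "weight (V \<inter> U) + enn2real (outer (V \<inter> \<Gamma> - U)) \<le> weight V + e"
        using o h k d by linarith
    qed
    have "outer (A \<inter> (\<Gamma> \<inter> U)) \<le> ennreal (weight (V \<inter> U))"
      using U V by (intro outer_le) auto
    moreover have "outer (A - \<Gamma> \<inter> U) \<le> outer (V \<inter> \<Gamma> - U)"
      using V A by (intro outer_mono) auto
    moreover have "outer (V \<inter> \<Gamma> - U) = ennreal (enn2real (outer (V \<inter> \<Gamma> - U)))"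
    proof -
      have "outer (V \<inter> \<Gamma> - U) \<le> 1" using outer_mono[of "V \<inter> \<Gamma> - U" \<Gamma>] outer_top by auto
      then have "outer (V \<inter> \<Gamma> - U) < top" by (rule le_less_trans) simp
      then show ?thesis by (simp add: ennreal_enn2real)
    qed
    ultimately have "outer (A \<inter> (\<Gamma> \<inter> U)) + outer (A - \<Gamma> \<inter> U)
      \<le> ennreal (weight (V \<inter> U)) + ennreal (enn2real (outer (V \<inter> \<Gamma> - U)))"
      by (metis add_mono)
    also have "\<dots> \<le> ennreal (weight V)"
      using ennreal_leI[OF *] by (simp only: ennreal_plus[OF weight_nonneg enn2real_nonneg])
    finally show "outer (A \<inter> (\<Gamma> \<inter> U)) + outer (A - \<Gamma> \<inter> U) \<le> ennreal (weight V)" .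
  qed
  moreover have "outer A \<le> outer (A \<inter> (\<Gamma> \<inter> U)) + outer (A - \<Gamma> \<inter> U)" for A
    using outer_Un[of "A \<inter> (\<Gamma> \<inter> U)" "A - \<Gamma> \<inter> U"] by (simp add: Int_Diff_Un)
  ultimately show ?thesis
    unfolding Pow.lambda_system_eq by (auto intro!: antisym)
qed

definition rep_measure :: "'m measure" where
  "rep_measure = measure_of \<Gamma> (sets (restrict_space borel \<Gamma>)) outer"

lemma measure_space_outer: "measure_space \<Gamma> (sets (restrict_space borel \<Gamma>)) outer"
proof (rule measure_down)
  show ms: "measure_space \<Gamma> (lambda_system \<Gamma> (Pow \<Gamma>) outer) outer"
    by (rule sigma_algebra.caratheodory_lemma[OF sigma_algebra_Pow outer_measure_space_outer])
  then interpret ls: sigma_algebra \<Gamma> "lambda_system \<Gamma> (Pow \<Gamma>) outer" by (simp add: measure_space_def)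
  show "sigma_algebra \<Gamma> (sets (restrict_space borel \<Gamma>))"
    using sets.sigma_algebra_axioms[of "restrict_space borel \<Gamma>"] by (simp add: space_restrict_space)
  have "\<Gamma> \<inter> B \<in> lambda_system \<Gamma> (Pow \<Gamma>) outer" if "B \<in> sets borel" for B
    using that unfolding sets_borel
  proof (induction rule: sigma_sets.induct)
    case (Basic a)
    then show ?case by (simp add: open_in_lambda)
  next
    case (Compl a)
    then have "\<Gamma> - \<Gamma> \<inter> a \<in> lambda_system \<Gamma> (Pow \<Gamma>) outer" by (intro ls.compl_sets)
    moreover have "\<Gamma> - \<Gamma> \<inter> a = \<Gamma> \<inter> (UNIV - a)" by auto
    ultimately show ?case by simp
  next
    case (Union a)
    then have "(\<Union>i. \<Gamma> \<inter> a i) \<in> lambda_system \<Gamma> (Pow \<Gamma>) outer" by (intro ls.countable_UN) auto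
    moreover have "(\<Union>i. \<Gamma> \<inter> a i) = \<Gamma> \<inter> (\<Union>i. a i)" by blast
    ultimately show ?case by (simp only:)
  qed (simp add: ls.empty_sets)
  then show "sets (restrict_space borel \<Gamma>) \<subseteq> lambda_system \<Gamma> (Pow \<Gamma>) outer"
    unfolding sets_restrict_space by (rule image_subsetI)
qed

lemma sets_rep_measure: "sets rep_measure = sets (restrict_space borel \<Gamma>)"
proof -
  interpret sigma_algebra \<Gamma> "sets (restrict_space borel \<Gamma>)"
    by (rule measure_space_outer[unfolded measure_space_def, THEN conjunct1])
  show ?thesis unfolding rep_measure_def by (rule sets_measure_of_eq)
qed

lemma space_rep_measure: "space rep_measure = \<Gamma>"
  using sets_eq_imp_space_eq[OF sets_rep_measure] by (simp add: space_restrict_space)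

lemma emeasure_rep_measure: "B \<in> sets rep_measure \<Longrightarrow> emeasure rep_measure B = outer B"
  unfolding sets_rep_measure unfolding rep_measure_def
  by (rule emeasure_measure_of_sigma[OF measure_space_outer[unfolded measure_space_def, THEN conjunct1]
        measure_space_outer[unfolded measure_space_def, THEN conjunct2, THEN conjunct1]
        measure_space_outer[unfolded measure_space_def, THEN conjunct2, THEN conjunct2]])

lemma emeasure_rep_measure_top: "emeasure rep_measure \<Gamma> = 1"
  using emeasure_rep_measure[of \<Gamma>] sets.top[of rep_measure] by (simp add: space_rep_measure outer_top)

text \<open>Composition with the inverse S carries competitors for the preimage of U to competitors
  for U, and L does not see the difference. Equality follows by exchanging T and S.\<close>

lemma outer_preimage_le:
  assumes T: "continuous_on \<Gamma> T" "T ` \<Gamma> \<subseteq> \<Gamma>"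
    and inv: "\<And>h. continuous_on \<Gamma> h \<Longrightarrow> L (\<lambda>x. h (T x)) = L h"
    and S: "continuous_on \<Gamma> S" "S ` \<Gamma> \<subseteq> \<Gamma>" "\<And>x. x \<in> \<Gamma> \<Longrightarrow> T (S x) = x" "\<And>x. x \<in> \<Gamma> \<Longrightarrow> S (T x) = x"
  shows "outer (T -` A \<inter> \<Gamma>) \<le> outer A"
proof (rule outer_ge)
  fix U assume U: "open U" "A \<subseteq> U"
  obtain V where V: "open V" "V \<inter> \<Gamma> = T -` U \<inter> \<Gamma>"
    using T(1)[unfolded continuous_on_open_invariant] U(1) by blast
  have "outer (T -` A \<inter> \<Gamma>) \<le> ennreal (weight V)" using V U by (intro outer_le) auto
  also have "weight V \<le> weight U"
  proof (rule weight_le)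
    fix h assume h: "h \<in> below V"
    have "continuous_on \<Gamma> (\<lambda>x. h (S x))"
      using continuous_on_compose2[OF below_cont[OF h] S(1) S(2)] .
    moreover have "0 \<le> h (S x) \<and> h (S x) \<le> indicator U x" if x: "x \<in> \<Gamma>" for x
    proof -
      have Sx: "S x \<in> \<Gamma>" using S x by auto
      have "S x \<in> V \<inter> \<Gamma> \<longleftrightarrow> S x \<in> T -` U \<inter> \<Gamma>" by (simp only: V(2))
      then have "S x \<in> V \<longleftrightarrow> x \<in> U" using Sx S(3)[OF x] by simp
      then have "indicator V (S x) = (indicator U x :: real)" by (simp add: indicator_def)
      then show ?thesis using h Sx by (auto simp: below_def)
    qed
    ultimately have hS: "(\<lambda>x. h (S x)) \<in> below U" by (simp add: below_def)
    have "L h \<le> L (\<lambda>x. h (S x))"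
      unfolding inv[OF below_cont[OF hS], symmetric]
    proof (rule L_mono[OF below_cont[OF h]])
      show "continuous_on \<Gamma> (\<lambda>x. h (S (T x)))"
        using continuous_on_compose2[OF below_cont[OF hS] T] .
    qed (simp add: S)
    also have "\<dots> \<le> weight U" by (rule weight_ge[OF hS])
    finally show "L h \<le> weight U" .
  qed
  finally show "outer (T -` A \<inter> \<Gamma>) \<le> ennreal (weight U)" by (simp add: ennreal_leI)
qed

section \<open>Comparison of the functional with the integral\<close>

lemma finite_measure_rep_measure: "finite_measure rep_measure"
  by (rule finite_measureI) (simp add: space_rep_measure emeasure_rep_measure_top)

lemma integrable_rep_measure:
  assumes "continuous_on \<Gamma> (h :: 'm \<Rightarrow> real)" shows "integrable rep_measure h"
proof -
  interpret finite_measure rep_measure by (rule finite_measure_rep_measure)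
  obtain B where "\<forall>x\<in>\<Gamma>. \<bar>h x\<bar> \<le> B" using compact_bounded_fun[OF compact assms] by blast
  then show ?thesis
    using borel_measurable_continuous_on_restrict[OF assms]
    by (intro integrable_const_bound[of _ B] AE_I2)
      (simp_all cong: measurable_cong_sets add: space_rep_measure sets_rep_measure)
qed

text \<open>Cuts a number into layers of height one; the next lemma counts the layers that are
  touched, which overshoots by at most one.\<close>

lemma sum_clamp:
  assumes "0 \<le> y" shows "(\<Sum>j<N. max 0 (min 1 (y - real j))) = min y (real N)"
  using assms by (induction N) auto

lemma sum_indicator_less:
  assumes "0 \<le> y" shows "(\<Sum>j<N. if real j < y then 1 else 0 :: real) \<le> min (y + 1) (real N)"
  using assms by (induction N) auto

text \<open>Slice \<open>N * h\<close> into N layers. The layer \<open>f j\<close> lies below the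
  open set where \<open>N * h\<close> exceeds j, so L of it is at most the measure of that set, and
  the sum of the indicators exceeds \<open>N * h\<close> by at most 1. The resulting error is 1 /
  N.\<close>

lemma L_le_integral_unit:
  assumes h: "continuous_on \<Gamma> h" "\<And>x. x \<in> \<Gamma> \<Longrightarrow> 0 \<le> h x \<and> h x \<le> 1"
  shows "L h \<le> (\<integral>x. h x \<partial>rep_measure)"
proof (rule field_le_epsilon)
  fix e :: real assume "0 < e"
  interpret finite_measure rep_measure by (rule finite_measure_rep_measure)
  obtain N :: nat where N: "1 / e < N" using reals_Archimedean2 by blast
  then have N0: "real N > 0" using \<open>0 < e\<close> by (smt (verit) divide_pos_pos)
  define f where "f j x = max 0 (min 1 (real N * h x - real j))" for j :: nat and x
  have f: "continuous_on \<Gamma> (f j)" for j unfolding f_def by (intro continuous_intros h)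
  have "\<exists>W. open W \<and> W \<inter> \<Gamma> = h -` {real j / real N<..} \<inter> \<Gamma>" for j :: nat
    using h(1)[unfolded continuous_on_open_invariant] open_greaterThan by blast
  then obtain W where W: "\<And>j. open (W j)" "\<And>j. W j \<inter> \<Gamma> = h -` {real j / real N<..} \<inter> \<Gamma>" by metis
  have Wiff: "x \<in> W j \<longleftrightarrow> real j < real N * h x" if "x \<in> \<Gamma>" for x j
    using W(2)[of j] that N0 by (auto simp: field_simps set_eq_iff)
  have fW: "f j \<in> below (W j)" for j
    unfolding below_iff using f Wiff by (auto simp: f_def)
  have WM: "\<Gamma> \<inter> W j \<in> sets rep_measure" for j
    using W(1) by (auto simp: sets_rep_measure sets_restrict_space)
  have ind: "(\<Sum>j<N. indicat_real (\<Gamma> \<inter> W j) x) \<le> real N * h x + 1" if x: "x \<in> \<Gamma>" for x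
  proof -
    have "(\<Sum>j<N. indicat_real (\<Gamma> \<inter> W j) x) = (\<Sum>j<N. if real j < real N * h x then 1 else 0)"
      using x Wiff[OF x] by (intro sum.cong) (auto simp: indicator_def)
    then show ?thesis using sum_indicator_less[of "real N * h x" N] h(2)[OF x] by simp
  qed
  have "real N * L h = L (\<lambda>x. real N * h x)" by (simp add: L_scale h)
  also have "\<dots> \<le> L (\<lambda>x. \<Sum>j<N. f j x)"
  proof (rule L_mono)
    fix x assume "x \<in> \<Gamma>"
    then show "real N * h x \<le> (\<Sum>j<N. f j x)"
      unfolding f_def using h(2)[of x] sum_clamp[of "real N * h x" N] N0
      by (auto simp: min_def mult_le_cancel_left2)
  qed (auto intro!: continuous_intros h f)
  also have "\<dots> = (\<Sum>j<N. L (f j))" by (rule L_sum) (rule f)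
  also have "\<dots> \<le> (\<Sum>j<N. weight (W j))" by (intro sum_mono weight_ge fW)
  also have "\<dots> = (\<Sum>j<N. measure rep_measure (\<Gamma> \<inter> W j))"
    using WM W(1) weight_nonneg
    by (intro sum.cong refl) (simp add: measure_def emeasure_rep_measure outer_open)
  also have "\<dots> = (\<integral>x. (\<Sum>j<N. indicat_real (\<Gamma> \<inter> W j) x) \<partial>rep_measure)"
    using WM by (subst Bochner_Integration.integral_sum) (auto simp: less_top[symmetric])
  also have "\<dots> \<le> (\<integral>x. real N * h x + 1 \<partial>rep_measure)"
  proof (rule integral_mono)
    show "integrable rep_measure (\<lambda>x. \<Sum>j<N. indicat_real (\<Gamma> \<inter> W j) x)"
      using WM by (intro Bochner_Integration.integrable_sum) (auto simp: less_top[symmetric])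
    show "integrable rep_measure (\<lambda>x. real N * h x + 1)"
      by (intro integrable_rep_measure continuous_intros h)
  qed (auto intro: ind simp: space_rep_measure)
  also have "\<dots> = real N * (\<integral>x. h x \<partial>rep_measure) + 1"
    using integrable_rep_measure[OF h(1)] emeasure_rep_measure_top
    by (simp add: measure_def space_rep_measure)
  finally have "L h \<le> (\<integral>x. h x \<partial>rep_measure) + 1 / N"
    using N0 by (simp add: field_simps)
  also have "1 / N \<le> e" using N N0 \<open>0 < e\<close> by (simp add: field_simps)
  finally show "L h \<le> (\<integral>x. h x \<partial>rep_measure) + e" by simp
qed

lemma L_le_integral:
  assumes h: "continuous_on \<Gamma> h" shows "L h \<le> (\<integral>x. h x \<partial>rep_measure)"
proof -
  obtain B where B: "0 < B" "\<forall>x\<in>\<Gamma>. \<bar>h x\<bar> \<le> B" using compact_bounded_fun[OF compact h] by blast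
  let ?k = "\<lambda>x. (1 / (2 * B)) * (h x + B)"
  have k: "continuous_on \<Gamma> ?k" by (intro continuous_intros h)
  have "L ?k \<le> (\<integral>x. ?k x \<partial>rep_measure)"
  proof (rule L_le_integral_unit[OF k])
    fix x assume "x \<in> \<Gamma>"
    then show "0 \<le> ?k x \<and> ?k x \<le> 1" using B(1) B(2)[rule_format, of x] by (auto simp: field_simps abs_le_iff)
  qed
  moreover have "L ?k = (1 / (2 * B)) * (L h + B)"
    using h by (subst L_scale) (auto simp: L_add L_const intro!: continuous_intros)
  moreover have "(\<integral>x. ?k x \<partial>rep_measure) = (1 / (2 * B)) * ((\<integral>x. h x \<partial>rep_measure) + B)"
    using integrable_rep_measure[OF h] integrable_rep_measure[of "\<lambda>_. B"] emeasure_rep_measure_top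
    by (simp add: measure_def space_rep_measure)
  ultimately show ?thesis using B(1) by (simp add: field_simps)
qed

lemma emeasure_rep_measure_preimage:
  assumes T: "continuous_on \<Gamma> T" "T ` \<Gamma> \<subseteq> \<Gamma>" "\<And>h. continuous_on \<Gamma> h \<Longrightarrow> L (\<lambda>x. h (T x)) = L h"
    and S: "continuous_on \<Gamma> S" "S ` \<Gamma> \<subseteq> \<Gamma>" "\<And>h. continuous_on \<Gamma> h \<Longrightarrow> L (\<lambda>x. h (S x)) = L h"
    and inv: "\<And>x. x \<in> \<Gamma> \<Longrightarrow> T (S x) = x" "\<And>x. x \<in> \<Gamma> \<Longrightarrow> S (T x) = x"
    and B: "B \<in> sets rep_measure"
  shows "emeasure rep_measure (T -` B \<inter> \<Gamma>) = emeasure rep_measure B"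
proof -
  have meas: "T -` B \<inter> \<Gamma> \<in> sets rep_measure"
    using measurable_sets[OF measurable_continuous_restrict[OF T(1,2)], of B] B
    by (simp add: sets_rep_measure space_restrict_space)
  have "S -` (T -` B \<inter> \<Gamma>) \<inter> \<Gamma> = B"
    using sets.sets_into_space[OF B] S(2) inv(1) by (auto simp: space_rep_measure)
  then have "outer B \<le> outer (T -` B \<inter> \<Gamma>)"
    using outer_preimage_le[OF S T(1,2) inv(2,1), of "T -` B \<inter> \<Gamma>"] by simp
  moreover have "outer (T -` B \<inter> \<Gamma>) \<le> outer B" by (rule outer_preimage_le[OF T S(1,2) inv])
  ultimately show ?thesis using meas B by (simp add: emeasure_rep_measure antisym)
qed

end

section \<open>Invariant measures of flows on compact sets\<close>

text \<open>By Tychonoff the sequence has a cluster point z in a product of intervals over an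
  arbitrary index type. G combines tails of the sequence with preimages of neighbourhoods of z; it
  is proper precisely because z is a cluster point.\<close>

lemma limit_along_filter:
  fixes f :: "nat \<Rightarrow> 'i \<Rightarrow> real"
  assumes "\<And>n i. \<bar>f n i\<bar> \<le> B i"
  shows "\<exists>G z. G \<noteq> bot \<and> G \<le> sequentially \<and> (\<forall>i. ((\<lambda>n. f n i) \<longlongrightarrow> z i) G)"
proof -
  define S where "S = PiE UNIV (\<lambda>i. {- B i..B i})"
  have "compactin (product_topology (\<lambda>_. euclidean) UNIV) S"
    unfolding S_def compactin_PiE by simp
  then have "compact S" by (simp add: euclidean_product_topology)
  moreover have "filtermap f sequentially \<noteq> bot" by (simp add: filtermap_bot_iff)
  moreover have "f n \<in> S" for n
    using assms[of n] by (auto simp: S_def PiE_iff abs_le_iff minus_le_iff)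
  then have "eventually (\<lambda>x. x \<in> S) (filtermap f sequentially)"
    by (simp add: eventually_filtermap)
  ultimately obtain z where z: "inf (nhds z) (filtermap f sequentially) \<noteq> bot"
    unfolding compact_filter by blast
  define G where "G = inf (filtercomap f (nhds z)) sequentially"
  have "G \<noteq> bot"
  proof
    assume "G = bot"
    then have "eventually (\<lambda>_. False) G" by simp
    then obtain P Q where PQ: "eventually P (filtercomap f (nhds z))" "eventually Q sequentially"
      "\<And>n. P n \<Longrightarrow> Q n \<Longrightarrow> False"
      unfolding G_def eventually_inf by blast
    then obtain P' where P': "eventually P' (nhds z)" "\<And>n. P' (f n) \<Longrightarrow> P n"
      unfolding eventually_filtercomap by blast
    have "eventually (\<lambda>w. \<exists>n. w = f n \<and> Q n) (filtermap f sequentially)"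
      unfolding eventually_filtermap using PQ(2) by (rule eventually_mono) blast
    with P'(1) have "eventually (\<lambda>_. False) (inf (nhds z) (filtermap f sequentially))"
      unfolding eventually_inf using P'(2) PQ(3) by blast
    then show False using z by (simp add: trivial_limit_def)
  qed
  moreover have "G \<le> sequentially" by (simp add: G_def)
  moreover have "((\<lambda>n. f n i) \<longlongrightarrow> z i) G" for i
  proof -
    have "filterlim f (nhds z) (filtercomap f (nhds z))" by (rule filterlim_filtercomap)
    then have "(f \<longlongrightarrow> z) G" by (rule filterlim_mono) (simp_all add: G_def)
    then show ?thesis
      by (rule continuous_on_tendsto_compose[OF continuous_on_product_coordinates[of i]]) auto
  qed
  ultimately show ?thesis by blast
qed

locale compact_flow =
  fixes \<Gamma> :: "'m::{t2_space,second_countable_topology} set" and \<phi> :: "real \<Rightarrow> 'm \<Rightarrow> 'm"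
  assumes compact: "compact \<Gamma>"
    and flow_in: "\<And>t x. x \<in> \<Gamma> \<Longrightarrow> \<phi> t x \<in> \<Gamma>"
    and flow_0: "\<And>x. x \<in> \<Gamma> \<Longrightarrow> \<phi> 0 x = x"
    and flow_add: "\<And>s t x. x \<in> \<Gamma> \<Longrightarrow> \<phi> (s + t) x = \<phi> s (\<phi> t x)"
    and flow_cont: "\<And>t. continuous_on \<Gamma> (\<phi> t)"
    and orbit_cont: "\<And>x. x \<in> \<Gamma> \<Longrightarrow> continuous_on {0..} (\<lambda>t. \<phi> t x)"
begin

text \<open>Averaging over real rather than integer times makes limits invariant under every
  \<open>\<phi> t\<close>, as total probability sets require.\<close>

definition avg :: "nat \<Rightarrow> 'm \<Rightarrow> ('m \<Rightarrow> real) \<Rightarrow> real" where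
  "avg n x h = (1 / real n) * integral {0..real n} (\<lambda>s. h (\<phi> s x))"

lemma along_orbit_cont:
  assumes "x \<in> \<Gamma>" "continuous_on \<Gamma> (h :: 'm \<Rightarrow> real)" "A \<subseteq> {0..}"
  shows "continuous_on A (\<lambda>s. h (\<phi> s x))"
  using continuous_on_compose2[OF assms(2) orbit_cont[OF assms(1)]] flow_in[OF assms(1)]
  by (intro continuous_on_subset[OF _ assms(3)]) blast

lemma along_orbit_integrable:
  assumes "x \<in> \<Gamma>" "continuous_on \<Gamma> (h :: 'm \<Rightarrow> real)" "0 \<le> a"
  shows "(\<lambda>s. h (\<phi> s x)) integrable_on {a..b}"
  using assms by (intro integrable_continuous_real along_orbit_cont) auto

lemma avg_le:
  assumes "x \<in> \<Gamma>" "continuous_on \<Gamma> h" "continuous_on \<Gamma> k" "\<And>y. y \<in> \<Gamma> \<Longrightarrow> h y \<le> k y"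
  shows "avg n x h \<le> avg n x k"
  unfolding avg_def using assms flow_in
  by (intro mult_left_mono integral_le along_orbit_integrable) auto

lemma avg_const: "n > 0 \<Longrightarrow> avg n x (\<lambda>_. c) = c"
  by (simp add: avg_def)

lemma avg_add:
  assumes "x \<in> \<Gamma>" "continuous_on \<Gamma> h" "continuous_on \<Gamma> k"
  shows "avg n x (\<lambda>y. h y + k y) = avg n x h + avg n x k"
  unfolding avg_def using assms
  by (subst Henstock_Kurzweil_Integration.integral_add) (auto intro!: along_orbit_integrable simp: algebra_simps)

lemma avg_scale: "avg n x (\<lambda>y. c * h y) = c * avg n x h"
  unfolding avg_def by simp

lemma orbit_integral_bound:
  assumes "x \<in> \<Gamma>" "continuous_on \<Gamma> h" "\<And>y. y \<in> \<Gamma> \<Longrightarrow> \<bar>h y\<bar> \<le> B" "0 \<le> b"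
  shows "\<bar>integral {0..b} (\<lambda>s. h (\<phi> s x))\<bar> \<le> B * b"
proof -
  have "norm (integral {0..b} (\<lambda>s. h (\<phi> s x))) \<le> B * (b - 0)"
    using assms flow_in by (intro integral_bound along_orbit_cont) auto
  then show ?thesis by simp
qed

lemma orbit_integral_split:
  assumes x: "x \<in> \<Gamma>" and h: "continuous_on \<Gamma> (h :: 'm \<Rightarrow> real)" and "0 \<le> t" "0 \<le> b"
  shows "integral {0..t} (\<lambda>s. h (\<phi> s x)) + integral {0..b} (\<lambda>s. h (\<phi> s (\<phi> t x))) = integral {0..b + t} (\<lambda>s. h (\<phi> s x))"
proof -
  have "integral {0..b} (\<lambda>s. h (\<phi> s (\<phi> t x))) = integral {0 + t..b + t} (\<lambda>s. h (\<phi> s x))"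
    using integral_shift[of 0 t b "\<lambda>s. h (\<phi> s x)"] assms
    by (simp add: o_def flow_add[OF x] along_orbit_cont)
  then show ?thesis
    using assms by (simp add: Henstock_Kurzweil_Integration.integral_combine along_orbit_integrable)
qed

lemma avg_bound:
  assumes "x \<in> \<Gamma>" "continuous_on \<Gamma> h" "\<And>y. y \<in> \<Gamma> \<Longrightarrow> \<bar>h y\<bar> \<le> B" "n > 0"
  shows "\<bar>avg n x h\<bar> \<le> B"
  using orbit_integral_bound[OF assms(1-3), of "real n"] assms(4) by (simp add: avg_def abs_mult field_simps)

text \<open>Shifting the interval of integration by t changes the integral only by two end pieces of
  length t.\<close>

lemma avg_flow:
  assumes x: "x \<in> \<Gamma>" and h: "continuous_on \<Gamma> h" and B: "\<And>y. y \<in> \<Gamma> \<Longrightarrow> \<bar>h y\<bar> \<le> B" and "n > 0" "0 \<le> t"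
  shows "\<bar>avg n x (\<lambda>y. h (\<phi> t y)) - avg n x h\<bar> \<le> 2 * t * B / real n"
proof -
  let ?I = "\<lambda>b x. integral {0..b} (\<lambda>s. h (\<phi> s x))"
  have "\<phi> t (\<phi> s x) = \<phi> s (\<phi> t x)" for s using flow_add[OF x, of t s] flow_add[OF x, of s t] by (simp add: add.commute)
  then have "avg n x (\<lambda>y. h (\<phi> t y)) - avg n x h = (1 / real n) * (?I (real n) (\<phi> t x) - ?I (real n) x)"
    by (simp add: avg_def right_diff_distrib)
  also have "?I (real n) (\<phi> t x) - ?I (real n) x = ?I t (\<phi> (real n) x) - ?I t x"
    using orbit_integral_split[OF x h, of t "real n"] orbit_integral_split[OF x h, of "real n" t] \<open>0 \<le> t\<close> by (simp add: add.commute)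
  finally have "\<bar>avg n x (\<lambda>y. h (\<phi> t y)) - avg n x h\<bar> = (1 / real n) * \<bar>?I t (\<phi> (real n) x) - ?I t x\<bar>"
    by (simp add: abs_mult)
  also have "\<dots> \<le> (1 / real n) * (2 * t * B)"
    using orbit_integral_bound[OF x h B \<open>0 \<le> t\<close>] orbit_integral_bound[OF flow_in[OF x] h B \<open>0 \<le> t\<close>, of "real n"]
    by (intro mult_left_mono) (auto simp: abs_le_iff mult_ac)
  finally show ?thesis by simp
qed

definition invariant_probability :: "'m measure \<Rightarrow> bool" where
  "invariant_probability \<mu> \<longleftrightarrow> sets \<mu> = sets (restrict_space borel \<Gamma>) \<and> emeasure \<mu> \<Gamma> = 1 \<and>
     (\<forall>t. \<forall>B\<in>sets \<mu>. emeasure \<mu> (\<phi> t -` B \<inter> \<Gamma>) = emeasure \<mu> B)"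

lemma invariant_probabilityD:
  assumes "invariant_probability \<mu>"
  shows "sets \<mu> = sets (restrict_space borel \<Gamma>)" "space \<mu> = \<Gamma>" "finite_measure \<mu>" "measure \<mu> \<Gamma> = 1"
proof -
  have mass: "emeasure \<mu> \<Gamma> = 1" using assms by (simp add: invariant_probability_def)
  show sets: "sets \<mu> = sets (restrict_space borel \<Gamma>)" using assms by (simp add: invariant_probability_def)
  show space: "space \<mu> = \<Gamma>" using sets_eq_imp_space_eq[OF sets] by (simp add: space_restrict_space)
  show "finite_measure \<mu>" by (rule finite_measureI) (simp add: space mass)
  show "measure \<mu> \<Gamma> = 1" using mass by (simp add: measure_def)
qed

lemma measurable_continuous:
  assumes "invariant_probability \<mu>" "continuous_on \<Gamma> (h :: 'm \<Rightarrow> real)"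
  shows "h \<in> borel_measurable \<mu>"
  using borel_measurable_continuous_on_restrict[OF assms(2)]
  by (simp cong: measurable_cong_sets add: invariant_probabilityD(1)[OF assms(1)])

lemma integrable_bounded:
  assumes "invariant_probability \<mu>" "h \<in> borel_measurable \<mu>" "\<And>x. x \<in> \<Gamma> \<Longrightarrow> \<bar>h x\<bar> \<le> (B :: real)"
  shows "integrable \<mu> h"
  using assms(2,3) invariant_probabilityD(2,3)[OF assms(1)]
  by (intro finite_measure.integrable_const_bound[of _ _ B]) auto

text \<open>Krylov--Bogoliubov. The filter \<open>G\<close> plays the role of a subsequence, so that no
  separability of the space of continuous functions is needed.\<close>

lemma invariant_probability_exists:
  assumes x: "\<And>n. x n \<in> \<Gamma>"
  shows "\<exists>\<mu> G. invariant_probability \<mu> \<and> G \<noteq> bot \<and> G \<le> sequentially \<and>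
    (\<forall>h c. continuous_on \<Gamma> h \<longrightarrow> (\<forall>e>0. \<forall>\<^sub>F n in sequentially. c - e \<le> avg (Suc n) (x n) h) \<longrightarrow> c \<le> (\<integral>y. h y \<partial>\<mu>))"
proof -
  \<comment> \<open>The limit is taken over all functions at once; the value 0 for discontinuous h
    only keeps every coordinate bounded.\<close>
  define f where "f n h = (if continuous_on \<Gamma> h then avg (Suc n) (x n) h else 0)" for n h
  have "\<exists>B. \<forall>n. \<bar>f n h\<bar> \<le> B" for h
  proof (cases "continuous_on \<Gamma> h")
    case True
    then obtain B where B: "\<forall>x\<in>\<Gamma>. \<bar>h x\<bar> \<le> B" using compact_bounded_fun[OF compact] by blast
    have "\<bar>avg (Suc n) (x n) h\<bar> \<le> B" for n using True B x by (intro avg_bound) auto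
    then show ?thesis using True by (auto simp: f_def)
  qed (auto simp: f_def)
  then obtain B where "\<And>n h. \<bar>f n h\<bar> \<le> B h" by metis
  then obtain G L where G: "G \<noteq> bot" "G \<le> sequentially" and L: "\<And>h. ((\<lambda>n. f n h) \<longlongrightarrow> L h) G"
    using limit_along_filter[of f B] by blast
  have lim: "((\<lambda>n. avg (Suc n) (x n) h) \<longlongrightarrow> L h) G" if "continuous_on \<Gamma> h" for h
    using L[of h] that by (simp add: f_def)
  have ev: "eventually P G" if "eventually P sequentially" for P
    using that G(2) by (rule filter_leD[rotated])
  interpret L: positive_functional \<Gamma> L
  proof
    fix h k :: "'m \<Rightarrow> real" assume h: "continuous_on \<Gamma> h" and k: "continuous_on \<Gamma> k"
    have "((\<lambda>n. avg (Suc n) (x n) (\<lambda>y. h y + k y)) \<longlongrightarrow> L h + L k) G"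
      unfolding avg_add[OF x h k] by (intro tendsto_add lim h k)
    moreover have "((\<lambda>n. avg (Suc n) (x n) (\<lambda>y. h y + k y)) \<longlongrightarrow> L (\<lambda>y. h y + k y)) G"
      by (intro lim continuous_on_add h k)
    ultimately show "L (\<lambda>y. h y + k y) = L h + L k" using tendsto_unique[OF G(1)] by blast
    show "L h \<le> L k" if "\<And>y. y \<in> \<Gamma> \<Longrightarrow> h y \<le> k y"
      using avg_le[OF x h k that] by (intro tendsto_le[OF G(1) lim[OF k] lim[OF h]]) auto
  next
    fix h :: "'m \<Rightarrow> real" and c :: real assume h: "continuous_on \<Gamma> h"
    have "((\<lambda>n. avg (Suc n) (x n) (\<lambda>y. c * h y)) \<longlongrightarrow> c * L h) G"
      unfolding avg_scale by (intro tendsto_mult_left lim h)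
    moreover have "((\<lambda>n. avg (Suc n) (x n) (\<lambda>y. c * h y)) \<longlongrightarrow> L (\<lambda>y. c * h y)) G"
      by (intro lim continuous_intros h)
    ultimately show "L (\<lambda>y. c * h y) = c * L h" using tendsto_unique[OF G(1)] by blast
  next
    have "((\<lambda>n. avg (Suc n) (x n) (\<lambda>_. 1)) \<longlongrightarrow> L (\<lambda>_. 1)) G" by (intro lim) auto
    then have "((\<lambda>n. 1) \<longlongrightarrow> L (\<lambda>_. 1)) G" by (simp add: avg_const)
    then show "L (\<lambda>_. 1) = 1" using tendsto_unique[OF G(1) _ tendsto_const] by blast
  qed (rule compact)
  have L_inv: "L (\<lambda>y. h (\<phi> t y)) = L h" if h: "continuous_on \<Gamma> h" and t: "0 \<le> t" for h t
  proof -
    have ht: "continuous_on \<Gamma> (\<lambda>y. h (\<phi> t y))"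
      using continuous_on_compose2[OF h flow_cont] flow_in by blast
    obtain B where B: "\<forall>x\<in>\<Gamma>. \<bar>h x\<bar> \<le> B" using compact_bounded_fun[OF compact h] by blast
    have "(\<lambda>n. 2 * t * B / real (Suc n)) \<longlonglongrightarrow> 0"
      by (rule LIMSEQ_Suc) (rule lim_const_over_n)
    then have "((\<lambda>n. 2 * t * B / real (Suc n)) \<longlongrightarrow> 0) G" using filterlim_mono[OF _ order_refl G(2)] by blast
    then have "((\<lambda>n. avg (Suc n) (x n) (\<lambda>y. h (\<phi> t y)) - avg (Suc n) (x n) h) \<longlongrightarrow> 0) G"
    proof (rule Lim_null_comparison[rotated])
      have "norm (avg (Suc n) (x n) (\<lambda>y. h (\<phi> t y)) - avg (Suc n) (x n) h) \<le> 2 * t * B / real (Suc n)" for n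
        using avg_flow[OF x h _ _ t, of B "Suc n" n] B by simp
      then show "\<forall>\<^sub>F n in G. norm (avg (Suc n) (x n) (\<lambda>y. h (\<phi> t y)) - avg (Suc n) (x n) h) \<le> 2 * t * B / real (Suc n)"
        by (intro always_eventually allI)
    qed
    moreover have "((\<lambda>n. avg (Suc n) (x n) (\<lambda>y. h (\<phi> t y)) - avg (Suc n) (x n) h) \<longlongrightarrow> L (\<lambda>y. h (\<phi> t y)) - L h) G"
      by (intro tendsto_diff lim h ht)
    ultimately have "L (\<lambda>y. h (\<phi> t y)) - L h = 0" using tendsto_unique[OF G(1)] by blast
    then show ?thesis by simp
  qed
  have inverse: "\<phi> t (\<phi> (- t) y) = y" if "y \<in> \<Gamma>" for t y
    using flow_add[OF that, of t "- t"] flow_0[OF that] by simp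
  \<comment> \<open>For negative t, invariance under time -t is applied to the composition of h with
    \<open>\<phi> t\<close>; the two flow maps cancel on \<Gamma>.\<close>
  have inv: "L (\<lambda>y. h (\<phi> t y)) = L h" if h: "continuous_on \<Gamma> h" for h t
  proof (cases "0 \<le> t")
    case False
    have ht: "continuous_on \<Gamma> (\<lambda>y. h (\<phi> t y))" using continuous_on_compose2[OF h flow_cont] flow_in by blast
    have htt: "continuous_on \<Gamma> (\<lambda>y. h (\<phi> t (\<phi> (- t) y)))" using continuous_on_compose2[OF ht flow_cont] flow_in by blast
    have "L (\<lambda>y. h (\<phi> t y)) = L (\<lambda>y. h (\<phi> t (\<phi> (- t) y)))" using L_inv[OF ht, of "- t"] False by simp
    also have "\<dots> = L h" by (rule antisym; rule L.L_mono) (use h htt inverse in auto)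
    finally show ?thesis .
  qed (rule L_inv[OF h])
  have "emeasure L.rep_measure (\<phi> t -` A \<inter> \<Gamma>) = emeasure L.rep_measure A"
    if A: "A \<in> sets L.rep_measure" for t A
    using flow_in inverse[of _ t] inverse[of _ "- t"]
    by (intro L.emeasure_rep_measure_preimage[where S = "\<phi> (- t)"] flow_cont inv A) auto
  then have "invariant_probability L.rep_measure"
    unfolding invariant_probability_def
    using L.sets_rep_measure L.emeasure_rep_measure_top by simp
  moreover have "c \<le> (\<integral>y. h y \<partial>L.rep_measure)"
    if h: "continuous_on \<Gamma> h" and c: "\<And>e. e > 0 \<Longrightarrow> \<forall>\<^sub>F n in sequentially. c - e \<le> avg (Suc n) (x n) h" for h c
  proof -
    have "c \<le> L h"
    proof (rule field_le_epsilon)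
      fix e :: real assume "e > 0"
      have "c - e \<le> L h" using tendsto_lowerbound[OF lim[OF h] ev[OF c[OF \<open>e > 0\<close>]] G(1)] .
      then show "c \<le> L h + e" by simp
    qed
    also have "\<dots> \<le> (\<integral>y. h y \<partial>L.rep_measure)" by (rule L.L_le_integral[OF h])
    finally show ?thesis .
  qed
  ultimately show ?thesis using G by blast
qed

end

section \<open>Subadditive cocycles\<close>

lemma Liminf_ereal_finite:
  fixes f :: "'i \<Rightarrow> real"
  assumes "F \<noteq> bot" and bd: "\<forall>\<^sub>F i in F. \<bar>f i\<bar> \<le> C"
  obtains p where "Liminf F (\<lambda>i. ereal (f i)) = ereal p" "\<bar>p\<bar> \<le> C"
proof -
  have "ereal (- C) \<le> Liminf F (\<lambda>i. ereal (f i))"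
    by (rule Liminf_bounded, rule eventually_mono[OF bd]) auto
  moreover have "Limsup F (\<lambda>i. ereal (f i)) \<le> ereal C"
    by (rule Limsup_bounded, rule eventually_mono[OF bd]) auto
  then have "Liminf F (\<lambda>i. ereal (f i)) \<le> ereal C" by (rule order_trans[OF Liminf_le_Limsup[OF assms(1)]])
  ultimately show ?thesis using that by (cases "Liminf F (\<lambda>i. ereal (f i))") (auto simp: abs_le_iff)
qed

text \<open>Subadditivity gives upper bounds only. The condition \<open>low\<close> prevents a
  sudden drop within a unit of time and so yields the linear lower bound in \<open>growth\<close>;
  for the norms of the flow it expresses that the derivative over short times is uniformly
  invertible.\<close>

locale subadditive_cocycle = compact_flow \<Gamma> \<phi>
  for \<Gamma> :: "'m::{t2_space,second_countable_topology} set" and \<phi> +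
  fixes a :: "real \<Rightarrow> 'm \<Rightarrow> real" and C :: real
  assumes sub: "\<And>s t x. x \<in> \<Gamma> \<Longrightarrow> 0 \<le> s \<Longrightarrow> 0 \<le> t \<Longrightarrow> a (s + t) x \<le> a s x + a t (\<phi> s x)"
    and bnd: "\<And>t x. x \<in> \<Gamma> \<Longrightarrow> 0 \<le> t \<Longrightarrow> t \<le> 1 \<Longrightarrow> \<bar>a t x\<bar> \<le> C"
    and low: "\<And>s t x. x \<in> \<Gamma> \<Longrightarrow> 0 \<le> s \<Longrightarrow> 0 \<le> t \<Longrightarrow> t \<le> 1 \<Longrightarrow> a s x - C \<le> a (s + t) x"
    and cont: "\<And>t. 0 \<le> t \<Longrightarrow> continuous_on \<Gamma> (a t)"
begin

lemma growth_nat: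
  assumes "x \<in> \<Gamma>" "0 \<le> r" "r \<le> 1"
  shows "\<bar>a (real n + r) x\<bar> \<le> C * (real n + 1)"
  using assms(1)
proof (induction n arbitrary: x)
  case 0
  then show ?case using bnd[OF 0 assms(2,3)] by simp
next
  case (Suc n)
  have "a (1 + (real n + r)) x \<le> a 1 x + a (real n + r) (\<phi> 1 x)"
    using assms by (intro sub Suc.prems) auto
  moreover have "a 1 x \<le> C" using bnd[OF Suc.prems, of 1] by simp
  moreover have "a (real n + r) x - C \<le> a (real n + r + 1) x"
    using assms by (intro low Suc.prems) auto
  moreover have "\<bar>a (real n + r) (\<phi> 1 x)\<bar> \<le> C * (real n + 1)" "\<bar>a (real n + r) x\<bar> \<le> C * (real n + 1)"
    using Suc.IH flow_in Suc.prems by auto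
  moreover have "1 + (real n + r) = real (Suc n) + r" "real n + r + 1 = real (Suc n) + r" by simp_all
  moreover have "C * (real (Suc n) + 1) = C * (real n + 1) + C" by (simp add: algebra_simps)
  ultimately show ?case unfolding abs_le_iff by (smt (verit))
qed

lemma C_nonneg: "x \<in> \<Gamma> \<Longrightarrow> 0 \<le> C"
  using bnd[of x 0] by (smt (verit))

lemma growth:
  assumes "x \<in> \<Gamma>" "0 \<le> t"
  shows "\<bar>a t x\<bar> \<le> C * (t + 1)"
proof -
  define n where "n = nat \<lfloor>t\<rfloor>"
  have n: "real n \<le> t" "t - real n \<le> 1" using assms(2) unfolding n_def by linarith+
  have "\<bar>a (real n + (t - real n)) x\<bar> \<le> C * (real n + 1)"
    using n by (intro growth_nat assms) auto
  also have "\<dots> \<le> C * (t + 1)" using n C_nonneg[OF assms(1)] by (intro mult_left_mono) auto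
  finally show ?thesis by simp
qed

text \<open>Averaging \<open>a\<^sub>n(y) \<le> a\<^sub>s(y) + a\<^sub>m(\<phi>\<^sub>s y) + a\<^sub>m(\<phi>\<^sub>s\<^sub>+\<^sub>m y) + \<dots>\<close> over \<open>s \<in> [0, m]\<close>.\<close>

lemma avg_cocycle_ge:
  assumes y: "y \<in> \<Gamma>" and m: "1 \<le> m" "m \<le> n" and "0 \<le> a (real n) y"
  shows "- (5 * C * (real m + 1) * real m) \<le> real n * avg n y (a (real m))"
proof -
  define D where "D = C * (real m + 1)"
  have D: "\<bar>a t z\<bar> \<le> D" if "z \<in> \<Gamma>" "0 \<le> t" "t \<le> real m" for t z
  proof -
    have "\<bar>a t z\<bar> \<le> C * (t + 1)" by (intro growth that)
    also have "\<dots> \<le> D" unfolding D_def using that C_nonneg[OF y] by (intro mult_left_mono) auto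
    finally show ?thesis .
  qed
  let ?I = "\<lambda>t b z. integral {0..real b} (\<lambda>s. a (real t) (\<phi> s z))"
  have bd: "\<bar>?I t b z\<bar> \<le> D * real b" if "z \<in> \<Gamma>" "t \<le> m" for t b z
    using that D by (intro orbit_integral_bound cont) auto
  have split: "?I t m z + ?I t b (\<phi> (real m) z) = ?I t (b + m) z" if "z \<in> \<Gamma>" for t b z
    using orbit_integral_split[OF that cont, of "real t" "real m" "real b"] by simp
  \<comment> \<open>Blocks of length m are peeled off one after the other. When fewer than m units
    remain, both integrals are bounded by \<open>D * m\<close>, which accounts for the additive
    term.\<close>
  have I_le: "?I n m z \<le> ?I m n z + 2 * D * real m" if "z \<in> \<Gamma>" for n z
    using that
  proof (induction n arbitrary: z rule: less_induct)
    case (less n)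
    show ?case
    proof (cases "m \<le> n")
      case True
      have "?I n m z \<le> integral {0..real m} (\<lambda>s. a (real m) (\<phi> s z) + a (real (n - m)) (\<phi> s (\<phi> (real m) z)))"
      proof (intro integral_le integrable_add along_orbit_integrable cont flow_in less.prems)
        fix s
        have "\<phi> (real m) (\<phi> s z) = \<phi> s (\<phi> (real m) z)"
          using flow_add[OF less.prems, of s "real m"] flow_add[OF less.prems, of "real m" s] by (simp add: add.commute)
        then show "a (real n) (\<phi> s z) \<le> a (real m) (\<phi> s z) + a (real (n - m)) (\<phi> s (\<phi> (real m) z))"
          using sub[OF flow_in[OF less.prems], of "real m" "real (n - m)" s] True by (simp add: of_nat_diff)
      qed auto
      also have "\<dots> = ?I m m z + ?I (n - m) m (\<phi> (real m) z)"
        by (intro Henstock_Kurzweil_Integration.integral_add along_orbit_integrable cont flow_in less.prems) auto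
      also have "?I (n - m) m (\<phi> (real m) z) \<le> ?I m (n - m) (\<phi> (real m) z) + 2 * D * real m"
        using True m by (intro less.IH flow_in less.prems) auto
      finally show ?thesis using split[OF less.prems, of m "n - m"] True by simp
    next
      case False
      then have "D * real n \<le> D * real m" using D[OF y, of 0] by (intro mult_left_mono) auto
      then show ?thesis using bd[OF less.prems, of n m] bd[OF less.prems, of m n] False by (simp add: abs_le_iff)
    qed
  qed
  \<comment> \<open>Nonnegativity of a at time n is passed on to shifted starting points: n is split
    as s, n - m and m - s, and each of the two short pieces costs at most D.\<close>
  have "integral {0..real m} (\<lambda>s. - 2 * D) \<le> ?I (n - m) m y"
  proof (rule integral_le[OF integrable_const_ivl along_orbit_integrable[OF y cont]])
    fix s assume s: "s \<in> {0..real m}"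
    have "a (s + (real n - s)) y \<le> a s y + a (real n - s) (\<phi> s y)" using s m by (intro sub y) auto
    moreover have "a (real (n - m) + (real m - s)) (\<phi> s y) \<le> a (real (n - m)) (\<phi> s y) + a (real m - s) (\<phi> (real (n - m)) (\<phi> s y))"
      using s by (intro sub flow_in y) auto
    moreover have "a s y \<le> D" "a (real m - s) (\<phi> (real (n - m)) (\<phi> s y)) \<le> D"
      using D[OF y, of s] D[OF flow_in[OF flow_in[OF y]], of "real m - s" "real (n - m)" s] s by (auto simp: abs_le_iff)
    ultimately show "- 2 * D \<le> a (real (n - m)) (\<phi> s y)" using assms(4) m by (simp add: of_nat_diff)
  qed auto
  moreover have "?I m (n - m) y + ?I m m (\<phi> (real (n - m)) y) = ?I m n y"
    using orbit_integral_split[OF y cont, of "real m" "real (n - m)" "real m"] m by (simp add: of_nat_diff)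
  moreover have "real n * avg n y (a (real m)) = ?I m n y" using m by (simp add: avg_def)
  \<comment> \<open>The constant 5 is 2 from the shift of the starting point, 2 from
    \<open>I_le\<close>, and 1 from the last block of length m.\<close>
  ultimately show ?thesis
    using I_le[OF y, of "n - m"] bd[OF flow_in[OF y, of "real (n - m)"], of m m] by (simp add: D_def abs_le_iff algebra_simps)
qed

text \<open>The lower growth rate along integers, a countable lower limit and hence measurable. The
  ratios are bounded by 2 C, so the conversion to a real number loses nothing on \<Gamma>.\<close>

definition g :: "'m \<Rightarrow> real" where
  "g x = real_of_ereal (liminf (\<lambda>n. ereal (a (real n) x / real n)))"

lemma ratio_bound:
  assumes "x \<in> \<Gamma>" "1 \<le> t" shows "\<bar>a t x / t\<bar> \<le> 2 * C"
proof -
  have "\<bar>a t x\<bar> \<le> C * (t + 1)" using assms by (intro growth) auto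
  also have "\<dots> \<le> C * (2 * t)" using assms C_nonneg by (intro mult_left_mono) auto
  finally show ?thesis using assms by (simp add: field_simps)
qed

lemma ereal_g: assumes "x \<in> \<Gamma>" shows "ereal (g x) = liminf (\<lambda>n. ereal (a (real n) x / real n))" "\<bar>g x\<bar> \<le> 2 * C"
proof -
  have "\<forall>\<^sub>F n in sequentially. \<bar>a (real n) x / real n\<bar> \<le> 2 * C"
    by (rule eventually_sequentiallyI[of 1], rule ratio_bound[OF assms]) simp
  from Liminf_ereal_finite[OF sequentially_bot this] obtain p
    where "liminf (\<lambda>n. ereal (a (real n) x / real n)) = ereal p" "\<bar>p\<bar> \<le> 2 * C" .
  then show "ereal (g x) = liminf (\<lambda>n. ereal (a (real n) x / real n))" "\<bar>g x\<bar> \<le> 2 * C" by (simp_all add: g_def)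
qed

text \<open>If an integer value of a exceeds \<open>t i * w i\<close> by at most C and
  \<open>t i\<close> is within 1 of the integer, then division by the integer leaves an error 3 C /
  n, namely C plus 2 C from replacing the time. This covers both rounding of times and a shift of
  the base point.\<close>

lemma g_le_Liminf_close:
  fixes n :: "'i \<Rightarrow> nat"
  assumes x: "x \<in> \<Gamma>" and n: "filterlim n sequentially F"
    and w: "\<forall>\<^sub>F i in F. a (real (n i)) x \<le> C + t i * w i \<and> \<bar>w i\<bar> \<le> 2 * C \<and> \<bar>t i - real (n i)\<bar> \<le> 1"
  shows "ereal (g x) \<le> Liminf F (\<lambda>i. ereal (w i))"
proof (rule ereal_le_epsilon2)
  fix e :: real assume e: "0 < e"
  have "ereal (g x - e / 2) < liminf (\<lambda>k. ereal (a (real k) x / real k))"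
    using e unfolding ereal_g(1)[OF x, symmetric] by simp
  then have "\<forall>\<^sub>F k in sequentially. g x - e / 2 < a (real k) x / real k"
    using less_LiminfD by force
  moreover have "\<forall>\<^sub>F k in sequentially. 3 * C / real k < e / 2"
    using order_tendstoD(2)[OF lim_const_over_n] e by simp
  ultimately have "\<forall>\<^sub>F k in sequentially. 0 < k \<and> g x - e / 2 < a (real k) x / real k \<and> 3 * C / real k < e / 2"
    using eventually_gt_at_top[of 0] by eventually_elim auto
  from eventually_compose_filterlim[OF this n] w have "\<forall>\<^sub>F i in F. ereal (g x - e) \<le> ereal (w i)"
  proof eventually_elim
    case (elim i)
    have "(t i - real (n i)) * w i \<le> \<bar>t i - real (n i)\<bar> * \<bar>w i\<bar>" by (simp flip: abs_mult)
    also have "\<dots> \<le> 1 * (2 * C)" using elim by (intro mult_mono) auto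
    finally have "a (real (n i)) x \<le> real (n i) * w i + 3 * C" using elim by (simp add: algebra_simps)
    then have "a (real (n i)) x / real (n i) \<le> w i + 3 * C / real (n i)" using elim by (simp add: field_simps)
    then show ?case using elim by simp
  qed
  then have "ereal (g x - e) \<le> Liminf F (\<lambda>i. ereal (w i))" by (rule Liminf_bounded)
  then show "ereal (g x) \<le> Liminf F (\<lambda>i. ereal (w i)) + ereal e"
    by (cases "Liminf F (\<lambda>i. ereal (w i))") auto
qed

text \<open>Times are rounded up, so that subadditivity bounds the integer value from above by the
  value at t plus C.\<close>

lemma g_le_Liminf:
  assumes x: "x \<in> \<Gamma>"
  shows "ereal (g x) \<le> Liminf at_top (\<lambda>t. ereal (1 / t * a t x))"
proof (rule g_le_Liminf_close[OF x, where n = "\<lambda>t. Suc (nat \<lfloor>t\<rfloor>)" and t = "\<lambda>t. t"])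
  show "filterlim (\<lambda>t::real. Suc (nat \<lfloor>t\<rfloor>)) sequentially at_top"
    by (intro filterlim_compose[OF filterlim_Suc] filterlim_compose[OF filterlim_nat_sequentially] filterlim_floor_sequentially)
  show "\<forall>\<^sub>F t in at_top. a (real (Suc (nat \<lfloor>t\<rfloor>))) x \<le> C + t * (1 / t * a t x) \<and> \<bar>1 / t * a t x\<bar> \<le> 2 * C \<and> \<bar>t - real (Suc (nat \<lfloor>t\<rfloor>))\<bar> \<le> 1"
    using eventually_ge_at_top[of 1]
  proof eventually_elim
    case (elim t)
    define r where "r = real (Suc (nat \<lfloor>t\<rfloor>)) - t"
    have r: "0 \<le> r" "r \<le> 1" unfolding r_def using elim by linarith+
    have "a (t + r) x \<le> a t x + a r (\<phi> t x)" using r elim by (intro sub x) auto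
    moreover have "a r (\<phi> t x) \<le> C" using bnd[OF flow_in[OF x] r] by (simp add: abs_le_iff)
    moreover have "t + r = real (Suc (nat \<lfloor>t\<rfloor>))" by (simp add: r_def)
    ultimately show ?case using ratio_bound[OF x elim] r elim by (simp add: r_def)
  qed
qed

text \<open>The first unit of time contributes a bounded amount, which disappears in the limit.
  Subadditivity gives this direction, and it is the one that bounds a block by a sum along the
  orbit.\<close>

lemma g_le_along_orbit: assumes x: "x \<in> \<Gamma>" shows "g x \<le> g (\<phi> (real j) x)"
proof (induction j)
  case (Suc j)
  let ?y = "\<phi> (real j) x"
  have y: "?y \<in> \<Gamma>" "\<phi> 1 ?y \<in> \<Gamma>" using flow_in x by auto
  have "ereal (g ?y) \<le> liminf (\<lambda>i. ereal (a (real i) (\<phi> 1 ?y) / real i))"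
  proof (rule g_le_Liminf_close[OF y(1) filterlim_Suc, where t = real])
    show "\<forall>\<^sub>F i in sequentially. a (real (Suc i)) ?y \<le> C + real i * (a (real i) (\<phi> 1 ?y) / real i) \<and>
      \<bar>a (real i) (\<phi> 1 ?y) / real i\<bar> \<le> 2 * C \<and> \<bar>real i - real (Suc i)\<bar> \<le> 1"
    proof (rule eventually_sequentiallyI[of 1])
      fix i :: nat assume "1 \<le> i"
      then show "a (real (Suc i)) ?y \<le> C + real i * (a (real i) (\<phi> 1 ?y) / real i) \<and>
        \<bar>a (real i) (\<phi> 1 ?y) / real i\<bar> \<le> 2 * C \<and> \<bar>real i - real (Suc i)\<bar> \<le> 1"
        using sub[OF y(1), of 1 "real i"] bnd[OF y(1), of 1] ratio_bound[OF y(2), of "real i"] by simp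
    qed
  qed
  then have "g ?y \<le> g (\<phi> 1 ?y)" using ereal_g(1)[OF y(2)] by (metis ereal_less_eq(3))
  also have "\<phi> 1 ?y = \<phi> (real (Suc j)) x" using flow_add[OF x, of 1 "real j"] by simp
  finally show ?case using Suc by simp
qed (simp add: flow_0 x)

text \<open>If every ratio stayed above g x + e, so would the lower limit.\<close>

lemma exists_good_time:
  assumes "x \<in> \<Gamma>" "0 < e"
  shows "\<exists>m\<ge>1. a (real m) x \<le> real m * (g x + e)"
proof (rule ccontr)
  assume *: "\<not> ?thesis"
  have "ereal (g x + e) \<le> liminf (\<lambda>n. ereal (a (real n) x / real n))"
  proof (rule Liminf_bounded, rule eventually_sequentiallyI[of 1])
    fix n :: nat assume "1 \<le> n"
    then have "real n * (g x + e) \<le> a (real n) x" using * by (meson less_imp_le not_le)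
    then show "ereal (g x + e) \<le> ereal (a (real n) x / real n)" using \<open>1 \<le> n\<close> by (simp add: field_simps)
  qed
  then show False using ereal_g(1)[OF assms(1)] assms(2) by (metis ereal_less_eq(3) less_add_same_cancel1 not_le)
qed

text \<open>The argument of Katznelson and Weiss: every orbit is cut into pieces of bounded length along
  which \<open>a\<close> is dominated by its lower growth rate \<open>g\<close>, except on a set of small measure.\<close>

lemma katznelson_weiss:
  assumes \<mu>: "invariant_probability \<mu>" and e: "0 < e"
  shows "integrable \<mu> g" "\<exists>N. \<forall>n\<ge>N. (\<integral>x. a (real n) x \<partial>\<mu>) \<le> real n * ((\<integral>x. g x \<partial>\<mu>) + 3 * e)"
proof -
  note \<mu>_facts = invariant_probabilityD[OF \<mu>]
  then have space_\<mu>: "space \<mu> = \<Gamma>" and measure_\<Gamma>: "measure \<mu> \<Gamma> = 1" by blast+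
  interpret finite_measure \<mu> by (rule \<mu>_facts(3))
  have "\<Gamma> \<noteq> {}" using measure_\<Gamma> by auto
  then have C0: "0 \<le> C" using C_nonneg by auto
  have a_meas: "a (real n) \<in> borel_measurable \<mu>" for n by (intro measurable_continuous[OF \<mu>] cont) simp
  have g_meas: "g \<in> borel_measurable \<mu>" unfolding g_def using a_meas by measurable
  have g_bd: "\<bar>g x\<bar> \<le> 2 * C" if "x \<in> \<Gamma>" for x using ereal_g[OF that] by simp
  show g_int: "integrable \<mu> g" by (rule integrable_bounded[OF \<mu> g_meas g_bd])
  \<comment> \<open>Points without a good time up to N. These sets shrink to the empty set, so their
    measure tends to 0.\<close>
  define A where "A N = {x \<in> space \<mu>. \<forall>m\<in>{1..N}. \<not> a (real m) x \<le> real m * (g x + e)}" for N :: nat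
  have A_meas: "A N \<in> sets \<mu>" for N
    unfolding A_def using a_meas g_meas by measurable
  have A_sub: "A N \<inter> \<Gamma> = A N" for N by (auto simp: A_def space_\<mu>)
  have "decseq A" by (rule decseq_SucI) (auto simp: A_def)
  moreover have "(\<Inter>N. A N) = {}"
  proof (rule ccontr)
    assume "(\<Inter>N. A N) \<noteq> {}"
    then obtain x where x: "\<And>N. x \<in> A N" by auto
    then have "x \<in> \<Gamma>" by (auto simp: A_def space_\<mu>)
    then obtain m where "m \<ge> 1" "a (real m) x \<le> real m * (g x + e)" using exists_good_time e by blast
    then show False using x[of m] by (auto simp: A_def)
  qed
  ultimately have "(\<lambda>N. measure \<mu> (A N)) \<longlonglongrightarrow> 0"
    using finite_Lim_measure_decseq[of A] A_meas by auto
  \<comment> \<open>On a bad point a block of length 1 is used. Its cost is at most C, while g is at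
    least -2 C; the surcharge 3 C on bad points covers the difference.\<close>
  moreover define D where "D = 3 * C"
  have "0 < e / (D + 1)" using e C0 by (simp add: D_def)
  ultimately obtain N where N: "measure \<mu> (A N) < e / (D + 1)"
    using order_tendstoD(2)[of _ 0 sequentially "e / (D + 1)"] by (metis eventually_sequentially order_refl)
  define f where "f x = g x + e + D * indicator (A N) x" for x
  have f_ge: "g x + e \<le> f x" for x using C0 by (simp add: f_def D_def)
  define N' where "N' = max 1 N"
  \<comment> \<open>Pays for an incomplete last block: with n + 1 \<le> N' the value of a is at most
    C (n + 1), and the sum of f over n steps is at least -2 C n.\<close>
  define K where "K = real N' * (4 * C)"
  have piece: "\<exists>m. 1 \<le> m \<and> m \<le> N' \<and> a (real m) x \<le> (\<Sum>j<m. f (\<phi> (real j) x))" if x: "x \<in> \<Gamma>" for x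
  proof (cases "x \<in> A N")
    case True
    have "a 1 x \<le> C" using bnd[OF x, of 1] by simp
    also have "\<dots> \<le> f x" using True g_bd[OF x] e by (simp add: f_def D_def)
    finally show ?thesis using flow_0[OF x] by (intro exI[of _ 1]) (auto simp: N'_def)
  next
    case False
    then obtain m where m: "1 \<le> m" "m \<le> N" "a (real m) x \<le> real m * (g x + e)"
      using x by (auto simp: A_def space_\<mu>)
    have "real m * (g x + e) = (\<Sum>j<m. g x + e)" by simp
    also have "\<dots> \<le> (\<Sum>j<m. f (\<phi> (real j) x))"
      by (intro sum_mono order_trans[OF add_right_mono f_ge] g_le_along_orbit x)
    finally show ?thesis using m by (intro exI[of _ m]) (auto simp: N'_def)
  qed
  \<comment> \<open>The orbit is cut greedily into blocks supplied by \<open>piece\<close>; the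
    induction removes the first block.\<close>
  have main: "a (real n) x \<le> (\<Sum>j<n. f (\<phi> (real j) x)) + K" if "x \<in> \<Gamma>" for n x
    using that
  proof (induction n arbitrary: x rule: less_induct)
    case (less n)
    obtain m where m: "1 \<le> m" "m \<le> N'" "a (real m) x \<le> (\<Sum>j<m. f (\<phi> (real j) x))"
      using piece[OF less.prems] by auto
    show ?case
    proof (cases "m \<le> n")
      case True
      then obtain q where q: "n = m + q" using le_Suc_ex by blast
      have "a (real (m + q)) x \<le> a (real m) x + a (real q) (\<phi> (real m) x)"
        using sub[OF less.prems, of "real m" "real q"] by simp
      moreover have "a (real q) (\<phi> (real m) x) \<le> (\<Sum>j<q. f (\<phi> (real j) (\<phi> (real m) x))) + K"
        using m q by (intro less.IH flow_in less.prems) auto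
      moreover have "(\<Sum>j<q. f (\<phi> (real j) (\<phi> (real m) x))) = (\<Sum>j<q. f (\<phi> (real (m + j)) x))"
        using flow_add[OF less.prems] by (intro sum.cong) (simp_all add: add.commute)
      moreover have split: "(\<Sum>j<m + q. h j) = (\<Sum>j<m. h j) + (\<Sum>j<q. h (m + j))" for h :: "nat \<Rightarrow> real"
        by (induction q) auto
      ultimately show ?thesis using m(3) unfolding q split by simp
    next
      case False
      have "a (real n) x \<le> C * (real n + 1)" using growth[OF less.prems, of "real n"] by simp
      moreover have "(\<Sum>j<n. - (2 * C)) \<le> (\<Sum>j<n. f (\<phi> (real j) x))"
        using f_ge g_bd[OF flow_in[OF less.prems]] e by (intro sum_mono) (smt (verit))
      moreover have "C * (real n + 1) + 2 * C * real n \<le> K"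
      proof -
        have "real n + 1 \<le> real N'" using False m by linarith
        then have *: "(4 * C) * (real n + 1) \<le> (4 * C) * real N'" using C0 by (intro mult_left_mono) auto
        have "C * (real n + 1) + 2 * C * real n \<le> (4 * C) * (real n + 1)"
          using C0 mult_nonneg_nonneg[OF C0 of_nat_0_le_iff[of n]] by (simp add: algebra_simps)
        also note *
        finally show ?thesis by (simp add: K_def mult.commute)
      qed
      ultimately show ?thesis by (simp add: algebra_simps)
    qed
  qed
  have flow_meas: "\<phi> t \<in> measurable \<mu> \<mu>" for t
    using measurable_continuous_restrict[OF flow_cont] flow_in
    by (auto cong: measurable_cong_sets simp: \<mu>_facts(1))
  have distr: "distr \<mu> \<mu> (\<phi> t) = \<mu>" for t
    by (rule measure_eqI) (auto simp: emeasure_distr[OF flow_meas] space_\<mu> \<mu>[unfolded invariant_probability_def])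
  have f_meas: "f \<in> borel_measurable \<mu>" unfolding f_def using g_meas A_meas by measurable
  have f_int: "integrable \<mu> f"
    unfolding f_def using g_int A_meas
    by (intro Bochner_Integration.integrable_add) (auto simp: less_top[symmetric])
  have f_shift: "integrable \<mu> (\<lambda>x. f (\<phi> t x))" "(\<integral>x. f (\<phi> t x) \<partial>\<mu>) = (\<integral>x. f x \<partial>\<mu>)" for t
    using integrable_distr_eq[OF flow_meas f_meas, of t] integral_distr[OF flow_meas f_meas, of t] f_int
    by (simp_all add: distr)
  have int_f: "(\<integral>x. f x \<partial>\<mu>) \<le> (\<integral>x. g x \<partial>\<mu>) + 2 * e"
  proof -
    have "(\<integral>x. f x \<partial>\<mu>) = (\<integral>x. g x \<partial>\<mu>) + e + D * measure \<mu> (A N)"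
      unfolding f_def using g_int A_meas
      by (subst Bochner_Integration.integral_add)
        (auto simp: less_top[symmetric] space_\<mu> measure_\<Gamma> A_sub intro!: Bochner_Integration.integrable_add)
    moreover have "D * measure \<mu> (A N) \<le> D * (e / (D + 1))"
      using N C0 by (intro mult_left_mono) (auto simp: D_def)
    moreover have "D * (e / (D + 1)) \<le> e" using e C0 by (simp add: D_def field_simps)
    ultimately show ?thesis by linarith
  qed
  \<comment> \<open>The integral of f exceeds that of g by at most 2 e, one e built into f and one
    from the bad points. From N0 on, K is at most n e, which is the third e.\<close>
  obtain N0 :: nat where N0: "K / e < N0" using reals_Archimedean2 by blast
  show "\<exists>N. \<forall>n\<ge>N. (\<integral>x. a (real n) x \<partial>\<mu>) \<le> real n * ((\<integral>x. g x \<partial>\<mu>) + 3 * e)"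
  proof (intro exI allI impI)
    fix n assume n: "N0 \<le> n"
    have a_int: "integrable \<mu> (a (real n))"
      by (rule integrable_bounded[OF \<mu> a_meas growth]) auto
    have "(\<integral>x. a (real n) x \<partial>\<mu>) \<le> (\<integral>x. (\<Sum>j<n. f (\<phi> (real j) x)) + K \<partial>\<mu>)"
      using main f_shift(1)
      by (intro integral_mono a_int Bochner_Integration.integrable_add Bochner_Integration.integrable_sum) (auto simp: space_\<mu>)
    also have "\<dots> = real n * (\<integral>x. f x \<partial>\<mu>) + K"
      using f_shift
      by (subst Bochner_Integration.integral_add) (auto simp: Bochner_Integration.integral_sum space_\<mu> measure_\<Gamma> intro!: Bochner_Integration.integrable_sum)
    also have "\<dots> \<le> real n * ((\<integral>x. g x \<partial>\<mu>) + 2 * e) + real n * e"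
    proof (intro add_mono mult_left_mono int_f)
      have "K / e \<le> real n" using N0 n by linarith
      then show "K \<le> real n * e" using e by (simp add: field_simps)
    qed simp
    finally show "(\<integral>x. a (real n) x \<partial>\<mu>) \<le> real n * ((\<integral>x. g x \<partial>\<mu>) + 3 * e)"
      by (simp add: algebra_simps)
  qed
qed

end

text \<open>If no iterate of the cocycle \<open>a + b\<close> were negative everywhere, orbit segments with
  nonnegative sums would produce an invariant measure contradicting the hypothesis.\<close>

lemma two_cocycles_negative_time:
  assumes a: "subadditive_cocycle \<Gamma> \<phi> a Ca" and b: "subadditive_cocycle \<Gamma> \<phi> b Cb"
    and ab: "subadditive_cocycle \<Gamma> \<phi> (\<lambda>t x. a t x + b t x) C"
    and Y: "total_probability \<phi> \<Gamma> Y" and "\<eta> < 0"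
    and lim: "\<And>x. x \<in> Y \<Longrightarrow> Liminf at_top (\<lambda>t. ereal (1 / t * a t x)) + Liminf at_top (\<lambda>t. ereal (1 / t * b t x)) < ereal \<eta>"
  shows "\<exists>n\<ge>1. \<forall>x\<in>\<Gamma>. a (real n) x + b (real n) x < 0"
proof (rule ccontr)
  interpret a: subadditive_cocycle \<Gamma> \<phi> a Ca by (rule a)
  interpret b: subadditive_cocycle \<Gamma> \<phi> b Cb by (rule b)
  interpret c: subadditive_cocycle \<Gamma> \<phi> "\<lambda>t x. a t x + b t x" C by (rule ab)
  assume "\<not> ?thesis"
  then have "\<exists>x\<in>\<Gamma>. 0 \<le> a (real (Suc n)) x + b (real (Suc n)) x" for n
    by (metis One_nat_def Suc_le_mono le0 not_le)
  then obtain x where x: "\<And>n. x n \<in> \<Gamma>" "\<And>n. 0 \<le> a (real (Suc n)) (x n) + b (real (Suc n)) (x n)" by metis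
  obtain \<mu> where \<mu>: "a.invariant_probability \<mu>"
    and lower: "\<forall>h c. continuous_on \<Gamma> h \<longrightarrow>
      (\<forall>e>0. \<forall>\<^sub>F n in sequentially. c - e \<le> a.avg (Suc n) (x n) h) \<longrightarrow> c \<le> (\<integral>y. h y \<partial>\<mu>)"
    using a.invariant_probability_exists[where x = x, OF x(1)] by (elim exE conjE) (rule that)
  have C0: "0 \<le> C" by (rule c.C_nonneg[OF x(1)])
  have nonneg: "0 \<le> (\<integral>y. a (real m) y + b (real m) y \<partial>\<mu>)" if m: "1 \<le> m" for m
  proof (rule lower[rule_format])
    show "continuous_on \<Gamma> (\<lambda>y. a (real m) y + b (real m) y)" by (intro c.cont) simp
    fix e :: real assume e: "0 < e"
    let ?K = "5 * C * (real m + 1) * real m"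
    obtain N :: nat where N: "?K / e < N" using reals_Archimedean2 by blast
    show "\<forall>\<^sub>F n in sequentially. 0 - e \<le> a.avg (Suc n) (x n) (\<lambda>y. a (real m) y + b (real m) y)"
    proof (rule eventually_sequentiallyI)
      fix n assume n: "max N m \<le> n"
      have "- ?K \<le> real (Suc n) * a.avg (Suc n) (x n) (\<lambda>y. a (real m) y + b (real m) y)"
        by (rule c.avg_cocycle_ge) (use x m n in auto)
      moreover have "?K \<le> real (Suc n) * e"
      proof -
        have "?K / e \<le> real (Suc n)" using N n by simp
        then show ?thesis using e by (simp only: pos_divide_le_eq)
      qed
      ultimately have "real (Suc n) * (- e) \<le> real (Suc n) * a.avg (Suc n) (x n) (\<lambda>y. a (real m) y + b (real m) y)"
        by simp
      then show "0 - e \<le> a.avg (Suc n) (x n) (\<lambda>y. a (real m) y + b (real m) y)"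
        by (subst (asm) mult_le_cancel_left_pos) auto
    qed
  qed
  note \<mu>_facts = a.invariant_probabilityD[OF \<mu>]
  then have space_\<mu>: "space \<mu> = \<Gamma>" by blast
  interpret finite_measure \<mu> by (rule \<mu>_facts(3))
  have Y1: "emeasure \<mu> Y = 1" and YG: "Y \<subseteq> \<Gamma>"
    using Y \<mu> unfolding total_probability_def a.invariant_probability_def by blast+
  \<comment> \<open>A set that is not measurable has \<open>emeasure\<close> 0 by convention, so
    mass 1 forces measurability.\<close>
  then have Y_sets: "Y \<in> sets \<mu>" using emeasure_notin_sets[of Y \<mu>] by force
  have "emeasure \<mu> (space \<mu> - Y) = 0"
    using emeasure_compl[OF Y_sets] Y1 \<mu> by (simp add: space_\<mu> a.invariant_probability_def)
  then have AE_Y: "AE x in \<mu>. x \<in> Y"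
    using Y_sets by (intro AE_I[of _ _ "space \<mu> - Y"]) auto
  have g_le: "a.g x + b.g x \<le> \<eta>" if "x \<in> Y" for x
  proof -
    have xG: "x \<in> \<Gamma>" using that YG by auto
    have "ereal (a.g x) + ereal (b.g x) \<le> Liminf at_top (\<lambda>t. ereal (1 / t * a t x)) + Liminf at_top (\<lambda>t. ereal (1 / t * b t x))"
      by (intro add_mono a.g_le_Liminf b.g_le_Liminf xG)
    also have "\<dots> < ereal \<eta>" by (rule lim[OF that])
    finally show ?thesis by simp
  qed
  \<comment> \<open>The two cocycles together contribute an error 6 e, which is half of the
    gap.\<close>
  define e where "e = - \<eta> / 12"
  have e: "0 < e" using \<open>\<eta> < 0\<close> by (simp add: e_def)
  note ga = a.katznelson_weiss[OF \<mu> e] and gb = b.katznelson_weiss[OF \<mu> e]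
  have "(\<integral>x. a.g x \<partial>\<mu>) + (\<integral>x. b.g x \<partial>\<mu>) = (\<integral>x. a.g x + b.g x \<partial>\<mu>)"
    using ga(1) gb(1) by simp
  also have "\<dots> \<le> (\<integral>x. \<eta> \<partial>\<mu>)"
    using ga(1) gb(1) AE_Y g_le by (intro integral_mono_AE) auto
  also have "\<dots> = \<eta>" by (simp add: \<mu>_facts)
  finally have int_g: "(\<integral>x. a.g x \<partial>\<mu>) + (\<integral>x. b.g x \<partial>\<mu>) \<le> \<eta>" .
  obtain Na Nb where Na: "\<And>n. Na \<le> n \<Longrightarrow> (\<integral>x. a (real n) x \<partial>\<mu>) \<le> real n * ((\<integral>x. a.g x \<partial>\<mu>) + 3 * e)"
    and Nb: "\<And>n. Nb \<le> n \<Longrightarrow> (\<integral>x. b (real n) x \<partial>\<mu>) \<le> real n * ((\<integral>x. b.g x \<partial>\<mu>) + 3 * e)"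
    using ga(2) gb(2) by blast
  define n where "n = max 1 (max Na Nb)"
  have n: "1 \<le> n" "Na \<le> n" "Nb \<le> n" by (auto simp: n_def)
  have int_a: "integrable \<mu> (a (real n))"
    by (rule a.integrable_bounded[OF \<mu> a.measurable_continuous[OF \<mu> a.cont] a.growth]) auto
  have int_b: "integrable \<mu> (b (real n))"
    by (rule a.integrable_bounded[OF \<mu> a.measurable_continuous[OF \<mu> b.cont] b.growth]) auto
  have "(\<integral>y. a (real n) y + b (real n) y \<partial>\<mu>) = (\<integral>y. a (real n) y \<partial>\<mu>) + (\<integral>y. b (real n) y \<partial>\<mu>)"
    by (intro Bochner_Integration.integral_add int_a int_b)
  also have "\<dots> \<le> real n * ((\<integral>x. a.g x \<partial>\<mu>) + (\<integral>x. b.g x \<partial>\<mu>) + 6 * e)"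
    using Na[OF n(2)] Nb[OF n(3)] by (simp add: algebra_simps)
  also have "\<dots> \<le> real n * (\<eta> + 6 * e)"
    using int_g by (intro mult_left_mono) auto
  also have "\<dots> < 0" using n \<open>\<eta> < 0\<close> by (intro mult_pos_neg) (auto simp: e_def)
  finally show False using nonneg[OF n(1)] by simp
qed

text \<open>By continuity and compactness the value at time n is at most -\<delta> everywhere.
  Writing t as q n + r, each of the q blocks gains \<delta>, and the remainder is bounded by the
  linear growth estimate.\<close>

lemma (in subadditive_cocycle) uniform_decay:
  assumes "1 \<le> n" "\<And>x. x \<in> \<Gamma> \<Longrightarrow> a (real n) x < 0"
  shows "\<exists>K \<kappa>. 0 < \<kappa> \<and> (\<forall>x\<in>\<Gamma>. \<forall>t\<ge>0. a t x \<le> K - \<kappa> * t)"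
proof (cases "\<Gamma> = {}")
  case False
  obtain x0 where x0: "x0 \<in> \<Gamma>" "\<And>x. x \<in> \<Gamma> \<Longrightarrow> a (real n) x \<le> a (real n) x0"
    using continuous_attains_sup[OF compact False cont[of "real n"]] by auto
  define \<delta> where "\<delta> = - a (real n) x0"
  have \<delta>: "0 < \<delta>" "\<And>x. x \<in> \<Gamma> \<Longrightarrow> a (real n) x \<le> - \<delta>" using x0 assms(2) by (auto simp: \<delta>_def)
  have C0: "0 \<le> C" by (rule C_nonneg[OF x0(1)])
  have iter: "a (real q * real n + r) x \<le> - \<delta> * real q + C * (real n + 1)" if "x \<in> \<Gamma>" "0 \<le> r" "r \<le> real n" for q r x
    using that(1)
  proof (induction q arbitrary: x)
    case 0
    have "a r x \<le> C * (r + 1)" using growth[OF 0, of r] that by simp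
    also have "\<dots> \<le> C * (real n + 1)" using C0 that by (intro mult_left_mono) auto
    finally show ?case by simp
  next
    case (Suc q)
    have "a (real n + (real q * real n + r)) x \<le> a (real n) x + a (real q * real n + r) (\<phi> (real n) x)"
      using that by (intro sub Suc.prems) auto
    also have "\<dots> \<le> - \<delta> + (- \<delta> * real q + C * (real n + 1))"
      by (intro add_mono \<delta> Suc.prems Suc.IH flow_in)
    finally show ?case by (simp add: algebra_simps)
  qed
  have n0: "0 < real n" using assms(1) by simp
  show ?thesis
  proof (intro exI conjI ballI allI impI)
    show "0 < \<delta> / real n" using \<delta> n0 by simp
    fix x t assume x: "x \<in> \<Gamma>" and t: "(0::real) \<le> t"
    define q where "q = nat \<lfloor>t / real n\<rfloor>"
    have q: "real q \<le> t / real n" "t / real n \<le> real q + 1"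
      using t n0 unfolding q_def by (auto simp: le_nat_floor)
    then have r: "0 \<le> t - real q * real n" "t - real q * real n \<le> real n"
      using n0 by (auto simp: field_simps)
    have "a t x \<le> - \<delta> * real q + C * (real n + 1)" using iter[OF x r, of q] by simp
    also have "- \<delta> * real q \<le> - \<delta> * (t / real n - 1)" using \<delta> q by simp
    finally show "a t x \<le> (\<delta> + C * (real n + 1)) - \<delta> / real n * t" by (simp add: algebra_simps)
  qed
qed (auto intro: exI[of _ "1::real"])

section \<open>Differentiable dependence on initial values\<close>

text \<open>At a time s where the norm is maximal, the mean value inequality between r and s bounds
  the maximum by the value at r plus half of the maximum plus \<open>\<tau> * \<delta>\<close>. As r
  is arbitrary, the estimate also works backwards in time.\<close>

lemma short_time_gronwall:
  fixes w w' :: "real \<Rightarrow> 'a::real_normed_vector"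
  assumes d: "\<And>t. t \<in> {0..\<tau>} \<Longrightarrow> (w has_vector_derivative w' t) (at t within {0..\<tau>})"
    and b: "\<And>t. t \<in> {0..\<tau>} \<Longrightarrow> norm (w' t) \<le> L * norm (w t) + \<delta>"
    and L: "0 \<le> L" "0 \<le> \<delta>" "L * \<tau> \<le> 1 / 2" and t: "t \<in> {0..\<tau>}" and r: "r \<in> {0..\<tau>}"
  shows "norm (w t) \<le> 2 * norm (w r) + 2 * \<tau> * \<delta>"
proof -
  have ne: "{0..\<tau>} \<noteq> {}" and \<tau>: "0 \<le> \<tau>" using t by auto
  have "continuous_on {0..\<tau>} w"
    using d by (meson continuous_on_eq_continuous_within has_vector_derivative_continuous)
  then have "continuous_on {0..\<tau>} (\<lambda>t. norm (w t))" by (rule continuous_on_norm)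
  then obtain s where s: "s \<in> {0..\<tau>}" "\<And>t. t \<in> {0..\<tau>} \<Longrightarrow> norm (w t) \<le> norm (w s)"
    using continuous_attains_sup[OF compact_Icc ne] by blast
  define B where "B = L * norm (w s) + \<delta>"
  have "norm (w s - w r) \<le> B * norm (s - r)"
  proof (rule differentiable_bound[of "{0..\<tau>}" w "\<lambda>t h. h *\<^sub>R w' t"])
    fix t assume t: "t \<in> {0..\<tau>}"
    show "(w has_derivative (\<lambda>h. h *\<^sub>R w' t)) (at t within {0..\<tau>})"
      using d[OF t] by (simp add: has_vector_derivative_def)
    have "norm (w' t) \<le> B"
      using b[OF t] s(2)[OF t] L by (auto simp: B_def intro!: order_trans[OF b[OF t]] mult_left_mono)
    then show "onorm (\<lambda>h. h *\<^sub>R w' t) \<le> B"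
      by (intro onorm_le) (simp add: mult.commute[of B] mult_left_mono)
  qed (use s r in auto)
  also have "\<dots> \<le> B * \<tau>" using s r L by (intro mult_left_mono) (auto simp: B_def abs_le_iff)
  also have "\<dots> = L * \<tau> * norm (w s) + \<tau> * \<delta>" by (simp add: B_def algebra_simps)
  also have "\<dots> \<le> 1 / 2 * norm (w s) + \<tau> * \<delta>" using L by (intro add_right_mono mult_right_mono) auto
  finally have "norm (w s) \<le> 2 * norm (w r) + 2 * \<tau> * \<delta>"
    using norm_triangle_ineq2[of "w s" "w r"] by simp
  then show ?thesis using s(2)[OF t] by simp
qed

text \<open>Both points vary near y. The notion is met by difference estimates alone, and it forces
  all derivatives that exist near y to be close to the one at y, which is how continuity of DX is
  obtained.\<close>

definition strict_derivative :: "('a::real_normed_vector \<Rightarrow> 'b::real_normed_vector) \<Rightarrow> ('a \<Rightarrow> 'b) \<Rightarrow> 'a \<Rightarrow> bool" where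
  "strict_derivative f f' y \<longleftrightarrow> linear f' \<and>
     (\<forall>\<epsilon>>0. \<exists>\<delta>>0. \<forall>a\<in>ball y \<delta>. \<forall>b\<in>ball y \<delta>. norm (f b - f a - f' (b - a)) \<le> \<epsilon> * norm (b - a))"

lemma strict_derivative_imp_has_derivative:
  fixes f :: "'a::euclidean_space \<Rightarrow> 'b::real_normed_vector"
  assumes "strict_derivative f f' y"
  shows "(f has_derivative f') (at y)"
  unfolding has_derivative_at_alt
proof safe
  show "bounded_linear f'" using assms by (simp add: strict_derivative_def linear_conv_bounded_linear)
  fix e :: real assume "0 < e"
  then obtain \<delta> where "\<delta> > 0" "\<And>a b. a \<in> ball y \<delta> \<Longrightarrow> b \<in> ball y \<delta> \<Longrightarrow> norm (f b - f a - f' (b - a)) \<le> e * norm (b - a)"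
    using assms unfolding strict_derivative_def by meson
  then show "\<exists>d>0. \<forall>ya. norm (ya - y) < d \<longrightarrow> norm (f ya - f y - f' (ya - y)) \<le> e * norm (ya - y)"
    by (intro exI[of _ \<delta>]) (simp add: dist_norm norm_minus_commute[of y])
qed

definition difference_quotient :: "('a::real_normed_vector \<Rightarrow> 'b::real_normed_vector) \<Rightarrow> 'a \<Rightarrow> real \<Rightarrow> 'a \<Rightarrow> 'b" where
  "difference_quotient f a h v = (1 / h) *\<^sub>R (f (a + h *\<^sub>R v) - f a)"

lemma eventually_in_ball:
  fixes a :: "'a::real_normed_vector"
  assumes "a \<in> ball y \<delta>"
  shows "\<forall>\<^sub>F n in sequentially. a + (1 / real (Suc n)) *\<^sub>R v \<in> ball y \<delta>"
proof -
  have "(\<lambda>n. a + (1 / real (Suc n)) *\<^sub>R v) \<longlonglongrightarrow> a + 0 *\<^sub>R v"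
    by (intro tendsto_intros LIMSEQ_Suc[OF lim_1_over_n])
  then show ?thesis using assms by (intro topological_tendstoD[of _ a]) auto
qed

lemma norm_difference_quotient_diff:
  assumes "linear D" "norm (f (a + h *\<^sub>R v) - f a - D (h *\<^sub>R v)) \<le> e * norm (h *\<^sub>R v)" "0 < h"
  shows "norm (difference_quotient f a h v - D v) \<le> e * norm v"
proof -
  have "f (a + h *\<^sub>R v) - f a - D (h *\<^sub>R v) = h *\<^sub>R (difference_quotient f a h v - D v)"
    using assms(3) by (simp add: difference_quotient_def linear_scale[OF assms(1)] scaleR_diff_right)
  with assms(2,3) have "h * norm (difference_quotient f a h v - D v) \<le> h * (e * norm v)" by (simp add: mult_ac)
  then show ?thesis using assms(3) by simp
qed

lemma difference_quotient_tendsto: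
  assumes "(f has_derivative D) (at z)"
  shows "(\<lambda>n. difference_quotient f z (1 / real (Suc n)) v) \<longlonglongrightarrow> D v"
proof (rule tendstoI)
  fix e :: real assume "0 < e"
  define e' where "e' = e / (norm v + 1)"
  have e': "0 < e'" "e' * norm v < e" using \<open>0 < e\<close> by (auto simp: e'_def pos_divide_less_eq distrib_left add_nonneg_pos)
  obtain d where d: "0 < d" "\<And>x. norm (x - z) < d \<Longrightarrow> norm (f x - f z - D (x - z)) \<le> e' * norm (x - z)"
    using assms e'(1) unfolding has_derivative_at_alt by blast
  have "z \<in> ball z d" using d(1) by simp
  from eventually_in_ball[OF this, of v]
  show "\<forall>\<^sub>F n in sequentially. dist (difference_quotient f z (1 / real (Suc n)) v) (D v) < e"
  proof eventually_elim
    case (elim n)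
    have "norm (difference_quotient f z (1 / real (Suc n)) v - D v) \<le> e' * norm v"
      using d(2)[of "z + (1 / real (Suc n)) *\<^sub>R v"] elim
      by (intro norm_difference_quotient_diff has_derivative_linear[OF assms]) (auto simp: dist_norm)
    then show ?case using e'(2) by (simp add: dist_norm)
  qed
qed

lemma strict_derivative_close:
  fixes f :: "'a::euclidean_space \<Rightarrow> 'b::real_normed_vector"
  assumes "strict_derivative f f' y" "0 < \<epsilon>"
  shows "\<exists>\<delta>>0. \<forall>z\<in>ball y \<delta>. \<forall>D. (f has_derivative D) (at z) \<longrightarrow> (\<forall>v. norm (D v - f' v) \<le> \<epsilon> * norm v)"
proof -
  obtain \<delta> where \<delta>: "\<delta> > 0" "\<And>a b. a \<in> ball y \<delta> \<Longrightarrow> b \<in> ball y \<delta> \<Longrightarrow> norm (f b - f a - f' (b - a)) \<le> \<epsilon> * norm (b - a)"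
    using assms unfolding strict_derivative_def by meson
  have lf: "linear f'" using assms by (simp add: strict_derivative_def)
  have "norm (D v - f' v) \<le> \<epsilon> * norm v" if z: "z \<in> ball y \<delta>" and D: "(f has_derivative D) (at z)" for z D v
  proof (rule tendsto_upperbound[OF tendsto_norm[OF tendsto_diff[OF difference_quotient_tendsto[OF D] tendsto_const]]])
    show "\<forall>\<^sub>F n in sequentially. norm (difference_quotient f z (1 / real (Suc n)) v - f' v) \<le> \<epsilon> * norm v"
      using eventually_in_ball[OF z, of v]
    proof eventually_elim
      case (elim n)
      from \<delta>(2)[OF z elim] show ?case by (intro norm_difference_quotient_diff lf) auto
    qed
  qed simp
  then show ?thesis using \<delta>(1) by blast
qed

text \<open>A map whose difference quotients almost preserve linear relations between the directions is
  strictly differentiable. For flow maps the hypothesis is a direct consequence of Gronwall's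
  inequality, which avoids solving the variational equation.\<close>

lemma strict_derivativeI:
  fixes f :: "'a::euclidean_space \<Rightarrow> 'b::euclidean_space"
  assumes "\<And>\<epsilon>. 0 < \<epsilon> \<Longrightarrow> \<exists>\<delta>>0. \<forall>c h a v. (\<forall>i<3::nat. h i \<noteq> 0 \<and> a i \<in> ball y \<delta> \<and> a i + h i *\<^sub>R v i \<in> ball y \<delta>) \<longrightarrow>
     norm (\<Sum>i<3. c i *\<^sub>R difference_quotient f (a i) (h i) (v i)) \<le> 2 * norm (\<Sum>i<3. c i *\<^sub>R v i) + \<epsilon> * (\<Sum>i<3. \<bar>c i\<bar> * norm (v i))"
  shows "\<exists>f'. strict_derivative f f' y \<and> (\<forall>v. norm (f' v) \<le> 2 * norm v)"
proof -
  let ?Q = "difference_quotient f"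
  define q where "q n = ?Q y (1 / real (Suc n))" for n
  \<comment> \<open>Three quotients, of which only the first has a base point other than y.
    Coefficients 1, -1, 0 give the Cauchy property, three directions at y give linearity, and a free
    base point against the limit gives strictness.\<close>
  define ok where "ok \<epsilon> \<delta> \<longleftrightarrow> (\<forall>c1 c2 c3 h1 h2 h3 a v1 v2 v3. h1 \<noteq> 0 \<and> h2 \<noteq> 0 \<and> h3 \<noteq> 0 \<and>
      {a, a + h1 *\<^sub>R v1, y + h2 *\<^sub>R v2, y + h3 *\<^sub>R v3} \<subseteq> ball y \<delta> \<longrightarrow>
      norm (c1 *\<^sub>R ?Q a h1 v1 + c2 *\<^sub>R ?Q y h2 v2 + c3 *\<^sub>R ?Q y h3 v3)
      \<le> 2 * norm (c1 *\<^sub>R v1 + c2 *\<^sub>R v2 + c3 *\<^sub>R v3) + \<epsilon> * (\<bar>c1\<bar> * norm v1 + \<bar>c2\<bar> * norm v2 + \<bar>c3\<bar> * norm v3))" for \<epsilon> \<delta>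
  note okD = ok_def[THEN iffD1, rule_format]
  have est: "\<exists>\<delta>>0. ok \<epsilon> \<delta>" if \<epsilon>: "0 < \<epsilon>" for \<epsilon>
  proof -
    obtain \<delta> where \<delta>: "\<delta> > 0" and d: "\<forall>c h a v. (\<forall>i<3::nat. h i \<noteq> 0 \<and> a i \<in> ball y \<delta> \<and> a i + h i *\<^sub>R v i \<in> ball y \<delta>) \<longrightarrow>
       norm (\<Sum>i<3. c i *\<^sub>R ?Q (a i) (h i) (v i)) \<le> 2 * norm (\<Sum>i<3. c i *\<^sub>R v i) + \<epsilon> * (\<Sum>i<3. \<bar>c i\<bar> * norm (v i))"
      using assms[OF \<epsilon>] by (elim exE conjE) (rule that)
    have "ok \<epsilon> \<delta>" unfolding ok_def
    proof (intro allI impI, goal_cases)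
      case (1 c1 c2 c3 h1 h2 h3 a v1 v2 v3)
      then show ?case
        using d[THEN spec[of _ "(!) [c1, c2, c3]"], THEN spec[of _ "(!) [h1, h2, h3]"], THEN spec[of _ "(!) [a, y, y]"],
            THEN spec[of _ "(!) [v1, v2, v3]"]] \<delta>
        by (simp add: numeral_3_eq_3 less_Suc_eq all_conj_distrib imp_disjL)
    qed
    with \<delta> show ?thesis by blast
  qed
  have near: "\<forall>\<^sub>F n in sequentially. y + (1 / real (Suc n)) *\<^sub>R v \<in> ball y \<delta>" if "\<delta> > 0" for \<delta> v
    using that by (intro eventually_in_ball) simp
  have "\<exists>T. (\<lambda>n. q n v) \<longlonglongrightarrow> T" for v
  proof (rule Cauchy_convergent[unfolded convergent_def], rule metric_CauchyI)
    fix e :: real assume e: "0 < e"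
    define \<epsilon> where "\<epsilon> = e / (2 * norm v + 1)"
    have p: "0 < 2 * norm v + 1" using norm_ge_zero[of v] by linarith
    have \<epsilon>: "\<epsilon> > 0" "\<epsilon> * (2 * norm v) < e"
      using e p by (simp_all add: \<epsilon>_def pos_divide_less_eq distrib_left)
    obtain \<delta> where \<delta>: "\<delta> > 0" and ok: "ok \<epsilon> \<delta>" using est[OF \<epsilon>(1)] by blast
    obtain N where N: "\<And>n. N \<le> n \<Longrightarrow> y + (1 / real (Suc n)) *\<^sub>R v \<in> ball y \<delta>"
      using near[OF \<delta>, of v] unfolding eventually_sequentially by blast
    have "dist (q m v) (q n v) < e" if "N \<le> m" "N \<le> n" for m n
    proof -
      have "norm (1 *\<^sub>R q m v + (- 1) *\<^sub>R q n v + 0 *\<^sub>R q n v) \<le> 2 * norm (1 *\<^sub>R v + (- 1) *\<^sub>R v + 0 *\<^sub>R v) + \<epsilon> * (\<bar>1\<bar> * norm v + \<bar>- 1\<bar> * norm v + \<bar>0\<bar> * norm v)"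
        unfolding q_def using N[OF that(1)] N[OF that(2)] \<delta> by (intro okD[OF ok]) simp
      then show ?thesis using \<epsilon>(2) by (simp add: dist_norm)
    qed
    then show "\<exists>M. \<forall>m\<ge>M. \<forall>n\<ge>M. dist (q m v) (q n v) < e" by blast
  qed
  then obtain T where T: "\<And>v. (\<lambda>n. q n v) \<longlonglongrightarrow> T v" by metis
  \<comment> \<open>The second and third quotient are replaced by their limits while the first is
    kept.\<close>
  have limit: "norm (c1 *\<^sub>R ?Q a h v1 + c2 *\<^sub>R T v2 + c3 *\<^sub>R T v3)
      \<le> 2 * norm (c1 *\<^sub>R v1 + c2 *\<^sub>R v2 + c3 *\<^sub>R v3) + \<epsilon> * (\<bar>c1\<bar> * norm v1 + \<bar>c2\<bar> * norm v2 + \<bar>c3\<bar> * norm v3)"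
    if ok: "ok \<epsilon> \<delta>" and \<delta>: "0 < \<delta>" and h: "h \<noteq> 0" "a \<in> ball y \<delta>" "a + h *\<^sub>R v1 \<in> ball y \<delta>" for c1 c2 c3 \<epsilon> \<delta> h a v1 v2 v3
  proof (rule tendsto_upperbound)
    show "(\<lambda>n. norm (c1 *\<^sub>R ?Q a h v1 + c2 *\<^sub>R q n v2 + c3 *\<^sub>R q n v3)) \<longlonglongrightarrow> norm (c1 *\<^sub>R ?Q a h v1 + c2 *\<^sub>R T v2 + c3 *\<^sub>R T v3)"
      by (intro tendsto_intros T)
    show "\<forall>\<^sub>F n in sequentially. norm (c1 *\<^sub>R ?Q a h v1 + c2 *\<^sub>R q n v2 + c3 *\<^sub>R q n v3)
      \<le> 2 * norm (c1 *\<^sub>R v1 + c2 *\<^sub>R v2 + c3 *\<^sub>R v3) + \<epsilon> * (\<bar>c1\<bar> * norm v1 + \<bar>c2\<bar> * norm v2 + \<bar>c3\<bar> * norm v3)"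
      using near[OF \<delta>, of v2] near[OF \<delta>, of v3] unfolding q_def by eventually_elim (use h in \<open>intro okD[OF ok]; simp\<close>)
  qed simp
  have small: "norm z \<le> B" if "\<And>\<epsilon>. 0 < \<epsilon> \<Longrightarrow> norm z \<le> B + \<epsilon> * K" "0 \<le> K" for z :: 'b and B K
  proof (rule field_le_epsilon)
    fix e :: real assume "0 < e"
    then have "norm z \<le> B + e / (K + 1) * K" using that(2) by (intro that(1)) (simp add: add_nonneg_pos)
    also have "e / (K + 1) * K \<le> e" using \<open>0 < e\<close> that(2) by (simp add: divide_le_eq add_nonneg_pos distrib_left)
    finally show "norm z \<le> B + e" by simp
  qed
  have bound: "norm (T v) \<le> 2 * norm v" for v
  proof (rule small[of _ _ "norm v"])
    fix \<epsilon> :: real assume "0 < \<epsilon>"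
    then obtain \<delta> where "\<delta> > 0" "ok \<epsilon> \<delta>" using est by blast
    then show "norm (T v) \<le> 2 * norm v + \<epsilon> * norm v" using limit[of \<epsilon> \<delta> 1 y 0 0 1 v 0 0] by simp
  qed simp
  have lin: "T (c *\<^sub>R u + v) = c *\<^sub>R T u + T v" for c u v
  proof -
    let ?w = "c *\<^sub>R u + v"
    have "norm (T ?w - c *\<^sub>R T u - T v) \<le> 0"
    proof (rule small[of _ _ "norm ?w + \<bar>c\<bar> * norm u + norm v"])
      fix \<epsilon> :: real assume "0 < \<epsilon>"
      then obtain \<delta> where \<delta>: "\<delta> > 0" and ok: "ok \<epsilon> \<delta>" using est by blast
      show "norm (T ?w - c *\<^sub>R T u - T v) \<le> 0 + \<epsilon> * (norm ?w + \<bar>c\<bar> * norm u + norm v)"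
      proof (rule tendsto_upperbound)
        show "(\<lambda>n. norm (1 *\<^sub>R q n ?w + (- c) *\<^sub>R T u + (- 1) *\<^sub>R T v)) \<longlonglongrightarrow> norm (T ?w - c *\<^sub>R T u - T v)"
          using tendsto_norm[OF tendsto_diff[OF tendsto_diff[OF T[of ?w] tendsto_const[of "c *\<^sub>R T u"]] tendsto_const[of "T v"]]] by simp
        show "\<forall>\<^sub>F n in sequentially. norm (1 *\<^sub>R q n ?w + (- c) *\<^sub>R T u + (- 1) *\<^sub>R T v) \<le> 0 + \<epsilon> * (norm ?w + \<bar>c\<bar> * norm u + norm v)"
          using near[OF \<delta>, of ?w]
        proof eventually_elim
          case (elim n)
          then show ?case using limit[OF ok \<delta>, of "1 / real (Suc n)" y ?w 1 "- c" u "- 1" v] \<delta> by (simp add: q_def)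
        qed
      qed simp
    qed (simp add: add_nonneg_nonneg)
    then show ?thesis by (simp add: algebra_simps)
  qed
  have "linear T" using lin[of _ _ 0] lin[of 1] bound[of 0] by (intro linearI) auto
  moreover have "\<exists>\<delta>>0. \<forall>a\<in>ball y \<delta>. \<forall>b\<in>ball y \<delta>. norm (f b - f a - T (b - a)) \<le> \<epsilon> * norm (b - a)" if \<epsilon>: "0 < \<epsilon>" for \<epsilon>
  proof -
    obtain \<delta> where \<delta>: "\<delta> > 0" and ok: "ok (\<epsilon> / 2) \<delta>" using est[of "\<epsilon> / 2"] \<epsilon> by auto
    have "norm (f b - f a - T (b - a)) \<le> \<epsilon> * norm (b - a)" if "a \<in> ball y \<delta>" "b \<in> ball y \<delta>" for a b
      using limit[OF ok \<delta>, of 1 a "b - a" 1 "- 1" "b - a" 0 0] that by (simp add: difference_quotient_def)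
    then show ?thesis using \<delta>(1) by blast
  qed
  ultimately show ?thesis unfolding strict_derivative_def using bound by blast
qed

section \<open>Uniform estimates for a differential equation in a ball\<close>

lemma linear_norm_le_sum_Basis:
  fixes T :: "'a::euclidean_space \<Rightarrow> 'b::real_normed_vector"
  assumes T: "linear T" and B: "\<And>b. b \<in> Basis \<Longrightarrow> norm (T b) \<le> B b"
  shows "norm (T v) \<le> (\<Sum>b\<in>Basis. B b) * norm v"
proof -
  have "T v = T (\<Sum>b\<in>Basis. (v \<bullet> b) *\<^sub>R b)" by (simp add: euclidean_representation)
  also have "\<dots> = (\<Sum>b\<in>Basis. (v \<bullet> b) *\<^sub>R T b)" by (simp add: linear_sum[OF T] linear_scale[OF T])
  also have "norm \<dots> \<le> (\<Sum>b\<in>Basis. norm v * B b)"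
    using B Basis_le_norm by (intro order_trans[OF norm_sum] sum_mono) (auto intro!: mult_mono)
  finally show ?thesis by (simp add: sum_distrib_left mult.commute)
qed

text \<open>The field is given on a full ball of the coordinate space. For a chart meeting the
  boundary it is an extension of the coordinate field past the half-space, so boundary charts are
  treated like the others.\<close>

locale c1_vector_field =
  fixes h :: "'a::euclidean_space \<Rightarrow> 'a" and h' :: "'a \<Rightarrow> 'a \<Rightarrow> 'a" and y0 :: 'a and R L :: real
  assumes deriv: "\<And>y. y \<in> cball y0 R \<Longrightarrow> (h has_derivative h' y) (at y)"
    and cont_deriv: "\<And>v. continuous_on (cball y0 R) (\<lambda>y. h' y v)"
    and deriv_bound: "\<And>y v. y \<in> cball y0 R \<Longrightarrow> norm (h' y v) \<le> L * norm v"
    and L0: "0 \<le> L"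
begin

lemma deriv_uniform:
  assumes "0 < \<epsilon>"
  shows "\<exists>\<delta>>0. \<forall>y\<in>cball y0 R. \<forall>z\<in>cball y0 R. dist z y < \<delta> \<longrightarrow> (\<forall>v. norm (h' z v - h' y v) \<le> \<epsilon> * norm v)"
proof -
  define d where "d = \<epsilon> / real DIM('a)"
  have d: "0 < d" using assms by (simp add: d_def)
  have "\<exists>\<delta>>0. \<forall>y\<in>cball y0 R. \<forall>z\<in>cball y0 R. dist z y < \<delta> \<longrightarrow> dist (h' z b) (h' y b) < d" for b
    using compact_uniformly_continuous[OF cont_deriv[of b] compact_cball] d
    unfolding uniformly_continuous_on_def by blast
  then obtain D where D: "\<And>b. 0 < D b" "\<And>b y z. y \<in> cball y0 R \<Longrightarrow> z \<in> cball y0 R \<Longrightarrow> dist z y < D b \<Longrightarrow> dist (h' z b) (h' y b) < d"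
    by metis
  define \<delta> where "\<delta> = Min (D ` Basis)"
  have "norm (h' z v - h' y v) \<le> \<epsilon> * norm v" if y: "y \<in> cball y0 R" and z: "z \<in> cball y0 R" and dist: "dist z y < \<delta>" for y z v
  proof -
    have "linear (\<lambda>v. h' z v - h' y v)" using deriv y z has_derivative_linear by (intro linear_compose_sub) blast+
    moreover have "norm (h' z b - h' y b) \<le> d" if "b \<in> Basis" for b
      using D(2)[OF y z, of b] dist that by (simp add: dist_norm \<delta>_def)
    ultimately have "norm (h' z v - h' y v) \<le> (\<Sum>b\<in>(Basis :: 'a set). d) * norm v" by (rule linear_norm_le_sum_Basis)
    then show ?thesis by (simp add: d_def)
  qed
  moreover have "0 < \<delta>" using D(1) by (simp add: \<delta>_def)
  ultimately show ?thesis by blast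
qed

lemma linearization_uniform:
  assumes "0 < \<epsilon>"
  shows "\<exists>\<delta>>0. \<forall>y\<in>cball y0 R. \<forall>a\<in>cball y0 R \<inter> ball y \<delta>. \<forall>b\<in>cball y0 R \<inter> ball y \<delta>.
     norm (h b - h a - h' y (b - a)) \<le> \<epsilon> * norm (b - a)"
proof -
  obtain \<delta> where \<delta>: "\<delta> > 0" and d: "\<And>y z v. y \<in> cball y0 R \<Longrightarrow> z \<in> cball y0 R \<Longrightarrow> dist z y < \<delta> \<Longrightarrow> norm (h' z v - h' y v) \<le> \<epsilon> * norm v"
    using deriv_uniform[OF assms] by metis
  have "norm (h b - h a - h' y (b - a)) \<le> \<epsilon> * norm (b - a)"
    if y: "y \<in> cball y0 R" and a: "a \<in> cball y0 R \<inter> ball y \<delta>" and b: "b \<in> cball y0 R \<inter> ball y \<delta>" for y a b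
  proof -
    let ?S = "cball y0 R \<inter> ball y \<delta>"
    have conv: "convex ?S" by (intro convex_Int convex_cball convex_ball)
    have "norm (h b - h a - h' y (b - a)) \<le> norm (b - a) * \<epsilon>"
    proof (rule differentiable_bound_linearization[of a b ?S h h'])
      fix t :: real assume "t \<in> {0..1}"
      then show "a + t *\<^sub>R (b - a) \<in> ?S"
        using convexD_alt[OF conv a b, of t] by (simp add: algebra_simps)
    next
      fix x assume x: "x \<in> ?S"
      then have xR: "x \<in> cball y0 R" and xy: "dist x y < \<delta>" by (simp_all add: dist_commute[of y])
      show "(h has_derivative h' x) (at x within ?S)" by (rule has_derivative_at_withinI[OF deriv[OF xR]])
      show "onorm (h' x - h' y) \<le> \<epsilon>"
        by (rule onorm_le) (simp add: d[OF y xR xy])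
    next
      show "y \<in> ?S" using y \<delta> by simp
    qed
    then show ?thesis by (simp add: mult.commute)
  qed
  then show ?thesis using \<delta> by blast
qed

lemma lipschitz:
  assumes "a \<in> cball y0 R" "b \<in> cball y0 R" shows "norm (h b - h a) \<le> L * norm (b - a)"
  by (rule differentiable_bound[OF convex_cball[of y0 R] has_derivative_at_withinI[OF deriv] onorm_le[OF deriv_bound] assms(2,1)])

definition solution :: "real \<Rightarrow> (real \<Rightarrow> 'a) \<Rightarrow> bool" where
  "solution \<tau> u \<longleftrightarrow> (\<forall>t\<in>{0..\<tau>}. u t \<in> cball y0 R \<and> (u has_vector_derivative h (u t)) (at t within {0..\<tau>}))"

text \<open>The comparison time r is free: r = 0 gives Lipschitz dependence on initial values, and
  later r bound the initial difference from above.\<close>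

lemma solution_lipschitz:
  assumes "solution \<tau> u" "solution \<tau> v" "L * \<tau> \<le> 1 / 2" "t \<in> {0..\<tau>}" "r \<in> {0..\<tau>}"
  shows "norm (u t - v t) \<le> 2 * norm (u r - v r)"
proof -
  have "norm (u t - v t) \<le> 2 * norm (u r - v r) + 2 * \<tau> * 0"
    using assms lipschitz unfolding solution_def
    by (intro short_time_gronwall[where w = "\<lambda>t. u t - v t" and w' = "\<lambda>t. h (u t) - h (v t)" and L = L])
      (auto intro: has_vector_derivative_diff L0)
  then show ?thesis by simp
qed

text \<open>The combination \<open>w\<close> of differences of solutions solves, up to a small
  remainder, the equation linearized along the solution through y. The remainder is controlled by
  uniform differentiability of h, and Gronwall's estimate then compares \<open>w\<close> at time t
  with its value at time 0.\<close>

lemma solution_strict_derivative: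
  fixes \<psi> :: "'a \<Rightarrow> real \<Rightarrow> 'a"
  assumes sol: "\<And>z. z \<in> ball y r \<Longrightarrow> solution \<tau> (\<psi> z) \<and> \<psi> z 0 = z" and r: "0 < r"
    and \<tau>: "L * \<tau> \<le> 1 / 2" and t: "t \<in> {0..\<tau>}"
  shows "\<exists>f'. strict_derivative (\<lambda>z. \<psi> z t) f' y \<and> (\<forall>v. norm (f' v) \<le> 2 * norm v)"
proof (rule strict_derivativeI)
  fix \<epsilon> :: real assume \<epsilon>: "0 < \<epsilon>"
  have \<tau>0: "0 \<le> \<tau>" using t by auto
  \<comment> \<open>The remainder is at most 2 e S, and the short-time estimate multiplies it by 2
    \<tau>.\<close>
  define e where "e = \<epsilon> / (4 * \<tau> + 1)"
  have e: "0 < e" "4 * \<tau> * e \<le> \<epsilon>" using \<epsilon> \<tau>0 by (auto simp: e_def field_simps)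
  obtain \<delta> where \<delta>: "\<delta> > 0" and lin: "\<And>y a b. y \<in> cball y0 R \<Longrightarrow> a \<in> cball y0 R \<inter> ball y \<delta> \<Longrightarrow> b \<in> cball y0 R \<inter> ball y \<delta> \<Longrightarrow>
     norm (h b - h a - h' y (b - a)) \<le> e * norm (b - a)"
    using linearization_uniform[OF e(1)] by metis
  have y: "y \<in> ball y r" using r by simp
  \<comment> \<open>Solutions spread by a factor of at most 2, so they stay within \<delta> of the
    solution through y.\<close>
  let ?\<delta> = "min r (\<delta> / 2)"
  show "\<exists>\<delta>>0. \<forall>c h a v. (\<forall>i<3::nat. h i \<noteq> 0 \<and> a i \<in> ball y \<delta> \<and> a i + h i *\<^sub>R v i \<in> ball y \<delta>) \<longrightarrow>
     norm (\<Sum>i<3. c i *\<^sub>R difference_quotient (\<lambda>z. \<psi> z t) (a i) (h i) (v i)) \<le> 2 * norm (\<Sum>i<3. c i *\<^sub>R v i) + \<epsilon> * (\<Sum>i<3. \<bar>c i\<bar> * norm (v i))"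
  proof (intro exI[of _ ?\<delta>] conjI allI impI)
    show "0 < ?\<delta>" using r \<delta> by simp
    fix c q :: "nat \<Rightarrow> real" and a v :: "nat \<Rightarrow> 'a" assume av: "\<forall>i<3::nat. q i \<noteq> 0 \<and> a i \<in> ball y ?\<delta> \<and> a i + q i *\<^sub>R v i \<in> ball y ?\<delta>"
    define b where "b i = a i + q i *\<^sub>R v i" for i
    define \<alpha> where "\<alpha> i = c i / q i" for i
    have ab: "\<forall>i<3::nat. a i \<in> ball y ?\<delta> \<and> b i \<in> ball y ?\<delta>" using av by (simp add: b_def)
    have sa: "solution \<tau> (\<psi> (a i))" "\<psi> (a i) 0 = a i" and sb: "solution \<tau> (\<psi> (b i))" "\<psi> (b i) 0 = b i" if "i < 3" for i
      using sol[of "a i"] sol[of "b i"] ab that by auto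
    have near: "\<psi> z s \<in> cball y0 R \<inter> ball (\<psi> y s) \<delta>" if "z \<in> ball y ?\<delta>" "s \<in> {0..\<tau>}" for z s
    proof -
      have "norm (\<psi> y s - \<psi> z s) \<le> 2 * norm (y - z)"
        using solution_lipschitz[of \<tau> "\<psi> y" "\<psi> z" s 0] sol[OF y] sol[of z] that \<tau> by auto
      also have "\<dots> < \<delta>" using that by (simp add: dist_norm)
      finally have "dist (\<psi> y s) (\<psi> z s) < \<delta>" by (simp add: dist_norm)
      moreover have "\<psi> z s \<in> cball y0 R" using sol[of z] that by (auto simp: solution_def)
      ultimately show ?thesis by simp
    qed
    define S where "S = (\<Sum>i<3::nat. \<bar>\<alpha> i\<bar> * norm (b i - a i))"
    have S0: "0 \<le> S" unfolding S_def by (intro sum_nonneg) auto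
    define w where "w s = (\<Sum>i<3::nat. \<alpha> i *\<^sub>R (\<psi> (b i) s - \<psi> (a i) s))" for s
    define w' where "w' s = (\<Sum>i<3::nat. \<alpha> i *\<^sub>R (h (\<psi> (b i) s) - h (\<psi> (a i) s)))" for s
    have "norm (w t) \<le> 2 * norm (w 0) + 2 * \<tau> * (2 * e * S)"
    proof (rule short_time_gronwall[where w' = w' and L = L])
      fix s assume s: "s \<in> {0..\<tau>}"
      show "(w has_vector_derivative w' s) (at s within {0..\<tau>})"
        unfolding w_def w'_def using sa sb s
        by (intro has_vector_derivative_sum has_vector_derivative_diff
            bounded_linear.has_vector_derivative[OF bounded_linear_scaleR_right])
          (auto simp: solution_def)
      have ys: "\<psi> y s \<in> cball y0 R" using sol[OF y] s by (auto simp: solution_def)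
      have linh: "linear (h' (\<psi> y s))" using deriv[OF ys] has_derivative_linear by blast
      define rem where "rem i = h (\<psi> (b i) s) - h (\<psi> (a i) s) - h' (\<psi> y s) (\<psi> (b i) s - \<psi> (a i) s)" for i
      have "h' (\<psi> y s) (w s) = (\<Sum>i<3. \<alpha> i *\<^sub>R h' (\<psi> y s) (\<psi> (b i) s - \<psi> (a i) s))"
        unfolding w_def by (simp add: linear_sum[OF linh] linear_scale[OF linh])
      then have "w' s = h' (\<psi> y s) (w s) + (\<Sum>i<3. \<alpha> i *\<^sub>R rem i)"
        by (simp add: w'_def rem_def sum.distrib[symmetric] scaleR_add_right[symmetric])
      also have "norm \<dots> \<le> L * norm (w s) + (\<Sum>i<3. norm (\<alpha> i *\<^sub>R rem i))"
        by (intro order_trans[OF norm_triangle_ineq] add_mono deriv_bound ys norm_sum)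
      also have "(\<Sum>i<3. norm (\<alpha> i *\<^sub>R rem i)) \<le> (\<Sum>i<3. 2 * e * (\<bar>\<alpha> i\<bar> * norm (b i - a i)))"
      proof (rule sum_mono)
        fix i :: nat assume "i \<in> {..<3}"
        then have i: "i < 3" by simp
        have "norm (rem i) \<le> e * norm (\<psi> (b i) s - \<psi> (a i) s)"
          unfolding rem_def using near s ab i by (intro lin ys) auto
        also have "\<dots> \<le> e * (2 * norm (b i - a i))"
          using solution_lipschitz[OF sb(1)[OF i] sa(1)[OF i] \<tau> s, of 0] \<tau>0 sa(2)[OF i] sb(2)[OF i] e(1)
          by (intro mult_left_mono) auto
        finally have "\<bar>\<alpha> i\<bar> * norm (rem i) \<le> \<bar>\<alpha> i\<bar> * (e * (2 * norm (b i - a i)))" by (intro mult_left_mono) auto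
        then show "norm (\<alpha> i *\<^sub>R rem i) \<le> 2 * e * (\<bar>\<alpha> i\<bar> * norm (b i - a i))" by (simp add: mult_ac)
      qed
      finally show "norm (w' s) \<le> L * norm (w s) + 2 * e * S" by (simp add: S_def sum_distrib_left)
    qed (use L0 \<tau> t S0 e in auto)
    moreover have "w 0 = (\<Sum>i<3. \<alpha> i *\<^sub>R (b i - a i))" unfolding w_def using sa(2) sb(2) by (intro sum.cong) auto
    moreover have "2 * \<tau> * (2 * e * S) \<le> \<epsilon> * S" using mult_right_mono[OF e(2) S0] by (simp add: mult_ac)
    moreover have "w t = (\<Sum>i<3. c i *\<^sub>R difference_quotient (\<lambda>z. \<psi> z t) (a i) (q i) (v i))"
      by (simp add: w_def \<alpha>_def b_def difference_quotient_def)
    moreover have "(\<Sum>i<3. \<alpha> i *\<^sub>R (b i - a i)) = (\<Sum>i<3. c i *\<^sub>R v i)" "S = (\<Sum>i<3. \<bar>c i\<bar> * norm (v i))"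
      unfolding S_def using av by (auto simp: \<alpha>_def b_def abs_mult intro!: sum.cong)
    ultimately show "norm (\<Sum>i<3. c i *\<^sub>R difference_quotient (\<lambda>z. \<psi> z t) (a i) (q i) (v i)) \<le> 2 * norm (\<Sum>i<3. c i *\<^sub>R v i) + \<epsilon> * (\<Sum>i<3. \<bar>c i\<bar> * norm (v i))"
      by simp
  qed
qed

text \<open>The Lipschitz estimate with the roles of time 0 and time t exchanged bounds difference
  quotients from below.\<close>

lemma solution_strict_derivative_ge:
  fixes \<psi> :: "'a \<Rightarrow> real \<Rightarrow> 'a"
  assumes sol: "\<And>z. z \<in> ball y r \<Longrightarrow> solution \<tau> (\<psi> z) \<and> \<psi> z 0 = z" and r: "0 < r"
    and \<tau>: "L * \<tau> \<le> 1 / 2" and t: "t \<in> {0..\<tau>}" and f': "strict_derivative (\<lambda>z. \<psi> z t) f' y"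
  shows "norm v \<le> 2 * norm (f' v)"
proof -
  have y: "y \<in> ball y r" and \<tau>0: "0 \<in> {0..\<tau>}" using r t by auto
  have "norm v \<le> norm (2 *\<^sub>R f' v)"
  proof (rule tendsto_lowerbound)
    show "(\<lambda>n. norm (2 *\<^sub>R difference_quotient (\<lambda>z. \<psi> z t) y (1 / real (Suc n)) v)) \<longlonglongrightarrow> norm (2 *\<^sub>R f' v)"
      by (intro tendsto_intros difference_quotient_tendsto strict_derivative_imp_has_derivative[OF f'])
    show "\<forall>\<^sub>F n in sequentially. norm v \<le> norm (2 *\<^sub>R difference_quotient (\<lambda>z. \<psi> z t) y (1 / real (Suc n)) v)"
      using eventually_in_ball[OF y, of v]
    proof eventually_elim
      case (elim n)
      let ?w = "(1 / real (Suc n)) *\<^sub>R v"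
      have "norm ?w \<le> 2 * norm (\<psi> (y + ?w) t - \<psi> y t)"
        using solution_lipschitz[OF _ _ \<tau> \<tau>0 t, of "\<psi> (y + ?w)" "\<psi> y"] sol[OF elim] sol[OF y] by simp
      then show ?case by (simp add: difference_quotient_def pos_divide_le_eq mult_ac del: of_nat_Suc)
    qed
  qed simp
  then show ?thesis by simp
qed

end

lemma compact_linear_bound:
  fixes h' :: "'a::euclidean_space \<Rightarrow> 'b::euclidean_space \<Rightarrow> 'c::real_normed_vector"
  assumes "compact K" "\<And>v. continuous_on K (\<lambda>y. h' y v)" "\<And>y. y \<in> K \<Longrightarrow> linear (h' y)"
  shows "\<exists>L>0. \<forall>y\<in>K. \<forall>v. norm (h' y v) \<le> L * norm v"
proof -
  have "\<exists>B. \<forall>y\<in>K. norm (h' y b) \<le> B" for b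
    using compact_imp_bounded[OF compact_continuous_image[OF assms(2)[of b] assms(1)]]
    unfolding bounded_iff by auto
  then obtain B where B: "\<And>b y. y \<in> K \<Longrightarrow> norm (h' y b) \<le> B b" by metis
  define L where "L = (\<Sum>b\<in>(Basis :: 'b set). \<bar>B b\<bar>) + 1"
  have "norm (h' y v) \<le> L * norm v" if y: "y \<in> K" for y v
    using linear_norm_le_sum_Basis[OF assms(3)[OF y] order_trans[OF B[OF y] abs_ge_self], of v]
    by (simp add: L_def distrib_right add_increasing2)
  moreover have "0 < L" unfolding L_def by (intro add_nonneg_pos sum_nonneg) auto
  ultimately show ?thesis by blast
qed

section \<open>Coordinates and the flow\<close>

lemma C_on_imp_C_open:
  assumes "C_on m f S" "x \<in> S" "enat j \<le> m"
  obtains W h where "open W" "x \<in> W" "C_open j h W" "\<And>y. y \<in> S \<Longrightarrow> y \<in> W \<Longrightarrow> h y = f y"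
proof -
  obtain W h where "open W" "x \<in> W" "\<forall>j. enat j \<le> m \<longrightarrow> C_open j h W" "\<forall>y\<in>S \<inter> W. h y = f y"
    using assms unfolding C_on_def by blast
  with assms(3) that show ?thesis by blast
qed

lemma C_on_continuous_on:
  assumes "C_on m f S" shows "continuous_on S f"
proof (rule continuous_on_eq_continuous_within[THEN iffD2], rule ballI)
  fix x assume x: "x \<in> S"
  have "enat 0 \<le> m" by (simp add: zero_enat_def[symmetric])
  obtain W h where W: "open W" "x \<in> W" "C_open 0 h W" "\<And>y. y \<in> S \<Longrightarrow> y \<in> W \<Longrightarrow> h y = f y"
    using C_on_imp_C_open[OF assms x \<open>enat 0 \<le> m\<close>] by metis
  have "(h \<longlongrightarrow> h x) (at x within S)"
    using W by (simp add: continuous_on_eq_continuous_at isCont_def tendsto_within_subset[of _ _ x UNIV])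
  then have "(f \<longlongrightarrow> h x) (at x within S)"
    by (rule Lim_transform_eventually) (use W in \<open>auto simp: eventually_at_topological\<close>)
  then show "continuous (at x within S) f" using W x by (simp add: continuous_within)
qed

text \<open>Local constants become one global constant by a finite subcover. Monotonicity in C lets
  the maximum of the local constants serve everywhere; properties are phrased so that a larger C is
  weaker.\<close>

lemma compact_uniform:
  fixes P :: "real \<Rightarrow> 'a::topological_space \<Rightarrow> bool"
  assumes K: "compact K" and mono: "\<And>C C' y. P C y \<Longrightarrow> C \<le> C' \<Longrightarrow> P C' y"
    and loc: "\<And>x. x \<in> K \<Longrightarrow> \<exists>C U. open U \<and> x \<in> U \<and> (\<forall>y\<in>U \<inter> K. P C y)"
  shows "\<exists>C\<ge>1. \<forall>y\<in>K. P C y"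
proof -
  have "\<forall>x. \<exists>C U. x \<in> K \<longrightarrow> open U \<and> x \<in> U \<and> (\<forall>y\<in>U \<inter> K. P C y)" using loc by blast
  then obtain C U where *: "\<And>x. x \<in> K \<Longrightarrow> open (U x) \<and> x \<in> U x \<and> (\<forall>y\<in>U x \<inter> K. P (C x) y)" by metis
  obtain D where D: "finite D" "D \<subseteq> K" "K \<subseteq> (\<Union>p\<in>D. U p)"
  proof (rule compactE_image[OF K, of K U])
    show "K \<subseteq> (\<Union>p\<in>K. U p)" using * by auto
  qed (use * that in auto)
  define M where "M = Max (insert 1 (C ` D))"
  have M: "1 \<le> M" "\<And>p. p \<in> D \<Longrightarrow> C p \<le> M" using D(1) by (auto simp: M_def)
  have "P M y" if "y \<in> K" for y
  proof -
    obtain p where "p \<in> D" "y \<in> U p" using D(3) \<open>y \<in> K\<close> by auto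
    then show ?thesis using * D(2) M(2) mono \<open>y \<in> K\<close> by blast
  qed
  then show ?thesis using M(1) by blast
qed

text \<open>Short times are those with \<open>t * C \<le> 1\<close>, so that enlarging C restricts
  them further, in agreement with \<open>compact_uniform\<close>. A longer time is divided into
  equal short steps.\<close>

lemma short_time_induct:
  fixes C t :: real
  assumes C: "1 \<le> C" and t: "0 \<le> t" and short: "\<And>t. 0 \<le> t \<Longrightarrow> t * C \<le> 1 \<Longrightarrow> P t"
    and step: "\<And>s t. 0 \<le> s \<Longrightarrow> 0 \<le> t \<Longrightarrow> t * C \<le> 1 \<Longrightarrow> P s \<Longrightarrow> P (t + s)"
  shows "P t"
proof -
  obtain n :: nat where n: "t * C \<le> real n" "0 < n" using real_arch_simple[of "max 1 (t * C)"] by force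
  define h where "h = t / real n"
  have h: "0 \<le> h" "h * C \<le> 1" "real n * h = t" using n t by (auto simp: h_def field_simps)
  have "P (real m * h)" for m
  proof (induction m)
    case (Suc m)
    then show ?case using step[of "real m * h" h] h by (simp add: distrib_right)
  qed (use short in simp)
  then show ?thesis using h(3) by metis
qed

section \<open>Charts and coordinate changes\<close>

locale manifold =
  fixes \<A> :: "('m::{t2_space,second_countable_topology}, 'n::{finite,linorder}) chart set"
  assumes atlas: "smooth_atlas \<A>"
begin

abbreviation dom :: "('m, 'n) chart \<Rightarrow> 'm set" where "dom c \<equiv> fst c"
abbreviation im :: "('m, 'n) chart \<Rightarrow> 'n coords set" where "im c \<equiv> snd c ` fst c"
abbreviation to_chart :: "('m, 'n) chart \<Rightarrow> 'm \<Rightarrow> 'n coords \<Rightarrow> 'n coords" where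
  "to_chart c p \<equiv> coord_change (chart_at \<A> p) c p"
abbreviation of_chart :: "('m, 'n) chart \<Rightarrow> 'm \<Rightarrow> 'n coords \<Rightarrow> 'n coords" where
  "of_chart c p \<equiv> coord_change c (chart_at \<A> p) p"

lemma chart_at: "chart_at \<A> p \<in> \<A>" "p \<in> dom (chart_at \<A> p)"
proof -
  have "\<exists>c. c \<in> \<A> \<and> p \<in> fst c" using atlas unfolding smooth_atlas_def by blast
  from someI_ex[OF this] show "chart_at \<A> p \<in> \<A>" "p \<in> dom (chart_at \<A> p)"
    by (simp_all add: chart_at_def)
qed

context
  fixes c assumes c: "c \<in> \<A>"
begin

lemma chart: "is_chart c" using atlas c by (simp add: smooth_atlas_def)

lemma open_dom: "open (dom c)" using chart by (simp add: is_chart_def)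

lemma homeo: "homeomorphism (dom c) (im c) (snd c) (chart_inv c)"
  using chart by (simp add: is_chart_def)

lemma chart_inv_left [simp]: "p \<in> dom c \<Longrightarrow> chart_inv c (snd c p) = p"
  using homeo by (simp add: homeomorphism_def)

lemma chart_inv_right: "y \<in> im c \<Longrightarrow> snd c (chart_inv c y) = y"
  using homeo by (auto simp: homeomorphism_def)

lemma chart_inv_in: "y \<in> im c \<Longrightarrow> chart_inv c y \<in> dom c"
  using homeo by (auto simp: homeomorphism_def)

lemma continuous_chart: "continuous_on (dom c) (snd c)"
  using homeo by (simp add: homeomorphism_def)

lemma continuous_chart_inv: "continuous_on (im c) (chart_inv c)"
  using homeo by (simp add: homeomorphism_def)

lemma isCont_chart: "p \<in> dom c \<Longrightarrow> isCont (snd c) p"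
  using continuous_chart open_dom by (simp add: continuous_on_eq_continuous_at)

lemma im_half: "im c \<subseteq> half_space"
  using chart by (auto simp: is_chart_def openin_subset topspace_euclidean_subtopology dest: openin_imp_subset)

lemma image_openin:
  assumes "open U" "U \<subseteq> dom c" shows "openin (top_of_set half_space) (snd c ` U)"
proof -
  have "openin (top_of_set (dom c)) U" using assms by (simp add: openin_open_eq open_dom)
  then have "openin (top_of_set (im c)) (snd c ` U)" by (rule homeomorphism_imp_open_map[OF homeo])
  then show ?thesis using chart unfolding is_chart_def by (blast intro: openin_trans)
qed

text \<open>Images of open sets are open only relative to the half-space; where the last coordinate
  is positive this makes no difference.\<close>

lemma image_interior:
  assumes "open U" "U \<subseteq> dom c" "p \<in> U" "0 < snd c p $ Max UNIV"
  shows "snd c p \<in> interior (snd c ` U)"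
proof -
  obtain V where V: "open V" "snd c ` U = half_space \<inter> V"
    using image_openin[OF assms(1,2)] by (auto simp: openin_open)
  let ?P = "{v :: 'n coords. 0 < v $ Max UNIV}"
  have "open ?P" by (intro open_Collect_less continuous_intros)
  then have "open (?P \<inter> V)" using V by blast
  moreover have "?P \<inter> V \<subseteq> snd c ` U" using V by (auto simp: half_space_def)
  moreover have "snd c p \<in> ?P \<inter> V" using assms V by auto
  ultimately show ?thesis by (meson interiorI)
qed

lemma preimage_open:
  assumes "openin (top_of_set half_space) S" "S \<subseteq> im c" shows "open (chart_inv c ` S)"
proof -
  have "openin (top_of_set (im c)) S"
    using assms chart by (meson is_chart_def openin_subset_trans openin_imp_subset)
  then have "openin (top_of_set (dom c)) (chart_inv c ` S)"
    using homeo by (meson homeomorphism_imp_open_map homeomorphism_symD)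
  then show ?thesis using open_dom by (simp add: openin_open_eq)
qed

end

text \<open>\<open>coord_change\<close> is defined by choosing a derivative; here it is shown to be
  one, by restricting a local extension across the boundary.\<close>

lemma transition_has_derivative:
  assumes "c \<in> \<A>" "c' \<in> \<A>" "p \<in> dom c" "p \<in> dom c'"
  shows "(snd c' \<circ> chart_inv c has_derivative coord_change c c' p) (at (snd c p) within snd c ` (dom c \<inter> dom c'))"
proof -
  let ?S = "snd c ` (dom c \<inter> dom c')"
  have C: "C_on \<infinity> (snd c' \<circ> chart_inv c) ?S" using atlas assms by (simp add: smooth_atlas_def)
  have pS: "snd c p \<in> ?S" using assms by auto
  obtain W h where W: "open W" "snd c p \<in> W" "C_open (Suc 0) h W" "\<And>y. y \<in> ?S \<Longrightarrow> y \<in> W \<Longrightarrow> h y = (snd c' \<circ> chart_inv c) y"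
    using C_on_imp_C_open[OF C pS, of "Suc 0"] by auto
  then obtain h' where "(h has_derivative h') (at (snd c p))" by auto
  then have "(h has_derivative h') (at (snd c p) within ?S)" by (rule has_derivative_at_withinI)
  then have "(snd c' \<circ> chart_inv c has_derivative h') (at (snd c p) within ?S)"
  proof (rule has_derivative_transform_eventually)
    show "\<forall>\<^sub>F y in at (snd c p) within ?S. h y = (snd c' \<circ> chart_inv c) y"
      unfolding eventually_at_topological using W by blast
  qed (use W(2,4) pS in auto)
  then have "(snd c' \<circ> chart_inv c) differentiable (at (snd c p) within ?S)" by (auto simp: differentiable_def)
  then show ?thesis unfolding coord_change_def by (simp add: frechet_derivative_works)
qed

text \<open>Demanded in every chart around p, so that no argument about transition maps preserving
  the boundary enters.\<close>

definition interior_point :: "'m \<Rightarrow> bool" where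
  "interior_point p \<longleftrightarrow> (\<forall>c\<in>\<A>. p \<in> dom c \<longrightarrow> 0 < snd c p $ Max UNIV)"

text \<open>On a ball inside the chart image the one-sided derivative is an ordinary one and unique,
  so \<open>coord_change\<close> at all nearby points is the derivative of the same C1
  extension.\<close>

lemma transition_C1:
  assumes c: "c \<in> \<A>" "c' \<in> \<A>" "p \<in> dom c" "p \<in> dom c'" and p: "interior_point p"
  obtains r h' where "0 < r" "ball (snd c p) r \<subseteq> snd c ` (dom c \<inter> dom c')"
    "\<And>y. y \<in> ball (snd c p) r \<Longrightarrow> (snd c' \<circ> chart_inv c has_derivative h' y) (at y)"
    "\<And>v. continuous_on (ball (snd c p) r) (\<lambda>y. h' y v)"
    "\<And>q. q \<in> dom c \<Longrightarrow> snd c q \<in> ball (snd c p) r \<Longrightarrow> coord_change c c' q = h' (snd c q)"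
proof -
  let ?S = "snd c ` (dom c \<inter> dom c')"
  have C: "C_on \<infinity> (snd c' \<circ> chart_inv c) ?S" using atlas assms by (simp add: smooth_atlas_def)
  have pS: "snd c p \<in> ?S" using assms by auto
  obtain W h where W: "open W" "snd c p \<in> W" "C_open (Suc 0) h W" "\<And>y. y \<in> ?S \<Longrightarrow> y \<in> W \<Longrightarrow> h y = (snd c' \<circ> chart_inv c) y"
    using C_on_imp_C_open[OF C pS, of "Suc 0"] by auto
  then obtain h' where h': "\<And>x. x \<in> W \<Longrightarrow> (h has_derivative h' x) (at x)" "\<And>v. continuous_on W (\<lambda>x. h' x v)" by auto
  have "snd c p \<in> interior ?S"
    using c p by (intro image_interior) (auto simp: interior_point_def open_dom intro!: open_Int)
  then have "snd c p \<in> interior ?S \<inter> W" using W by simp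
  then obtain r where r: "0 < r" "ball (snd c p) r \<subseteq> interior ?S \<inter> W"
    using W(1) by (meson open_Int open_contains_ball open_interior)
  have sub: "ball (snd c p) r \<subseteq> ?S" "ball (snd c p) r \<subseteq> W" using r(2) interior_subset by blast+
  have der: "(snd c' \<circ> chart_inv c has_derivative h' y) (at y)" if y: "y \<in> ball (snd c p) r" for y
  proof (rule has_derivative_transform_within_open[OF _ open_ball y])
    show "(h has_derivative h' y) (at y)" using y sub by (intro h') auto
    show "h x = (snd c' \<circ> chart_inv c) x" if "x \<in> ball (snd c p) r" for x
      by (rule W(4)[OF subsetD[OF sub(1) that] subsetD[OF sub(2) that]])
  qed
  show ?thesis
  proof (rule that[OF r(1) sub(1) der])
    show "continuous_on (ball (snd c p) r) (\<lambda>y. h' y v)" for v using continuous_on_subset[OF h'(2) sub(2)] .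
    fix q assume q: "q \<in> dom c" "snd c q \<in> ball (snd c p) r"
    have "snd c q \<in> interior ?S" using q(2) sub(1) by (meson interiorI open_ball)
    then have "at (snd c q) within ?S = at (snd c q)" by (rule at_within_interior)
    moreover have "q \<in> dom c'"
    proof -
      obtain q' where q': "q' \<in> dom c \<inter> dom c'" "snd c q = snd c q'"
        using subsetD[OF sub(1) q(2)] by auto
      have "q = q'" using chart_inv_left[OF c(1) q(1)] chart_inv_left[OF c(1), of q'] q' by simp
      then show ?thesis using q'(1) by simp
    qed
    ultimately have "(snd c' \<circ> chart_inv c has_derivative coord_change c c' q) (at (snd c q))"
      using transition_has_derivative[OF c(1,2) q(1)] by simp
    then show "coord_change c c' q = h' (snd c q)" using der[OF q(2)] by (rule has_derivative_unique)
  qed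
qed

lemma transition_derivative_interior:
  assumes c: "c \<in> \<A>" "c' \<in> \<A>" "p \<in> dom c" "p \<in> dom c'" and p: "interior_point p"
  shows "(snd c' \<circ> chart_inv c has_derivative coord_change c c' p) (at (snd c p))"
  using transition_C1[OF assms] c(3) by (metis centre_in_ball)

lemma linear_coord_change:
  assumes "c \<in> \<A>" "c' \<in> \<A>" "p \<in> dom c" "p \<in> dom c'"
  shows "linear (coord_change c c' p)"
  using transition_has_derivative[OF assms] by (rule has_derivative_linear)

lemma eventually_chart:
  assumes c: "c \<in> \<A>" "p \<in> dom c" and p: "interior_point p" and P: "eventually P (nhds p)"
  shows "eventually (\<lambda>y. y \<in> im c \<and> P (chart_inv c y)) (nhds (snd c p))"
proof -
  obtain U where U: "open U" "p \<in> U" "\<And>q. q \<in> U \<Longrightarrow> P q" using P by (auto simp: eventually_nhds)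
  have "snd c p \<in> interior (snd c ` (U \<inter> dom c))"
    using c p U by (intro image_interior) (auto simp: interior_point_def open_dom)
  then have "eventually (\<lambda>y. y \<in> interior (snd c ` (U \<inter> dom c))) (nhds (snd c p))"
    by (auto simp: eventually_nhds intro!: exI[of _ "interior (snd c ` (U \<inter> dom c))"])
  then show ?thesis
  proof (rule eventually_mono)
    fix y assume "y \<in> interior (snd c ` (U \<inter> dom c))"
    then obtain q where "q \<in> U" "q \<in> dom c" "y = snd c q" using interior_subset by blast
    then show "y \<in> im c \<and> P (chart_inv c y)" using U(3) c by auto
  qed
qed

text \<open>The chain rule, together with uniqueness of ordinary derivatives at an interior
  point.\<close>

lemma coord_change_compose:
  assumes c: "c \<in> \<A>" "c' \<in> \<A>" "c'' \<in> \<A>" "p \<in> dom c" "p \<in> dom c'" "p \<in> dom c''" and p: "interior_point p"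
  shows "coord_change c' c'' p (coord_change c c' p v) = coord_change c c'' p v"
proof -
  have 1: "(snd c' \<circ> chart_inv c has_derivative coord_change c c' p) (at (snd c p))"
    by (rule transition_derivative_interior[OF c(1,2,4,5) p])
  have 2: "(snd c'' \<circ> chart_inv c' has_derivative coord_change c' c'' p) (at ((snd c' \<circ> chart_inv c) (snd c p)))"
    using transition_derivative_interior[OF c(2,3,5,6) p] c by simp
  have "((snd c'' \<circ> chart_inv c') \<circ> (snd c' \<circ> chart_inv c) has_derivative coord_change c' c'' p \<circ> coord_change c c' p) (at (snd c p))"
    by (rule diff_chain_at[OF 1 2])
  then have "(snd c'' \<circ> chart_inv c has_derivative coord_change c' c'' p \<circ> coord_change c c' p) (at (snd c p))"
  proof (rule has_derivative_transform_eventually)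
    have "eventually (\<lambda>q. q \<in> dom c') (nhds p)"
      using c(5) open_dom[OF c(2)] unfolding eventually_nhds by blast
    from eventually_chart[OF c(1,4) p this]
    have "\<forall>\<^sub>F y in nhds (snd c p). (snd c'' \<circ> chart_inv c' \<circ> (snd c' \<circ> chart_inv c)) y = (snd c'' \<circ> chart_inv c) y"
      by (rule eventually_mono) (use c in auto)
    then show "\<forall>\<^sub>F y in at (snd c p). (snd c'' \<circ> chart_inv c' \<circ> (snd c' \<circ> chart_inv c)) y = (snd c'' \<circ> chart_inv c) y"
      by (simp add: eventually_nhds_conv_at)
  qed (use c in auto)
  then have "coord_change c' c'' p \<circ> coord_change c c' p = coord_change c c'' p"
    using transition_derivative_interior[OF c(1,3,4,6) p] by (rule has_derivative_unique)
  then show ?thesis by (metis comp_apply)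
qed

lemma coord_change_refl:
  assumes c: "c \<in> \<A>" "p \<in> dom c" and p: "interior_point p"
  shows "coord_change c c p v = v"
proof -
  have "((\<lambda>y. y) has_derivative (\<lambda>v. v)) (at (snd c p))" by (rule has_derivative_ident)
  then have "(snd c \<circ> chart_inv c has_derivative (\<lambda>v. v)) (at (snd c p))"
  proof (rule has_derivative_transform_eventually)
    have "\<forall>\<^sub>F y in nhds (snd c p). y = (snd c \<circ> chart_inv c) y"
      using eventually_chart[OF c p, of "\<lambda>_. True"] by (rule eventually_mono[OF _ ]) (use c chart_inv_right in auto)
    then show "\<forall>\<^sub>F y in at (snd c p). y = (snd c \<circ> chart_inv c) y" by (simp add: eventually_nhds_conv_at)
  qed (use c in auto)
  then show ?thesis
    using has_derivative_unique[OF transition_derivative_interior[OF c(1,1,2,2) p]] by metis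
qed

lemma of_to_chart: "c \<in> \<A> \<Longrightarrow> p \<in> dom c \<Longrightarrow> interior_point p \<Longrightarrow> of_chart c p (to_chart c p v) = v"
  and to_of_chart: "c \<in> \<A> \<Longrightarrow> p \<in> dom c \<Longrightarrow> interior_point p \<Longrightarrow> to_chart c p (of_chart c p v) = v"
  using coord_change_compose[OF chart_at(1) _ chart_at(1) chart_at(2) _ chart_at(2)] coord_change_refl[OF chart_at]
    coord_change_compose[OF _ chart_at(1) _ _ chart_at(2)] coord_change_refl by simp_all

end

section \<open>The flow in charts: confinement, uniqueness, continuity\<close>

locale manifold_flow = manifold \<A>
  for \<A> :: "('m::{t2_space,second_countable_topology}, 'n::{finite,linorder}) chart set" +
  fixes X :: "'m \<Rightarrow> 'n coords" and \<phi> :: "real \<Rightarrow> 'm \<Rightarrow> 'm"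
  assumes compact_M: "compact (UNIV :: 'm set)" and field: "C1_vector_field \<A> X" and inward: "inwardly_transverse \<A> X" and flow: "is_flow \<A> X \<phi>"
begin

definition vf :: "('m, 'n) chart \<Rightarrow> 'n coords \<Rightarrow> 'n coords" where
  "vf c y = (let p = chart_inv c y in to_chart c p (X p))"

text \<open>The definition tests the velocity only in the chart selected at the current point. The
  transition derivative carries it to an arbitrary chart, after restriction to times at which the
  curve lies in both domains.\<close>

lemma integral_curve_in_chart:
  assumes \<gamma>: "integral_curve \<A> X \<gamma> {0..}" and t: "0 \<le> t" and c: "c \<in> \<A>" "\<gamma> t \<in> dom c"
  shows "((snd c \<circ> \<gamma>) has_vector_derivative vf c (snd c (\<gamma> t))) (at t within {0..})"
proof -
  define c0 where "c0 = chart_at \<A> (\<gamma> t)"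
  have c0: "c0 \<in> \<A>" "\<gamma> t \<in> dom c0" unfolding c0_def by (rule chart_at)+
  let ?O = "dom c0 \<inter> dom c"
  have "open ?O" using open_dom c c0 by blast
  moreover have cont: "continuous_on {0..} \<gamma>" using \<gamma> by (simp add: integral_curve_def)
  ultimately obtain V where V: "open V" "V \<inter> {0..} = \<gamma> -` ?O \<inter> {0..}"
    unfolding continuous_on_open_invariant by blast
  define S where "S = V \<inter> {0..}"
  have tS: "t \<in> S" "t \<in> V" using V t c c0 by (auto simp: S_def)
  have SO: "\<gamma> s \<in> ?O" if "s \<in> S" for s using V that by (auto simp: S_def)
  have at_eq: "at t within S = at t within {0..}"
    by (rule at_within_nhd[OF tS(2) V(1)]) (auto simp: S_def)
  have "((snd c0 \<circ> \<gamma>) has_vector_derivative X (\<gamma> t)) (at t within {0..})"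
    using \<gamma> t by (simp add: integral_curve_def c0_def)
  then have 1: "((snd c0 \<circ> \<gamma>) has_derivative (\<lambda>h. h *\<^sub>R X (\<gamma> t))) (at t within S)"
    unfolding at_eq by (simp add: has_vector_derivative_def)
  have "(snd c \<circ> chart_inv c0 has_derivative coord_change c0 c (\<gamma> t)) (at (snd c0 (\<gamma> t)) within snd c0 ` ?O)"
    by (rule transition_has_derivative[OF c0(1) c(1) c0(2) c(2)])
  then have 2: "(snd c \<circ> chart_inv c0 has_derivative coord_change c0 c (\<gamma> t)) (at ((snd c0 \<circ> \<gamma>) t) within (snd c0 \<circ> \<gamma>) ` S)"
    using SO by (simp only: comp_apply) (rule has_derivative_subset, auto)
  have lin: "linear (coord_change c0 c (\<gamma> t))" by (rule linear_coord_change[OF c0(1) c(1) c0(2) c(2)])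
  have "((snd c \<circ> chart_inv c0) \<circ> (snd c0 \<circ> \<gamma>) has_derivative coord_change c0 c (\<gamma> t) \<circ> (\<lambda>h. h *\<^sub>R X (\<gamma> t))) (at t within S)"
    by (rule diff_chain_within[OF 1 2])
  then have "(snd c \<circ> \<gamma> has_derivative coord_change c0 c (\<gamma> t) \<circ> (\<lambda>h. h *\<^sub>R X (\<gamma> t))) (at t within S)"
    by (rule has_derivative_transform[OF tS(1), rotated]) (use SO chart_inv_left[OF c0(1)] in auto)
  moreover have "coord_change c0 c (\<gamma> t) \<circ> (\<lambda>h. h *\<^sub>R X (\<gamma> t)) = (\<lambda>h. h *\<^sub>R vf c (snd c (\<gamma> t)))"
    unfolding c0_def
    using chart_inv_left[OF c] by (simp add: fun_eq_iff linear_scale[OF lin[unfolded c0_def]] vf_def Let_def)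
  ultimately show ?thesis unfolding at_eq has_vector_derivative_def by simp
qed

lemma chart_field:
  assumes c: "c \<in> \<A>" "p \<in> dom c"
  shows "\<exists>h h' R L. 0 < R \<and> c1_vector_field h h' (snd c p) R L \<and> cball (snd c p) R \<inter> half_space \<subseteq> im c \<and>
    (\<forall>y\<in>cball (snd c p) R \<inter> half_space. h y = vf c y)"
proof -
  have 1: "C_on 1 (vf c) (im c)" using field c by (simp add: C1_vector_field_def vf_def[abs_def])
  have 2: "snd c p \<in> im c" using c by auto
  have 3: "enat (Suc 0) \<le> 1" by (simp add: one_enat_def)
  obtain W h where W: "open W" "snd c p \<in> W" "C_open (Suc 0) h W" "\<And>y. y \<in> im c \<Longrightarrow> y \<in> W \<Longrightarrow> h y = vf c y"
    using C_on_imp_C_open[OF 1 2 3] by metis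
  then obtain h' where h': "\<And>x. x \<in> W \<Longrightarrow> (h has_derivative h' x) (at x)" "\<And>v. continuous_on W (\<lambda>x. h' x v)" by auto
  obtain V where V: "open V" "im c = half_space \<inter> V"
    using chart[OF c(1)] by (auto simp: is_chart_def openin_open)
  have "open (W \<inter> V)" "snd c p \<in> W \<inter> V" using W V c by auto
  then obtain R where R: "0 < R" "cball (snd c p) R \<subseteq> W \<inter> V" by (meson open_contains_cball)
  have RW: "cball (snd c p) R \<subseteq> W" using R by blast
  obtain L where L: "0 < L" "\<forall>y\<in>cball (snd c p) R. \<forall>v. norm (h' y v) \<le> L * norm v"
  proof -
    have "\<exists>L>0. \<forall>y\<in>cball (snd c p) R. \<forall>v. norm (h' y v) \<le> L * norm v"
    proof (rule compact_linear_bound[OF compact_cball])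
      show "continuous_on (cball (snd c p) R) (\<lambda>y. h' y v)" for v using continuous_on_subset[OF h'(2) RW] .
      show "linear (h' y)" if "y \<in> cball (snd c p) R" for y
        using h'(1)[OF subsetD[OF RW that]] by (rule has_derivative_linear)
    qed
    then show ?thesis using that by blast
  qed
  have "c1_vector_field h h' (snd c p) R L"
  proof
    show "(h has_derivative h' y) (at y)" if "y \<in> cball (snd c p) R" for y using h'(1)[OF subsetD[OF RW that]] .
    show "continuous_on (cball (snd c p) R) (\<lambda>y. h' y v)" for v using continuous_on_subset[OF h'(2) RW] .
  qed (use L in auto)
  moreover have "cball (snd c p) R \<inter> half_space \<subseteq> im c" using R V by blast
  moreover have "\<forall>y\<in>cball (snd c p) R \<inter> half_space. h y = vf c y"
    using calculation(2) W(4) RW by blast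
  ultimately show ?thesis using R(1) by blast
qed

text \<open>A curve starting close to \<open>p\<close> cannot leave the chart before time \<open>\<tau>\<close>, since in coordinates
  its speed is bounded as long as it stays in the ball.\<close>

lemma local_flow:
  assumes c: "c \<in> \<A>" "p \<in> dom c"
  shows "\<exists>h h' R L r \<tau>. c1_vector_field h h' (snd c p) R L \<and> 0 < r \<and> 0 < \<tau> \<and> L * \<tau> \<le> 1 / 2 \<and>
    (\<forall>\<gamma>. integral_curve \<A> X \<gamma> {0..} \<longrightarrow> \<gamma> 0 \<in> dom c \<longrightarrow> snd c (\<gamma> 0) \<in> ball (snd c p) r \<longrightarrow>
      (\<forall>t\<in>{0..\<tau>}. \<gamma> t \<in> dom c) \<and> c1_vector_field.solution h (snd c p) R \<tau> (snd c \<circ> \<gamma>))"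
proof -
  let ?y0 = "snd c p"
  obtain h h' R L where R: "0 < R" "cball ?y0 R \<inter> half_space \<subseteq> im c"
    and c1: "c1_vector_field h h' ?y0 R L" and h: "\<And>y. y \<in> cball ?y0 R \<inter> half_space \<Longrightarrow> h y = vf c y"
    using chart_field[OF c] by metis
  interpret c1_vector_field h h' ?y0 R L by (rule c1)
  have "continuous_on (cball ?y0 R) h"
    using deriv by (meson continuous_at_imp_continuous_on has_derivative_continuous)
  then have "bounded (h ` cball ?y0 R)" by (intro compact_imp_bounded compact_continuous_image) auto
  then obtain B where B: "0 < B" "\<And>y. y \<in> cball ?y0 R \<Longrightarrow> norm (h y) \<le> B" unfolding bounded_pos by auto
  \<comment> \<open>The first bound keeps a curve that starts within R / 2 inside the ball of radius
    3 R / 4, since its speed is at most B; the second makes \<open>L * \<tau>\<close> at most 1 /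
    2.\<close>
  define \<tau> where "\<tau> = min (R / (4 * B)) (1 / (2 * (L + 1)))"
  have \<tau>: "0 < \<tau>" "B * \<tau> \<le> R / 4" "L * \<tau> \<le> 1 / 2"
  proof -
    show "0 < \<tau>" using R B L0 by (simp add: \<tau>_def)
    have "B * \<tau> \<le> B * (R / (4 * B))" using B by (intro mult_left_mono) (auto simp: \<tau>_def)
    then show "B * \<tau> \<le> R / 4" using B by simp
    have "L * \<tau> \<le> L * (1 / (2 * (L + 1)))" using L0 by (intro mult_left_mono) (auto simp: \<tau>_def)
    also have "\<dots> \<le> 1 / 2" using L0 by (simp add: field_simps)
    finally show "L * \<tau> \<le> 1 / 2" .
  qed
  define N where "N = chart_inv c ` (ball ?y0 R \<inter> half_space)"
  define K where "K = chart_inv c ` (cball ?y0 (3 * R / 4) \<inter> half_space)"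
  have half_closed: "closed (half_space :: 'n coords set)"
    unfolding half_space_def by (intro closed_Collect_le continuous_intros)
  have sub: "ball ?y0 R \<inter> half_space \<subseteq> im c" "cball ?y0 (3 * R / 4) \<inter> half_space \<subseteq> im c"
    "cball ?y0 (3 * R / 4) \<inter> half_space \<subseteq> ball ?y0 R \<inter> half_space"
  proof -
    show *: "ball ?y0 R \<inter> half_space \<subseteq> im c" using R(2) ball_subset_cball by blast
    show **: "cball ?y0 (3 * R / 4) \<inter> half_space \<subseteq> ball ?y0 R \<inter> half_space" using R(1) by auto
    show "cball ?y0 (3 * R / 4) \<inter> half_space \<subseteq> im c" using * ** by blast
  qed
  have "open N" unfolding N_def
    using sub(1) by (intro preimage_open[OF c(1)]) (auto simp: openin_open)
  have "compact (cball ?y0 (3 * R / 4) \<inter> half_space)" using half_closed by (intro compact_Int_closed) auto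
  then have "compact K" unfolding K_def
    using continuous_on_subset[OF continuous_chart_inv[OF c(1)] sub(2)] by (rule compact_continuous_image[rotated])
  then have "closed K" by (rule compact_imp_closed)
  have KN: "K \<subseteq> N" unfolding K_def N_def using sub(3) by blast
  have N_iff: "q \<in> dom c \<and> snd c q \<in> ball ?y0 R" if "q \<in> N" for q
    using that sub(1) chart_inv_right[OF c(1)] chart_inv_in[OF c(1)] unfolding N_def by auto
  have in_half: "snd c q \<in> half_space" if "q \<in> dom c" for q using im_half[OF c(1)] that by auto
  have curve: "(\<forall>t\<in>{0..\<tau>}. \<gamma> t \<in> dom c) \<and> solution \<tau> (snd c \<circ> \<gamma>)"
    if \<gamma>: "integral_curve \<A> X \<gamma> {0..}" "\<gamma> 0 \<in> dom c" "snd c (\<gamma> 0) \<in> ball ?y0 (R / 2)" for \<gamma>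
  proof -
    have cont: "continuous_on {0..} \<gamma>" using \<gamma>(1) by (simp add: integral_curve_def)
    have vd: "((snd c \<circ> \<gamma>) has_vector_derivative h (snd c (\<gamma> t))) (at t within {0..})" if "0 \<le> t" "\<gamma> t \<in> N" for t
    proof -
      have "snd c (\<gamma> t) \<in> cball ?y0 R \<inter> half_space" using N_iff[OF that(2)] in_half by auto
      then show ?thesis using integral_curve_in_chart[OF \<gamma>(1) that(1) c(1)] N_iff[OF that(2)] h by simp
    qed
    have stay: "\<gamma> s \<in> K" if s: "s \<in> {0..\<tau>}" "\<And>t. t \<in> {0..s} \<Longrightarrow> \<gamma> t \<in> N" for s
    proof -
      have "norm ((snd c \<circ> \<gamma>) s - (snd c \<circ> \<gamma>) 0) \<le> B * norm (s - 0)"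
      proof (rule differentiable_bound[of "{0..s}" _ "\<lambda>t u. u *\<^sub>R h (snd c (\<gamma> t))"])
        fix t assume t: "t \<in> {0..s}"
        have "((snd c \<circ> \<gamma>) has_vector_derivative h (snd c (\<gamma> t))) (at t within {0..s})"
          by (rule has_vector_derivative_within_subset[OF vd]) (use s(2)[OF t] t in auto)
        then show "((snd c \<circ> \<gamma>) has_derivative (\<lambda>u. u *\<^sub>R h (snd c (\<gamma> t)))) (at t within {0..s})"
          by (simp add: has_vector_derivative_def)
        have "norm (h (snd c (\<gamma> t))) \<le> B" using N_iff[OF s(2)[OF t]] by (intro B) auto
        then show "onorm (\<lambda>u. u *\<^sub>R h (snd c (\<gamma> t))) \<le> B"
          by (intro onorm_le) (simp add: mult.commute[of B] mult_left_mono)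
      qed (use s in auto)
      also have "\<dots> \<le> B * \<tau>" using s B by (intro mult_left_mono) auto
      finally have "norm (snd c (\<gamma> s) - snd c (\<gamma> 0)) \<le> R / 4" using \<tau>(2) by simp
      moreover have "norm (snd c (\<gamma> 0) - ?y0) < R / 2" using \<gamma>(3) by (simp add: dist_norm norm_minus_commute)
      ultimately have "norm (snd c (\<gamma> s) - ?y0) \<le> 3 * R / 4"
        using norm_triangle_ineq[of "snd c (\<gamma> s) - snd c (\<gamma> 0)" "snd c (\<gamma> 0) - ?y0"] by simp
      moreover have "\<gamma> s \<in> dom c" using N_iff[OF s(2)[of s]] s(1) by auto
      ultimately show ?thesis
        unfolding K_def using in_half chart_inv_left[OF c(1)]
        by (intro image_eqI[of _ _ "snd c (\<gamma> s)"]) (auto simp: dist_norm norm_minus_commute)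
    qed
    have "\<gamma> t \<in> N" if t: "t \<in> {0..\<tau>}" for t
    proof (rule ccontr)
      assume "\<gamma> t \<notin> N"
      define Z where "Z = {0..t} \<inter> \<gamma> -` (- N)"
      have "closed Z" unfolding Z_def
        using t \<open>open N\<close> by (intro continuous_closed_preimage continuous_on_subset[OF cont]) auto
      then have "compact Z" unfolding Z_def by (metis Int_commute bounded_Int bounded_closed_interval compact_eq_bounded_closed inf_le1 bounded_subset)
      moreover have "Z \<noteq> {}" using \<open>\<gamma> t \<notin> N\<close> t by (auto simp: Z_def)
      \<comment> \<open>The first time outside the open set N. Up to then the curve lies in the
        compact set K, which is closed because the manifold is Hausdorff, so at time s it still lies
        in K and hence in N.\<close>
      ultimately obtain s where s: "s \<in> Z" "\<And>u. u \<in> Z \<Longrightarrow> s \<le> u" using compact_attains_inf by metis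
      have "\<gamma> 0 \<in> N" unfolding N_def
        using \<gamma>(2,3) R(1) in_half chart_inv_left[OF c(1)] by (intro image_eqI[of _ _ "snd c (\<gamma> 0)"]) auto
      then have "s \<noteq> 0" "0 \<le> s" "s \<le> t" using s(1) by (auto simp: Z_def)
      then have s0: "0 < s" by simp
      have "\<gamma> u \<in> K" if "u \<in> {0..<s}" for u
      proof (rule stay)
        show "u \<in> {0..\<tau>}" using that \<open>s \<le> t\<close> t by auto
        show "\<gamma> v \<in> N" if "v \<in> {0..u}" for v
          using s(2)[of v] that \<open>u \<in> {0..<s}\<close> \<open>s \<le> t\<close> by (force simp: Z_def)
      qed
      then have "{0..<s} \<subseteq> {0..s} \<inter> \<gamma> -` K" by auto
      moreover have "closed ({0..s} \<inter> \<gamma> -` K)"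
        using \<open>closed K\<close> by (intro continuous_closed_preimage continuous_on_subset[OF cont]) auto
      ultimately have "closure {0..<s} \<subseteq> {0..s} \<inter> \<gamma> -` K" by (rule closure_minimal)
      moreover have "s \<in> closure {0..<s}" using s0 by simp
      ultimately have "\<gamma> s \<in> K" by blast
      then show False using s(1) KN by (auto simp: Z_def)
    qed
    then have all: "\<And>t. t \<in> {0..\<tau>} \<Longrightarrow> \<gamma> t \<in> N" .
    have "((snd c \<circ> \<gamma>) has_vector_derivative h ((snd c \<circ> \<gamma>) t)) (at t within {0..\<tau>})" if t: "t \<in> {0..\<tau>}" for t
    proof -
      have "((snd c \<circ> \<gamma>) has_vector_derivative h (snd c (\<gamma> t))) (at t within {0..\<tau>})"
        by (rule has_vector_derivative_within_subset[OF vd]) (use all[OF t] t in auto)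
      then show ?thesis by simp
    qed
    then show ?thesis using N_iff[OF all] by (auto simp: solution_def less_imp_le)
  qed
  show ?thesis
    using c1 R(1) \<tau> curve by (intro exI[of _ h] exI[of _ h'] exI[of _ R] exI[of _ L] exI[of _ "R / 2"] exI[of _ \<tau>]) simp
qed

text \<open>Keeps from the local theory only confinement to the chart and the Lipschitz estimate,
  for all pairs of integral curves. Applied to curves with the same starting point it gives
  uniqueness.\<close>

definition controlled :: "('m, 'n) chart \<Rightarrow> 'm \<Rightarrow> real \<Rightarrow> real \<Rightarrow> bool" where
  "controlled c p r \<tau> \<longleftrightarrow> 0 < r \<and> 0 < \<tau> \<and> (\<forall>\<gamma> \<delta>. integral_curve \<A> X \<gamma> {0..} \<longrightarrow> integral_curve \<A> X \<delta> {0..} \<longrightarrow>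
    \<gamma> 0 \<in> dom c \<longrightarrow> \<delta> 0 \<in> dom c \<longrightarrow> snd c (\<gamma> 0) \<in> ball (snd c p) r \<longrightarrow> snd c (\<delta> 0) \<in> ball (snd c p) r \<longrightarrow>
    (\<forall>t\<in>{0..\<tau>}. \<gamma> t \<in> dom c \<and> norm (snd c (\<gamma> t) - snd c (\<delta> t)) \<le> 2 * norm (snd c (\<gamma> 0) - snd c (\<delta> 0))))"

lemma controlled_exists:
  assumes c: "c \<in> \<A>" "p \<in> dom c"
  shows "\<exists>r \<tau>. controlled c p r \<tau>"
proof -
  obtain h h' R L r \<tau> where c1: "c1_vector_field h h' (snd c p) R L" and r: "0 < r" "0 < \<tau>" "L * \<tau> \<le> 1 / 2"
    and sol: "\<forall>\<gamma>. integral_curve \<A> X \<gamma> {0..} \<longrightarrow> \<gamma> 0 \<in> dom c \<longrightarrow> snd c (\<gamma> 0) \<in> ball (snd c p) r \<longrightarrow>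
      (\<forall>t\<in>{0..\<tau>}. \<gamma> t \<in> dom c) \<and> c1_vector_field.solution h (snd c p) R \<tau> (snd c \<circ> \<gamma>)"
    using local_flow[OF c] by (elim exE conjE) (rule that)
  interpret c1_vector_field h h' "snd c p" R L by (rule c1)
  have "controlled c p r \<tau>" unfolding controlled_def
  proof (intro conjI r allI impI ballI, goal_cases)
    case (1 \<gamma> \<delta> t)
    from sol[rule_format, THEN conjunct1, OF 1(1,3,5)] 1(7) show ?case by (rule bspec)
  next
    case (2 \<gamma> \<delta> t)
    from solution_lipschitz[OF sol[rule_format, THEN conjunct2, OF 2(1,3,5)] sol[rule_format, THEN conjunct2, OF 2(2,4,6)] r(3) 2(7), of 0]
    show ?case using r(2) by simp
  qed
  then show ?thesis by blast
qed

lemma integral_curve_shift: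
  assumes \<gamma>: "integral_curve \<A> X \<gamma> {0..}" and s: "0 \<le> s"
  shows "integral_curve \<A> X (\<lambda>t. \<gamma> (s + t)) {0..}"
  unfolding integral_curve_def
proof (intro conjI ballI)
  have "continuous_on {0..} \<gamma>" using \<gamma> by (simp add: integral_curve_def)
  then show "continuous_on {0..} (\<lambda>t. \<gamma> (s + t))"
    by (rule continuous_on_compose2) (use s in \<open>auto intro!: continuous_intros\<close>)
  fix t :: real assume t: "t \<in> {0..}"
  let ?c = "snd (chart_at \<A> (\<gamma> (s + t)))"
  have "((?c \<circ> \<gamma>) has_vector_derivative X (\<gamma> (s + t))) (at (s + t) within {0..})"
    using \<gamma> s t by (simp add: integral_curve_def)
  then have "((?c \<circ> \<gamma>) has_vector_derivative X (\<gamma> (s + t))) (at (s + t) within (\<lambda>t. s + t) ` {0..})"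
    by (rule has_vector_derivative_within_subset) (use s in auto)
  moreover have "((\<lambda>t. s + t) has_vector_derivative 1) (at t within {0..})"
    by (auto intro!: derivative_eq_intros)
  ultimately have "(((?c \<circ> \<gamma>) \<circ> (\<lambda>t. s + t)) has_vector_derivative 1 *\<^sub>R X (\<gamma> (s + t))) (at t within {0..})"
    by (intro vector_diff_chain_within)
  then show "((?c \<circ> (\<lambda>t. \<gamma> (s + t))) has_vector_derivative X (\<gamma> (s + t))) (at t within {0..})"
    by (simp add: o_def)
qed

text \<open>At the infimum s of the times of disagreement the curves agree by continuity, and the
  Lipschitz estimate started at s extends the agreement by a fixed time \<tau>.\<close>

lemma integral_curve_unique:
  assumes \<gamma>: "integral_curve \<A> X \<gamma> {0..}" and \<delta>: "integral_curve \<A> X \<delta> {0..}" and eq: "\<gamma> 0 = \<delta> 0" and t: "0 \<le> t"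
  shows "\<gamma> t = \<delta> t"
proof (rule ccontr)
  assume "\<gamma> t \<noteq> \<delta> t"
  define Z where "Z = {t. 0 \<le> t \<and> \<gamma> t \<noteq> \<delta> t}"
  have "Z \<noteq> {}" "bdd_below Z" using \<open>\<gamma> t \<noteq> \<delta> t\<close> t by (auto simp: Z_def intro: bdd_belowI[of _ 0])
  define s where "s = Inf Z"
  have s0: "0 \<le> s" unfolding s_def using \<open>Z \<noteq> {}\<close> by (intro cInf_greatest) (auto simp: Z_def)
  have before: "\<gamma> u = \<delta> u" if "u \<in> {0..<s}" for u
    using cInf_lower[OF _ \<open>bdd_below Z\<close>, of u] that by (auto simp: Z_def s_def)
  have cont: "continuous_on {0..} \<gamma>" "continuous_on {0..} \<delta>" using \<gamma> \<delta> by (auto simp: integral_curve_def)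
  have at_s: "\<gamma> s = \<delta> s"
  proof (cases "s = 0")
    case False
    then have "0 < s" using s0 by simp
    have "isCont \<gamma> s" "isCont \<delta> s"
      using continuous_on_interior[OF cont(1), of s] continuous_on_interior[OF cont(2), of s] \<open>0 < s\<close> by auto
    then have "(\<gamma> \<longlongrightarrow> \<gamma> s) (at_left s)" "(\<delta> \<longlongrightarrow> \<delta> s) (at_left s)"
      unfolding isCont_def by (auto intro: tendsto_within_subset)
    moreover have "\<forall>\<^sub>F u in at_left s. \<gamma> u = \<delta> u"
      using eventually_at_left_real[OF \<open>0 < s\<close>] by (rule eventually_mono) (auto intro: before)
    ultimately show ?thesis
      using tendsto_unique[OF trivial_limit_at_left_real, of \<gamma> "\<gamma> s" s "\<delta> s"]
      by (metis (mono_tags, lifting) eventually_mono tendsto_cong)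
  qed (use eq in simp)
  define c where "c = chart_at \<A> (\<gamma> s)"
  have c: "c \<in> \<A>" "\<gamma> s \<in> dom c" unfolding c_def by (rule chart_at)+
  obtain r \<tau> where ctl: "controlled c (\<gamma> s) r \<tau>" using controlled_exists[OF c] by blast
  then have r: "0 < r" "0 < \<tau>" by (auto simp: controlled_def)
  note lip = ctl[unfolded controlled_def, THEN conjunct2, THEN conjunct2]
  note shift = integral_curve_shift[OF \<gamma> s0] integral_curve_shift[OF \<delta> s0]
  have after: "\<gamma> (s + u) = \<delta> (s + u)" if u: "u \<in> {0..\<tau>}" for u
  proof -
    have "\<gamma> (s + u) \<in> dom c" "\<delta> (s + u) \<in> dom c" "norm (snd c (\<gamma> (s + u)) - snd c (\<delta> (s + u))) \<le> 0"
      using lip[rule_format, OF shift _ _ _ _ u] lip[rule_format, OF shift(2,1) _ _ _ _ u] c r(1) at_s by auto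
    then show ?thesis using chart_inv_left[OF c(1)] by (metis norm_le_zero_iff right_minus_eq)
  qed
  have "s + \<tau> \<le> z" if "z \<in> Z" for z
  proof (rule ccontr)
    assume "\<not> s + \<tau> \<le> z"
    then show False using before[of z] after[of "z - s"] that by (cases "z < s") (auto simp: Z_def)
  qed
  then have "s + \<tau> \<le> s" unfolding s_def[symmetric] using \<open>Z \<noteq> {}\<close> cInf_greatest[of Z "s + \<tau>"] by (simp add: s_def)
  then show False using r(2) by simp
qed

lemma flow_zero: "\<phi> 0 x = x"
  using flow by (simp add: is_flow_def)

lemma flow_curve: "integral_curve \<A> X (\<lambda>t. \<phi> t x) {0..}"
  using flow by (simp add: is_flow_def)

lemma flow_inverse: "0 \<le> t \<Longrightarrow> \<phi> (- t) (\<phi> t x) = x"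
  using flow by (simp add: is_flow_def)

lemma flow_semigroup: "0 \<le> s \<Longrightarrow> 0 \<le> t \<Longrightarrow> \<phi> (s + t) x = \<phi> s (\<phi> t x)"
  using integral_curve_unique[OF integral_curve_shift[OF flow_curve] flow_curve, of t x "\<phi> t x" s]
  by (simp add: flow_zero add.commute)

lemma controlled_flow:
  assumes "controlled c p r \<tau>" "q \<in> dom c" "q' \<in> dom c" "snd c q \<in> ball (snd c p) r" "snd c q' \<in> ball (snd c p) r" "t \<in> {0..\<tau>}"
  shows "\<phi> t q \<in> dom c" "norm (snd c (\<phi> t q) - snd c (\<phi> t q')) \<le> 2 * norm (snd c q - snd c q')"
  using assms(1)[unfolded controlled_def, THEN conjunct2, THEN conjunct2, rule_format, OF flow_curve flow_curve, unfolded flow_zero, OF assms(2-)]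
  by auto

lemma chart_ball_open:
  assumes c: "c \<in> \<A>" shows "open {q \<in> dom c. snd c q \<in> ball y r}"
proof -
  have "openin (top_of_set (dom c)) (dom c \<inter> snd c -` ball y r)"
    using continuous_chart[OF c] by (intro continuous_openin_preimage_gen) auto
  moreover have "dom c \<inter> snd c -` ball y r = {q \<in> dom c. snd c q \<in> ball y r}" by auto
  ultimately show ?thesis using open_dom[OF c] by (simp add: openin_open_eq)
qed

lemma flow_short_continuous: "\<exists>\<tau>>0. \<exists>N. open N \<and> p \<in> N \<and> (\<forall>t\<in>{0..\<tau>}. continuous_on N (\<phi> t))"
proof -
  define c where "c = chart_at \<A> p"
  have c: "c \<in> \<A>" "p \<in> dom c" unfolding c_def by (rule chart_at)+
  obtain r \<tau> where ctl: "controlled c p r \<tau>" using controlled_exists[OF c] by blast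
  then have r: "0 < r" "0 < \<tau>" by (auto simp: controlled_def)
  note lip = controlled_flow[OF ctl]
  define N where "N = {q \<in> dom c. snd c q \<in> ball (snd c p) r}"
  have N: "open N" "p \<in> N" unfolding N_def using chart_ball_open[OF c(1)] c r by auto
  have "continuous_on N (\<phi> t)" if t: "t \<in> {0..\<tau>}" for t
  proof -
    have "continuous_on N (\<lambda>q. snd c (\<phi> t q))"
      unfolding continuous_on_def
    proof
      fix q assume q: "q \<in> N"
      have "(snd c \<longlongrightarrow> snd c q) (at q within N)"
        by (rule tendsto_within_subset[of _ _ _ UNIV]) (use isCont_chart[OF c(1), of q] q in \<open>auto simp: N_def isCont_def\<close>)
      then have "((\<lambda>q'. 2 * norm (snd c q' - snd c q)) \<longlongrightarrow> 2 * norm (snd c q - snd c q)) (at q within N)"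
        by (intro tendsto_intros)
      then have "((\<lambda>q'. 2 * norm (snd c q' - snd c q)) \<longlongrightarrow> 0) (at q within N)" by simp
      then have "((\<lambda>q'. snd c (\<phi> t q') - snd c (\<phi> t q)) \<longlongrightarrow> 0) (at q within N)"
        by (rule Lim_null_comparison[rotated]) (use lip q t in \<open>auto simp: eventually_at_topological N_def\<close>)
      then show "((\<lambda>q'. snd c (\<phi> t q')) \<longlongrightarrow> snd c (\<phi> t q)) (at q within N)" by (rule LIM_zero_cancel)
    qed
    then have "continuous_on N (\<lambda>q. chart_inv c (snd c (\<phi> t q)))"
      using lip t by (intro continuous_on_compose2[OF continuous_chart_inv[OF c(1)]]) (auto simp: N_def)
    then show ?thesis
      by (rule continuous_on_eq) (use lip t chart_inv_left[OF c(1)] in \<open>auto simp: N_def\<close>)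
  qed
  then show ?thesis using N r by blast
qed

text \<open>Compactness of the manifold gives one time step that works at all points; longer times
  are compositions.\<close>

lemma isCont_flow: assumes "0 \<le> t" shows "isCont (\<phi> t) p"
proof -
  have "\<exists>C\<ge>1. \<forall>q\<in>UNIV. \<forall>t. 0 \<le> t \<longrightarrow> t * C \<le> 1 \<longrightarrow> isCont (\<phi> t) q"
  proof (rule compact_uniform[OF compact_M], goal_cases)
    case (1 C C' q)
    then show ?case using mult_left_mono order_trans by blast
  next
    case (2 p)
    obtain \<tau> N where \<tau>: "0 < \<tau>" and N: "open N" "p \<in> N" "\<forall>t\<in>{0..\<tau>}. continuous_on N (\<phi> t)"
      using flow_short_continuous[of p] by (elim exE conjE) (rule that)
    have "isCont (\<phi> t) q" if "q \<in> N" "0 \<le> t" "t * (1 / \<tau>) \<le> 1" for q t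
      using N that \<tau> continuous_on_eq_continuous_at[OF N(1), of "\<phi> t"] by (auto simp: field_simps)
    then show ?case using N by blast
  qed
  then obtain C where C: "1 \<le> C" "\<And>q t. 0 \<le> t \<Longrightarrow> t * C \<le> 1 \<Longrightarrow> isCont (\<phi> t) q" by blast
  have "\<forall>p. isCont (\<phi> t) p"
  proof (rule short_time_induct[OF C(1) assms], goal_cases)
    case (2 s t)
    have "\<phi> (t + s) = (\<lambda>x. \<phi> t (\<phi> s x))" using flow_semigroup[of t s] 2 by auto
    then show ?case using 2(4) by (auto intro: isCont_o2 C(2)[OF 2(2,3)])
  qed (use C in blast)
  then show ?thesis by blast
qed

lemma flow_continuous: "0 \<le> t \<Longrightarrow> continuous_on S (\<phi> t)"
  using isCont_flow by (simp add: continuous_at_imp_continuous_on)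

end

section \<open>The invariant set and the derivative of the flow over it\<close>

locale manifold_flow_set = manifold_flow \<A> X \<phi>
  for \<A> :: "('m::{t2_space,second_countable_topology}, 'n::{finite,linorder}) chart set" and X \<phi> +
  fixes \<Gamma> :: "'m set"
  assumes compact_\<Gamma>: "compact \<Gamma>" and invariant: "invariant_set \<phi> \<Gamma>"
begin

abbreviation "DX \<equiv> flow_deriv \<A> \<phi>"

lemma flow_in: "x \<in> \<Gamma> \<Longrightarrow> \<phi> t x \<in> \<Gamma>"
  using invariant by (auto simp: invariant_set_def)

lemma flow_inverse': assumes "x \<in> \<Gamma>" shows "\<phi> t (\<phi> (- t) x) = x"
proof (cases "0 \<le> t")
  case True
  obtain y where "x = \<phi> t y" using invariant assms unfolding invariant_set_def by blast
  then show ?thesis using flow_inverse[OF True] by simp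
next
  case False
  then show ?thesis using flow_inverse[of "- t" x] by simp
qed

text \<open>For times of arbitrary sign both sides are pushed forward by a time u so long that the
  totals become nonnegative, where uniqueness of curves applies; \<open>\<phi> (- u)\<close> then
  undoes the push.\<close>

lemma flow_add: assumes x: "x \<in> \<Gamma>" shows "\<phi> (s + t) x = \<phi> s (\<phi> t x)"
proof -
  have *: "\<phi> u (\<phi> s x) = \<phi> (u + s) x" if "x \<in> \<Gamma>" "0 \<le> u" "0 \<le> u + s" for u s x
  proof (cases "0 \<le> s")
    case True
    then show ?thesis using flow_semigroup that by simp
  next
    case False
    have "\<phi> (u + s) (\<phi> (- s) (\<phi> s x)) = \<phi> (u + s + - s) (\<phi> s x)"
      using False that by (intro flow_semigroup[symmetric]) auto
    then show ?thesis using flow_inverse'[OF that(1), of "- s"] by simp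
  qed
  define u where "u = \<bar>s\<bar> + \<bar>t\<bar>"
  have "\<phi> u (\<phi> (s + t) x) = \<phi> (u + (s + t)) x" by (rule *[OF x]) (auto simp: u_def)
  also have "\<dots> = \<phi> ((u + s) + t) x" by (simp add: add.assoc)
  also have "\<dots> = \<phi> (u + s) (\<phi> t x)" by (rule *[OF x, symmetric]) (auto simp: u_def)
  also have "\<dots> = \<phi> u (\<phi> s (\<phi> t x))" by (rule *[OF flow_in[OF x], symmetric]) (auto simp: u_def)
  finally have "\<phi> (- u) (\<phi> u (\<phi> (s + t) x)) = \<phi> (- u) (\<phi> u (\<phi> s (\<phi> t x)))" by simp
  then show ?thesis using flow_inverse[of u] by (simp add: u_def)
qed

text \<open>A point of \<open>\<Gamma>\<close> has a past, which would lie outside the half-space if the point were on the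
  boundary, where the field points inwards.\<close>

lemma interior_\<Gamma>: assumes p: "p \<in> \<Gamma>" shows "interior_point p"
  unfolding interior_point_def
proof (intro ballI impI)
  fix c assume c: "c \<in> \<A>" "p \<in> dom c"
  let ?m = "Max (UNIV :: 'n set)"
  \<comment> \<open>Seen from \<open>q\<close>, the point p is reached at the interior time 1, so
    the derivative there is two-sided and earlier times are available.\<close>
  define q where "q = \<phi> (- 1) p"
  have q: "\<phi> 1 q = p" using flow_inverse'[OF p, of 1] by (simp add: q_def)
  have ge: "0 \<le> snd c x $ ?m" if "x \<in> dom c" for x
    using im_half[OF c(1)] that by (auto simp: half_space_def)
  show "0 < snd c p $ ?m"
  proof (rule ccontr)
    assume "\<not> 0 < snd c p $ ?m"
    then have zero: "snd c p $ ?m = 0" using ge[OF c(2)] by simp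
    have pos: "0 < vf c (snd c p) $ ?m"
      using inward c zero chart_inv_left[OF c] by (simp add: inwardly_transverse_def vf_def Let_def)
    let ?u = "\<lambda>t. snd c (\<phi> t q) $ ?m"
    have "((snd c \<circ> (\<lambda>t. \<phi> t q)) has_vector_derivative vf c (snd c (\<phi> 1 q))) (at 1 within {0..})"
      using c q by (intro integral_curve_in_chart[OF flow_curve]) auto
    moreover have "at (1::real) within {0..} = at 1" by (rule at_within_interior) simp
    ultimately have "((\<lambda>t. snd c (\<phi> t q)) has_vector_derivative vf c (snd c p)) (at 1)"
      using q by (simp add: o_def)
    then have "(?u has_vector_derivative vf c (snd c p) $ ?m) (at 1)"
      by (rule bounded_linear.has_vector_derivative[OF bounded_linear_vec_nth])
    then have "DERIV ?u 1 :> vf c (snd c p) $ ?m"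
      by (simp add: has_real_derivative_iff_has_vector_derivative)
    then obtain d where d: "0 < d" "\<And>h. 0 < h \<Longrightarrow> h < d \<Longrightarrow> ?u (1 - h) < ?u 1"
      using DERIV_pos_inc_left[OF _ pos] by blast
    have "continuous_on {0..} (\<lambda>t. \<phi> t q)" using flow_curve[of q] by (simp add: integral_curve_def)
    then have "isCont (\<lambda>t. \<phi> t q) 1" by (rule continuous_on_interior) simp
    moreover have "open (dom c)" "\<phi> 1 q \<in> dom c" using open_dom c q by auto
    ultimately have "\<forall>\<^sub>F t in at 1. \<phi> t q \<in> dom c" unfolding isCont_def by (rule topological_tendstoD)
    then obtain e where e: "0 < e" "\<And>t. t \<noteq> 1 \<Longrightarrow> dist t 1 < e \<Longrightarrow> \<phi> t q \<in> dom c"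
      unfolding eventually_at by auto
    define h where "h = min d e / 2"
    have h: "0 < h" "h < d" "h < e" using d e by (auto simp: h_def)
    have "?u (1 - h) < 0" using d(2)[OF h(1,2)] q zero by simp
    moreover have "0 \<le> ?u (1 - h)" using h by (intro ge e) (auto simp: dist_real_def)
    ultimately show False by simp
  qed
qed

text \<open>T represents the derivative in every pair of charts simultaneously;
  \<open>fdiffI\<close> shows that one pair is enough.\<close>

definition fdiff :: "real \<Rightarrow> 'm \<Rightarrow> ('n coords \<Rightarrow> 'n coords) \<Rightarrow> bool" where
  "fdiff t p T \<longleftrightarrow> linear T \<and> (\<forall>c\<in>\<A>. \<forall>c'\<in>\<A>. p \<in> dom c \<longrightarrow> \<phi> t p \<in> dom c' \<longrightarrow>
    (snd c' \<circ> \<phi> t \<circ> chart_inv c has_derivative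
      (\<lambda>v. to_chart c' (\<phi> t p) (T (of_chart c p v)))) (at (snd c p)))"

text \<open>The chain rule with transition maps on both sides. Continuity at p keeps nearby images
  in the domain of c'; for negative t it has to be supplied, as \<open>\<phi> t\<close> is arbitrary
  off the image of the forward map.\<close>

lemma fdiffI:
  assumes p: "p \<in> \<Gamma>" and cont: "isCont (\<phi> t) p" and c: "c \<in> \<A>" "p \<in> dom c" and c': "c' \<in> \<A>" "\<phi> t p \<in> dom c'"
    and D: "(snd c' \<circ> \<phi> t \<circ> chart_inv c has_derivative D) (at (snd c p))"
  shows "fdiff t p (\<lambda>v. of_chart c' (\<phi> t p) (D (to_chart c p v)))"
  unfolding fdiff_def
proof (intro conjI ballI impI)
  let ?q = "\<phi> t p"
  have ip: "interior_point p" and iq: "interior_point ?q" using p flow_in interior_\<Gamma> by auto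
  show "linear (\<lambda>v. of_chart c' ?q (D (to_chart c p v)))"
    using linear_compose[OF linear_compose[OF linear_coord_change[OF chart_at(1) c(1) chart_at(2) c(2)] has_derivative_linear[OF D]]
        linear_coord_change[OF c'(1) chart_at(1) c'(2) chart_at(2)]] by (simp add: o_def)
  fix d d' assume d: "d \<in> \<A>" "d' \<in> \<A>" "p \<in> dom d" "?q \<in> dom d'"
  have 1: "(snd c \<circ> chart_inv d has_derivative coord_change d c p) (at (snd d p))"
    by (rule transition_derivative_interior[OF d(1) c(1) d(3) c(2) ip])
  have 2: "(snd c' \<circ> \<phi> t \<circ> chart_inv c has_derivative D) (at ((snd c \<circ> chart_inv d) (snd d p)))"
    using D chart_inv_left[OF d(1,3)] by simp
  note 12 = diff_chain_at[OF 1 2]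
  have 3: "(snd d' \<circ> chart_inv c' has_derivative coord_change c' d' ?q)
      (at ((snd c' \<circ> \<phi> t \<circ> chart_inv c \<circ> (snd c \<circ> chart_inv d)) (snd d p)))"
    using transition_derivative_interior[OF c'(1) d(2) c'(2) d(4) iq] chart_inv_left[OF d(1,3)] chart_inv_left[OF c] by simp
  have "((snd d' \<circ> chart_inv c') \<circ> (snd c' \<circ> \<phi> t \<circ> chart_inv c \<circ> (snd c \<circ> chart_inv d))
      has_derivative coord_change c' d' ?q \<circ> (D \<circ> coord_change d c p)) (at (snd d p))"
    by (rule diff_chain_at[OF 12 3])
  then have "(snd d' \<circ> \<phi> t \<circ> chart_inv d has_derivative coord_change c' d' ?q \<circ> (D \<circ> coord_change d c p)) (at (snd d p))"
  proof (rule has_derivative_transform_eventually)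
    have "(\<phi> t \<longlongrightarrow> \<phi> t p) (nhds p)" using cont by (simp add: isCont_def tendsto_at_iff_tendsto_nhds)
    then have "\<forall>\<^sub>F r in nhds p. \<phi> t r \<in> dom c'" using open_dom[OF c'(1)] c'(2) by (rule topological_tendstoD)
    moreover have "\<forall>\<^sub>F r in nhds p. r \<in> dom c" using open_dom[OF c(1)] c(2) by (rule eventually_nhds_in_open)
    ultimately have "\<forall>\<^sub>F r in nhds p. r \<in> dom c \<and> \<phi> t r \<in> dom c'" by (auto intro: eventually_conj)
    from eventually_chart[OF d(1,3) ip this]
    have "\<forall>\<^sub>F y in nhds (snd d p). ((snd d' \<circ> chart_inv c') \<circ> (snd c' \<circ> \<phi> t \<circ> chart_inv c \<circ> (snd c \<circ> chart_inv d))) y = (snd d' \<circ> \<phi> t \<circ> chart_inv d) y"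
      by (rule eventually_mono) (use chart_inv_left[OF c(1)] chart_inv_left[OF c'(1)] in auto)
    then show "\<forall>\<^sub>F y in at (snd d p). ((snd d' \<circ> chart_inv c') \<circ> (snd c' \<circ> \<phi> t \<circ> chart_inv c \<circ> (snd c \<circ> chart_inv d))) y = (snd d' \<circ> \<phi> t \<circ> chart_inv d) y"
      by (simp add: eventually_nhds_conv_at)
  qed (use chart_inv_left[OF d(1,3)] chart_inv_left[OF c] chart_inv_left[OF c'] in auto)
  moreover have "coord_change c' d' ?q \<circ> (D \<circ> coord_change d c p) =
      (\<lambda>v. to_chart d' ?q (of_chart c' ?q (D (to_chart c p (of_chart d p v)))))"
    using coord_change_compose[OF d(1) chart_at(1) c(1) d(3) chart_at(2) c(2) ip]
      coord_change_compose[OF c'(1) chart_at(1) d(2) c'(2) chart_at(2) d(4) iq] by (simp add: fun_eq_iff)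
  ultimately show "(snd d' \<circ> \<phi> t \<circ> chart_inv d has_derivative
      (\<lambda>v. to_chart d' ?q (of_chart c' ?q (D (to_chart c p (of_chart d p v)))))) (at (snd d p))"
    by simp
qed

lemma flow_deriv_in_charts:
  assumes "p \<in> \<Gamma>" "fdiff t p T" "c \<in> \<A>" "p \<in> dom c" "c' \<in> \<A>" "\<phi> t p \<in> dom c'"
  shows "(snd c' \<circ> \<phi> t \<circ> chart_inv c has_derivative
      (\<lambda>v. to_chart c' (\<phi> t p) (T (of_chart c p v)))) (at (snd c p))"
  using assms unfolding fdiff_def by blast

lemma fdiff_flow_deriv:
  assumes p: "p \<in> \<Gamma>" and T: "fdiff t p T"
  shows "DX t p = T"
proof -
  let ?c = "chart_at \<A> p" and ?c' = "chart_at \<A> (\<phi> t p)"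
  have ip: "interior_point p" and iq: "interior_point (\<phi> t p)" using p flow_in interior_\<Gamma> by auto
  have "(snd ?c' \<circ> \<phi> t \<circ> chart_inv ?c has_derivative T) (at (snd ?c p))"
    using flow_deriv_in_charts[OF p T chart_at chart_at] coord_change_refl[OF chart_at ip] coord_change_refl[OF chart_at iq]
    by simp
  moreover have "at (snd ?c p) within im ?c = at (snd ?c p)"
    using ip chart_at[of p] open_dom[OF chart_at(1)]
    by (intro at_within_interior image_interior) (auto simp: interior_point_def)
  ultimately show ?thesis
    unfolding flow_deriv_def Let_def using frechet_derivative_at by metis
qed

lemma fdiff_compose:
  assumes p: "p \<in> \<Gamma>" and s: "0 \<le> s" "fdiff s p S" and t: "0 \<le> t" "fdiff t (\<phi> s p) T"
  shows "fdiff (t + s) p (\<lambda>v. T (S v))"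
proof -
  let ?q = "\<phi> s p" and ?r = "\<phi> (t + s) p"
  have r: "?r = \<phi> t ?q" using flow_semigroup[OF t(1) s(1)] .
  have q: "?q \<in> \<Gamma>" and rG: "?r \<in> \<Gamma>" using p flow_in by auto
  have ip: "interior_point p" and iq: "interior_point ?q" and ir: "interior_point ?r" using p q rG interior_\<Gamma> by auto
  let ?c = "chart_at \<A> p" and ?c' = "chart_at \<A> ?q" and ?c'' = "chart_at \<A> ?r"
  have 1: "(snd ?c' \<circ> \<phi> s \<circ> chart_inv ?c has_derivative S) (at (snd ?c p))"
    using flow_deriv_in_charts[OF p s(2) chart_at chart_at] coord_change_refl[OF chart_at ip] coord_change_refl[OF chart_at iq] by simp
  have 2: "(snd ?c'' \<circ> \<phi> t \<circ> chart_inv ?c' has_derivative T) (at ((snd ?c' \<circ> \<phi> s \<circ> chart_inv ?c) (snd ?c p)))"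
    using flow_deriv_in_charts[OF q t(2) chart_at, of ?c''] chart_at[of ?r] coord_change_refl[OF chart_at iq] coord_change_refl[OF chart_at ir]
      chart_inv_left[OF chart_at[of p]] by (simp add: r)
  have "((snd ?c'' \<circ> \<phi> t \<circ> chart_inv ?c') \<circ> (snd ?c' \<circ> \<phi> s \<circ> chart_inv ?c) has_derivative T \<circ> S) (at (snd ?c p))"
    by (rule diff_chain_at[OF 1 2])
  then have D: "(snd ?c'' \<circ> \<phi> (t + s) \<circ> chart_inv ?c has_derivative T \<circ> S) (at (snd ?c p))"
  proof (rule has_derivative_transform_eventually)
    have "(\<phi> s \<longlongrightarrow> \<phi> s p) (nhds p)" using isCont_flow[OF s(1)] by (simp add: isCont_def tendsto_at_iff_tendsto_nhds)
    then have "\<forall>\<^sub>F r in nhds p. \<phi> s r \<in> dom ?c'" using open_dom[OF chart_at(1)] chart_at(2) by (rule topological_tendstoD)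
    from eventually_chart[OF chart_at ip this]
    have "\<forall>\<^sub>F y in nhds (snd ?c p). ((snd ?c'' \<circ> \<phi> t \<circ> chart_inv ?c') \<circ> (snd ?c' \<circ> \<phi> s \<circ> chart_inv ?c)) y = (snd ?c'' \<circ> \<phi> (t + s) \<circ> chart_inv ?c) y"
      by (rule eventually_mono) (use chart_inv_left[OF chart_at(1)] flow_semigroup[OF t(1) s(1)] in auto)
    then show "\<forall>\<^sub>F y in at (snd ?c p). ((snd ?c'' \<circ> \<phi> t \<circ> chart_inv ?c') \<circ> (snd ?c' \<circ> \<phi> s \<circ> chart_inv ?c)) y = (snd ?c'' \<circ> \<phi> (t + s) \<circ> chart_inv ?c) y"
      by (simp add: eventually_nhds_conv_at)
  qed (use chart_inv_left[OF chart_at[of p]] chart_inv_left[OF chart_at[of ?q]] r in auto)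
  have "0 \<le> t + s" using s t by simp
  from fdiffI[OF p isCont_flow[OF this] chart_at chart_at D] show ?thesis
    using coord_change_refl[OF chart_at ip] coord_change_refl[OF chart_at ir] by (simp add: o_def)
qed

text \<open>Up to time \<open>1 / C\<close> the orbit of \<open>q\<close> stays in the chart \<open>c\<close>, where the flow is strictly
  differentiable, with derivative close to the identity.\<close>

definition flow_box :: "('m, 'n) chart \<Rightarrow> real \<Rightarrow> 'm \<Rightarrow> bool" where
  "flow_box c C q \<longleftrightarrow> c \<in> \<A> \<and> q \<in> dom c \<and> (\<forall>t. 0 \<le> t \<longrightarrow> t * C \<le> 1 \<longrightarrow> \<phi> t q \<in> dom c \<and>
    (\<exists>f'. strict_derivative (snd c \<circ> \<phi> t \<circ> chart_inv c) f' (snd c q) \<and> (\<forall>v. norm (f' v) \<le> 2 * norm v \<and> norm v \<le> 2 * norm (f' v))))"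

lemma flow_box_local:
  assumes p: "p \<in> \<Gamma>"
  shows "\<exists>c C N. open N \<and> p \<in> N \<and> (\<forall>q\<in>N \<inter> \<Gamma>. flow_box c C q)"
proof -
  define c where "c = chart_at \<A> p"
  have c: "c \<in> \<A>" "p \<in> dom c" unfolding c_def by (rule chart_at)+
  obtain h h' R L r \<tau> where c1: "c1_vector_field h h' (snd c p) R L" and r: "0 < r" "0 < \<tau>" "L * \<tau> \<le> 1 / 2"
    and sol: "\<forall>\<gamma>. integral_curve \<A> X \<gamma> {0..} \<longrightarrow> \<gamma> 0 \<in> dom c \<longrightarrow> snd c (\<gamma> 0) \<in> ball (snd c p) r \<longrightarrow>
      (\<forall>t\<in>{0..\<tau>}. \<gamma> t \<in> dom c) \<and> c1_vector_field.solution h (snd c p) R \<tau> (snd c \<circ> \<gamma>)"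
    using local_flow[OF c] by (elim exE conjE) (rule that)
  note sol = sol[rule_format, OF flow_curve, unfolded flow_zero]
  interpret c1_vector_field h h' "snd c p" R L by (rule c1)
  define N where "N = {q \<in> dom c. snd c q \<in> ball (snd c p) r}"
  have N: "open N" "p \<in> N" unfolding N_def using chart_ball_open[OF c(1)] c r by auto
  have "flow_box c (1 / \<tau>) q" if q: "q \<in> N \<inter> \<Gamma>" for q
    unfolding flow_box_def
  proof (intro conjI allI impI)
    show "c \<in> \<A>" "q \<in> dom c" using c q by (auto simp: N_def)
    fix t assume "0 \<le> t" "t * (1 / \<tau>) \<le> 1"
    then have t: "t \<in> {0..\<tau>}" using r(2) by (simp add: field_simps)
    then show "\<phi> t q \<in> dom c" using sol q by (auto simp: N_def)
    \<comment> \<open>Points of \<Gamma> are interior, so a full ball of coordinate vectors around q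
      consists of starting points, as the estimates on difference quotients require.\<close>
    have "snd c q \<in> interior (snd c ` N)"
      using q interior_\<Gamma>[of q] c(1) N by (intro image_interior) (auto simp: N_def interior_point_def)
    then obtain r' where r': "0 < r'" "ball (snd c q) r' \<subseteq> snd c ` N"
      by (meson interior_subset mem_interior subset_trans)
    define \<psi> where "\<psi> z t = snd c (\<phi> t (chart_inv c z))" for z t
    have \<psi>: "solution \<tau> (\<psi> z) \<and> \<psi> z 0 = z" if z: "z \<in> ball (snd c q) r'" for z
    proof -
      obtain q' where q': "q' \<in> N" "z = snd c q'" using r'(2) z by blast
      then have "\<psi> z = snd c \<circ> (\<lambda>t. \<phi> t q')" using chart_inv_left[OF c(1)] by (simp add: N_def \<psi>_def fun_eq_iff)
      then show ?thesis using sol q' by (simp add: N_def flow_zero)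
    qed
    obtain f' where f': "strict_derivative (\<lambda>z. \<psi> z t) f' (snd c q)" "\<And>v. norm (f' v) \<le> 2 * norm v"
      using solution_strict_derivative[OF \<psi> r'(1) r(3) t] by blast
    have "norm v \<le> 2 * norm (f' v)" for v
      by (rule solution_strict_derivative_ge[OF \<psi> r'(1) r(3) t f'(1)])
    moreover have "(\<lambda>z. \<psi> z t) = snd c \<circ> \<phi> t \<circ> chart_inv c" by (simp add: \<psi>_def fun_eq_iff)
    ultimately show "\<exists>f'. strict_derivative (snd c \<circ> \<phi> t \<circ> chart_inv c) f' (snd c q) \<and> (\<forall>v. norm (f' v) \<le> 2 * norm v \<and> norm v \<le> 2 * norm (f' v))"
      using f' by auto
  qed
  then show ?thesis using N by blast
qed

lemma flow_box_uniform: "\<exists>C\<ge>1. \<forall>q\<in>\<Gamma>. \<exists>c. flow_box c C q"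
proof (rule compact_uniform[OF compact_\<Gamma>])
  fix C C' q assume "\<exists>c. flow_box c C q" and le: "C \<le> C'"
  then obtain c where box: "flow_box c C q" by blast
  have "t * C \<le> 1" if "0 \<le> t" "t * C' \<le> 1" for t
    using mult_left_mono[OF le that(1)] that(2) by simp
  with box have "flow_box c C' q" by (simp add: flow_box_def)
  then show "\<exists>c. flow_box c C' q" by blast
next
  fix p assume p: "p \<in> \<Gamma>"
  obtain c C N where "open N" "p \<in> N" "\<forall>q\<in>N \<inter> \<Gamma>. flow_box c C q"
    using flow_box_local[OF p] by (elim exE conjE) (rule that)
  then show "\<exists>C U. open U \<and> p \<in> U \<and> (\<forall>q\<in>U \<inter> \<Gamma>. \<exists>c. flow_box c C q)"
    by (intro exI[of _ C] exI[of _ N] conjI ballI exI[of _ c]) auto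
qed

lemma inj_coord_change:
  assumes "c \<in> \<A>" "c' \<in> \<A>" "p \<in> dom c" "p \<in> dom c'" "interior_point p"
  shows "inj (coord_change c c' p)"
  using coord_change_compose[OF assms(1,2,1,3,4,3,5)] coord_change_refl[OF assms(1,3,5)]
  by (metis injI)

lemma fdiff_short:
  assumes p: "p \<in> \<Gamma>" and t: "0 \<le> t" and c: "c \<in> \<A>" "p \<in> dom c" "\<phi> t p \<in> dom c"
    and f': "strict_derivative (snd c \<circ> \<phi> t \<circ> chart_inv c) f' (snd c p)"
  shows "fdiff t p (\<lambda>v. of_chart c (\<phi> t p) (f' (to_chart c p v)))"
  by (rule fdiffI[OF p isCont_flow[OF t] c(1,2) c(1,3) strict_derivative_imp_has_derivative[OF f']])

lemma fdiff_exists: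
  assumes p: "p \<in> \<Gamma>" and t: "0 \<le> t" shows "\<exists>T. fdiff t p T \<and> inj T"
proof -
  obtain C where C: "1 \<le> C" and box: "\<forall>q\<in>\<Gamma>. \<exists>c. flow_box c C q" using flow_box_uniform by blast
  have base: "\<exists>T. fdiff t p T \<and> inj T" if p: "p \<in> \<Gamma>" and t: "0 \<le> t" "t * C \<le> 1" for p t
  proof -
    obtain c f' where c: "c \<in> \<A>" "p \<in> dom c" "\<phi> t p \<in> dom c"
      and f': "strict_derivative (snd c \<circ> \<phi> t \<circ> chart_inv c) f' (snd c p)" "\<And>v. norm v \<le> 2 * norm (f' v)"
      using box p t unfolding flow_box_def by meson
    have "linear f'" using f'(1) by (simp add: strict_derivative_def)
    moreover have "v = 0" if "f' v = 0" for v using f'(2)[of v] that by simp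
    ultimately have inj: "inj f'" using linear_injective_0 by blast
    have "inj (of_chart c (\<phi> t p) \<circ> (f' \<circ> to_chart c p))"
      using inj_coord_change[OF chart_at(1) c(1) chart_at(2) c(2) interior_\<Gamma>[OF p]] inj
        inj_coord_change[OF c(1) chart_at(1) c(3) chart_at(2) interior_\<Gamma>[OF flow_in[OF p]]]
      by (intro inj_compose)
    then show ?thesis using fdiff_short[OF p t(1) c f'(1)] by (auto simp: o_def)
  qed
  show ?thesis
  proof (rule short_time_induct[OF C t])
    fix s t assume s: "0 \<le> (s::real)" and t: "0 \<le> t" "t * C \<le> 1" and "\<exists>T. fdiff s p T \<and> inj T"
    then obtain S where S: "fdiff s p S" "inj S" by blast
    obtain T where T: "fdiff t (\<phi> s p) T" "inj T" using base[OF flow_in[OF p] t] by blast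
    have "inj (\<lambda>v. T (S v))" using inj_compose[OF T(2) S(2)] by (simp add: o_def)
    then show "\<exists>T. fdiff (t + s) p T \<and> inj T" using fdiff_compose[OF p s S(1) t(1) T(1)] by blast
  qed (rule base[OF p])
qed

text \<open>\<open>\<phi> (- t)\<close> is meaningful only on the image of \<open>\<phi> t\<close>,
  so it first has to be shown that this image contains a neighbourhood of \<open>\<phi> t p\<close>.
  Differentiability then comes from the inverse function theorem.\<close>

lemma fdiff_inverse:
  assumes p: "p \<in> \<Gamma>" and t: "0 \<le> t" and T: "fdiff t p T" "inj T"
  shows "\<exists>S. fdiff (- t) (\<phi> t p) S \<and> (\<forall>v. S (T v) = v) \<and> (\<forall>v. T (S v) = v)"
proof -
  let ?q = "\<phi> t p"
  define c where "c = chart_at \<A> p"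
  define c' where "c' = chart_at \<A> ?q"
  have c: "c \<in> \<A>" "p \<in> dom c" and c': "c' \<in> \<A>" "?q \<in> dom c'" unfolding c_def c'_def by (rule chart_at)+
  have q: "?q \<in> \<Gamma>" by (rule flow_in[OF p])
  note ip = interior_\<Gamma>[OF p] and iq = interior_\<Gamma>[OF q]
  have ret: "\<phi> (- t) ?q = p" by (rule flow_inverse[OF t])
  define f where "f = snd c' \<circ> \<phi> t \<circ> chart_inv c"
  define g where "g = snd c \<circ> \<phi> (- t) \<circ> chart_inv c'"
  have f_deriv: "(f has_derivative T) (at (snd c p))"
    using flow_deriv_in_charts[OF p T(1) c c'] coord_change_refl[OF c ip] coord_change_refl[OF c' iq]
    by (simp add: f_def c_def c'_def)
  have lT: "linear T" using T(1) by (simp add: fdiff_def)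
  obtain S where S: "linear S" "S \<circ> T = id" using linear_injective_left_inverse[OF lT T(2)] by blast
  have TS: "T \<circ> S = id" using S linear_inverse_left[OF lT S(1)] by blast
  define U where "U = \<phi> t -` dom c' \<inter> dom c"
  have "open (\<phi> t -` dom c')" using open_vimage[OF open_dom[OF c'(1)] flow_continuous[OF t]] .
  then have U: "open U" "p \<in> U" "U \<subseteq> dom c" using c c' open_dom[OF c(1)] by (auto simp: U_def)
  define W where "W = interior (snd c ` U)"
  have W: "open W" "snd c p \<in> W" "W \<subseteq> snd c ` U"
    unfolding W_def using image_interior[OF c(1) U(1,3,2)] ip c interior_subset by (auto simp: interior_point_def)
  have W_im: "W \<subseteq> im c" using W(3) U(3) by blast
  have W_flow: "\<phi> t (chart_inv c z) \<in> dom c'" if "z \<in> W" for z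
    using W(3) that chart_inv_left[OF c(1)] by (auto simp: U_def)
  have f_cont: "continuous_on W f"
    unfolding f_def o_def
    by (rule continuous_on_compose2[OF continuous_chart[OF c'(1)]
          continuous_on_compose2[OF flow_continuous[OF t] continuous_on_subset[OF continuous_chart_inv[OF c(1)] W_im]]])
      (use W_flow in auto)
  have gf: "g (f z) = z" if z: "z \<in> W" for z
    using chart_inv_left[OF c'(1) W_flow[OF z]] flow_inverse[OF t] chart_inv_right[OF c(1)] W_im z
    by (auto simp: g_def f_def)
  have "(g has_derivative S) (at (f (snd c p)))"
    by (rule has_derivative_inverse_strong[OF W(1,2) f_cont gf f_deriv TS])
  then have g_deriv: "(g has_derivative S) (at (snd c' ?q))" using chart_inv_left[OF c] by (simp add: f_def)
  have "inj_on f W" using gf by (metis inj_on_inverseI)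
  \<comment> \<open>Invariance of domain applies because the coordinate map is injective and
    continuous on an open set of full dimension.\<close>
  then have "open (f ` W)" by (rule invariance_of_domain[OF f_cont W(1)])
  moreover have fW: "f ` W \<subseteq> im c'" using W_flow by (auto simp: f_def)
  ultimately have "openin (top_of_set half_space) (f ` W)"
    using im_half[OF c'(1)] by (intro open_subset) auto
  then have V: "open (chart_inv c' ` f ` W)" using fW by (rule preimage_open[OF c'(1)])
  have "chart_inv c' ` f ` W \<subseteq> \<phi> t ` UNIV"
    using chart_inv_left[OF c'(1) W_flow] by (auto simp: f_def)
  \<comment> \<open>A continuous injection of a compact space has a continuous inverse on its
    image.\<close>
  moreover have "continuous_on (\<phi> t ` UNIV) (\<phi> (- t))"
    by (rule continuous_on_inv[OF flow_continuous[OF t] compact_M]) (simp add: flow_inverse[OF t])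
  ultimately have "continuous_on (chart_inv c' ` f ` W) (\<phi> (- t))" by (metis continuous_on_subset)
  moreover have "?q \<in> chart_inv c' ` f ` W"
    using W(2) chart_inv_left[OF c] chart_inv_left[OF c'] by (force simp: f_def)
  ultimately have "isCont (\<phi> (- t)) ?q" using continuous_on_eq_continuous_at[OF V] by blast
  from fdiffI[OF q this c' c(1), of S]
  have "fdiff (- t) ?q (\<lambda>v. of_chart c p (S (to_chart c' ?q v)))"
    using g_deriv c(2) by (simp add: ret g_def)
  then have "fdiff (- t) ?q S"
    using coord_change_refl[OF chart_at ip] coord_change_refl[OF chart_at iq] by (simp add: c_def c'_def)
  then show ?thesis using S(2) TS by (auto simp: fun_eq_iff)
qed

text \<open>A negative time t is the inverse of the flow over time -t started at
  \<open>\<phi> t p\<close>.\<close>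

lemma flow_deriv_fdiff:
  assumes p: "p \<in> \<Gamma>" shows "fdiff t p (DX t p) \<and> inj (DX t p)"
proof (cases "0 \<le> t")
  case True
  then show ?thesis using fdiff_exists[OF p True] fdiff_flow_deriv[OF p] by metis
next
  case False
  let ?r = "\<phi> t p"
  have r: "?r \<in> \<Gamma>" by (rule flow_in[OF p])
  obtain T where T: "fdiff (- t) ?r T" "inj T" using fdiff_exists[OF r, of "- t"] False by auto
  have "\<phi> (- t) ?r = p" using flow_inverse'[OF p, of "- t"] by simp
  then obtain S where S: "fdiff t p S" "\<And>v. T (S v) = v" using fdiff_inverse[OF r _ T] False by auto
  have "inj S" using S(2) by (metis injI)
  then show ?thesis using S fdiff_flow_deriv[OF p S(1)] by simp
qed

lemma linear_flow_deriv: "p \<in> \<Gamma> \<Longrightarrow> linear (DX t p)"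
  using flow_deriv_fdiff[of p t] by (simp add: fdiff_def)

lemma inj_flow_deriv: "p \<in> \<Gamma> \<Longrightarrow> inj (DX t p)"
  using flow_deriv_fdiff[of p t] by simp

lemma flow_deriv_add:
  assumes p: "p \<in> \<Gamma>" and "0 \<le> s" "0 \<le> t"
  shows "DX (s + t) p v = DX t (\<phi> s p) (DX s p v)"
  using fdiff_flow_deriv[OF p fdiff_compose[OF p assms(2) flow_deriv_fdiff[OF p, THEN conjunct1] assms(3)
      flow_deriv_fdiff[OF flow_in[OF p], THEN conjunct1]]] by (simp add: add.commute)

lemma flow_deriv_inverse:
  assumes p: "p \<in> \<Gamma>" and t: "0 \<le> t"
  shows "DX (- t) (\<phi> t p) (DX t p v) = v"
    "DX t p (DX (- t) (\<phi> t p) v) = v"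
proof -
  obtain S where S: "fdiff (- t) (\<phi> t p) S" "\<And>v. S (DX t p v) = v" "\<And>v. DX t p (S v) = v"
    using fdiff_inverse[OF p t] flow_deriv_fdiff[OF p, of t] by blast
  have "DX (- t) (\<phi> t p) = S" by (rule fdiff_flow_deriv[OF flow_in[OF p] S(1)])
  then show "DX (- t) (\<phi> t p) (DX t p v) = v"
    "DX t p (DX (- t) (\<phi> t p) v) = v" using S by auto
qed

lemma flow_deriv_zero: assumes p: "p \<in> \<Gamma>" shows "DX 0 p v = v"
  using flow_deriv_inverse(1)[OF p, of 0 v] flow_deriv_add[OF p, of 0 0 v] linear_flow_deriv[OF p]
    inj_flow_deriv[OF p, of 0] by (simp add: flow_zero inj_def)

end

section \<open>Frames adapted to the splitting\<close>

lemma pos_def_form_restriction: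
  fixes G :: "'n::{finite,linorder} coords \<Rightarrow> 'n coords \<Rightarrow> real" and G' :: "'n coords \<Rightarrow> 'n coords \<Rightarrow> real"
  assumes "pos_def_form G" "pos_def_form G'" "linear T" "subspace V" "V \<noteq> {0}"
  shows "\<exists>(P :: 'n coords \<Rightarrow> 'n coords) (Q :: 'n coords \<Rightarrow> 'n coords).
    normed_restriction (form_norm G) (form_norm G') P Q V T \<and> (\<forall>v. Q v = 0 \<longrightarrow> v = 0)"
proof -
  obtain P :: "'n coords \<Rightarrow> 'n coords" where P: "linear P" "inj P" "\<And>v. form_norm G v = norm (P v)"
    using pos_def_form_factor[OF assms(1)] by auto
  obtain Q :: "'n coords \<Rightarrow> 'n coords" where Q: "linear Q" "inj Q" "\<And>v. form_norm G' v = norm (Q v)"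
    using pos_def_form_factor[OF assms(2)] by auto
  have P0: "v = 0" if "P v = 0" for v using P(1,2) that by (simp add: linear_injective_0)
  have Q0: "v = 0" if "Q v = 0" for v using Q(1,2) that by (simp add: linear_injective_0)
  show ?thesis
    by (intro exI[of _ P] exI[of _ Q] conjI normed_restriction.intro) (fact P(3) Q(3) P(1) Q(1) assms(3-5) | use P0 Q0 in blast)+
qed

context
  fixes G G' :: "'n::{finite,linorder} coords \<Rightarrow> 'n coords \<Rightarrow> real" and T :: "'n coords \<Rightarrow> 'n coords" and V :: "'n coords set"
  assumes form: "pos_def_form G" "pos_def_form G'" "linear T" "subspace V" "V \<noteq> {0}"
begin

lemma form_op_norm_ge: "v \<in> V \<Longrightarrow> form_norm G' (T v) \<le> op_norm (form_norm G) (form_norm G') V T * form_norm G v"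
  using pos_def_form_restriction[OF form] normed_restriction.op_norm_ge by fast

lemma form_op_norm_le:
  "(\<And>v. v \<in> V \<Longrightarrow> form_norm G' (T v) \<le> c * form_norm G v) \<Longrightarrow> op_norm (form_norm G) (form_norm G') V T \<le> c"
  using pos_def_form_restriction[OF form] normed_restriction.op_norm_le by fast

lemma form_op_norm_pos:
  assumes "inj T" shows "0 < op_norm (form_norm G) (form_norm G') V T"
proof -
  obtain P Q :: "'n coords \<Rightarrow> 'n coords" where "normed_restriction (form_norm G) (form_norm G') P Q V T" and Q0: "\<forall>v. Q v = 0 \<longrightarrow> v = 0"
    using pos_def_form_restriction[OF form] by blast
  then interpret normed_restriction "form_norm G" "form_norm G'" P Q V T by simp
  show ?thesis
  proof (rule op_norm_pos)
    fix v assume "Q (T v) = 0"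
    then have "T v = 0" using Q0 by blast
    then show "v = 0" using assms linear_injective_0[OF form(3)] by blast
  qed
qed

lemma form_min_norm_eq:
  assumes "linear S" "\<And>v. S (T v) = v"
  shows "min_norm (form_norm G) (form_norm G') V T = 1 / op_norm (form_norm G') (form_norm G) (T ` V) S"
proof -
  obtain P Q :: "'n coords \<Rightarrow> 'n coords" where "normed_restriction (form_norm G) (form_norm G') P Q V T" and Q0: "\<forall>v. Q v = 0 \<longrightarrow> v = 0"
    using pos_def_form_restriction[OF form] by blast
  then interpret normed_restriction "form_norm G" "form_norm G'" P Q V T by simp
  show ?thesis using min_norm_eq(2)[OF assms] Q0 by blast
qed

end

lemma form_norm_pos: "pos_def_form G \<Longrightarrow> v \<noteq> 0 \<Longrightarrow> 0 < form_norm G v"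
  by (auto simp: pos_def_form_def form_norm_def)

lemma form_norm_0: "pos_def_form G \<Longrightarrow> form_norm G 0 = 0"
  by (auto simp: pos_def_form_def form_norm_def bilinear_lzero)

lemma form_norm_nonneg: "pos_def_form G \<Longrightarrow> 0 \<le> form_norm G v"
  using form_norm_pos[of G v] form_norm_0[of G] by (cases "v = 0") auto

lemma bilinear_axis_expansion:
  fixes H :: "real ^ 'n \<Rightarrow> 'w::real_vector"
  assumes "bilinear G" "linear H"
  shows "G (H \<xi>) (H \<xi>) = (\<Sum>i\<in>UNIV. \<Sum>j\<in>UNIV. \<xi> $ i * \<xi> $ j * G (H (axis i 1)) (H (axis j 1)))"
  by (subst (1 2) linear_axis_expansion[OF assms(2)])
    (simp add: bilinear_sum[OF assms(1)] sum.cartesian_product[symmetric] bilinear_lmul[OF assms(1)] bilinear_rmul[OF assms(1)] mult_ac del: UNIV_Times_UNIV)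

text \<open>Convergence of the finitely many matrix entries gives uniform closeness on the unit
  sphere, and positivity of the limit form on that sphere turns the additive error into a
  multiplicative one.\<close>

lemma form_family_close:
  fixes G :: "'z \<Rightarrow> 'w::real_vector \<Rightarrow> 'w \<Rightarrow> real" and H :: "'z \<Rightarrow> real ^ 'n \<Rightarrow> 'w"
  assumes lin: "\<And>z. bilinear (G z)" "\<forall>\<^sub>F z in Fil. linear (H z)" "bilinear G0" "linear H0"
    and lim: "\<And>i j. ((\<lambda>z. G z (H z (axis i 1)) (H z (axis j 1))) \<longlongrightarrow> G0 (H0 (axis i 1)) (H0 (axis j 1))) Fil"
    and pos: "\<And>\<xi>. \<xi> \<noteq> 0 \<Longrightarrow> 0 < G0 (H0 \<xi>) (H0 \<xi>)" and \<epsilon>: "0 < \<epsilon>"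
  shows "\<forall>\<^sub>F z in Fil. \<forall>\<xi>. form_norm G0 (H0 \<xi>) \<le> exp \<epsilon> * form_norm (G z) (H z \<xi>) \<and>
    form_norm (G z) (H z \<xi>) \<le> exp \<epsilon> * form_norm G0 (H0 \<xi>)"
proof -
  let ?Q = "\<lambda>z \<xi>. G z (H z \<xi>) (H z \<xi>)" and ?R = "\<lambda>\<xi>. G0 (H0 \<xi>) (H0 \<xi>)"
  have "continuous_on (sphere 0 1) ?R"
    unfolding bilinear_axis_expansion[OF lin(3,4)] by (intro continuous_intros)
  then obtain \<xi>0 where \<xi>0: "\<xi>0 \<in> sphere 0 1" "\<forall>\<xi>\<in>sphere 0 1. ?R \<xi>0 \<le> ?R \<xi>"
    using continuous_attains_inf[of "sphere (0::real^'n) 1" ?R] by auto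
  define m where "m = ?R \<xi>0"
  have m: "0 < m" unfolding m_def by (rule pos) (use \<xi>0(1) in auto)
  have lower: "m * (norm \<xi>)\<^sup>2 \<le> ?R \<xi>" for \<xi>
  proof (cases "\<xi> = 0")
    case True
    then show ?thesis by (simp add: linear_0[OF lin(4)] bilinear_lzero[OF lin(3)])
  next
    case False
    have "m \<le> ?R ((1 / norm \<xi>) *\<^sub>R \<xi>)" unfolding m_def by (rule \<xi>0(2)[rule_format]) (use False in auto)
    also have "\<dots> = ?R \<xi> / (norm \<xi>)\<^sup>2"
      by (simp add: linear_scale[OF lin(4)] bilinear_lmul[OF lin(3)] bilinear_rmul[OF lin(3)] power2_eq_square)
    finally show ?thesis using False by (simp add: field_simps)
  qed
  \<comment> \<open>The estimate concerns squares of norms, hence 2 \<epsilon>; the factor m is the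
    minimum of the limit form on the unit sphere.\<close>
  define \<delta> where "\<delta> = m * (1 - exp (- (2 * \<epsilon>)))"
  have \<delta>: "0 < \<delta>" using m \<epsilon> by (simp add: \<delta>_def)
  let ?s = "\<lambda>z. \<Sum>i\<in>UNIV. \<Sum>j\<in>UNIV. \<bar>G z (H z (axis i 1)) (H z (axis j 1)) - G0 (H0 (axis i 1)) (H0 (axis j 1))\<bar>"
  have "(?s \<longlongrightarrow> (\<Sum>i\<in>(UNIV::'n set). \<Sum>j\<in>(UNIV::'n set). \<bar>G0 (H0 (axis i 1)) (H0 (axis j 1)) - G0 (H0 (axis i 1)) (H0 (axis j 1))\<bar>)) Fil"
    by (intro tendsto_intros lim)
  then have "(?s \<longlongrightarrow> 0) Fil" by simp
  then have "\<forall>\<^sub>F z in Fil. ?s z < \<delta>" using \<delta> by (rule order_tendstoD)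
  then show ?thesis using lin(2)
  proof eventually_elim
    case (elim z)
    show ?case
    proof
      fix \<xi>
      have "\<bar>?Q z \<xi> - ?R \<xi>\<bar> = \<bar>\<Sum>i\<in>UNIV. \<Sum>j\<in>UNIV. \<xi> $ i * \<xi> $ j * (G z (H z (axis i 1)) (H z (axis j 1)) - G0 (H0 (axis i 1)) (H0 (axis j 1)))\<bar>"
        unfolding bilinear_axis_expansion[OF lin(3,4)] bilinear_axis_expansion[OF lin(1) elim(2)]
        by (simp add: sum_subtractf right_diff_distrib)
      also have "\<dots> \<le> (\<Sum>i\<in>UNIV. \<Sum>j\<in>UNIV. \<bar>\<xi> $ i * \<xi> $ j * (G z (H z (axis i 1)) (H z (axis j 1)) - G0 (H0 (axis i 1)) (H0 (axis j 1)))\<bar>)"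
        by (rule order_trans[OF sum_abs]) (intro sum_mono sum_abs)
      also have "\<dots> \<le> (\<Sum>i\<in>UNIV. \<Sum>j\<in>UNIV. (norm \<xi>)\<^sup>2 * \<bar>G z (H z (axis i 1)) (H z (axis j 1)) - G0 (H0 (axis i 1)) (H0 (axis j 1))\<bar>)"
        unfolding abs_mult power2_eq_square
        by (intro sum_mono mult_right_mono mult_mono component_le_norm_cart) auto
      also have "\<dots> = ?s z * (norm \<xi>)\<^sup>2" by (simp add: sum_distrib_left mult.commute)
      also have "\<dots> \<le> \<delta> * (norm \<xi>)\<^sup>2" using elim by (intro mult_right_mono) auto
      also have "\<dots> \<le> (1 - exp (- (2 * \<epsilon>))) * ?R \<xi>"
        using mult_left_mono[OF lower[of \<xi>], of "1 - exp (- (2 * \<epsilon>))"] \<epsilon> by (simp add: \<delta>_def mult_ac)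
      finally have *: "\<bar>?Q z \<xi> - ?R \<xi>\<bar> \<le> (1 - exp (- (2 * \<epsilon>))) * ?R \<xi>" .
      have Q0: "0 \<le> ?R \<xi>" using lower[of \<xi>] m by (meson less_imp_le mult_nonneg_nonneg order_trans zero_le_power2)
      define a where "a = exp (2 * \<epsilon>)"
      have a: "1 \<le> a" "exp (- (2 * \<epsilon>)) = 1 / a" "a = (exp \<epsilon>)\<^sup>2"
        using \<epsilon> by (auto simp: a_def exp_minus inverse_eq_divide exp_double)
      note * = *[unfolded a(2)]
      have "?R \<xi> - (1 - 1 / a) * ?R \<xi> \<le> ?Q z \<xi>" using * by linarith
      then have 1: "?R \<xi> / a \<le> ?Q z \<xi>" by (simp add: algebra_simps)
      \<comment> \<open>The relative error was chosen for the lower bound 1 / a; this shows that it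
        is also good enough for the upper bound a.\<close>
      have "1 - 1 / a \<le> a - 1"
      proof -
        have "0 \<le> (a - 1)\<^sup>2 / a" using a(1) by simp
        then show ?thesis using a(1) by (simp add: power2_eq_square field_simps)
      qed
      then have "(1 - 1 / a) * ?R \<xi> \<le> (a - 1) * ?R \<xi>" using Q0 by (rule mult_right_mono)
      with * have "?Q z \<xi> \<le> ?R \<xi> + (a - 1) * ?R \<xi>" by linarith
      then have 2: "?Q z \<xi> \<le> a * ?R \<xi>" by (simp add: algebra_simps)
      have "?R \<xi> \<le> (exp \<epsilon>)\<^sup>2 * ?Q z \<xi>" using 1 a(1) unfolding a(3)[symmetric] by (simp add: field_simps)
      then have "sqrt (?R \<xi>) \<le> sqrt ((exp \<epsilon>)\<^sup>2 * ?Q z \<xi>)" by (rule real_sqrt_le_mono)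
      moreover have "sqrt (?Q z \<xi>) \<le> sqrt ((exp \<epsilon>)\<^sup>2 * ?R \<xi>)" using 2 a(3) by (intro real_sqrt_le_mono) simp
      ultimately show "form_norm G0 (H0 \<xi>) \<le> exp \<epsilon> * form_norm (G z) (H z \<xi>) \<and>
          form_norm (G z) (H z \<xi>) \<le> exp \<epsilon> * form_norm G0 (H0 \<xi>)"
        unfolding form_norm_def by (simp add: real_sqrt_mult)
    qed
  qed
qed

section \<open>Frames built from two complementary bases\<close>

lemma is_basis_dim: "is_basis V d b \<Longrightarrow> dim V = d"
  using dim_span_eq_card_independent[of "b ` {..<d}"] by (auto simp: is_basis_def card_image)

lemma is_basis_in: "is_basis V d b \<Longrightarrow> i < d \<Longrightarrow> b i \<in> V"
  by (auto simp: is_basis_def intro: span_base)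

lemma is_basis_subspace: "is_basis V d b \<Longrightarrow> subspace V"
  by (auto simp: is_basis_def)

text \<open>Coordinates are numbered in the order of the index type: the first l go to a basis of E,
  the last k to one of F. The index sets I and J are thereby the same at all points, which makes
  frames at different points comparable.\<close>

definition frame_map :: "nat \<Rightarrow> nat \<Rightarrow> (nat \<Rightarrow> 'n coords) \<Rightarrow> (nat \<Rightarrow> 'n coords) \<Rightarrow> 'n::{finite,linorder} coords \<Rightarrow> 'n coords" where
  "frame_map l k s s' \<xi> = (\<Sum>j<l. \<xi> $ elem UNIV j *\<^sub>R s j) + (\<Sum>j<k. \<xi> $ elem UNIV (l + j) *\<^sub>R s' j)"

locale complementary_bases =
  fixes E F :: "'n::{finite,linorder} coords set" and l k :: nat and s s' :: "nat \<Rightarrow> 'n coords"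
  assumes bE: "is_basis E l s" and bF: "is_basis F k s'" and sum_EF: "{u + v | u v. u \<in> E \<and> v \<in> F} = UNIV" and int_EF: "E \<inter> F = {0}"
begin

abbreviation "I \<equiv> elem (UNIV :: 'n set) ` {..<l}"
abbreviation "J \<equiv> - elem (UNIV :: 'n set) ` {..<l}"
abbreviation "H \<equiv> frame_map l k s s' :: 'n coords \<Rightarrow> 'n coords"

lemma dim_sum: "l + k = CARD('n)"
  using dim_sums_Int[OF is_basis_subspace[OF bE] is_basis_subspace[OF bF]] is_basis_dim[OF bE] is_basis_dim[OF bF]
  by (simp add: sum_EF int_EF dim_UNIV)

lemma elem_UNIV: "bij_betw (elem (UNIV :: 'n set)) {..<l + k} UNIV"
  using elem_bij_betw[OF refl, of UNIV] by (simp add: dim_sum)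

lemma elem_UNIV_eq: "i < l + k \<Longrightarrow> j < l + k \<Longrightarrow> elem (UNIV :: 'n set) i = elem UNIV j \<longleftrightarrow> i = j"
  using elem_UNIV by (auto simp: bij_betw_def inj_on_def)

lemma J_eq: "J = elem UNIV ` {l..<l + k}"
proof -
  have "UNIV = elem (UNIV :: 'n set) ` {..<l + k}" using elem_UNIV by (simp add: bij_betw_def)
  also have "{..<l + k} = {..<l} \<union> {l..<l + k}" by auto
  finally show ?thesis using elem_UNIV_eq by (auto simp: image_Un)
qed

text \<open>J is a final segment of the index type, so its increasing enumeration is the tail of the
  full one. Hence the frame wedge over J is the wedge of the basis of F in its given order.\<close>

lemma elem_J: "i < k \<Longrightarrow> elem J i = elem UNIV (l + i)"
proof -
  assume i: "i < k"
  let ?L = "sorted_list_of_set (UNIV :: 'n set)"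
  have len: "length ?L = l + k" by (simp add: dim_sum)
  have "elem UNIV ` {l..<l + k} = set (drop l ?L)"
  proof safe
    fix j assume "j \<in> {l..<l + k}"
    then show "elem UNIV j \<in> set (drop l ?L)"
      using len unfolding in_set_conv_nth by (intro exI[of _ "j - l"]) (auto simp: elem_def)
  next
    fix a assume "a \<in> set (drop l ?L)"
    then obtain i where "i < k" "a = elem UNIV (l + i)" using len unfolding in_set_conv_nth by (auto simp: elem_def)
    then show "a \<in> elem UNIV ` {l..<l + k}" by auto
  qed
  then have "J = set (drop l ?L)" using J_eq by simp
  then have "sorted_list_of_set J = drop l ?L"
    by (simp add: sorted_list_of_set.idem_if_sorted_distinct)
  then show ?thesis using i len by (simp add: elem_def)
qed

lemma H_axis: "j < l \<Longrightarrow> H (axis (elem UNIV j) 1) = s j" "j < k \<Longrightarrow> H (axis (elem UNIV (l + j)) 1) = s' j"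
proof -
  have *: "(\<Sum>j\<in>A. (if elem UNIV j = (elem UNIV i::'n) then 1 else 0) *\<^sub>R f j) = (\<Sum>j\<in>A. if j = i then f j else 0)"
    if "i < l + k" "A \<subseteq> {..<l + k}" for i A and f :: "nat \<Rightarrow> 'n coords"
    using that elem_UNIV_eq by (intro sum.cong refl) (auto simp: subset_iff)
  show "H (axis (elem UNIV j) 1) = s j" if j: "j < l"
  proof -
    have "(\<Sum>i<k. (axis (elem UNIV j) 1 :: 'n coords) $ elem UNIV (l + i) *\<^sub>R s' i) = 0"
      using j elem_UNIV_eq by (intro sum.neutral) (auto simp: axis_def)
    moreover have "(\<Sum>i<l. (axis (elem UNIV j) 1 :: 'n coords) $ elem UNIV i *\<^sub>R s i) = s j"
      using j *[of j "{..<l}" s] by (simp add: axis_def)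
    ultimately show ?thesis by (simp add: frame_map_def)
  qed
  show "H (axis (elem UNIV (l + j)) 1) = s' j" if j: "j < k"
  proof -
    have "(\<Sum>i<l. (axis (elem UNIV (l + j)) 1 :: 'n coords) $ elem UNIV i *\<^sub>R s i) = 0"
      using j elem_UNIV_eq by (intro sum.neutral) (auto simp: axis_def)
    moreover have "(\<Sum>i<k. (axis (elem UNIV (l + j)) 1 :: 'n coords) $ elem UNIV (l + i) *\<^sub>R s' i) = (\<Sum>i<k. if i = j then s' i else 0)"
      using j elem_UNIV_eq by (intro sum.cong refl) (auto simp: axis_def)
    ultimately show ?thesis using j by (simp add: frame_map_def)
  qed
qed

lemma linear_H: "linear H"
  unfolding frame_map_def
  by (intro linear_compose_add linear_compose_sum ballI linearI) (auto simp: algebra_simps)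

lemma H_coord_space: "H ` coord_space I = E" "H ` coord_space J = F"
proof -
  have sp: "H ` coord_space A = span ((\<lambda>i. H (axis i 1)) ` A)" for A
    by (simp add: coord_space_eq_span linear_span_image[OF linear_H, symmetric] image_image)
  show "H ` coord_space I = E" unfolding sp using bE by (simp add: is_basis_def image_image H_axis(1))
  have "{l..<l + k} = (+) l ` {..<k}" by (simp add: lessThan_atLeast0 add.commute)
  then show "H ` coord_space J = F" unfolding sp J_eq using bF by (simp add: is_basis_def image_image H_axis(2))
qed

lemma adapted_frame: "adapted_frame I J H E F k"
proof (rule adapted_frame.intro)
  show "card J = k" unfolding J_eq
    using elem_UNIV_eq by (subst card_image) (auto simp: inj_on_def)
  have "v \<in> range H" for v
  proof -
    obtain u w where "u \<in> E" "w \<in> F" "v = u + w" using sum_EF by blast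
    then obtain \<xi> \<eta> where "u = H \<xi>" "w = H \<eta>" unfolding H_coord_space[symmetric] by auto
    then have "v = H (\<xi> + \<eta>)" using \<open>v = u + w\<close> by (simp add: linear_add[OF linear_H])
    then show ?thesis by simp
  qed
  then show "inj H" using linear_surjective_imp_injective[OF linear_H] by blast
qed (simp_all only: linear_H H_coord_space)

sublocale adapted_frame I J H E F k by (rule adapted_frame)

end

section \<open>The generators of the induced splitting\<close>

lemma F_tilde_eq:
  assumes "complementary_bases E0 (F0 :: 'n::{finite,linorder} coords set) l k (\<lambda>i. e i x) (\<lambda>i. f i x)"
  shows "F_tilde k f x = pure_power k F0"
proof -
  interpret complementary_bases E0 F0 l k "\<lambda>i. e i x" "\<lambda>i. f i x" by (rule assms)
  have "wedge k (\<lambda>i. H (axis (elem J i) 1)) = wedge k (\<lambda>i. f i x)"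
    using H_axis(2) elem_J by (intro wedge_cong) auto
  then show ?thesis by (simp add: F_tilde_def pure_power_eq_span)
qed

text \<open>Indices of E precede those of F, so the increasing enumeration of an index set S lists i
  vectors of E followed by k - i vectors of F. The case i = k falls into the first family of
  generators and 0 < i < k into the second.\<close>

lemma E_tilde_eq:
  assumes cb: "complementary_bases E0 (F0 :: 'n::{finite,linorder} coords set) l k (\<lambda>i. e i x) (\<lambda>i. f i x)" and k: "1 \<le> k"
  shows "E_tilde l k e f x = mixed_power k E0 F0"
proof
  interpret complementary_bases E0 F0 l k "\<lambda>i. e i x" "\<lambda>i. f i x" by (rule cb)
  have eE: "e i x \<in> E0" if "i < l" for i using is_basis_in[OF bE that] .
  have fF: "f i x \<in> F0" if "i < k" for i using is_basis_in[OF bF that] .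
  show "E_tilde l k e f x \<subseteq> mixed_power k E0 F0"
    unfolding E_tilde_def
  proof (intro span_minimal subspace_mixed_power Un_least subsetI)
    fix \<omega> assume "\<omega> \<in> {wedge k (\<lambda>r. e (a r) x) | a. strict_mono_on {..<k} a \<and> a ` {..<k} \<subseteq> {..<l}}"
    then obtain a where a: "\<omega> = wedge k (\<lambda>r. e (a r) x)" "a ` {..<k} \<subseteq> {..<l}" by auto
    then have "e (a r) x \<in> E0" if "r < k" for r using that eE by auto
    then show "\<omega> \<in> mixed_power k E0 F0" unfolding mixed_power_def a(1) using k
      by (intro span_base CollectI exI[of _ "\<lambda>r. e (a r) x"]) (auto intro!: exI[of _ 0])
  next
    fix \<omega> assume "\<omega> \<in> {wedge k (\<lambda>r. if r < i then e (a r) x else f (b (r - i)) x) | i j a b.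
        i + j = k \<and> 1 \<le> i \<and> 1 \<le> j \<and> a ` {..<i} \<subseteq> {..<l} \<and> b ` {..<j} \<subseteq> {..<k}}"
    then obtain i j a b where a: "\<omega> = wedge k (\<lambda>r. if r < i then e (a r) x else f (b (r - i)) x)"
      "i + j = k" "1 \<le> i" "a ` {..<i} \<subseteq> {..<l}" "b ` {..<j} \<subseteq> {..<k}" by blast
    have "(if r < i then e (a r) x else f (b (r - i)) x) \<in> E0 \<union> F0" if "r < k" for r
      using that a eE[of "a r"] fF[of "b (r - i)"] by (auto simp: image_subset_iff)
    moreover have "\<exists>r<k. (if r < i then e (a r) x else f (b (r - i)) x) \<in> E0"
      using a(3,4) eE[of "a 0"] k by (auto simp: image_subset_iff intro!: exI[of _ 0])
    ultimately show "\<omega> \<in> mixed_power k E0 F0" unfolding mixed_power_def a(1)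
      by (intro span_base CollectI exI[of _ "\<lambda>r. if r < i then e (a r) x else f (b (r - i)) x"]) blast
  qed
  show "mixed_power k E0 F0 \<subseteq> E_tilde l k e f x"
  proof -
    have "wedge k (\<lambda>i. H (axis (elem S i) 1)) \<in> E_tilde l k e f x" if S: "card S = k" "S \<noteq> J" for S
    proof -
      have "\<exists>m<l + k. elem UNIV m = elem S r" for r
        using elem_UNIV unfolding bij_betw_def by (metis UNIV_I imageE lessThan_iff)
      then obtain m where m: "\<And>r. m r < l + k" "\<And>r. elem UNIV (m r) = elem S r" by metis
      have mono: "m r < m s" if "r < s" "s < k" for r s
      proof (rule ccontr)
        assume "\<not> m r < m s"
        then consider "m s = m r" | "m s < m r" by linarith
        then have "elem S s \<le> elem S r"
        proof cases
          case 2
          then have "elem (UNIV :: 'n set) (m s) < elem UNIV (m r)"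
            using m dim_sum by (intro elem_strict_mono[OF refl]) auto
          then show ?thesis using m by simp
        qed (use m in \<open>metis order_refl\<close>)
        then show False using elem_strict_mono[OF S(1) that] by simp
      qed
      define i where "i = (LEAST r. r = k \<or> l \<le> m r)"
      have i: "i = k \<or> l \<le> m i" "i \<le> k" "\<And>r. r < i \<Longrightarrow> m r < l"
        unfolding i_def by (rule LeastI[of _ k] Least_le, simp)+ (use not_less_Least in fastforce)
      have ge: "l \<le> m r" if "i \<le> r" "r < k" for r
        using i(1) mono[of i r] that by (cases "i = r") auto
      \<comment> \<open>If no index of E occurred, S would be contained in J and of the same size,
        hence equal to it.\<close>
      have "0 < i"
      proof (rule ccontr)
        assume "\<not> 0 < i"
        have "elem S r \<in> J" if "r < k" for r
          using ge[of r] m[of r] that \<open>\<not> 0 < i\<close> unfolding J_eq by (auto intro!: rev_image_eqI[of "m r"])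
        then have "elem S ` {..<k} \<subseteq> J" by (intro image_subsetI) simp
        moreover have "elem S ` {..<k} = S" using elem_bij_betw[OF S(1)] by (simp add: bij_betw_def)
        ultimately have "S \<subseteq> J" by metis
        then show False using S card_J card_subset_eq[of J S] by auto
      qed
      have Hm: "H (axis (elem S r) 1) = (if r < i then e (m r) x else f (m r - l) x)" if "r < k" for r
      proof (cases "r < i")
        case True
        then show ?thesis using H_axis(1)[OF i(3)[OF True]] m(2)[of r] by simp
      next
        case False
        then have "l \<le> m r" using ge that by auto
        then show ?thesis using H_axis(2)[of "m r - l"] m[of r] False by simp
      qed
      show ?thesis
      proof (cases "i = k")
        case True
        then have "wedge k (\<lambda>i. H (axis (elem S i) 1)) = wedge k (\<lambda>r. e (m r) x)"
          using Hm by (intro wedge_cong) auto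
        moreover have "strict_mono_on {..<k} m" "m ` {..<k} \<subseteq> {..<l}"
          using mono i(3) True by (auto intro!: strict_mono_onI)
        ultimately show ?thesis unfolding E_tilde_def by (intro span_base UnI1) auto
      next
        case False
        have "wedge k (\<lambda>i. H (axis (elem S i) 1)) = wedge k (\<lambda>r. if r < i then e (m r) x else f (m (i + (r - i)) - l) x)"
          using Hm by (intro wedge_cong) auto
        moreover have "i + (k - i) = k" "1 \<le> i" "1 \<le> k - i" "m ` {..<i} \<subseteq> {..<l}" using i False \<open>0 < i\<close> by auto
        moreover have "(\<lambda>r. m (i + r) - l) ` {..<k - i} \<subseteq> {..<k}"
        proof safe
          fix r assume "r < k - i"
          then show "m (i + r) - l < k" using m(1)[of "i + r"] ge[of "i + r"] by linarith
        qed
        ultimately show ?thesis unfolding E_tilde_def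
          by (intro span_base UnI2 CollectI exI[of _ i] exI[of _ "k - i"] exI[of _ m] exI[of _ "\<lambda>r. m (i + r) - l"]) auto
      qed
    qed
    then show ?thesis unfolding mixed_power_eq_span
      by (intro span_minimal) (auto simp: E_tilde_def)
  qed
qed

context adapted_frame
begin

lemma mixed_pure_decomposition:
  "{u + v | u v. u \<in> mixed_power k E F \<and> v \<in> pure_power k F} = ext_power k"
    "mixed_power k E F \<inter> pure_power k F = {0}"
proof -
  let ?M = "coord_space {S. card S = k \<and> S \<noteq> J}" and ?N = "coord_space {J}"
  have mono: "coord_space A \<subseteq> coord_space B" if "A \<subseteq> B" for A B :: "'n set set"
    unfolding coord_space_eq_span using that by (intro span_mono image_mono)
  have MN: "?M \<subseteq> ext_power k" "?N \<subseteq> ext_power k" unfolding ext_power_eq using card_J by (intro mono; blast)+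
  have "\<theta> = 0" if \<theta>: "\<theta> \<in> ?M" "\<theta> \<in> ?N" for \<theta> :: "'n kvector"
    unfolding vec_eq_iff
  proof
    show "\<theta> $ S = 0 $ S" for S using \<theta> by (cases "S = J") (simp_all add: coord_space_def)
  qed
  then have "?M \<inter> ?N = {0}" using subspace_0[OF subspace_coord_space] by blast
  then show "mixed_power k E F \<inter> pure_power k F = {0}"
    using inj_on_image_Int[OF inj_on_ext_map[OF lin inj] MN] by (simp add: mixed_power_eq pure_power_eq linear_0[OF linear_ext_map])
  show "{u + v | u v. u \<in> mixed_power k E F \<and> v \<in> pure_power k F} = ext_power k"
  proof (intro equalityI subsetI)
    fix \<omega> assume "\<omega> \<in> {u + v | u v. u \<in> mixed_power k E F \<and> v \<in> pure_power k F}"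
    then show "\<omega> \<in> ext_power k"
      using subsetD[OF mixed_power_subset] subsetD[OF pure_power_subset]
      by (auto intro!: subspace_add[OF subspace_ext_power])
  next
    fix \<omega> :: "'n kvector" assume \<omega>: "\<omega> \<in> ext_power k"
    obtain S where S: "linear S" "H \<circ> S = id"
      using linear_surjective_right_inverse[OF lin] linear_injective_imp_surjective[OF lin inj] by blast
    define \<theta> where "\<theta> = ext_map k S \<omega>"
    define \<kappa> where "\<kappa> = (\<theta> $ J) *\<^sub>R axis J (1::real)"
    have "\<theta> \<in> ext_power k" and "ext_map k H \<theta> = \<omega>"
      unfolding \<theta>_def using ext_map_in_ext_power ext_map_compose[OF lin, of k S \<omega>] S(2) ext_map_ident[OF \<omega>]
      by (auto simp: fun_eq_iff cong: ext_map_cong)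
    moreover have "\<omega> = ext_map k H (\<theta> - \<kappa>) + ext_map k H \<kappa>"
      by (simp add: linear_diff[OF linear_ext_map] \<open>ext_map k H \<theta> = \<omega>\<close>)
    moreover have "\<theta> - \<kappa> \<in> ?M" "\<kappa> \<in> ?N"
      using \<open>\<theta> \<in> ext_power k\<close> card_J by (auto simp: \<kappa>_def ext_power_eq coord_space_def axis_def)
    ultimately show "\<omega> \<in> {u + v | u v. u \<in> mixed_power k E F \<and> v \<in> pure_power k F}"
      unfolding mixed_power_eq pure_power_eq by blast
  qed
qed

lemma is_basis_wedge:
  assumes \<sigma>: "bij_betw \<sigma> {..<d} \<S>" "\<S> \<subseteq> {S. card S = k}"
  shows "is_basis (span ((\<lambda>S. wedge k (\<lambda>i. H (axis (elem S i) 1))) ` \<S>)) d (\<lambda>m. wedge k (\<lambda>i. H (axis (elem (\<sigma> m) i) 1)))"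
proof -
  let ?w = "\<lambda>S. wedge k (\<lambda>i. H (axis (elem S i) 1))"
  have w: "?w S = ext_map k H (axis S 1)" if "S \<in> \<S>" for S using \<sigma>(2) that by (subst ext_map_axis) auto
  note inj_ext = inj_on_ext_map[OF lin inj]
  let ?A = "(\<lambda>S. axis S (1::real)) ` \<S>"
  have A: "?A \<subseteq> ext_power k" using \<sigma>(2) by (auto simp: ext_power_eq axis_in_coord_space)
  then have span_A: "span ?A \<subseteq> ext_power k" using subspace_ext_power by (rule span_minimal)
  have "independent ?A"
    by (rule independent_mono[OF independent_Basis]) (auto simp: axis_in_Basis_iff)
  moreover have "inj_on (ext_map k H) (span ?A)" using inj_ext span_A by (rule inj_on_subset)
  ultimately have "independent (ext_map k H ` ?A)"
    using linear_independent_injective_image[OF linear_ext_map] by blast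
  moreover have im: "ext_map k H ` ?A = ?w ` \<S>" using w by (auto simp: image_image)
  moreover have sw: "(\<lambda>m. ?w (\<sigma> m)) ` {..<d} = ?w ` \<S>" using \<sigma>(1) by (auto simp: bij_betw_def)
  moreover have "inj_on (\<lambda>m. ?w (\<sigma> m)) {..<d}"
  proof (rule inj_onI)
    fix m m' assume m: "m \<in> {..<d}" "m' \<in> {..<d}" "?w (\<sigma> m) = ?w (\<sigma> m')"
    then have "\<sigma> m \<in> \<S>" "\<sigma> m' \<in> \<S>" using \<sigma>(1) by (auto simp: bij_betw_def)
    then have "ext_map k H (axis (\<sigma> m) 1) = ext_map k H (axis (\<sigma> m') 1)"
        "axis (\<sigma> m) 1 \<in> ext_power k" "axis (\<sigma> m') 1 \<in> ext_power k"
      using m(3) A by (simp_all only: w[symmetric]) blast+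
    then have "axis (\<sigma> m) (1::real) = axis (\<sigma> m') 1" by (rule inj_onD[OF inj_ext])
    then have "\<sigma> m = \<sigma> m'" by (simp add: axis_eq_axis)
    then show "m = m'" using \<sigma>(1) m by (auto simp: bij_betw_def inj_on_def)
  qed
  ultimately show ?thesis unfolding is_basis_def by simp
qed

end

lemma continuous_on_wedge:
  assumes "\<And>i. i < k \<Longrightarrow> continuous_on S (\<lambda>x. v i x)"
  shows "continuous_on S (\<lambda>x. wedge k (\<lambda>i. v i x))"
  unfolding wedge_def
proof (rule continuous_on_vec_lambda)
  fix A :: "'b set"
  show "continuous_on S (\<lambda>x. if card A = k then leibniz_det k (\<lambda>i j. v i x $ elem A j) else 0)"
  proof (cases "card A = k")
    case True
    have comp: "continuous_on S (\<lambda>x. v i x $ a)" if "i < k" for i a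
      by (rule continuous_on_component[OF assms[OF that]])
    have "continuous_on S (\<lambda>x. leibniz_det k (\<lambda>i j. v i x $ elem A j))"
      unfolding leibniz_det_def
      by (rule continuous_on_sum, rule continuous_on_mult, rule continuous_on_const, rule continuous_on_prod) (simp add: comp)
    then show ?thesis using True by simp
  qed simp
qed

section \<open>Continuity of the derivative of the flow\<close>

context manifold
begin

text \<open>Joint convergence in point and vector: expanding the vector in the standard basis
  reduces it to continuity of finitely many columns of the derivative.\<close>

lemma coord_change_tendsto:
  assumes c: "c \<in> \<A>" "c' \<in> \<A>" "q \<in> dom c" "q \<in> dom c'" and q: "interior_point q"
    and \<theta>: "(\<theta> \<longlongrightarrow> q) Fil" and w: "(w \<longlongrightarrow> w0) Fil"
  shows "((\<lambda>z. coord_change c c' (\<theta> z) (w z)) \<longlongrightarrow> coord_change c c' q w0) Fil"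
proof (rule transition_C1[OF c q])
  fix r h' assume r: "0 < r" and der: "\<And>y. y \<in> ball (snd c q) r \<Longrightarrow> (snd c' \<circ> chart_inv c has_derivative h' y) (at y)"
    and cont: "\<And>v. continuous_on (ball (snd c q) r) (\<lambda>y. h' y v)"
    and eq: "\<And>p. p \<in> dom c \<Longrightarrow> snd c p \<in> ball (snd c q) r \<Longrightarrow> coord_change c c' p = h' (snd c p)"
  have sc: "((\<lambda>z. snd c (\<theta> z)) \<longlongrightarrow> snd c q) Fil" by (rule isCont_tendsto_compose[OF isCont_chart[OF c(1,3)] \<theta>])
  have ev: "\<forall>\<^sub>F z in Fil. \<theta> z \<in> dom c \<and> snd c (\<theta> z) \<in> ball (snd c q) r"
    using topological_tendstoD[OF \<theta> open_dom[OF c(1)] c(3)] topological_tendstoD[OF sc open_ball, of "snd c q" r] r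
    by (auto intro: eventually_conj)
  have "((\<lambda>z. h' (snd c (\<theta> z)) (axis i 1)) \<longlongrightarrow> h' (snd c q) (axis i 1)) Fil" for i
  proof -
    have "isCont (\<lambda>y. h' y (axis i 1)) (snd c q)"
      using cont r by (simp add: continuous_on_eq_continuous_at)
    then show ?thesis using sc by (rule isCont_tendsto_compose)
  qed
  then have "((\<lambda>z. \<Sum>i\<in>UNIV. w z $ i *\<^sub>R h' (snd c (\<theta> z)) (axis i 1)) \<longlongrightarrow> (\<Sum>i\<in>UNIV. w0 $ i *\<^sub>R h' (snd c q) (axis i 1))) Fil"
    by (intro tendsto_intros w)
  moreover have "(\<Sum>i\<in>UNIV. w0 $ i *\<^sub>R h' (snd c q) (axis i 1)) = coord_change c c' q w0"
    using linear_axis_expansion[OF has_derivative_linear[OF der], of "snd c q" w0] eq[of q] c r by simp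
  moreover have "\<forall>\<^sub>F z in Fil. (\<Sum>i\<in>UNIV. w z $ i *\<^sub>R h' (snd c (\<theta> z)) (axis i 1)) = coord_change c c' (\<theta> z) (w z)"
    using ev
  proof eventually_elim
    case (elim z)
    then show ?case using linear_axis_expansion[OF has_derivative_linear[OF der], of "snd c (\<theta> z)" "w z"] eq[of "\<theta> z"] by simp
  qed
  ultimately show ?thesis using Lim_transform_eventually by force
qed

end

context manifold_flow_set
begin

text \<open>Convergence in the tangent bundle: \<open>v z\<close>, a vector at \<open>\<theta> z\<close>, tends to the vector \<open>w\<close> at \<open>q\<close>.\<close>

definition tlim :: "'z filter \<Rightarrow> ('z \<Rightarrow> 'm) \<Rightarrow> ('z \<Rightarrow> 'n coords) \<Rightarrow> 'm \<Rightarrow> 'n coords \<Rightarrow> bool" where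
  "tlim Fil \<theta> v q w \<longleftrightarrow> q \<in> \<Gamma> \<and> (\<forall>\<^sub>F z in Fil. \<theta> z \<in> \<Gamma>) \<and> (\<theta> \<longlongrightarrow> q) Fil \<and>
    ((\<lambda>z. to_chart (chart_at \<A> q) (\<theta> z) (v z)) \<longlongrightarrow> w) Fil"

lemma eventually_in_dom:
  "(\<theta> \<longlongrightarrow> q) Fil \<Longrightarrow> c \<in> \<A> \<Longrightarrow> q \<in> dom c \<Longrightarrow> \<forall>\<^sub>F z in Fil. \<theta> z \<in> dom c"
  using topological_tendstoD open_dom by blast

lemma tendsto_to_chart:
  assumes q: "q \<in> \<Gamma>" and G: "\<forall>\<^sub>F z in Fil. \<theta> z \<in> \<Gamma>" and \<theta>: "(\<theta> \<longlongrightarrow> q) Fil"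
    and c: "c \<in> \<A>" "q \<in> dom c" and c': "c' \<in> \<A>" "q \<in> dom c'" and l: "((\<lambda>z. to_chart c (\<theta> z) (v z)) \<longlongrightarrow> w) Fil"
  shows "((\<lambda>z. to_chart c' (\<theta> z) (v z)) \<longlongrightarrow> coord_change c c' q w) Fil"
proof -
  have "((\<lambda>z. coord_change c c' (\<theta> z) (to_chart c (\<theta> z) (v z))) \<longlongrightarrow> coord_change c c' q w) Fil"
    by (rule coord_change_tendsto[OF c(1) c'(1) c(2) c'(2) interior_\<Gamma>[OF q] \<theta> l])
  moreover have "\<forall>\<^sub>F z in Fil. coord_change c c' (\<theta> z) (to_chart c (\<theta> z) (v z)) = to_chart c' (\<theta> z) (v z)"
    using eventually_in_dom[OF \<theta> c] eventually_in_dom[OF \<theta> c'] G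
    by eventually_elim (rule coord_change_compose[OF chart_at(1) c(1) c'(1)], simp_all add: chart_at interior_\<Gamma>)
  ultimately show ?thesis by (rule Lim_transform_eventually)
qed

lemma tlimD:
  assumes "tlim Fil \<theta> v q w" "c \<in> \<A>" "q \<in> dom c"
  shows "((\<lambda>z. to_chart c (\<theta> z) (v z)) \<longlongrightarrow> to_chart c q w) Fil"
  using assms tendsto_to_chart[of q \<theta> Fil "chart_at \<A> q" c v w] chart_at[of q] by (simp add: tlim_def)

lemma tlimI:
  assumes "q \<in> \<Gamma>" "\<forall>\<^sub>F z in Fil. \<theta> z \<in> \<Gamma>" "(\<theta> \<longlongrightarrow> q) Fil" "c \<in> \<A>" "q \<in> dom c"
    "((\<lambda>z. to_chart c (\<theta> z) (v z)) \<longlongrightarrow> to_chart c q w) Fil"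
  shows "tlim Fil \<theta> v q w"
  using tendsto_to_chart[OF assms(1-5) chart_at assms(6)] assms(1-5)
  by (simp add: tlim_def of_to_chart interior_\<Gamma>)

lemma tlim_cong:
  assumes t: "tlim Fil \<theta> v q w" and eq: "\<forall>\<^sub>F z in Fil. v z = v' z"
  shows "tlim Fil \<theta> v' q w"
proof -
  have "\<forall>\<^sub>F z in Fil. to_chart (chart_at \<A> q) (\<theta> z) (v z) = to_chart (chart_at \<A> q) (\<theta> z) (v' z)"
    using eq by eventually_elim simp
  then show ?thesis using t Lim_transform_eventually unfolding tlim_def by force
qed

lemma tlim_linear:
  assumes q: "q \<in> \<Gamma>" and G: "\<forall>\<^sub>F z in Fil. \<theta> z \<in> \<Gamma>" and \<theta>: "(\<theta> \<longlongrightarrow> q) Fil"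
    and lin: "\<forall>\<^sub>F z in Fil. linear (H z)" "linear (H0 :: 'n coords \<Rightarrow> 'n coords)"
    and lim: "\<And>i. tlim Fil \<theta> (\<lambda>z. H z (axis i 1)) q (H0 (axis i 1))"
  shows "tlim Fil \<theta> (\<lambda>z. H z \<xi>) q (H0 \<xi>)"
  unfolding tlim_def
proof (intro conjI q G \<theta>)
  let ?c = "chart_at \<A> q"
  have "((\<lambda>z. \<Sum>i\<in>UNIV. \<xi> $ i *\<^sub>R to_chart ?c (\<theta> z) (H z (axis i 1))) \<longlongrightarrow> (\<Sum>i\<in>UNIV. \<xi> $ i *\<^sub>R H0 (axis i 1))) Fil"
    using lim by (intro tendsto_intros) (auto simp: tlim_def)
  moreover have "\<forall>\<^sub>F z in Fil. (\<Sum>i\<in>UNIV. \<xi> $ i *\<^sub>R to_chart ?c (\<theta> z) (H z (axis i 1))) = to_chart ?c (\<theta> z) (H z \<xi>)"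
    using eventually_in_dom[OF \<theta> chart_at] lin(1)
  proof eventually_elim
    case (elim z)
    have "linear (\<lambda>\<xi>. to_chart ?c (\<theta> z) (H z \<xi>))"
      using linear_compose[OF elim(2) linear_coord_change[OF chart_at(1) chart_at(1) chart_at(2) elim(1)]] by (simp add: o_def)
    from linear_axis_expansion[OF this, of \<xi>] show ?case by simp
  qed
  ultimately show "((\<lambda>z. to_chart ?c (\<theta> z) (H z \<xi>)) \<longlongrightarrow> H0 \<xi>) Fil"
    unfolding linear_axis_expansion[OF lin(2), of \<xi>] by (rule Lim_transform_eventually)
qed

lemma tlim_chart_vector:
  assumes q: "q \<in> \<Gamma>" and G: "\<forall>\<^sub>F z in Fil. \<theta> z \<in> \<Gamma>" and \<theta>: "(\<theta> \<longlongrightarrow> q) Fil" and c: "c \<in> \<A>" "q \<in> dom c"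
  shows "tlim Fil \<theta> (\<lambda>z. of_chart c (\<theta> z) u) q (of_chart c q u)"
proof (rule tlimI[OF q G \<theta> c])
  have inv: "to_chart c p (of_chart c p u) = u" if "p \<in> \<Gamma>" "p \<in> dom c" for p
    by (rule to_of_chart[OF c(1) that(2) interior_\<Gamma>[OF that(1)]])
  have "\<forall>\<^sub>F z in Fil. u = to_chart c (\<theta> z) (of_chart c (\<theta> z) u)"
    using eventually_in_dom[OF \<theta> c] G by eventually_elim (simp add: inv)
  then show "((\<lambda>z. to_chart c (\<theta> z) (of_chart c (\<theta> z) u)) \<longlongrightarrow> to_chart c q (of_chart c q u)) Fil"
    unfolding inv[OF q c(2)] by (rule Lim_transform_eventually[OF tendsto_const])
qed

lemma tlim_continuous_section:
  assumes s: "continuous_section \<A> id (U \<inter> \<Gamma>) s" and U: "open U" "x \<in> U" "x \<in> \<Gamma>"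
  shows "tlim (at x within \<Gamma>) (\<lambda>y. y) s x (s x)"
  unfolding tlim_def
proof (intro conjI U(3))
  let ?c = "chart_at \<A> x"
  show "\<forall>\<^sub>F z in at x within \<Gamma>. z \<in> \<Gamma>" by (auto simp: eventually_at_topological)
  have "continuous_on (U \<inter> \<Gamma> \<inter> dom ?c) (\<lambda>y. to_chart ?c y (s y))"
    using s chart_at(1) by (auto simp: continuous_section_def)
  then have "((\<lambda>y. to_chart ?c y (s y)) \<longlongrightarrow> coord_change ?c ?c x (s x)) (at x within U \<inter> \<Gamma> \<inter> dom ?c)"
    using U chart_at(2) by (auto simp: continuous_on_def)
  moreover have "at x within U \<inter> \<Gamma> \<inter> dom ?c = at x within \<Gamma>"
    by (rule at_within_nhd[of x "U \<inter> dom ?c"]) (use U chart_at[of x] open_dom[OF chart_at(1)] in auto)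
  ultimately show "((\<lambda>y. to_chart ?c y (s y)) \<longlongrightarrow> s x) (at x within \<Gamma>)"
    using coord_change_refl[OF chart_at interior_\<Gamma>[OF U(3)]] by simp
qed simp

text \<open>Strict differentiability at q makes the derivatives at nearby points uniformly close to
  the one at q, on bounded sets of vectors. This gives convergence along any filter.\<close>

lemma tlim_flow_deriv_short:
  assumes t: "tlim Fil \<theta> v q w" and \<tau>: "0 \<le> \<tau>" and c: "c \<in> \<A>" "q \<in> dom c" "\<phi> \<tau> q \<in> dom c"
    and f': "strict_derivative (snd c \<circ> \<phi> \<tau> \<circ> chart_inv c) f' (snd c q)"
  shows "tlim Fil (\<lambda>z. \<phi> \<tau> (\<theta> z)) (\<lambda>z. DX \<tau> (\<theta> z) (v z)) (\<phi> \<tau> q) (DX \<tau> q w)"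
proof -
  have q: "q \<in> \<Gamma>" and \<theta>: "(\<theta> \<longlongrightarrow> q) Fil" and G: "\<forall>\<^sub>F z in Fil. \<theta> z \<in> \<Gamma>" using t by (auto simp: tlim_def)
  have \<phi>\<theta>: "((\<lambda>z. \<phi> \<tau> (\<theta> z)) \<longlongrightarrow> \<phi> \<tau> q) Fil" using isCont_flow[OF \<tau>] \<theta> by (rule isCont_tendsto_compose)
  let ?u = "\<lambda>z. to_chart c (\<theta> z) (v z)" and ?w = "to_chart c q w"
  let ?D = "\<lambda>p v. to_chart c (\<phi> \<tau> p) (DX \<tau> p (of_chart c p v))"
  have D: "(snd c \<circ> \<phi> \<tau> \<circ> chart_inv c has_derivative ?D p) (at (snd c p))"
    if "p \<in> \<Gamma>" "p \<in> dom c" "\<phi> \<tau> p \<in> dom c" for p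
    by (rule flow_deriv_in_charts[OF that(1) _ c(1) that(2) c(1) that(3)]) (simp add: flow_deriv_fdiff that(1))
  have f'D: "f' = ?D q"
    by (rule has_derivative_unique[OF strict_derivative_imp_has_derivative[OF f'] D[OF q c(2,3)]])
  have inv: "of_chart c p (to_chart c p v) = v" if "p \<in> \<Gamma>" "p \<in> dom c" for p v
    by (rule of_to_chart[OF c(1) that(2) interior_\<Gamma>[OF that(1)]])
  have u: "(?u \<longlongrightarrow> ?w) Fil" by (rule tlimD[OF t c(1,2)])
  have lf: "linear f'" using f' by (simp add: strict_derivative_def)
  have lim1: "((\<lambda>z. f' (?u z)) \<longlongrightarrow> f' ?w) Fil"
    by (rule bounded_linear.tendsto[OF lf[unfolded linear_conv_bounded_linear] u])
  have ev: "\<forall>\<^sub>F z in Fil. \<theta> z \<in> \<Gamma> \<and> \<theta> z \<in> dom c \<and> \<phi> \<tau> (\<theta> z) \<in> dom c"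
    using eventually_in_dom[OF \<theta> c(1,2)] eventually_in_dom[OF \<phi>\<theta> c(1,3)] G by eventually_elim simp
  have sc: "((\<lambda>z. snd c (\<theta> z)) \<longlongrightarrow> snd c q) Fil" by (rule isCont_tendsto_compose[OF isCont_chart[OF c(1,2)] \<theta>])
  have lim2: "((\<lambda>z. ?D (\<theta> z) (?u z) - f' (?u z)) \<longlongrightarrow> 0) Fil"
  proof (rule tendstoI)
    fix e :: real assume e: "0 < e"
    \<comment> \<open>The converging vectors eventually have norm below
      \<open>norm ?w + 1\<close>.\<close>
    define \<epsilon> where "\<epsilon> = e / (norm ?w + 1)"
    have \<epsilon>: "0 < \<epsilon>" using e by (simp add: \<epsilon>_def add_nonneg_pos)
    obtain \<delta> where \<delta>: "0 < \<delta>" "\<forall>z\<in>ball (snd c q) \<delta>. \<forall>D. (snd c \<circ> \<phi> \<tau> \<circ> chart_inv c has_derivative D) (at z) \<longrightarrow> (\<forall>v. norm (D v - f' v) \<le> \<epsilon> * norm v)"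
      using strict_derivative_close[OF f' \<epsilon>] by blast
    have "((\<lambda>z. norm (?u z)) \<longlongrightarrow> norm ?w) Fil" by (intro tendsto_norm u)
    then have "\<forall>\<^sub>F z in Fil. norm (?u z) < norm ?w + 1" by (rule order_tendstoD(2)) simp
    moreover have "\<forall>\<^sub>F z in Fil. snd c (\<theta> z) \<in> ball (snd c q) \<delta>"
      using topological_tendstoD[OF sc open_ball, of "snd c q" \<delta>] \<delta>(1) by simp
    ultimately show "\<forall>\<^sub>F z in Fil. dist (?D (\<theta> z) (?u z) - f' (?u z)) 0 < e"
      using ev
    proof eventually_elim
      case (elim z)
      have "norm (?D (\<theta> z) (?u z) - f' (?u z)) \<le> \<epsilon> * norm (?u z)"
        using \<delta>(2) elim(2,3) D by blast
      also have "\<dots> < \<epsilon> * (norm ?w + 1)" using elim(1) \<epsilon> by simp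
      also have "\<dots> = e" by (simp add: \<epsilon>_def add_nonneg_pos less_imp_neq[symmetric])
      finally show ?case by simp
    qed
  qed
  have lim3: "((\<lambda>z. ?D (\<theta> z) (?u z)) \<longlongrightarrow> f' ?w) Fil" using tendsto_add[OF lim2 lim1] by simp
  show ?thesis
  proof (rule tlimI[OF flow_in[OF q] _ \<phi>\<theta> c(1,3)])
    show "\<forall>\<^sub>F z in Fil. \<phi> \<tau> (\<theta> z) \<in> \<Gamma>" using G by eventually_elim (rule flow_in)
    have "\<forall>\<^sub>F z in Fil. ?D (\<theta> z) (?u z) = to_chart c (\<phi> \<tau> (\<theta> z)) (DX \<tau> (\<theta> z) (v z))"
      using ev by eventually_elim (simp add: inv)
    moreover have "f' ?w = to_chart c (\<phi> \<tau> q) (DX \<tau> q w)"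
      unfolding f'D using inv[OF q c(2)] by simp
    ultimately show "((\<lambda>z. to_chart c (\<phi> \<tau> (\<theta> z)) (DX \<tau> (\<theta> z) (v z)))
        \<longlongrightarrow> to_chart c (\<phi> \<tau> q) (DX \<tau> q w)) Fil"
      using Lim_transform_eventually[OF lim3] by simp
  qed
qed

lemma tlim_flow_deriv:
  assumes t: "tlim Fil \<theta> v q w" and \<tau>: "0 \<le> \<tau>"
  shows "tlim Fil (\<lambda>z. \<phi> \<tau> (\<theta> z)) (\<lambda>z. DX \<tau> (\<theta> z) (v z)) (\<phi> \<tau> q) (DX \<tau> q w)"
proof -
  obtain C where C: "1 \<le> C" and box: "\<forall>q\<in>\<Gamma>. \<exists>c. flow_box c C q" using flow_box_uniform by blast
  have base: "tlim Fil (\<lambda>z. \<phi> \<tau> (\<theta> z)) (\<lambda>z. DX \<tau> (\<theta> z) (v z)) (\<phi> \<tau> q) (DX \<tau> q w)"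
    if t: "tlim Fil \<theta> v q w" and \<tau>: "0 \<le> \<tau>" "\<tau> * C \<le> 1" for \<theta> v q w \<tau>
  proof -
    have "q \<in> \<Gamma>" using t by (simp add: tlim_def)
    then obtain c f' where "c \<in> \<A>" "q \<in> dom c" "\<phi> \<tau> q \<in> dom c" "strict_derivative (snd c \<circ> \<phi> \<tau> \<circ> chart_inv c) f' (snd c q)"
      using box \<tau> unfolding flow_box_def by meson
    then show ?thesis using tlim_flow_deriv_short[OF t] \<tau> by auto
  qed
  have q: "q \<in> \<Gamma>" and G: "\<forall>\<^sub>F z in Fil. \<theta> z \<in> \<Gamma>" using t by (auto simp: tlim_def)
  show ?thesis
  proof (rule short_time_induct[OF C \<tau>])
    fix s r assume s: "0 \<le> (s::real)" and r: "0 \<le> r" "r * C \<le> 1"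
      and lim: "tlim Fil (\<lambda>z. \<phi> s (\<theta> z)) (\<lambda>z. DX s (\<theta> z) (v z)) (\<phi> s q) (DX s q w)"
    have deriv: "DX (r + s) p u = DX r (\<phi> s p) (DX s p u)" if "p \<in> \<Gamma>" for p u
      using flow_deriv_add[OF that s r(1)] by (simp add: add.commute)
    have "\<forall>\<^sub>F z in Fil. DX r (\<phi> s (\<theta> z)) (DX s (\<theta> z) (v z)) = DX (r + s) (\<theta> z) (v z)"
      using G by eventually_elim (simp add: deriv)
    from tlim_cong[OF base[OF lim r] this]
    show "tlim Fil (\<lambda>z. \<phi> (r + s) (\<theta> z)) (\<lambda>z. DX (r + s) (\<theta> z) (v z)) (\<phi> (r + s) q) (DX (r + s) q w)"
      unfolding flow_semigroup[OF r(1) s] deriv[OF q] .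
  qed (rule base[OF t])
qed

end

context manifold_flow
begin

text \<open>A time bound valid for all starting points near p at once. It combines continuity of the
  single orbit of p with the Lipschitz estimate between orbits.\<close>

lemma flow_stays_near:
  assumes V: "open V" "p \<in> V"
  shows "\<exists>\<tau>>0. \<exists>N. open N \<and> p \<in> N \<and> (\<forall>q\<in>N. \<forall>t\<in>{0..\<tau>}. \<phi> t q \<in> V)"
proof -
  define c where "c = chart_at \<A> p"
  have c: "c \<in> \<A>" "p \<in> dom c" unfolding c_def by (rule chart_at)+
  obtain r \<tau> where ctl: "controlled c p r \<tau>" using controlled_exists[OF c] by blast
  then have r: "0 < r" "0 < \<tau>" by (auto simp: controlled_def)
  have "continuous (at (snd c p) within im c) (chart_inv c)"
    using continuous_chart_inv[OF c(1)] c(2) by (simp add: continuous_on_eq_continuous_within)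
  then have "(chart_inv c \<longlongrightarrow> p) (at (snd c p) within im c)" using chart_inv_left[OF c] by (simp add: continuous_within)
  then have "\<forall>\<^sub>F y in at (snd c p) within im c. chart_inv c y \<in> V" using V by (rule topological_tendstoD)
  then obtain \<epsilon> where \<epsilon>: "0 < \<epsilon>" "\<And>y. y \<in> im c \<Longrightarrow> y \<noteq> snd c p \<Longrightarrow> dist y (snd c p) < \<epsilon> \<Longrightarrow> chart_inv c y \<in> V"
    unfolding eventually_at by auto
  have near: "q \<in> V" if "q \<in> dom c" "dist (snd c q) (snd c p) < \<epsilon>" for q
  proof (cases "snd c q = snd c p")
    case True
    then have "q = p" using chart_inv_left[OF c] chart_inv_left[OF c(1) that(1)] by simp
    then show ?thesis using V by simp
  next
    case False
    then show ?thesis using \<epsilon>(2)[of "snd c q"] that chart_inv_left[OF c(1) that(1)] by auto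
  qed
  have "continuous_on {0..} (\<lambda>t. \<phi> t p)" using flow_curve[of p] by (simp add: integral_curve_def)
  then have "((\<lambda>t. \<phi> t p) \<longlongrightarrow> p) (at 0 within {0..})" by (force simp: continuous_on_def flow_zero)
  with isCont_chart[OF c] have "((\<lambda>t. snd c (\<phi> t p)) \<longlongrightarrow> snd c p) (at 0 within {0..})" by (rule isCont_tendsto_compose)
  then have "\<forall>\<^sub>F t in at 0 within {0..}. dist (snd c (\<phi> t p)) (snd c p) < \<epsilon> / 2" using \<epsilon>(1) by (intro tendstoD) auto
  then obtain d where d: "0 < d" "\<And>t. 0 \<le> t \<Longrightarrow> t \<noteq> 0 \<Longrightarrow> dist t 0 < d \<Longrightarrow> dist (snd c (\<phi> t p)) (snd c p) < \<epsilon> / 2"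
    unfolding eventually_at by auto
  \<comment> \<open>Starting points within \<epsilon> / 4 separate to at most \<epsilon> / 2, and
    the orbit of p itself moves by less than \<epsilon> / 2.\<close>
  define N where "N = {q \<in> dom c. snd c q \<in> ball (snd c p) (min r (\<epsilon> / 4))}"
  define \<tau>' where "\<tau>' = min \<tau> (d / 2)"
  have "\<phi> t q \<in> V" if q: "q \<in> N" and t: "t \<in> {0..\<tau>'}" for q t
  proof (rule near)
    have t': "t \<in> {0..\<tau>}" using t by (auto simp: \<tau>'_def)
    have q': "q \<in> dom c" "p \<in> dom c" "snd c q \<in> ball (snd c p) r" "snd c p \<in> ball (snd c p) r" using q c r by (auto simp: N_def)
    show "\<phi> t q \<in> dom c" by (rule controlled_flow(1)[OF ctl q' t'])
    have "norm (snd c (\<phi> t q) - snd c (\<phi> t p)) \<le> 2 * norm (snd c q - snd c p)" by (rule controlled_flow(2)[OF ctl q' t'])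
    moreover have "norm (snd c q - snd c p) < \<epsilon> / 4" using q by (auto simp: N_def dist_norm norm_minus_commute)
    moreover have "dist (snd c (\<phi> t p)) (snd c p) < \<epsilon> / 2"
    proof (cases "t = 0")
      case True
      then show ?thesis using \<epsilon>(1) by (simp add: flow_zero)
    next
      case False
      then show ?thesis using t d(1) by (intro d(2)) (auto simp: \<tau>'_def)
    qed
    ultimately show "dist (snd c (\<phi> t q)) (snd c p) < \<epsilon>"
      using dist_triangle[of "snd c (\<phi> t q)" "snd c p" "snd c (\<phi> t p)"] by (simp add: dist_norm)
  qed
  moreover have "open N" unfolding N_def by (rule chart_ball_open[OF c(1)])
  moreover have "p \<in> N" unfolding N_def using c r \<epsilon>(1) by auto
  moreover have "0 < \<tau>'" using r d by (simp add: \<tau>'_def)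
  ultimately show ?thesis by blast
qed

end

lemma continuous_section_cong:
  assumes "\<And>y. y \<in> S \<Longrightarrow> \<tau> y = \<sigma> y" "continuous_section \<A> L S \<sigma>"
  shows "continuous_section \<A> L S \<tau>"
  unfolding continuous_section_def
proof
  fix c assume "c \<in> \<A>"
  then have "continuous_on (S \<inter> fst c) (\<lambda>y. L (coord_change (chart_at \<A> y) c y) (\<sigma> y))"
    using assms(2) by (simp add: continuous_section_def)
  then show "continuous_on (S \<inter> fst c) (\<lambda>y. L (coord_change (chart_at \<A> y) c y) (\<tau> y))"
    by (rule continuous_on_eq) (simp add: assms(1))
qed

section \<open>The metric and adapted frames over the invariant set\<close>

locale flow_splitting = manifold_flow_set \<A> X \<phi> \<Gamma>
  for \<A> :: "('m::{t2_space,second_countable_topology}, 'n::{finite,linorder}) chart set" and X \<phi> \<Gamma> +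
  fixes g :: "'m \<Rightarrow> 'n coords \<Rightarrow> 'n coords \<Rightarrow> real" and E F :: "'m \<Rightarrow> 'n coords set" and k l :: nat
  assumes metric: "riemannian_metric \<A> g"
    and splitting: "invariant_splitting \<A> \<phi> id UNIV \<Gamma> E F"
    and dim_E: "\<And>x. x \<in> \<Gamma> \<Longrightarrow> dim (E x) = l" and dim_F: "\<And>x. x \<in> \<Gamma> \<Longrightarrow> dim (F x) = k" and k: "1 \<le> k"
begin

abbreviation "gn p \<equiv> form_norm (g p)"
abbreviation "I \<equiv> elem (UNIV :: 'n set) ` {..<l}"
abbreviation "J \<equiv> - elem (UNIV :: 'n set) ` {..<l}"

lemma pos_def: "pos_def_form (g p)"
  using metric unfolding riemannian_metric_def pos_def_form_def by blast

lemma
  assumes "x \<in> \<Gamma>"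
  shows subspace_E: "subspace (E x)" and subspace_F: "subspace (F x)" and E_nonzero: "E x \<noteq> {0}" and F_nonzero: "F x \<noteq> {0}"
    and sum_EF: "{u + v | u v. u \<in> E x \<and> v \<in> F x} = UNIV" and int_EF: "E x \<inter> F x = {0}"
    and DX_E: "DX t x ` E x = E (\<phi> t x)" and DX_F: "DX t x ` F x = F (\<phi> t x)"
  using splitting assms unfolding invariant_splitting_def by simp_all

lemma metric_tendsto:
  assumes u: "tlim Fil \<theta> u q u'" and v: "tlim Fil \<theta> v q v'"
  shows "((\<lambda>z. g (\<theta> z) (u z) (v z)) \<longlongrightarrow> g q u' v') Fil"
proof -
  define c where "c = chart_at \<A> q"
  have c: "c \<in> \<A>" "q \<in> dom c" unfolding c_def by (rule chart_at)+
  have q: "q \<in> \<Gamma>" and \<theta>: "(\<theta> \<longlongrightarrow> q) Fil" and G: "\<forall>\<^sub>F z in Fil. \<theta> z \<in> \<Gamma>" using u by (auto simp: tlim_def)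
  define B where "B y u v = (let p = chart_inv c y; T = of_chart c p in g p (T u) (T v))" for y u v
  have "continuous_on (im c) (\<lambda>y. B y u v)" for u v
    using metric c unfolding riemannian_metric_def B_def by (intro C_on_continuous_on[of \<infinity>]) blast
  moreover have "((\<lambda>z. snd c (\<theta> z)) \<longlongrightarrow> snd c q) Fil" by (rule isCont_tendsto_compose[OF isCont_chart[OF c] \<theta>])
  moreover have dc: "\<forall>\<^sub>F z in Fil. \<theta> z \<in> dom c" by (rule eventually_in_dom[OF \<theta> c])
  then have "\<forall>\<^sub>F z in Fil. snd c (\<theta> z) \<in> im c" by eventually_elim auto
  ultimately have B: "((\<lambda>z. B (snd c (\<theta> z)) u v) \<longlongrightarrow> B (snd c q) u v) Fil" for u v
    using c(2) by (intro continuous_on_tendsto_compose[of "im c" "\<lambda>y. B y u v"]) auto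
  let ?u = "\<lambda>z. to_chart c (\<theta> z) (u z)" and ?v = "\<lambda>z. to_chart c (\<theta> z) (v z)"
  have uv: "(?u \<longlongrightarrow> u') Fil" "(?v \<longlongrightarrow> v') Fil" using u v by (auto simp: tlim_def c_def)
  have lin: "linear (of_chart c p)" if "p \<in> dom c" for p
    by (rule linear_coord_change[OF c(1) chart_at(1) that chart_at(2)])
  have bil: "bilinear (g p)" for p using pos_def by (simp add: pos_def_form_def)
  have expand: "B (snd c p) a b = (\<Sum>i\<in>UNIV. \<Sum>j\<in>UNIV. a $ i * b $ j * B (snd c p) (axis i 1) (axis j 1))" if "p \<in> dom c" for p a b
  proof -
    have "B (snd c p) a b = g p (of_chart c p a) (of_chart c p b)"
      using chart_inv_left[OF c(1) that] by (simp add: B_def Let_def)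
    then show ?thesis
      using chart_inv_left[OF c(1) that]
      by (simp add: B_def Let_def linear_axis_expansion[OF lin[OF that], of a] linear_axis_expansion[OF lin[OF that], of b]
          bilinear_sum[OF bil] sum.cartesian_product[symmetric] bilinear_lmul[OF bil] bilinear_rmul[OF bil] mult_ac del: UNIV_Times_UNIV)
  qed
  have "((\<lambda>z. \<Sum>i\<in>UNIV. \<Sum>j\<in>UNIV. ?u z $ i * ?v z $ j * B (snd c (\<theta> z)) (axis i 1) (axis j 1))
      \<longlongrightarrow> (\<Sum>i\<in>UNIV. \<Sum>j\<in>UNIV. u' $ i * v' $ j * B (snd c q) (axis i 1) (axis j 1))) Fil"
    by (intro tendsto_intros uv B)
  then have "((\<lambda>z. \<Sum>i\<in>UNIV. \<Sum>j\<in>UNIV. ?u z $ i * ?v z $ j * B (snd c (\<theta> z)) (axis i 1) (axis j 1))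
      \<longlongrightarrow> B (snd c q) u' v') Fil" by (simp only: expand[OF c(2), symmetric])
  moreover have "B (snd c q) u' v' = g q u' v'"
    using chart_inv_left[OF c] coord_change_refl[OF c interior_\<Gamma>[OF q]] by (simp add: B_def Let_def c_def)
  moreover have "\<forall>\<^sub>F z in Fil. (\<Sum>i\<in>UNIV. \<Sum>j\<in>UNIV. ?u z $ i * ?v z $ j * B (snd c (\<theta> z)) (axis i 1) (axis j 1)) = g (\<theta> z) (u z) (v z)"
    using dc G
  proof eventually_elim
    case (elim z)
    have inv: "of_chart c (\<theta> z) (to_chart c (\<theta> z) w) = w" for w
      by (rule of_to_chart[OF c(1) elim(1) interior_\<Gamma>[OF elim(2)]])
    have "B (snd c (\<theta> z)) (?u z) (?v z) = g (\<theta> z) (u z) (v z)"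
      using chart_inv_left[OF c(1) elim(1)] by (simp add: B_def Let_def inv)
    then show ?case by (simp only: expand[OF elim(1), symmetric])
  qed
  ultimately show ?thesis using Lim_transform_eventually by force
qed

lemma adapted_local_frame:
  assumes x: "x \<in> \<Gamma>"
  shows "\<exists>U H. open U \<and> x \<in> U \<and> (\<forall>y\<in>U \<inter> \<Gamma>. adapted_frame I J (H y) (E y) (F y) k) \<and>
    (\<forall>a. continuous_section \<A> id (U \<inter> \<Gamma>) (\<lambda>y. H y (axis a 1)))"
proof -
  have sE: "continuous_subbundle \<A> id \<Gamma> E" and sF: "continuous_subbundle \<A> id \<Gamma> F"
    using splitting by (auto simp: invariant_splitting_def)
  obtain U1 d1 s where U1: "open U1" "x \<in> U1" "\<forall>y\<in>U1 \<inter> \<Gamma>. is_basis (E y) d1 (\<lambda>i. s i y)"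
      "\<forall>i<d1. continuous_section \<A> id (U1 \<inter> \<Gamma>) (s i)"
    using bspec[OF sE[unfolded continuous_subbundle_def] x] by (elim exE conjE) (rule that)
  obtain U2 d2 s' where U2: "open U2" "x \<in> U2" "\<forall>y\<in>U2 \<inter> \<Gamma>. is_basis (F y) d2 (\<lambda>i. s' i y)"
      "\<forall>i<d2. continuous_section \<A> id (U2 \<inter> \<Gamma>) (s' i)"
    using bspec[OF sF[unfolded continuous_subbundle_def] x] by (elim exE conjE) (rule that)
  have d: "d1 = l" "d2 = k" using is_basis_dim[OF U1(3)[rule_format]] is_basis_dim[OF U2(3)[rule_format]] U1(2) U2(2) dim_E[OF x] dim_F[OF x] x by auto
  have sub: "continuous_section \<A> id (U1 \<inter> U2 \<inter> \<Gamma>) \<sigma>"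
    if "continuous_section \<A> id (U \<inter> \<Gamma>) \<sigma>" "U1 \<inter> U2 \<subseteq> U" for U and \<sigma> :: "'m \<Rightarrow> 'n coords"
    using that unfolding continuous_section_def by (meson Int_mono continuous_on_subset order_refl)
  then have s: "continuous_section \<A> id (U1 \<inter> U2 \<inter> \<Gamma>) (s i)" if "i < l" for i using U1(4) d that by blast
  have s': "continuous_section \<A> id (U1 \<inter> U2 \<inter> \<Gamma>) (s' i)" if "i < k" for i using sub[of U2] U2(4) d that by blast
  have cb: "complementary_bases (E y) (F y) l k (\<lambda>i. s i y) (\<lambda>i. s' i y)" if "y \<in> U1 \<inter> U2 \<inter> \<Gamma>" for y
    using U1(3) U2(3) d that sum_EF int_EF by (intro complementary_bases.intro) auto
  define H where "H y = frame_map l k (\<lambda>i. s i y) (\<lambda>i. s' i y)" for y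
  have "continuous_section \<A> id (U1 \<inter> U2 \<inter> \<Gamma>) (\<lambda>y. H y (axis a 1))" for a
  proof -
    have "bij_betw (elem (UNIV :: 'n set)) {..<l + k} UNIV"
      using cb[of x] U1 U2 x by (intro complementary_bases.elem_UNIV) auto
    then obtain j where j: "j < l + k" "a = elem UNIV j" unfolding bij_betw_def by (metis UNIV_I imageE lessThan_iff)
    show ?thesis
    proof (cases "j < l")
      case True
      have "H y (axis a 1) = s j y" if "y \<in> U1 \<inter> U2 \<inter> \<Gamma>" for y
        unfolding H_def j(2) by (rule complementary_bases.H_axis(1)[OF cb[OF that] True])
      then show ?thesis using s[OF True] by (rule continuous_section_cong)
    next
      case False
      then have j': "j - l < k" "a = elem UNIV (l + (j - l))" using j by auto
      have "H y (axis a 1) = s' (j - l) y" if "y \<in> U1 \<inter> U2 \<inter> \<Gamma>" for y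
        unfolding H_def j'(2) by (rule complementary_bases.H_axis(2)[OF cb[OF that] j'(1)])
      then show ?thesis using s'[OF j'(1)] by (rule continuous_section_cong)
    qed
  qed
  moreover have "adapted_frame I J (H y) (E y) (F y) k" if "y \<in> U1 \<inter> U2 \<inter> \<Gamma>" for y
    unfolding H_def by (rule complementary_bases.adapted_frame[OF cb[OF that]])
  ultimately show ?thesis using U1(1,2) U2(1,2) by (intro exI[of _ "U1 \<inter> U2"] exI[of _ H]) auto
qed

lemma dims: assumes "x \<in> \<Gamma>" shows "1 \<le> l" "I \<noteq> {}"
proof -
  have "dim (E x) \<noteq> 0" using E_nonzero[OF assms] subspace_0[OF subspace_E[OF assms]] by (auto simp: dim_eq_0)
  then show "1 \<le> l" using dim_E[OF assms] by simp
  then show "I \<noteq> {}" by (auto simp: lessThan_empty_iff)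
qed

lemma continuous_frame:
  assumes x: "x \<in> \<Gamma>"
  shows "\<exists>U H. open U \<and> x \<in> U \<and> (\<forall>y\<in>U \<inter> \<Gamma>. adapted_frame I J (H y) (E y) (F y) k) \<and>
    (\<forall>\<xi>. tlim (at x within \<Gamma>) (\<lambda>y. y) (\<lambda>y. H y \<xi>) x (H x \<xi>))"
proof -
  obtain U H where U: "open U" "x \<in> U" and H: "\<forall>y\<in>U \<inter> \<Gamma>. adapted_frame I J (H y) (E y) (F y) k"
    and sec: "\<forall>a. continuous_section \<A> id (U \<inter> \<Gamma>) (\<lambda>y. H y (axis a 1))"
    using adapted_local_frame[OF x] by (elim exE conjE) (rule that)
  have lin: "linear (H y)" if "y \<in> U \<inter> \<Gamma>" for y using H that by (auto simp: adapted_frame_def)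
  have ev: "\<forall>\<^sub>F z in at x within \<Gamma>. z \<in> \<Gamma>" "\<forall>\<^sub>F z in at x within \<Gamma>. linear (H z)"
    unfolding eventually_at_topological using U lin by blast+
  have "tlim (at x within \<Gamma>) (\<lambda>y. y) (\<lambda>y. H y \<xi>) x (H x \<xi>)" for \<xi>
    by (rule tlim_linear[OF x ev(1) _ ev(2) lin tlim_continuous_section[OF sec[rule_format] U x]]) (use U x in auto)
  then show ?thesis using U H by blast
qed

text \<open>The form in question is the metric at time t pulled back by DX after the frame; its
  matrix entries converge by continuity of the derivative of the flow. Time 0 gives the metric
  itself.\<close>

lemma frame_close:
  fixes H :: "'m \<Rightarrow> 'n coords \<Rightarrow> 'n coords"
  assumes x: "x \<in> \<Gamma>" and t: "0 \<le> t" and lin: "\<forall>\<^sub>F y in at x within \<Gamma>. linear (H y)" "linear (H x)" "inj (H x)"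
    and lim: "\<And>\<xi>. tlim (at x within \<Gamma>) (\<lambda>y. y) (\<lambda>y. H y \<xi>) x (H x \<xi>)" and \<epsilon>: "0 < \<epsilon>"
  shows "\<forall>\<^sub>F y in at x within \<Gamma>. \<forall>\<xi>. gn (\<phi> t x) (DX t x (H x \<xi>)) \<le> exp \<epsilon> * gn (\<phi> t y) (DX t y (H y \<xi>)) \<and>
    gn (\<phi> t y) (DX t y (H y \<xi>)) \<le> exp \<epsilon> * gn (\<phi> t x) (DX t x (H x \<xi>))"
proof (rule form_family_close[where G = "\<lambda>y. g (\<phi> t y)" and H = "\<lambda>y \<xi>. DX t y (H y \<xi>)"
      and ?G0.0 = "g (\<phi> t x)" and ?H0.0 = "\<lambda>\<xi>. DX t x (H x \<xi>)"])
  have ev: "\<forall>\<^sub>F y in at x within \<Gamma>. y \<in> \<Gamma>" by (auto simp: eventually_at_topological)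
  show "bilinear (g (\<phi> t y))" for y using pos_def by (simp add: pos_def_form_def)
  show "\<forall>\<^sub>F y in at x within \<Gamma>. linear (\<lambda>\<xi>. DX t y (H y \<xi>))"
    using lin(1) ev
  proof eventually_elim
    case (elim y)
    show ?case using linear_compose[OF elim(1) linear_flow_deriv[OF elim(2), of t]] by (simp add: o_def)
  qed
  show linear: "linear (\<lambda>\<xi>. DX t x (H x \<xi>))" using linear_compose[OF lin(2) linear_flow_deriv[OF x, of t]] by (simp add: o_def)
  show "bilinear (g (\<phi> t x))" using pos_def by (simp add: pos_def_form_def)
  show "((\<lambda>y. g (\<phi> t y) (DX t y (H y (axis i 1))) (DX t y (H y (axis j 1)))) \<longlongrightarrow>
      g (\<phi> t x) (DX t x (H x (axis i 1))) (DX t x (H x (axis j 1)))) (at x within \<Gamma>)" for i j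
    by (rule metric_tendsto[OF tlim_flow_deriv[OF lim t] tlim_flow_deriv[OF lim t]])
  fix \<xi> :: "'n coords" assume "\<xi> \<noteq> 0"
  have "inj (\<lambda>\<xi>. DX t x (H x \<xi>))" using inj_compose[OF inj_flow_deriv[OF x, of t] lin(3)] by (simp add: o_def)
  then have "DX t x (H x \<xi>) \<noteq> 0" using linear_injective_0[OF linear] \<open>\<xi> \<noteq> 0\<close> by blast
  then show "0 < g (\<phi> t x) (DX t x (H x \<xi>)) (DX t x (H x \<xi>))" using pos_def by (simp add: pos_def_form_def)
qed (rule \<epsilon>)

lemma norm_equivalence_at:
  assumes "linear H" "inj (H :: 'n coords \<Rightarrow> 'n coords)"
  shows "\<exists>C\<ge>1. \<forall>\<xi>. norm \<xi> \<le> C * gn p (H \<xi>) \<and> gn p (H \<xi>) \<le> C * norm \<xi>"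
proof -
  obtain P :: "'n coords \<Rightarrow> 'n coords" where P: "linear P" "inj P" "\<And>v. gn p v = norm (P v)"
    using pos_def_form_factor[OF pos_def[of p]] by auto
  have lin: "linear (\<lambda>\<xi>. P (H \<xi>))" using linear_compose[OF assms(1) P(1)] by (simp add: o_def)
  have "inj (\<lambda>\<xi>. P (H \<xi>))" using inj_compose[OF P(2) assms(2)] by (simp add: o_def)
  then have z: "\<And>\<xi>. \<xi> \<in> UNIV \<Longrightarrow> P (H \<xi>) = 0 \<Longrightarrow> \<xi> = 0" using linear_injective_0[OF lin] by blast
  have "\<exists>c>0. \<forall>\<xi>. norm \<xi> \<le> c * norm (P (H \<xi>))"
  proof (rule norm_le_on_subspace[OF lin subspace_UNIV z])
    fix c assume "0 < c" "\<And>v. v \<in> UNIV \<Longrightarrow> norm v \<le> c * norm (P (H v))"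
    then show ?thesis by blast
  qed
  then obtain c where c: "c > 0" "\<And>\<xi>. norm \<xi> \<le> c * norm (P (H \<xi>))" by blast
  obtain b where b: "b > 0" "\<And>\<xi>. norm (P (H \<xi>)) \<le> b * norm \<xi>" using linear_bounded_pos[OF lin] by blast
  let ?C = "max 1 (max c b)"
  have "norm \<xi> \<le> ?C * norm (P (H \<xi>))" for \<xi>
    by (rule order_trans[OF c(2)], rule mult_right_mono) auto
  moreover have "norm (P (H \<xi>)) \<le> ?C * norm \<xi>" for \<xi>
    by (rule order_trans[OF b(2)], rule mult_right_mono) auto
  ultimately show ?thesis unfolding P(3) by (intro exI[of _ ?C]) auto
qed

lemma frame_locally_bounded:
  fixes H :: "'m \<Rightarrow> 'n coords \<Rightarrow> 'n coords"
  assumes x: "x \<in> \<Gamma>" and lin: "\<forall>\<^sub>F y in at x within \<Gamma>. linear (H y)" "linear (H x)" "inj (H x)"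
    and lim: "\<And>\<xi>. tlim (at x within \<Gamma>) (\<lambda>y. y) (\<lambda>y. H y \<xi>) x (H x \<xi>)"
  shows "\<exists>C\<ge>1. \<exists>V. open V \<and> x \<in> V \<and> (\<forall>y\<in>V \<inter> \<Gamma>. \<forall>\<xi>. norm \<xi> \<le> C * gn y (H y \<xi>) \<and> gn y (H y \<xi>) \<le> C * norm \<xi>)"
proof -
  obtain C where C: "1 \<le> C" "\<And>\<xi>. norm \<xi> \<le> C * gn x (H x \<xi>)" "\<And>\<xi>. gn x (H x \<xi>) \<le> C * norm \<xi>"
    using norm_equivalence_at[OF lin(2,3), of x] by blast
  have ev: "\<forall>\<^sub>F y in at x within \<Gamma>. y \<in> \<Gamma>" by (auto simp: eventually_at_topological)
  have "\<forall>\<^sub>F y in at x within \<Gamma>. \<forall>\<xi>. gn x (H x \<xi>) \<le> exp 1 * gn y (H y \<xi>) \<and> gn y (H y \<xi>) \<le> exp 1 * gn x (H x \<xi>)"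
    using frame_close[OF x order_refl lin lim zero_less_one] ev
    by eventually_elim (simp add: flow_zero flow_deriv_zero x)
  then obtain V where V: "open V" "x \<in> V"
    "\<And>y. y \<in> V \<Longrightarrow> y \<noteq> x \<Longrightarrow> y \<in> \<Gamma> \<Longrightarrow> \<forall>\<xi>. gn x (H x \<xi>) \<le> exp 1 * gn y (H y \<xi>) \<and> gn y (H y \<xi>) \<le> exp 1 * gn x (H x \<xi>)"
    unfolding eventually_at_topological by auto
  have e1: "(1::real) \<le> exp 1" by simp
  have "norm \<xi> \<le> C * exp 1 * gn y (H y \<xi>) \<and> gn y (H y \<xi>) \<le> C * exp 1 * norm \<xi>" if "y \<in> V \<inter> \<Gamma>" for y \<xi>
  proof -
    have *: "gn x (H x \<xi>) \<le> exp 1 * gn y (H y \<xi>)" "gn y (H y \<xi>) \<le> exp 1 * gn x (H x \<xi>)"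
      using V(3)[of y] that mult_right_mono[OF e1 form_norm_nonneg[OF pos_def, of x "H x \<xi>"]] by (cases "y = x"; auto)+
    have "norm \<xi> \<le> C * (exp 1 * gn y (H y \<xi>))"
      by (rule order_trans[OF C(2)], rule mult_left_mono[OF *(1)]) (use C(1) in simp)
    moreover have "gn y (H y \<xi>) \<le> exp 1 * (C * norm \<xi>)"
      by (rule order_trans[OF *(2)], rule mult_left_mono[OF C(3)]) simp
    ultimately show ?thesis by (simp add: mult_ac)
  qed
  moreover have "1 \<le> C * exp 1" using mult_mono[OF C(1) e1] C(1) by simp
  ultimately show ?thesis using V(1,2) by blast
qed

text \<open>Frames that vary continuously exist only locally. Asking for a frame at each single
  point with common constants is the part that survives patching over the compact set.\<close>

lemma uniform_frames:
  "\<exists>C\<ge>1. \<forall>y\<in>\<Gamma>. \<exists>H. adapted_frame I J H (E y) (F y) k \<and> (\<forall>\<xi>. norm \<xi> \<le> C * gn y (H \<xi>) \<and> gn y (H \<xi>) \<le> C * norm \<xi>)"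
proof (rule compact_uniform[OF compact_\<Gamma>])
  fix C C' y assume "\<exists>H. adapted_frame I J H (E y) (F y) k \<and> (\<forall>\<xi>. norm \<xi> \<le> C * gn y (H \<xi>) \<and> gn y (H \<xi>) \<le> C * norm \<xi>)" "C \<le> C'"
  then obtain H where H: "adapted_frame I J H (E y) (F y) k" "\<And>\<xi>. norm \<xi> \<le> C * gn y (H \<xi>)" "\<And>\<xi>. gn y (H \<xi>) \<le> C * norm \<xi>" by blast
  have "norm \<xi> \<le> C' * gn y (H \<xi>) \<and> gn y (H \<xi>) \<le> C' * norm \<xi>" for \<xi>
    using H(2,3)[of \<xi>] mult_right_mono[OF \<open>C \<le> C'\<close> norm_ge_zero[of \<xi>]]
      mult_right_mono[OF \<open>C \<le> C'\<close> form_norm_nonneg[OF pos_def, of y "H \<xi>"]] by linarith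
  then show "\<exists>H. adapted_frame I J H (E y) (F y) k \<and> (\<forall>\<xi>. norm \<xi> \<le> C' * gn y (H \<xi>) \<and> gn y (H \<xi>) \<le> C' * norm \<xi>)"
    using H(1) by blast
next
  fix x assume x: "x \<in> \<Gamma>"
  obtain U H where U: "open U" "x \<in> U" and H: "\<And>y. y \<in> U \<inter> \<Gamma> \<Longrightarrow> adapted_frame I J (H y) (E y) (F y) k"
    and lim: "\<And>\<xi>. tlim (at x within \<Gamma>) (\<lambda>y. y) (\<lambda>y. H y \<xi>) x (H x \<xi>)"
    using continuous_frame[OF x] by auto
  have lin: "linear (H y)" "inj (H y)" if "y \<in> U \<inter> \<Gamma>" for y
    using H[OF that] by (auto simp: adapted_frame_def)
  have ev: "\<forall>\<^sub>F y in at x within \<Gamma>. linear (H y)" unfolding eventually_at_topological using U lin(1) by blast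
  have "linear (H x)" "inj (H x)" using lin[of x] U(2) x by auto
  then obtain C V where V: "open V" "x \<in> V" "\<forall>y\<in>V \<inter> \<Gamma>. \<forall>\<xi>. norm \<xi> \<le> C * gn y (H y \<xi>) \<and> gn y (H y \<xi>) \<le> C * norm \<xi>"
    using frame_locally_bounded[OF x ev _ _ lim] by (elim meta_impE exE conjE; (assumption | rule that)?)
  show "\<exists>C U. open U \<and> x \<in> U \<and> (\<forall>y\<in>U \<inter> \<Gamma>. \<exists>H. adapted_frame I J H (E y) (F y) k \<and> (\<forall>\<xi>. norm \<xi> \<le> C * gn y (H \<xi>) \<and> gn y (H \<xi>) \<le> C * norm \<xi>))"
  proof (intro exI conjI ballI)
    show "open (U \<inter> V)" "x \<in> U \<inter> V" using U V by auto
    fix y assume "y \<in> U \<inter> V \<inter> \<Gamma>"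
    then show "adapted_frame I J (H y) (E y) (F y) k" "\<forall>\<xi>. norm \<xi> \<le> C * gn y (H y \<xi>) \<and> gn y (H y \<xi>) \<le> C * norm \<xi>"
      using H V(3) by auto
  qed
qed

end

context flow_splitting
begin

text \<open>In frame coordinates E and F have disjoint supports, so adding a vector of F cannot
  shorten the coordinates of a vector of E. One factor C is paid on the way into coordinates and one
  on the way back.\<close>

lemma uniform_angle:
  "\<exists>C\<ge>1. \<forall>y\<in>\<Gamma>. \<forall>u\<in>E y. \<forall>v\<in>F y. gn y u \<le> C * gn y (u + v)"
proof -
  obtain C where C: "1 \<le> C" "\<forall>y\<in>\<Gamma>. \<exists>H. adapted_frame I J H (E y) (F y) k \<and> (\<forall>\<xi>. norm \<xi> \<le> C * gn y (H \<xi>) \<and> gn y (H \<xi>) \<le> C * norm \<xi>)"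
    using uniform_frames by blast
  have "gn y u \<le> C * C * gn y (u + v)" if y: "y \<in> \<Gamma>" and u: "u \<in> E y" and v: "v \<in> F y" for y u v
  proof -
    obtain H where "adapted_frame I J H (E y) (F y) k"
      and bd: "\<And>\<xi>. norm \<xi> \<le> C * gn y (H \<xi>)" "\<And>\<xi>. gn y (H \<xi>) \<le> C * norm \<xi>"
      using C(2) y by blast
    then interpret adapted_frame I J H "E y" "F y" k by simp
    obtain \<xi> \<eta> where \<xi>: "\<xi> \<in> coord_space I" "u = H \<xi>" and \<eta>: "\<eta> \<in> coord_space J" "v = H \<eta>"
      using u v unfolding E_eq F_eq by auto
    have "norm \<xi> \<le> norm (\<xi> + \<eta>)"
    proof (rule norm_le_componentwise_cart)
      fix i
      show "norm (\<xi> $ i) \<le> norm ((\<xi> + \<eta>) $ i)"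
        using \<xi>(1) \<eta>(1) by (cases "i \<in> I") (auto simp: coord_space_def)
    qed
    then have "C * norm \<xi> \<le> C * norm (\<xi> + \<eta>)" using C(1) by (intro mult_left_mono) auto
    then have "gn y u \<le> C * norm (\<xi> + \<eta>)" using bd(2)[of \<xi>] unfolding \<xi>(2) by linarith
    also have "\<dots> \<le> C * (C * gn y (H (\<xi> + \<eta>)))" using bd(1) C(1) by (intro mult_left_mono) auto
    finally show ?thesis using \<xi>(2) \<eta>(2) by (simp add: linear_add[OF lin] mult.assoc)
  qed
  moreover have "1 \<le> C * C" using mult_mono[OF C(1) C(1)] C(1) by simp
  ultimately show ?thesis by blast
qed

lemma chart_frame_bounded:
  assumes x: "x \<in> \<Gamma>" and c: "c \<in> \<A>" "x \<in> dom c"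
  shows "\<exists>C\<ge>1. \<exists>V. open V \<and> x \<in> V \<and> V \<subseteq> dom c \<and> (\<forall>y\<in>V \<inter> \<Gamma>. \<forall>u.
    norm u \<le> C * gn y (of_chart c y u) \<and> gn y (of_chart c y u) \<le> C * norm u)"
proof -
  let ?H = "\<lambda>y. of_chart c y"
  have ev: "\<forall>\<^sub>F y in at x within \<Gamma>. y \<in> \<Gamma>" by (auto simp: eventually_at_topological)
  have lin: "linear (?H y)" if "y \<in> dom c" for y
    by (rule linear_coord_change[OF c(1) chart_at(1) that chart_at(2)])
  have "\<forall>\<^sub>F y in at x within \<Gamma>. linear (?H y)"
    unfolding eventually_at_topological using open_dom[OF c(1)] c(2) lin by blast
  moreover have "inj (?H x)" by (rule inj_coord_change[OF c(1) chart_at(1) c(2) chart_at(2) interior_\<Gamma>[OF x]])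
  moreover have "tlim (at x within \<Gamma>) (\<lambda>y. y) (\<lambda>y. ?H y u) x (?H x u)" for u
    by (rule tlim_chart_vector[OF x ev _ c]) simp
  ultimately have "\<exists>C\<ge>1. \<exists>V. open V \<and> x \<in> V \<and> (\<forall>y\<in>V \<inter> \<Gamma>. \<forall>u. norm u \<le> C * gn y (?H y u) \<and> gn y (?H y u) \<le> C * norm u)"
    using lin[OF c(2)] by (intro frame_locally_bounded[OF x])
  then obtain C V where C: "1 \<le> C" "open V" "x \<in> V" "\<forall>y\<in>V \<inter> \<Gamma>. \<forall>u. norm u \<le> C * gn y (?H y u) \<and> gn y (?H y u) \<le> C * norm u"
    by (elim exE conjE) (rule that)
  show ?thesis
    by (rule exI[of _ C], rule conjI[OF C(1)], rule exI[of _ "V \<inter> dom c"]) (use C(2-4) c open_dom[OF c(1)] in auto)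
qed

text \<open>In one chart the derivative changes lengths by a factor of at most 2 either way. The
  comparison of coordinate norm and metric is valid only near x, so both ends of the orbit segment
  have to remain there.\<close>

lemma uniform_short_bound:
  "\<exists>C\<ge>1. \<forall>y\<in>\<Gamma>. \<forall>t. 0 \<le> t \<longrightarrow> t * C \<le> 1 \<longrightarrow> (\<forall>v. gn (\<phi> t y) (DX t y v) \<le> C * gn y v \<and> gn y v \<le> C * gn (\<phi> t y) (DX t y v))"
proof (rule compact_uniform[OF compact_\<Gamma>])
  fix C C' y assume *: "\<forall>t. 0 \<le> t \<longrightarrow> t * C \<le> 1 \<longrightarrow> (\<forall>v. gn (\<phi> t y) (DX t y v) \<le> C * gn y v \<and> gn y v \<le> C * gn (\<phi> t y) (DX t y v))" and "C \<le> C'"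
  show "\<forall>t. 0 \<le> t \<longrightarrow> t * C' \<le> 1 \<longrightarrow> (\<forall>v. gn (\<phi> t y) (DX t y v) \<le> C' * gn y v \<and> gn y v \<le> C' * gn (\<phi> t y) (DX t y v))"
  proof (intro allI impI)
    fix t :: real and v assume t: "0 \<le> t" "t * C' \<le> 1"
    have "t * C \<le> 1" using mult_left_mono[OF \<open>C \<le> C'\<close> t(1)] t(2) by simp
    then have "gn (\<phi> t y) (DX t y v) \<le> C * gn y v \<and> gn y v \<le> C * gn (\<phi> t y) (DX t y v)" using * t(1) by blast
    then show "gn (\<phi> t y) (DX t y v) \<le> C' * gn y v \<and> gn y v \<le> C' * gn (\<phi> t y) (DX t y v)"
      using mult_right_mono[OF \<open>C \<le> C'\<close> form_norm_nonneg[OF pos_def, of y v]]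
        mult_right_mono[OF \<open>C \<le> C'\<close> form_norm_nonneg[OF pos_def, of "\<phi> t y" "DX t y v"]] by linarith
  qed
next
  fix x assume x: "x \<in> \<Gamma>"
  obtain c D N where N: "open N" "x \<in> N" "\<forall>q\<in>N \<inter> \<Gamma>. flow_box c D q"
    using flow_box_local[OF x] by (elim exE conjE) (rule that)
  have c: "c \<in> \<A>" and xc: "x \<in> dom c" using N x by (auto simp: flow_box_def)
  let ?H = "\<lambda>y. of_chart c y"
  obtain C V where C: "1 \<le> C" and V: "open V" "x \<in> V" "V \<subseteq> dom c"
    "\<forall>y\<in>V \<inter> \<Gamma>. \<forall>u. norm u \<le> C * gn y (?H y u) \<and> gn y (?H y u) \<le> C * norm u"
    using chart_frame_bounded[OF x c xc] by (elim exE conjE) (rule that)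
  obtain \<tau>' N' where \<tau>': "0 < \<tau>'" and N': "open N'" "x \<in> N'" "\<forall>q\<in>N'. \<forall>t\<in>{0..\<tau>'}. \<phi> t q \<in> V"
    using flow_stays_near[OF V(1,2)] by (elim exE conjE) (rule that)
  \<comment> \<open>The three terms are the norm constant, the time limit of the flow box, and the
    time limit for staying in V.\<close>
  define C' where "C' = max (2 * C * C) (max D (1 / \<tau>'))"
  have "gn (\<phi> t y) (DX t y v) \<le> C' * gn y v \<and> gn y v \<le> C' * gn (\<phi> t y) (DX t y v)"
    if y: "y \<in> N \<inter> N' \<inter> V \<inter> \<Gamma>" and t: "0 \<le> t" "t * C' \<le> 1" for y t v
  proof -
    have "t * D \<le> t * C'" "t * (1 / \<tau>') \<le> t * C'" by (rule mult_left_mono[OF _ t(1)], simp add: C'_def)+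
    with t(2) have "t * D \<le> 1" "t * (1 / \<tau>') \<le> 1" by linarith+
    then have t': "t * D \<le> 1" "t \<in> {0..\<tau>'}" using t(1) \<tau>' by (auto simp: field_simps)
    let ?q = "\<phi> t y"
    have yG: "y \<in> \<Gamma>" and qG: "?q \<in> \<Gamma>" using y flow_in by auto
    have box: "flow_box c D y" using N(3) y by blast
    have yc: "y \<in> dom c" and qc: "?q \<in> dom c" using box t(1) t'(1) by (auto simp: flow_box_def)
    have qV: "?q \<in> V" using N'(3) y t'(2) by blast
    obtain f' where f': "strict_derivative (snd c \<circ> \<phi> t \<circ> chart_inv c) f' (snd c y)"
      "\<And>v. norm (f' v) \<le> 2 * norm v" "\<And>v. norm v \<le> 2 * norm (f' v)"
      using box[unfolded flow_box_def] t(1) t'(1) by blast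
    define u where "u = to_chart c y v"
    have v: "v = ?H y u" unfolding u_def by (rule of_to_chart[OF c yc interior_\<Gamma>[OF yG], symmetric])
    have Tv: "DX t y v = ?H ?q (f' u)"
      using fdiff_flow_deriv[OF yG fdiff_short[OF yG t(1) c yc qc f'(1)]] by (simp add: u_def)
    have 1: "norm u \<le> C * gn y v" "gn y v \<le> C * norm u" using V(4) y unfolding v by blast+
    have 2: "norm (f' u) \<le> C * gn ?q (DX t y v)" "gn ?q (DX t y v) \<le> C * norm (f' u)" using V(4) qV qG unfolding Tv by blast+
    have C0: "0 \<le> C" using C by simp
    have "gn ?q (DX t y v) \<le> C * (2 * (C * gn y v))"
      using 2(2) f'(2)[of u] 1(1) mult_left_mono[OF _ C0, of "norm (f' u)" "2 * (C * gn y v)"] by linarith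
    moreover have "gn y v \<le> C * (2 * (C * gn ?q (DX t y v)))"
      using 1(2) f'(3)[of u] 2(1) mult_left_mono[OF _ C0, of "norm u" "2 * (C * gn ?q (DX t y v))"] by linarith
    moreover have "2 * C * C * gn y v \<le> C' * gn y v" "2 * C * C * gn ?q (DX t y v) \<le> C' * gn ?q (DX t y v)"
      by (rule mult_right_mono; simp add: C'_def form_norm_nonneg[OF pos_def])+
    ultimately show ?thesis by (simp add: mult_ac)
  qed
  then show "\<exists>C U. open U \<and> x \<in> U \<and> (\<forall>y\<in>U \<inter> \<Gamma>. \<forall>t. 0 \<le> t \<longrightarrow> t * C \<le> 1 \<longrightarrow>
      (\<forall>v. gn (\<phi> t y) (DX t y v) \<le> C * gn y v \<and> gn y v \<le> C * gn (\<phi> t y) (DX t y v)))"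
    using N N' V by (intro exI[of _ C'] exI[of _ "N \<inter> N' \<inter> V"]) blast
qed

text \<open>A unit of time consists of n = ceiling of C steps, each short enough for the local
  bound, so the constant is the n-th power.\<close>

lemma uniform_bound:
  "\<exists>C\<ge>1. \<forall>y\<in>\<Gamma>. \<forall>t\<in>{0..1}. \<forall>v. gn (\<phi> t y) (DX t y v) \<le> C * gn y v \<and> gn y v \<le> C * gn (\<phi> t y) (DX t y v)"
proof -
  obtain C where C: "1 \<le> C" "\<forall>y\<in>\<Gamma>. \<forall>t. 0 \<le> t \<longrightarrow> t * C \<le> 1 \<longrightarrow> (\<forall>v. gn (\<phi> t y) (DX t y v) \<le> C * gn y v \<and> gn y v \<le> C * gn (\<phi> t y) (DX t y v))"
    using uniform_short_bound by (elim exE conjE) (rule that)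
  define n where "n = nat \<lceil>C\<rceil>"
  have n: "C \<le> real n" "0 < n" using C(1) by (auto simp: n_def real_nat_ceiling_ge)
  have step: "gn (\<phi> (real m * s) y) (DX (real m * s) y v) \<le> C ^ m * gn y v \<and> gn y v \<le> C ^ m * gn (\<phi> (real m * s) y) (DX (real m * s) y v)"
    if y: "y \<in> \<Gamma>" and s: "0 \<le> s" "s * C \<le> 1" for m s y v
  proof (induction m)
    case 0
    then show ?case using flow_deriv_zero[OF y] by (simp add: flow_zero)
  next
    case (Suc m)
    let ?t = "real m * s"
    have eq: "real (Suc m) * s = ?t + s" by (simp add: algebra_simps)
    have t: "0 \<le> ?t" using s by simp
    have flow: "\<phi> (?t + s) y = \<phi> s (\<phi> ?t y)" using flow_semigroup[OF s(1) t] by (simp add: add.commute)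
    have deriv: "DX (?t + s) y v = DX s (\<phi> ?t y) (DX ?t y v)" by (rule flow_deriv_add[OF y t s(1)])
    have *: "gn (\<phi> s (\<phi> ?t y)) (DX s (\<phi> ?t y) w) \<le> C * gn (\<phi> ?t y) w" "gn (\<phi> ?t y) w \<le> C * gn (\<phi> s (\<phi> ?t y)) (DX s (\<phi> ?t y) w)" for w
      using C(2) flow_in[OF y] s by blast+
    have "C * gn (\<phi> ?t y) (DX ?t y v) \<le> C * (C ^ m * gn y v)" using Suc C(1) by (intro mult_left_mono) auto
    moreover have "C ^ m * gn (\<phi> ?t y) (DX ?t y v) \<le> C ^ m * (C * gn (\<phi> s (\<phi> ?t y)) (DX s (\<phi> ?t y) (DX ?t y v)))"
      using * C(1) by (intro mult_left_mono) auto
    ultimately show ?case unfolding eq flow deriv using *(1)[of "DX ?t y v"] Suc by (auto simp: mult_ac)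
  qed
  have "gn (\<phi> t y) (DX t y v) \<le> C ^ n * gn y v \<and> gn y v \<le> C ^ n * gn (\<phi> t y) (DX t y v)"
    if "y \<in> \<Gamma>" "t \<in> {0..1}" for y t v
  proof -
    have "t * C \<le> 1 * C" using that C(1) by (intro mult_right_mono) auto
    then have "t / real n * C \<le> 1" using n by (simp add: field_simps)
    then show ?thesis using step[OF that(1), of "t / real n" n v] that(2) n by simp
  qed
  moreover have "1 \<le> C ^ n" using C(1) by simp
  ultimately show ?thesis by blast
qed

definition norm_E :: "real \<Rightarrow> 'm \<Rightarrow> real" where
  "norm_E t x = op_norm (gn x) (gn (\<phi> t x)) (E x) (DX t x)"

text \<open>Indexed by the starting point x although the inverse acts from the fibre at the end
  point. With this indexing it is submultiplicative along the forward flow, and it is the reciprocal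
  of the co-norm on F at x.\<close>

definition inv_norm_F :: "real \<Rightarrow> 'm \<Rightarrow> real" where
  "inv_norm_F t x = op_norm (gn (\<phi> t x)) (gn x) (F (\<phi> t x)) (DX (- t) (\<phi> t x))"

lemma
  assumes x: "x \<in> \<Gamma>"
  shows norm_E_ge: "u \<in> E x \<Longrightarrow> gn (\<phi> t x) (DX t x u) \<le> norm_E t x * gn x u"
    and norm_E_le: "(\<And>u. u \<in> E x \<Longrightarrow> gn (\<phi> t x) (DX t x u) \<le> c * gn x u) \<Longrightarrow> norm_E t x \<le> c"
    and norm_E_pos: "0 < norm_E t x"
  unfolding norm_E_def
  by ((rule form_op_norm_ge form_op_norm_le form_op_norm_pos;
    simp add: pos_def linear_flow_deriv inj_flow_deriv subspace_E E_nonzero x)+)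

lemma
  assumes x: "x \<in> \<Gamma>" and t: "0 \<le> t"
  shows inv_norm_F_ge: "v \<in> F x \<Longrightarrow> gn x v \<le> inv_norm_F t x * gn (\<phi> t x) (DX t x v)"
    and inv_norm_F_le: "(\<And>v. v \<in> F x \<Longrightarrow> gn x v \<le> c * gn (\<phi> t x) (DX t x v)) \<Longrightarrow> inv_norm_F t x \<le> c"
    and inv_norm_F_pos: "0 < inv_norm_F t x"
    and min_norm_F: "min_norm (gn x) (gn (\<phi> t x)) (F x) (DX t x) = 1 / inv_norm_F t x"
proof -
  let ?y = "\<phi> t x"
  have y: "?y \<in> \<Gamma>" by (rule flow_in[OF x])
  note form = pos_def[of ?y] pos_def[of x] linear_flow_deriv[OF y, of "- t"] subspace_F[OF y] F_nonzero[OF y]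
  have Fy: "F ?y = DX t x ` F x" using DX_F[OF x] by simp
  note inv = flow_deriv_inverse[OF x t]
  show "gn x v \<le> inv_norm_F t x * gn ?y (DX t x v)" if "v \<in> F x"
    using form_op_norm_ge[OF form, of "DX t x v"] that Fy inv by (simp add: inv_norm_F_def)
  show "inv_norm_F t x \<le> c" if *: "\<And>v. v \<in> F x \<Longrightarrow> gn x v \<le> c * gn ?y (DX t x v)"
    unfolding inv_norm_F_def
  proof (rule form_op_norm_le[OF form])
    fix w assume "w \<in> F ?y"
    then obtain v where "v \<in> F x" "w = DX t x v" using Fy by auto
    then show "gn x (DX (- t) ?y w) \<le> c * gn ?y w" using * inv by simp
  qed
  show "0 < inv_norm_F t x" unfolding inv_norm_F_def by (rule form_op_norm_pos[OF form inj_flow_deriv[OF y]])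
  show "min_norm (gn x) (gn ?y) (F x) (DX t x) = 1 / inv_norm_F t x"
    unfolding inv_norm_F_def Fy
    by (rule form_min_norm_eq[OF pos_def pos_def linear_flow_deriv[OF x] subspace_F[OF x] F_nonzero[OF x] linear_flow_deriv[OF y] inv(1)])
qed

end

section \<open>The growth cocycles\<close>

lemma continuous_on_lnI:
  fixes f :: "'z::topological_space \<Rightarrow> real"
  assumes pos: "\<And>x. x \<in> S \<Longrightarrow> 0 < f x"
    and close: "\<And>x \<epsilon>. x \<in> S \<Longrightarrow> 0 < \<epsilon> \<Longrightarrow> \<forall>\<^sub>F y in at x within S. f x \<le> exp \<epsilon> * f y \<and> f y \<le> exp \<epsilon> * f x"
  shows "continuous_on S (\<lambda>x. ln (f x))"
  unfolding continuous_on_def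
proof (intro ballI tendstoI)
  fix x and e :: real assume x: "x \<in> S" and e: "0 < e"
  have "\<forall>\<^sub>F y in at x within S. y \<in> S" by (auto simp: eventually_at_topological)
  then show "\<forall>\<^sub>F y in at x within S. dist (ln (f y)) (ln (f x)) < e"
    using close[OF x half_gt_zero[OF e]]
  proof eventually_elim
    case (elim y)
    have p: "0 < f x" "0 < f y" using pos x elim by auto
    have "ln (f x) \<le> ln (exp (e / 2) * f y)" "ln (f y) \<le> ln (exp (e / 2) * f x)"
      using elim p by (simp_all only: ln_le_cancel_iff mult_pos_pos exp_gt_zero)
    then have "ln (f x) \<le> e / 2 + ln (f y)" "ln (f y) \<le> e / 2 + ln (f x)" using p by (simp_all add: ln_mult)
    then show ?case using e by (simp add: dist_real_def)
  qed
qed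

lemma subadditive_cocycle_add:
  assumes "subadditive_cocycle \<Gamma> \<phi> a C" "subadditive_cocycle \<Gamma> \<phi> b D"
  shows "subadditive_cocycle \<Gamma> \<phi> (\<lambda>t x. a t x + b t x) (C + D)"
proof -
  interpret a: subadditive_cocycle \<Gamma> \<phi> a C by (rule assms)
  interpret b: subadditive_cocycle \<Gamma> \<phi> b D by (rule assms)
  show ?thesis
  proof
    fix s t x assume *: "x \<in> \<Gamma>" "0 \<le> (s::real)" "0 \<le> (t::real)"
    show "a (s + t) x + b (s + t) x \<le> a s x + b s x + (a t (\<phi> s x) + b t (\<phi> s x))"
      using a.sub[OF *] b.sub[OF *] by linarith
  next
    fix t x assume *: "x \<in> \<Gamma>" "0 \<le> (t::real)" "t \<le> 1"
    show "\<bar>a t x + b t x\<bar> \<le> C + D" using a.bnd[OF *] b.bnd[OF *] by linarith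
  next
    fix s t x assume *: "x \<in> \<Gamma>" "0 \<le> (s::real)" "0 \<le> (t::real)" "t \<le> 1"
    show "a s x + b s x - (C + D) \<le> a (s + t) x + b (s + t) x" using a.low[OF *] b.low[OF *] by linarith
  next
    fix t :: real assume "0 \<le> t"
    then show "continuous_on \<Gamma> (\<lambda>x. a t x + b t x)" using a.cont b.cont by (intro continuous_on_add)
  qed
qed

context flow_splitting
begin

lemma compact_flow: "compact_flow \<Gamma> \<phi>"
proof
  show "continuous_on \<Gamma> (\<phi> t)" for t
  proof (cases "0 \<le> t")
    case True
    then show ?thesis using continuous_on_subset[OF flow_continuous] by blast
  next
    case False
    then have t: "0 \<le> - t" by simp
    have "continuous_on (\<phi> (- t) ` \<Gamma>) (\<phi> (- (- t)))"
      by (rule continuous_on_inv[OF continuous_on_subset[OF flow_continuous[OF t] subset_UNIV] compact_\<Gamma>])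
        (simp add: flow_inverse')
    moreover have "\<phi> (- t) ` \<Gamma> = \<Gamma>" using invariant by (simp add: invariant_set_def)
    ultimately show ?thesis by simp
  qed
  show "continuous_on {0..} (\<lambda>t. \<phi> t x)" for x using flow_curve[of x] by (simp add: integral_curve_def)
qed (simp_all add: compact_\<Gamma> flow_in flow_zero flow_add)

text \<open>An operator norm compares a vector with its image, so one and the same frame has to be
  controlled at time 0 and at time t.\<close>

lemma frame_close_twice:
  assumes x: "x \<in> \<Gamma>" and t: "0 \<le> t" and \<epsilon>: "0 < \<epsilon>"
  shows "\<exists>H. (adapted_frame I J (H x) (E x) (F x) k) \<and> (\<forall>\<^sub>F y in at x within \<Gamma>. y \<in> \<Gamma> \<and> adapted_frame I J (H y) (E y) (F y) k \<and>
    (\<forall>\<xi>. gn x (H x \<xi>) \<le> exp \<epsilon> * gn y (H y \<xi>) \<and> gn y (H y \<xi>) \<le> exp \<epsilon> * gn x (H x \<xi>) \<and>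
      gn (\<phi> t x) (DX t x (H x \<xi>)) \<le> exp \<epsilon> * gn (\<phi> t y) (DX t y (H y \<xi>)) \<and>
      gn (\<phi> t y) (DX t y (H y \<xi>)) \<le> exp \<epsilon> * gn (\<phi> t x) (DX t x (H x \<xi>))))"
proof -
  obtain U H where U: "open U" "x \<in> U" and H: "\<forall>y\<in>U \<inter> \<Gamma>. adapted_frame I J (H y) (E y) (F y) k"
    and lim: "\<forall>\<xi>. tlim (at x within \<Gamma>) (\<lambda>y. y) (\<lambda>y. H y \<xi>) x (H x \<xi>)"
    using continuous_frame[OF x] by (elim exE conjE) (rule that)
  have ev: "\<forall>\<^sub>F y in at x within \<Gamma>. y \<in> U \<inter> \<Gamma>" unfolding eventually_at_topological using U by blast
  have ev_lin: "\<forall>\<^sub>F y in at x within \<Gamma>. linear (H y)"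
    using ev by eventually_elim (use H in \<open>auto simp: adapted_frame_def\<close>)
  have lin: "linear (H x)" "inj (H x)" using H U(2) x by (auto simp: adapted_frame_def)
  note close = frame_close[OF x _ ev_lin lin lim[rule_format] \<epsilon>]
  have "\<forall>\<^sub>F y in at x within \<Gamma>. y \<in> \<Gamma> \<and> adapted_frame I J (H y) (E y) (F y) k \<and>
    (\<forall>\<xi>. gn x (H x \<xi>) \<le> exp \<epsilon> * gn y (H y \<xi>) \<and> gn y (H y \<xi>) \<le> exp \<epsilon> * gn x (H x \<xi>) \<and>
      gn (\<phi> t x) (DX t x (H x \<xi>)) \<le> exp \<epsilon> * gn (\<phi> t y) (DX t y (H y \<xi>)) \<and>
      gn (\<phi> t y) (DX t y (H y \<xi>)) \<le> exp \<epsilon> * gn (\<phi> t x) (DX t x (H x \<xi>)))"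
    using ev close[OF order_refl] close[OF t]
  proof eventually_elim
    case (elim y)
    have "adapted_frame I J (H y) (E y) (F y) k" "y \<in> \<Gamma>" using H elim(1) by auto
    then show ?case using elim(2,3) by (simp add: flow_zero flow_deriv_zero x)
  qed
  moreover have "adapted_frame I J (H x) (E x) (F x) k" using H U x by blast
  ultimately show ?thesis by blast
qed

text \<open>The operator norm of \<open>DX\<^sub>t\<close> on \<open>E\<close> and that of its inverse on \<open>F\<close> are treated alike: both are
  the least constants in an inequality between the norms of \<open>v\<close> and \<open>DX\<^sub>t v\<close>.\<close>

definition bounded_by :: "bool \<Rightarrow> real \<Rightarrow> 'm \<Rightarrow> real \<Rightarrow> bool" where
  "bounded_by b t x c \<longleftrightarrow> (if b then \<forall>v\<in>E x. gn (\<phi> t x) (DX t x v) \<le> c * gn x v else \<forall>v\<in>F x. gn x v \<le> c * gn (\<phi> t x) (DX t x v))"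

definition least_bound :: "bool \<Rightarrow> real \<Rightarrow> 'm \<Rightarrow> real" where
  "least_bound b t x = (if b then norm_E t x else inv_norm_F t x)"

lemma
  assumes x: "x \<in> \<Gamma>" and t: "0 \<le> t"
  shows bounded_by_least: "bounded_by b t x (least_bound b t x)"
    and least_bound_le: "bounded_by b t x c \<Longrightarrow> least_bound b t x \<le> c"
    and least_bound_pos: "0 < least_bound b t x"
  using norm_E_ge[OF x] norm_E_le[OF x] norm_E_pos[OF x] inv_norm_F_ge[OF x t] inv_norm_F_le[OF x t] inv_norm_F_pos[OF x t]
  by (simp_all add: bounded_by_def least_bound_def split: if_splits)

text \<open>Vectors with equal frame coordinates are matched between the fibres at x and y. The
  factor r enters once for each of the two norms in the inequality.\<close>

lemma bounded_by_close:
  assumes Hx: "adapted_frame I J Hx (E x) (F x) k" and Hy: "adapted_frame I J Hy (E y) (F y) k" and r: "0 \<le> r" and c: "0 \<le> c"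
    and 1: "\<And>\<xi>. gn x (Hx \<xi>) \<le> r * gn y (Hy \<xi>)" "\<And>\<xi>. gn y (Hy \<xi>) \<le> r * gn x (Hx \<xi>)"
    and 2: "\<And>\<xi>. gn (\<phi> t x) (DX t x (Hx \<xi>)) \<le> r * gn (\<phi> t y) (DX t y (Hy \<xi>))"
      "\<And>\<xi>. gn (\<phi> t y) (DX t y (Hy \<xi>)) \<le> r * gn (\<phi> t x) (DX t x (Hx \<xi>))"
    and bd: "bounded_by b t x c"
  shows "bounded_by b t y (r * r * c)"
proof -
  have le: "q \<le> r * r * c * p'" if "q \<le> r * q'" "q' \<le> c * p" "p \<le> r * p'" for p q p' q'
  proof -
    have "r * q' \<le> r * (c * (r * p'))"
      using mult_left_mono[OF order_trans[OF that(2) mult_left_mono[OF that(3) c]] r] .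
    then show ?thesis using that(1) by (simp add: mult_ac)
  qed
  have EF: "E x = Hx ` coord_space I" "E y = Hy ` coord_space I" "F x = Hx ` coord_space J" "F y = Hy ` coord_space J"
    using Hx Hy by (auto simp: adapted_frame_def)
  show ?thesis
    using bd le[OF 2(2) _ 1(1)] le[OF 1(2) _ 2(1)] by (cases b) (auto simp: bounded_by_def EF)
qed

lemma continuous_least_bound:
  assumes t: "0 \<le> t" shows "continuous_on \<Gamma> (\<lambda>x. ln (least_bound b t x))"
proof (rule continuous_on_lnI[OF least_bound_pos[OF _ t]])
  fix x \<epsilon> assume x: "x \<in> \<Gamma>" and "0 < (\<epsilon>::real)"
  then have "0 < \<epsilon> / 2" by simp
  obtain H where H: "adapted_frame I J (H x) (E x) (F x) k" and ev: "\<forall>\<^sub>F y in at x within \<Gamma>. y \<in> \<Gamma> \<and> adapted_frame I J (H y) (E y) (F y) k \<and>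
    (\<forall>\<xi>. gn x (H x \<xi>) \<le> exp (\<epsilon> / 2) * gn y (H y \<xi>) \<and> gn y (H y \<xi>) \<le> exp (\<epsilon> / 2) * gn x (H x \<xi>) \<and>
      gn (\<phi> t x) (DX t x (H x \<xi>)) \<le> exp (\<epsilon> / 2) * gn (\<phi> t y) (DX t y (H y \<xi>)) \<and>
      gn (\<phi> t y) (DX t y (H y \<xi>)) \<le> exp (\<epsilon> / 2) * gn (\<phi> t x) (DX t x (H x \<xi>)))"
    using frame_close_twice[OF x t \<open>0 < \<epsilon> / 2\<close>] by (elim exE conjE) (rule that)
  have r: "exp \<epsilon> = exp (\<epsilon> / 2) * exp (\<epsilon> / 2)" by (simp flip: exp_add)
  show "\<forall>\<^sub>F y in at x within \<Gamma>. least_bound b t x \<le> exp \<epsilon> * least_bound b t y \<and> least_bound b t y \<le> exp \<epsilon> * least_bound b t x"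
    using ev
  proof eventually_elim
    case (elim y)
    then have y: "y \<in> \<Gamma>" and Hy: "adapted_frame I J (H y) (E y) (F y) k"
      and le: "\<And>\<xi>. gn x (H x \<xi>) \<le> exp (\<epsilon> / 2) * gn y (H y \<xi>)" "\<And>\<xi>. gn y (H y \<xi>) \<le> exp (\<epsilon> / 2) * gn x (H x \<xi>)"
        "\<And>\<xi>. gn (\<phi> t x) (DX t x (H x \<xi>)) \<le> exp (\<epsilon> / 2) * gn (\<phi> t y) (DX t y (H y \<xi>))"
        "\<And>\<xi>. gn (\<phi> t y) (DX t y (H y \<xi>)) \<le> exp (\<epsilon> / 2) * gn (\<phi> t x) (DX t x (H x \<xi>))" by blast+
    have p: "0 \<le> least_bound b t x" "0 \<le> least_bound b t y" using least_bound_pos t x y by (simp_all add: less_imp_le)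
    show ?case unfolding r
      using least_bound_le[OF y t bounded_by_close[OF H Hy exp_ge_zero p(1) le bounded_by_least[OF x t]]]
        least_bound_le[OF x t bounded_by_close[OF Hy H exp_ge_zero p(2) le(2,1,4,3) bounded_by_least[OF y t]]] by simp
  qed
qed

text \<open>Subadditivity expresses that bounds along consecutive orbit segments multiply. The
  remaining estimates use that the flow over at most a unit of time distorts norms by at most C in
  either direction.\<close>

lemma cocycles: "\<exists>C. \<forall>b. subadditive_cocycle \<Gamma> \<phi> (\<lambda>t x. ln (least_bound b t x)) C"
proof -
  obtain C where C1: "1 \<le> C" and C: "\<forall>y\<in>\<Gamma>. \<forall>t\<in>{0..1}. \<forall>v. gn (\<phi> t y) (DX t y v) \<le> C * gn y v \<and> gn y v \<le> C * gn (\<phi> t y) (DX t y v)"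
    using uniform_bound by (elim exE conjE) (rule that)
  have C0: "0 < C" using C1 by simp
  have up: "gn (\<phi> t y) (DX t y v) \<le> C * gn y v" and lo: "gn y v \<le> C * gn (\<phi> t y) (DX t y v)"
    if "y \<in> \<Gamma>" "0 \<le> t" "t \<le> 1" for t y v using C that by auto
  have add: "\<phi> (s + t) x = \<phi> t (\<phi> s x)" "DX (s + t) x v = DX t (\<phi> s x) (DX s x v)" if "x \<in> \<Gamma>" "0 \<le> s" "0 \<le> t" for s t x v
    using flow_add[OF that(1), of t s] flow_deriv_add[OF that] by (simp_all add: add.commute)
  have EF: "DX t x ` E x = E (\<phi> t x)" "DX t x ` F x = F (\<phi> t x)" if "x \<in> \<Gamma>" for t x using DX_E DX_F that by auto
  have chain: "p \<le> c * d * q" if "p \<le> c * m" "m \<le> d * q" "0 \<le> c" for p q m c d :: real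
    using order_trans[OF that(1) mult_left_mono[OF that(2,3)]] by (simp add: mult.assoc)
  have compose: "bounded_by b (s + t) x (c * d)"
    if x: "x \<in> \<Gamma>" and st: "0 \<le> s" "0 \<le> t" and bd: "bounded_by b s x c" "bounded_by b t (\<phi> s x) d" and cd: "0 \<le> c" "0 \<le> d" for b s t x c d
  proof (cases b)
    case True
    then show ?thesis using bd chain[OF _ _ cd(2)] by (force simp: bounded_by_def add[OF x st] EF(1)[OF x, symmetric] mult.commute[of c])
  next
    case False
    then show ?thesis using bd chain[OF _ _ cd(1)] by (force simp: bounded_by_def add[OF x st] EF(2)[OF x, symmetric])
  qed
  have low: "bounded_by b s x (C * c)" if x: "x \<in> \<Gamma>" and st: "0 \<le> s" "0 \<le> t" "t \<le> 1" and bd: "bounded_by b (s + t) x c" and c: "0 \<le> c" for b s t x c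
  proof (cases b)
    case True
    then show ?thesis using bd chain[OF lo[OF flow_in[OF x] st(2,3)] _ less_imp_le[OF C0]]
      by (auto simp: bounded_by_def add[OF x st(1,2)])
  next
    case False
    then show ?thesis using bd chain[OF _ up[OF flow_in[OF x] st(2,3)] c]
      by (auto simp: bounded_by_def add[OF x st(1,2)] mult.commute[of C])
  qed
  have ln_le: "ln p - ln C \<le> ln q" if "p \<le> C * q" "0 < p" "0 < q" for p q
  proof -
    have "ln p \<le> ln (C * q)" using that C0 by (subst ln_le_cancel_iff) auto
    then show ?thesis using that C0 by (simp add: ln_mult)
  qed
  have "subadditive_cocycle \<Gamma> \<phi> (\<lambda>t x. ln (least_bound b t x)) (ln C)" for b
  proof (intro subadditive_cocycle.intro compact_flow subadditive_cocycle_axioms.intro)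
    fix s t x assume x: "x \<in> \<Gamma>" and s: "0 \<le> (s::real)" and t: "0 \<le> (t::real)"
    have pos: "0 < least_bound b s x" "0 < least_bound b t (\<phi> s x)" "0 < least_bound b (s + t) x"
      using s t x by (auto intro!: least_bound_pos flow_in)
    have "least_bound b (s + t) x \<le> least_bound b s x * least_bound b t (\<phi> s x)"
      using s t x pos by (intro least_bound_le compose bounded_by_least flow_in) auto
    then have "ln (least_bound b (s + t) x) \<le> ln (least_bound b s x * least_bound b t (\<phi> s x))" using pos by (subst ln_le_cancel_iff) auto
    then show "ln (least_bound b (s + t) x) \<le> ln (least_bound b s x) + ln (least_bound b t (\<phi> s x))" using pos by (simp add: ln_mult)
  next
    fix t x assume x: "x \<in> \<Gamma>" and t: "0 \<le> (t::real)" "t \<le> 1"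
    have p: "0 < least_bound b t x" by (rule least_bound_pos[OF x t(1)])
    \<comment> \<open>At time 0 the flow is the identity, whose least bound is 1; tested on a
      nonzero vector this gives \<open>1 \<le> C * least_bound b t x\<close>.\<close>
    have "bounded_by b 0 x (C * least_bound b t x)"
      using low[OF x order_refl t, of b "least_bound b t x"] bounded_by_least[OF x t(1)] p by simp
    moreover obtain v where v: "v \<in> (if b then E x else F x)" "v \<noteq> 0"
      using E_nonzero[OF x] F_nonzero[OF x] subspace_0[OF subspace_E[OF x]] subspace_0[OF subspace_F[OF x]] by (cases b) auto
    ultimately have "gn x v \<le> C * least_bound b t x * gn x v"
      by (auto simp: bounded_by_def flow_zero flow_deriv_zero x split: if_splits)
    then have "1 \<le> C * least_bound b t x" using form_norm_pos[OF pos_def v(2), of x] by simp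
    then have "ln 1 - ln C \<le> ln (least_bound b t x)" using p by (intro ln_le) auto
    moreover have "bounded_by b t x C" using up[OF x t] lo[OF x t] by (simp add: bounded_by_def)
    then have "ln (least_bound b t x) \<le> ln C" using least_bound_le[OF x t(1)] p C0 by simp
    ultimately show "\<bar>ln (least_bound b t x)\<bar> \<le> ln C" by simp
  next
    fix s t x assume x: "x \<in> \<Gamma>" and s: "0 \<le> (s::real)" and t: "0 \<le> (t::real)" "t \<le> 1"
    have pos: "0 < least_bound b s x" "0 < least_bound b (s + t) x" using s t x by (auto intro!: least_bound_pos)
    then show "ln (least_bound b s x) - ln C \<le> ln (least_bound b (s + t) x)"
      using s t x by (intro ln_le least_bound_le low[OF _ _ t] bounded_by_least) auto
  qed (rule continuous_least_bound)
  then show ?thesis by blast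
qed

end

text \<open>The sum of two lower limits is at most the lower limit of the sum. In the contradiction
  each lower limit gives up \<kappa> / 8, and K / t is at most \<kappa> / 4 for large t, which
  leaves -3 \<kappa> / 4 on both sides of a strict inequality.\<close>

lemma Liminf_add_decay:
  fixes a b :: "real \<Rightarrow> real"
  assumes bd: "\<And>t. 1 \<le> t \<Longrightarrow> \<bar>a t / t\<bar> \<le> C" "\<And>t. 1 \<le> t \<Longrightarrow> \<bar>b t / t\<bar> \<le> C"
    and decay: "\<And>t. 0 < t \<Longrightarrow> a t + b t \<le> K - \<kappa> * t" and \<kappa>: "0 < \<kappa>"
  shows "Liminf at_top (\<lambda>t. ereal (1 / t * a t)) + Liminf at_top (\<lambda>t. ereal (1 / t * b t)) < ereal (- \<kappa> / 2)"
proof -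
  have fin: "\<forall>\<^sub>F t in at_top. \<bar>1 / t * c t\<bar> \<le> C" if "\<And>t. 1 \<le> t \<Longrightarrow> \<bar>c t / t\<bar> \<le> C" for c :: "real \<Rightarrow> real"
    using eventually_ge_at_top[of 1] by eventually_elim (use that in simp)
  note limit = Liminf_ereal_finite[OF trivial_limit_at_top_linorder fin]
  obtain p where p: "Liminf at_top (\<lambda>t. ereal (1 / t * a t)) = ereal p" using limit[OF bd(1)] .
  obtain q where q: "Liminf at_top (\<lambda>t. ereal (1 / t * b t)) = ereal q" using limit[OF bd(2)] .
  have "p + q < - \<kappa> / 2"
  proof (rule ccontr)
    assume neg: "\<not> p + q < - \<kappa> / 2"
    have "\<forall>\<^sub>F t in at_top. ereal (p - \<kappa> / 8) < ereal (1 / t * a t)" by (rule less_LiminfD) (use \<kappa> p in simp)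
    moreover have "\<forall>\<^sub>F t in at_top. ereal (q - \<kappa> / 8) < ereal (1 / t * b t)" by (rule less_LiminfD) (use \<kappa> q in simp)
    moreover have "\<forall>\<^sub>F t in at_top. max 1 (4 * K / \<kappa>) \<le> t" by (rule eventually_ge_at_top)
    ultimately have "\<forall>\<^sub>F t :: real in at_top. False"
    proof eventually_elim
      case (elim t)
      have t: "0 < t" "4 * K \<le> \<kappa> * t" using elim(3) \<kappa> by (auto simp: field_simps)
      have "p + q - \<kappa> / 4 < 1 / t * (a t + b t)" using elim(1,2) by (simp add: distrib_left)
      also have "\<dots> \<le> 1 / t * (K - \<kappa> * t)" using decay[OF t(1)] t(1) by (intro mult_left_mono) auto
      also have "\<dots> \<le> 1 / t * (\<kappa> * t / 4 - \<kappa> * t)" using t by (intro mult_left_mono) auto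
      also have "\<dots> = - 3 * \<kappa> / 4" using t(1) by (simp add: field_simps)
      finally show False using neg by simp
    qed
    then show False by simp
  qed
  then show ?thesis unfolding p q by simp
qed

context flow_splitting
begin

section \<open>Transfer to the exterior power and the equivalence\<close>

definition ext_norm_E :: "real \<Rightarrow> 'm \<Rightarrow> real" where
  "ext_norm_E t x = op_norm (form_norm (ext_inner k (g x))) (form_norm (ext_inner k (g (\<phi> t x))))
     (mixed_power k (E x) (F x)) (ext_map k (DX t x))"

definition ext_inv_norm_F :: "real \<Rightarrow> 'm \<Rightarrow> real" where
  "ext_inv_norm_F t x = op_norm (form_norm (ext_inner k (g (\<phi> t x)))) (form_norm (ext_inner k (g x)))
     (pure_power k (F (\<phi> t x))) (ext_map k (DX (- t) (\<phi> t x)))"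

lemma ext_comparison:
  "\<exists>K>0. \<forall>x\<in>\<Gamma>. \<forall>t\<ge>0. norm_E t x * inv_norm_F t x \<le> K * (ext_norm_E t x * ext_inv_norm_F t x) \<and>
    ext_norm_E t x * ext_inv_norm_F t x \<le> K * (norm_E t x * inv_norm_F t x + (norm_E t x * inv_norm_F t x) ^ k)"
proof -
  obtain C1 where C1: "1 \<le> C1" "\<forall>y\<in>\<Gamma>. \<exists>H. adapted_frame I J H (E y) (F y) k \<and> (\<forall>\<xi>. norm \<xi> \<le> C1 * gn y (H \<xi>) \<and> gn y (H \<xi>) \<le> C1 * norm \<xi>)"
    using uniform_frames by (elim exE conjE) (rule that)
  obtain C2 where C2: "1 \<le> C2" "\<forall>y\<in>\<Gamma>. \<forall>u\<in>E y. \<forall>v\<in>F y. gn y u \<le> C2 * gn y (u + v)"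
    using uniform_angle by (elim exE conjE) (rule that)
  define C where "C = max C1 C2"
  have C: "1 \<le> C" "C1 \<le> C" "C2 \<le> C" using C1(1) by (auto simp: C_def)
  define K where "K = max (real CARD('n) * C ^ 3) ((real CARD('n set))\<^sup>2 * C ^ (4 * k))"
  have nn: "0 \<le> gn p v" for p v by (rule form_norm_nonneg[OF pos_def])
  have main: "norm_E t x * inv_norm_F t x \<le> real CARD('n) * C ^ 3 * (ext_norm_E t x * ext_inv_norm_F t x) \<and>
    ext_norm_E t x * ext_inv_norm_F t x \<le> (real CARD('n set))\<^sup>2 * C ^ (4 * k) * (norm_E t x * inv_norm_F t x + (norm_E t x * inv_norm_F t x) ^ k)"
    if x: "x \<in> \<Gamma>" and t: "0 \<le> t" for x t
  proof -
    obtain H where "adapted_frame I J H (E x) (F x) k"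
      and bd: "\<forall>\<xi>. norm \<xi> \<le> C1 * gn x (H \<xi>) \<and> gn x (H \<xi>) \<le> C1 * norm \<xi>"
      using C1(2)[rule_format, OF x] by (elim exE conjE) (rule that)
    then interpret adapted_frame I J H "E x" "F x" k by simp
    let ?y = "\<phi> t x"
    have y: "?y \<in> \<Gamma>" by (rule flow_in[OF x])
    have 1: "norm \<xi> \<le> C * gn x (H \<xi>)" for \<xi>
      using bd[rule_format, of \<xi>] mult_right_mono[OF C(2) nn[of x "H \<xi>"]] by linarith
    have 2: "gn x (H \<xi>) \<le> C * norm \<xi>" for \<xi>
      using bd[rule_format, of \<xi>] mult_right_mono[OF C(2) norm_ge_zero[of \<xi>]] by linarith
    have 3: "gn ?y (DX t x u) \<le> C * gn ?y (DX t x u + DX t x v)" if "u \<in> E x" "v \<in> F x" for u v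
    proof -
      have "DX t x u \<in> E ?y" "DX t x v \<in> F ?y" using that DX_E[OF x, of t] DX_F[OF x, of t] by auto
      then show ?thesis using C2(2) y mult_right_mono[OF C(3) nn[of ?y "DX t x u + DX t x v"]] by force
    qed
    note cmp = ext_op_norm_comparison[OF pos_def[of x] pos_def[of ?y] linear_flow_deriv[OF x, of t] inj_flow_deriv[OF x, of t]
        linear_flow_deriv[OF y, of "- t"] flow_deriv_inverse(1)[OF x t] dims(2)[OF x] k C(1) 1 2 3]
    show ?thesis
      using cmp unfolding norm_E_def inv_norm_F_def ext_norm_E_def ext_inv_norm_F_def DX_F[OF x] by blast
  qed
  have le: "c * s \<le> K * s" if "c \<le> K" "0 \<le> s" for c s using that by (rule mult_right_mono)
  have pos: "0 \<le> norm_E t x * inv_norm_F t x" if "x \<in> \<Gamma>" "0 \<le> t" for x t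
    using norm_E_pos[OF that(1), of t] inv_norm_F_pos[OF that] by simp
  have cpos: "0 < real CARD('n) * C ^ 3" using C(1) by simp
  have "norm_E t x * inv_norm_F t x \<le> K * (ext_norm_E t x * ext_inv_norm_F t x) \<and>
    ext_norm_E t x * ext_inv_norm_F t x \<le> K * (norm_E t x * inv_norm_F t x + (norm_E t x * inv_norm_F t x) ^ k)"
    if x: "x \<in> \<Gamma>" and t: "0 \<le> t" for x t
  proof
    have "0 \<le> real CARD('n) * C ^ 3 * (ext_norm_E t x * ext_inv_norm_F t x)" using main[OF x t] pos[OF x t] by linarith
    then have "0 \<le> ext_norm_E t x * ext_inv_norm_F t x" using cpos by (simp only: zero_le_mult_iff) linarith
    then have "real CARD('n) * C ^ 3 * (ext_norm_E t x * ext_inv_norm_F t x) \<le> K * (ext_norm_E t x * ext_inv_norm_F t x)"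
      by (intro le) (simp add: K_def)
    then show "norm_E t x * inv_norm_F t x \<le> K * (ext_norm_E t x * ext_inv_norm_F t x)" using main[OF x t] by linarith
    have "(real CARD('n set))\<^sup>2 * C ^ (4 * k) * (norm_E t x * inv_norm_F t x + (norm_E t x * inv_norm_F t x) ^ k)
        \<le> K * (norm_E t x * inv_norm_F t x + (norm_E t x * inv_norm_F t x) ^ k)"
      using pos[OF x t] by (intro le add_nonneg_nonneg zero_le_power) (simp_all add: K_def)
    then show "ext_norm_E t x * ext_inv_norm_F t x \<le> K * (norm_E t x * inv_norm_F t x + (norm_E t x * inv_norm_F t x) ^ k)"
      using main[OF x t] by linarith
  qed
  moreover have "0 < K" using cpos by (simp add: K_def less_max_iff_disj)
  ultimately show ?thesis by blast
qed

text \<open>The wedges of a continuous local frame over a fixed family of index sets form continuous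
  sections; passing to another chart commutes with wedging.\<close>

lemma wedge_subbundle:
  assumes \<S>: "\<S> \<subseteq> {S. card S = k}"
    and V: "\<And>y H. y \<in> \<Gamma> \<Longrightarrow> adapted_frame I J H (E y) (F y) k \<Longrightarrow> V y = span ((\<lambda>S. wedge k (\<lambda>i. H (axis (elem S i) 1))) ` \<S>)"
  shows "continuous_subbundle \<A> (ext_map k) \<Gamma> V"
  unfolding continuous_subbundle_def
proof
  fix x assume x: "x \<in> \<Gamma>"
  obtain U H where U: "open U" "x \<in> U" and H: "\<forall>y\<in>U \<inter> \<Gamma>. adapted_frame I J (H y) (E y) (F y) k"
    and sec: "\<forall>a. continuous_section \<A> id (U \<inter> \<Gamma>) (\<lambda>y. H y (axis a 1))"
    using adapted_local_frame[OF x] by (elim exE conjE) (rule that)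
  have cont: "continuous_section \<A> (ext_map k) (U \<inter> \<Gamma>) (\<lambda>y. wedge k (\<lambda>i. H y (axis (elem S i) 1)))" for S
    unfolding continuous_section_def
  proof
    fix c assume c: "c \<in> \<A>"
    have "continuous_on (U \<inter> \<Gamma> \<inter> dom c) (\<lambda>y. wedge k (\<lambda>i. to_chart c y (H y (axis (elem S i) 1))))"
      using sec c by (intro continuous_on_wedge) (auto simp: continuous_section_def)
    then show "continuous_on (U \<inter> \<Gamma> \<inter> dom c) (\<lambda>y. ext_map k (to_chart c y) (wedge k (\<lambda>i. H y (axis (elem S i) 1))))"
      by (rule continuous_on_eq) (simp add: ext_map_wedge linear_coord_change chart_at c)
  qed
  obtain \<sigma> where "bij_betw \<sigma> {0..<card \<S>} \<S>" using ex_bij_betw_nat_finite[of \<S>] by auto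
  then have \<sigma>: "bij_betw \<sigma> {..<card \<S>} \<S>" by (simp add: atLeast0LessThan)
  show "\<exists>U d s. open U \<and> x \<in> U \<and> (\<forall>y\<in>U \<inter> \<Gamma>. is_basis (V y) d (\<lambda>i. s i y)) \<and>
      (\<forall>i<d. continuous_section \<A> (ext_map k) (U \<inter> \<Gamma>) (s i))"
  proof (intro exI[of _ U] exI[of _ "card \<S>"] exI[of _ "\<lambda>m y. wedge k (\<lambda>i. H y (axis (elem (\<sigma> m) i) 1))"] conjI U ballI allI impI)
    fix y assume y: "y \<in> U \<inter> \<Gamma>"
    then have fr: "adapted_frame I J (H y) (E y) (F y) k" using H by blast
    show "is_basis (V y) (card \<S>) (\<lambda>m. wedge k (\<lambda>i. H y (axis (elem (\<sigma> m) i) 1)))"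
      using V[OF _ fr] y adapted_frame.is_basis_wedge[OF fr \<sigma> \<S>] by simp
  next
    fix m
    show "continuous_section \<A> (ext_map k) (U \<inter> \<Gamma>) (\<lambda>y. wedge k (\<lambda>i. H y (axis (elem (\<sigma> m) i) 1)))" by (rule cont)
  qed
qed

lemma ext_invariant_splitting:
  assumes Et: "\<And>x. x \<in> \<Gamma> \<Longrightarrow> Et x = mixed_power k (E x) (F x)" and Ft: "\<And>x. x \<in> \<Gamma> \<Longrightarrow> Ft x = pure_power k (F x)"
  shows "invariant_splitting \<A> \<phi> (ext_map k) (ext_power k) \<Gamma> Et Ft"
  unfolding invariant_splitting_def
proof (intro conjI ballI allI)
  show "continuous_subbundle \<A> (ext_map k) \<Gamma> Et"
    by (rule wedge_subbundle[of "{S. card S = k \<and> S \<noteq> J}"])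
      (auto simp: Et adapted_frame.mixed_power_eq_span)
  show "continuous_subbundle \<A> (ext_map k) \<Gamma> Ft"
  proof (cases "card J = k")
    case True
    then show ?thesis by (intro wedge_subbundle[of "{J}"]) (auto simp: Ft adapted_frame.pure_power_eq_span)
  next
    case False
    \<comment> \<open>The cardinality of J is determined by any adapted frame, so it can differ from
      k only when there is no point to carry one.\<close>
    then have "\<Gamma> = {}" using uniform_frames adapted_frame.card_J by (metis equals0I)
    then show ?thesis by (simp add: continuous_subbundle_def)
  qed
  fix x assume x: "x \<in> \<Gamma>"
  obtain H where "adapted_frame I J H (E x) (F x) k" using uniform_frames x by meson
  then interpret adapted_frame I J H "E x" "F x" k .
  show "subspace (Et x)" "subspace (Ft x)" by (simp_all add: Et Ft x subspace_mixed_power subspace_pure_power)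
  show "Et x \<noteq> {0}" "Ft x \<noteq> {0}" using mixed_power_nontrivial[OF dims(2)[OF x] k] pure_power_nontrivial by (simp_all add: Et Ft x)
  show "{u + v |u v. u \<in> Et x \<and> v \<in> Ft x} = ext_power k" "Et x \<inter> Ft x = {0}"
    using mixed_pure_decomposition by (simp_all add: Et Ft x)
next
  fix t x assume x: "x \<in> \<Gamma>"
  have y: "\<phi> t x \<in> \<Gamma>" by (rule flow_in[OF x])
  show "ext_map k (DX t x) ` Et x = Et (\<phi> t x)" "ext_map k (DX t x) ` Ft x = Ft (\<phi> t x)"
    unfolding Et[OF x] Ft[OF x] Et[OF y] Ft[OF y]
      ext_map_image_mixed_power[OF linear_flow_deriv[OF x]] ext_map_image_pure_power[OF linear_flow_deriv[OF x]]
      DX_E[OF x] DX_F[OF x] by (rule refl)+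
qed

text \<open>Stated for any families that coincide over \<Gamma> with the intrinsic powers, so that
  the choice of basis sections is dealt with separately.\<close>

theorem domination_iff:
  assumes Et: "\<And>x. x \<in> \<Gamma> \<Longrightarrow> Et x = mixed_power k (E x) (F x)" and Ft: "\<And>x. x \<in> \<Gamma> \<Longrightarrow> Ft x = pure_power k (F x)"
  shows "dominated_ext_splitting \<A> g \<phi> k \<Gamma> Et Ft \<longleftrightarrow>
    (\<exists>\<eta><0. \<exists>Y. total_probability \<phi> \<Gamma> Y \<and> (\<forall>x\<in>Y.
        Liminf at_top (\<lambda>t. ereal (1 / t * ln (op_norm (gn x) (gn (\<phi> t x)) (E x) (DX t x))))
        - Limsup at_top (\<lambda>t. ereal (1 / t * ln (min_norm (gn x) (gn (\<phi> t x)) (F x) (DX t x)))) < ereal \<eta>))"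
    (is "_ \<longleftrightarrow> ?rhs")
proof -
  let ?a = "\<lambda>t x. ln (norm_E t x)" and ?b = "\<lambda>t x. ln (inv_norm_F t x)"
  obtain C where C: "\<And>b. subadditive_cocycle \<Gamma> \<phi> (\<lambda>t x. ln (least_bound b t x)) C" using cocycles by blast
  note a = C[of True, unfolded least_bound_def, simplified] and b = C[of False, unfolded least_bound_def, simplified]
  interpret ab: subadditive_cocycle \<Gamma> \<phi> "\<lambda>t x. ?a t x + ?b t x" "C + C" by (rule subadditive_cocycle_add[OF a b])
  obtain K0 where K0: "0 < K0" and cmp: "\<forall>x\<in>\<Gamma>. \<forall>t\<ge>0. norm_E t x * inv_norm_F t x \<le> K0 * (ext_norm_E t x * ext_inv_norm_F t x) \<and>
    ext_norm_E t x * ext_inv_norm_F t x \<le> K0 * (norm_E t x * inv_norm_F t x + (norm_E t x * inv_norm_F t x) ^ k)"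
    using ext_comparison by (elim exE conjE) (rule that)
  have dom_iff: "dominated_ext_splitting \<A> g \<phi> k \<Gamma> Et Ft \<longleftrightarrow>
      (\<exists>K \<kappa>. 0 < K \<and> 0 < \<kappa> \<and> (\<forall>x\<in>\<Gamma>. \<forall>t>0. ext_norm_E t x * ext_inv_norm_F t x < K * exp (- \<kappa> * t)))"
    using ext_invariant_splitting[OF Et Ft] Et Ft flow_in
    by (simp add: dominated_ext_splitting_def Let_def ext_norm_E_def ext_inv_norm_F_def)
  have liminf: "Liminf at_top (\<lambda>t. ereal (1 / t * ln (op_norm (gn x) (gn (\<phi> t x)) (E x) (DX t x))))
        - Limsup at_top (\<lambda>t. ereal (1 / t * ln (min_norm (gn x) (gn (\<phi> t x)) (F x) (DX t x))))
      = Liminf at_top (\<lambda>t. ereal (1 / t * ?a t x)) + Liminf at_top (\<lambda>t. ereal (1 / t * ?b t x))" if x: "x \<in> \<Gamma>" for x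
  proof -
    \<comment> \<open>The co-norm is the reciprocal of \<open>inv_norm_F\<close> for t \<ge> 0, so
      minus the upper limit of its logarithm is the lower limit of \<open>?b\<close>.\<close>
    have "- Limsup at_top (\<lambda>t. ereal (1 / t * ln (min_norm (gn x) (gn (\<phi> t x)) (F x) (DX t x))))
        = Liminf at_top (\<lambda>t. - ereal (1 / t * ln (min_norm (gn x) (gn (\<phi> t x)) (F x) (DX t x))))"
      by (rule ereal_Liminf_uminus[symmetric])
    also have "\<dots> = Liminf at_top (\<lambda>t. ereal (1 / t * ?b t x))"
    proof (rule Liminf_eq)
      show "\<forall>\<^sub>F t in at_top. - ereal (1 / t * ln (min_norm (gn x) (gn (\<phi> t x)) (F x) (DX t x))) = ereal (1 / t * ?b t x)"
        using eventually_ge_at_top[of 0]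
      proof eventually_elim
        case (elim t)
        show ?case using inv_norm_F_pos[OF x elim] by (simp add: min_norm_F[OF x elim] ln_div)
      qed
    qed
    finally show ?thesis by (simp add: minus_ereal_def norm_E_def)
  qed
  have pos: "0 < norm_E t x * inv_norm_F t x" if "x \<in> \<Gamma>" "0 \<le> t" for x t
    using norm_E_pos[OF that(1), of t] inv_norm_F_pos[OF that] by simp
  have ln_prod: "ln (norm_E t x * inv_norm_F t x) = ?a t x + ?b t x" if "x \<in> \<Gamma>" "0 \<le> t" for x t
    using norm_E_pos[OF that(1), of t] inv_norm_F_pos[OF that] by (simp add: ln_mult)
  show ?thesis
  proof
    assume "dominated_ext_splitting \<A> g \<phi> k \<Gamma> Et Ft"
    then obtain K \<kappa> where K: "0 < K" "0 < \<kappa>" and dom: "\<forall>x\<in>\<Gamma>. \<forall>t>0. ext_norm_E t x * ext_inv_norm_F t x < K * exp (- \<kappa> * t)"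
      unfolding dom_iff by (elim exE conjE) (rule that)
    have decay: "?a t x + ?b t x \<le> ln (K0 * K) - \<kappa> * t" if x: "x \<in> \<Gamma>" and t: "0 < t" for x t
    proof -
      have "norm_E t x * inv_norm_F t x \<le> K0 * (ext_norm_E t x * ext_inv_norm_F t x)" using cmp x t by simp
      also have "\<dots> \<le> K0 * (K * exp (- \<kappa> * t))" using dom x t K0 by (intro mult_left_mono) (auto intro: less_imp_le)
      finally have "ln (norm_E t x * inv_norm_F t x) \<le> ln (K0 * (K * exp (- \<kappa> * t)))"
        using pos[OF x, of t] t K K0 by (subst ln_le_cancel_iff) auto
      then show ?thesis using ln_prod[OF x, of t] t K K0 by (simp add: ln_mult)
    qed
    have "Liminf at_top (\<lambda>t. ereal (1 / t * ?a t x)) + Liminf at_top (\<lambda>t. ereal (1 / t * ?b t x)) < ereal (- \<kappa> / 2)"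
      if x: "x \<in> \<Gamma>" for x
      by (rule Liminf_add_decay[OF subadditive_cocycle.ratio_bound[OF a x] subadditive_cocycle.ratio_bound[OF b x] decay[OF x] K(2)])
    moreover have "total_probability \<phi> \<Gamma> \<Gamma>" by (simp add: total_probability_def)
    ultimately show ?rhs using K(2) liminf by (intro exI[of _ "- \<kappa> / 2"] conjI exI[of _ \<Gamma>]) auto
  next
    assume ?rhs
    then obtain \<eta> Y where \<eta>: "\<eta> < 0" and Y: "total_probability \<phi> \<Gamma> Y" and neg: "\<forall>x\<in>Y.
        Liminf at_top (\<lambda>t. ereal (1 / t * ln (op_norm (gn x) (gn (\<phi> t x)) (E x) (DX t x))))
        - Limsup at_top (\<lambda>t. ereal (1 / t * ln (min_norm (gn x) (gn (\<phi> t x)) (F x) (DX t x)))) < ereal \<eta>"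
      by (elim exE conjE) (rule that)
    have "Liminf at_top (\<lambda>t. ereal (1 / t * ?a t x)) + Liminf at_top (\<lambda>t. ereal (1 / t * ?b t x)) < ereal \<eta>" if "x \<in> Y" for x
    proof -
      have "x \<in> \<Gamma>" using Y that by (auto simp: total_probability_def)
      then show ?thesis using neg[rule_format, OF that] by (simp only: liminf)
    qed
    from two_cocycles_negative_time[OF a b ab.subadditive_cocycle_axioms Y \<eta> this]
    obtain n where n: "1 \<le> n" "\<forall>x\<in>\<Gamma>. ?a (real n) x + ?b (real n) x < 0" by auto
    have "\<exists>K \<kappa>. 0 < \<kappa> \<and> (\<forall>x\<in>\<Gamma>. \<forall>t\<ge>0. ?a t x + ?b t x \<le> K - \<kappa> * t)"
      using n(2) by (intro ab.uniform_decay[OF n(1)]) blast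
    then obtain K \<kappa> where \<kappa>: "0 < \<kappa>" and decay: "\<forall>x\<in>\<Gamma>. \<forall>t\<ge>0. ?a t x + ?b t x \<le> K - \<kappa> * t"
      by (elim exE conjE) (rule that)
    \<comment> \<open>For t > 0 the product \<open>?p\<close> is at most exp K times exp (- \<kappa>
      t), and its k-th power at most exp K ^ k times the same exponential, since a power k \<ge> 1
      of a number at most 1 does not exceed it. Using M + 1 afterwards makes the bound
      strict.\<close>
    define M where "M = K0 * (exp K + exp K ^ k)"
    have M: "0 < M" using K0 by (simp add: M_def add_pos_pos)
    have "ext_norm_E t x * ext_inv_norm_F t x < (M + 1) * exp (- \<kappa> * t)" if x: "x \<in> \<Gamma>" and t: "0 < t" for x t
    proof -
      let ?p = "norm_E t x * inv_norm_F t x" and ?e = "exp (- \<kappa> * t)"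
      have p: "0 < ?p" using pos[OF x] t by simp
      have "ln ?p \<le> K - \<kappa> * t" using ln_prod[OF x, of t] decay x t by simp
      then have "exp (ln ?p) \<le> exp (K - \<kappa> * t)" by (simp only: exp_le_cancel_iff)
      then have le: "?p \<le> exp K * ?e" using p by (simp add: exp_diff exp_minus field_simps)
      have e: "0 < ?e" "?e \<le> 1" using \<kappa> t by auto
      have "?p ^ k \<le> (exp K * ?e) ^ k" using le p by (intro power_mono) auto
      also have "\<dots> = exp K ^ k * ?e ^ k" by (rule power_mult_distrib)
      also have "\<dots> \<le> exp K ^ k * ?e" using power_decreasing[OF k, of ?e] e by (intro mult_left_mono) auto
      finally have "?p + ?p ^ k \<le> (exp K + exp K ^ k) * ?e" using le by (simp add: distrib_right)
      then have "K0 * (?p + ?p ^ k) \<le> K0 * ((exp K + exp K ^ k) * ?e)" using K0 by (intro mult_left_mono) auto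
      moreover have "ext_norm_E t x * ext_inv_norm_F t x \<le> K0 * (?p + ?p ^ k)" using cmp x t by simp
      ultimately have "ext_norm_E t x * ext_inv_norm_F t x \<le> M * ?e" by (simp add: M_def mult.assoc)
      also have "\<dots> < (M + 1) * ?e" by (intro mult_strict_right_mono) auto
      finally show ?thesis .
    qed
    then show "dominated_ext_splitting \<A> g \<phi> k \<Gamma> Et Ft" unfolding dom_iff using M \<kappa>
      by (intro exI[of _ "M + 1"] exI[of _ \<kappa>]) auto
  qed
qed

end

theorem corollary1p6:
  fixes \<A> :: "('m::{t2_space,second_countable_topology}, 'n::{finite,linorder}) chart set"
    and g :: "'m \<Rightarrow> 'n coords \<Rightarrow> 'n coords \<Rightarrow> real"
    and X :: "'m \<Rightarrow> 'n coords"
    and \<phi> :: "real \<Rightarrow> 'm \<Rightarrow> 'm"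
    and \<Gamma> :: "'m set"
    and E F :: "'m \<Rightarrow> 'n coords set"
    and e f :: "nat \<Rightarrow> 'm \<Rightarrow> 'n coords"
    and k l :: nat
  assumes "compact (UNIV :: 'm set)" and "connected (UNIV :: 'm set)"
    and "3 \<le> CARD('n)"
    and "smooth_atlas \<A>" and "riemannian_metric \<A> g"
    and "C1_vector_field \<A> X" and "inwardly_transverse \<A> X" and "is_flow \<A> X \<phi>"
    and "compact \<Gamma>" and "invariant_set \<phi> \<Gamma>"
    and "invariant_splitting \<A> \<phi> id UNIV \<Gamma> E F"
    and "2 \<le> k" and "\<forall>x\<in>\<Gamma>. dim (F x) = k"
    and "\<forall>x\<in>\<Gamma>. is_basis (E x) l (\<lambda>i. e i x)"
    and "\<forall>x\<in>\<Gamma>. is_basis (F x) k (\<lambda>i. f i x)"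
  shows "dominated_ext_splitting \<A> g \<phi> k \<Gamma> (E_tilde l k e f) (F_tilde k f) \<longleftrightarrow>
    (\<exists>\<eta><0. \<exists>Y. total_probability \<phi> \<Gamma> Y \<and>
      (\<forall>x\<in>Y.
        Liminf at_top (\<lambda>t. ereal (1 / t * ln (op_norm (form_norm (g x)) (form_norm (g (\<phi> t x)))
          (E x) (flow_deriv \<A> \<phi> t x))))
        - Limsup at_top (\<lambda>t. ereal (1 / t * ln (min_norm (form_norm (g x)) (form_norm (g (\<phi> t x)))
          (F x) (flow_deriv \<A> \<phi> t x))))
        < ereal \<eta>))"
proof -
  have "dim (E x) = l" if "x \<in> \<Gamma>" for x by (rule is_basis_dim[OF assms(14)[rule_format, OF that]])
  then interpret flow_splitting \<A> X \<phi> \<Gamma> g E F k l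
    using assms by unfold_locales auto
  have bases: "complementary_bases (E x) (F x) l k (\<lambda>i. e i x) (\<lambda>i. f i x)" if "x \<in> \<Gamma>" for x
    using assms(14,15) that sum_EF int_EF by (intro complementary_bases.intro) auto
  have "E_tilde l k e f x = mixed_power k (E x) (F x)" "F_tilde k f x = pure_power k (F x)" if "x \<in> \<Gamma>" for x
    using E_tilde_eq[of "E x" "F x" l k e x f] F_tilde_eq[of "E x" "F x" l k e x f] bases[OF that] k by auto
  then show ?thesis by (rule domination_iff)
qed

end
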